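(* Fix a small $\delta>0$, a positive integer $n$ and a nonnegative integer $r$. As $\mu\to\infty$ with $\lambda=\kappa/\mu\in[0,1-\delta]$ (i.e. for all sufficiently large $\mu$ and all such $\lambda$), one has $$W_{-\kappa,\mu}\left(\mu ze^{-\pi i}\right)=e^{\kappa\pi i}(1-\lambda)^{\mu}\left(\frac{2e}{\mu}\right)^{\kappa}\left(\frac zZ\right)^{1/2}\exp\left\{\mu\xi+\sum_{s=1}^{n-1}\frac{\hat E_s(z)}{\mu^s}\right\}\{1+\eta_{n,3}(\mu,z)\},$$ where for $z\in Z_3(\delta)$ $$|\eta_{n,3}(\mu,z)|\le\left|\exp\left\{\sum_{s=n}^{n+r-1}\frac{\hat E_s(z)}{\mu^s}\right\}-1\right|+\frac{\omega_{n+r,3}(\mu,z)}{\mu^{n+r}}\exp\left\{\frac{\varpi_{n+r,3}(\mu,z)}{\mu}+\sum_{s=n}^{n+r-1}\frac{\Re\{\hat E_s(z)\}}{\mu^s}+\frac{\omega_{n+r,3}(\mu,z)}{\mu^{n+r}}\right\}$$ (sums being zero if $r=0$). Here $$\omega_{n,3}(\mu,z)=\int_{\mathscr L_3(z)}\left|\frac{Z(t)\hat F_n(t)\,dt}{t}\right|+\sum_{s=1}^{n-1}\frac{1}{2\mu^s}\int_{\mathscr L_3(z)}\left|\frac{Z(t)\hat G_{n,s}(t)\,dt}{t}\right|,\qquad \varpi_{n,3}(\mu,z)=\sum_{s=0}^{n-2}\frac{2}{\mu^s}\int_{\mathscr L_3(z)}\left|\frac{Z(t)\hat F_{s+1}(t)\,dt}{t}\right|,$$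 with $\hat G_{n,s}(z)=\sum_{k=s}^{n-1}\hat F_k(z)\hat F_{s+n-k-1}(z)$ and $\mathscr L_3(z)$ a progressive path linking $z$ to $z^{(3)}=\infty e^{\pi i}$. The multivalued functions $\xi$, $Z$, $(z/Z)^{1/2}$, $\hat E_s(z)$ take their principal values except when $z\in S_{-1}$, in which case they denote the values obtained by analytic continuation from $S_1$ into $S_{-1}$ across the curve $\gamma_2$.
   Context: $W_{\kappa,\mu}$ is the Whittaker function, the solution of $y''=\left(\frac{\mu^2-1/4}{z^2}-\frac{\kappa}{z}+\frac14\right)y$ with $W_{\kappa,\mu}(z)\sim z^\kappa e^{-z/2}$ as $z\to\infty$, $|\arg z|\le\frac32\pi-\delta$. Here $\mu>0$, $\kappa=\lambda\mu$ are real and $\mathbb C^+=\{z\ne0:0\le\arg z\le\pi\}$. $\delta$ denotes an arbitrary small positive constant. **Turning point and Liouville variable.** Put $f(z)=\frac{z^2-4\lambda z+4}{4z^2}$. For $0\le\lambda<1$ its zero in the upper half plane is $z^+=z^+(\lambda)=2\lambda+2i\sqrt{1-\lambda^2}$. Let $$Z=Z(z)=(z^2-4\lambda z+4)^{1/2},\qquad \xi=\xi(z)=\tfrac12Z-\lambda\ln(Z+z-2\lambda)-\ln\left(\frac{Z-\lambda z+2}{z}\right),$$ so that $d\xi/dz=f^{1/2}(z)=Z/(2z)$. **Curves and regions.** Three level curves $\Re\,\xi(z)=\Re\,\xi(z^+)$ in $\mathbb C^+$ emanate from $z^+$ and divide $\mathbb C^+$ into three regions: $S_{-1}$ (bounded,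 having $z^{(1)}=0$ on its boundary), $S_0$ (containing the end $z^{(2)}=+\infty$ of the positive real axis) and $S_1$ (containing the end $z^{(3)}=\infty e^{\pi i}$ of the negative real axis). The curve separating $S_0$ and $S_1$ is $\gamma_1$, the one separating $S_{-1}$ and $S_1$ is $\gamma_2$, and the one separating $S_{-1}$ and $S_0$ is $\gamma_3$. $Z_j(\delta)$ ($j=1,2,3$) is the set of points of $\mathbb C^+$ whose distance to $\gamma_j$ is at least $\delta$. **Principal values.** With a branch cut along $\gamma_2$, the principal values of $Z$, $\xi$, $(z/Z)^{1/2}$ are the branches continuous in $\mathbb C^+\setminus\gamma_2$ for which $Z>0$, $\xi$ is real and $(z/Z)^{1/2}>0$ for $z\in(0,\infty)$ (so $(z/Z)^{1/2}\to1$ as $z\to\infty$ in $\mathbb C^+$). **Progressive paths.** A path $\mathscr L_j(z)$ from $z^{(j)}$ to $z\in Z_j(\delta)$ is progressive if (i) it is a finite chain of $R_2$ arcs (arcs with a parametrization having continuous second derivative and nonvanishing first derivative); (ii) $\Re\,\xi(t)$ is monotonic as $t$ passes along it from $z^{(j)}$ to $z$, with the branch of $\xi(t)$ taken continuous in $Z_j(\delta)$; (iii) $|t-z^+|\ge\delta$ for all $t$ on it. $Z_j(\delta)$ is such that all its points can be linked to $z^{(j)}$ by such a path. **Coefficients.** $$\hat F_1(z)=-\frac{z(z^3-16z+4\lambda^2z+16\lambda)}{2Z^6},\qquad \hat F_2(z)=-\frac zZ\frac{d\hat F_1(z)}{dz},$$ $$\hat F_{s+1}(z)=-\frac zZ\frac{d\hat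 F_s(z)}{dz}-\frac12\sum_{j=1}^{s-1}\hat F_j(z)\hat F_{s-j}(z)\quad(s\ge2),\qquad \hat E_s(z)=\frac12\int_\infty^z\frac{Z(t)\hat F_s(t)}{t}\,dt\quad(s\ge1),$$ whose principal values are those with $Z$ principal and the integration path in $\mathbb C^+\setminus\gamma_2$. *)

theory Defs
  imports "HOL-Complex_Analysis.Complex_Analysis"
begin

text \<open>
  A function y of z on the Riemann surface of the logarithm is represented by the function
  g(w) = y(e^w) of the logarithmic coordinate w = ln z, so that Im w is the argument of z
  and g is single-valued on the complex plane. In this coordinate d/dz = e^(-w) d/dw.
\<close>

definition d_dz :: "(complex \<Rightarrow> complex) \<Rightarrow> complex \<Rightarrow> complex" where
  "d_dz g w = deriv g w / exp w"

definition is_whittaker_W :: "real \<Rightarrow> real \<Rightarrow> (complex \<Rightarrow> complex) \<Rightarrow> bool" where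
  "is_whittaker_W \<kappa> \<mu> g \<longleftrightarrow>
     g holomorphic_on UNIV \<and>
     (\<forall>w. d_dz (d_dz g) w =
        ((complex_of_real \<mu> ^ 2 - 1/4) / exp w ^ 2 - complex_of_real \<kappa> / exp w + 1/4) * g w) \<and>
     (\<forall>\<delta>>0. ((\<lambda>w. g w / (exp (complex_of_real \<kappa> * w) * exp (- exp w / 2))) \<longlongrightarrow> 1)
        (inf (filtercomap Re at_top) (principal {w. \<bar>Im w\<bar> \<le> 3 / 2 * pi - \<delta>})))"

text \<open>whittaker_W \<open>\<kappa>\<close> \<open>\<mu>\<close> w is the value of the Whittaker function at the point e^w of argument Im w.\<close>

definition whittaker_W :: "real \<Rightarrow> real \<Rightarrow> complex \<Rightarrow> complex" where
  "whittaker_W \<kappa> \<mu> = (THE g. is_whittaker_W \<kappa> \<mu> g)"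

definition Cplus :: "complex set" where
  "Cplus = {z. z \<noteq> 0 \<and> Im z \<ge> 0}"

definition zplus :: "real \<Rightarrow> complex" where
  "zplus lam = Complex (2 * lam) (2 * sqrt (1 - lam\<^sup>2))"

definition Zsq :: "real \<Rightarrow> complex \<Rightarrow> complex" where
  "Zsq lam z = z ^ 2 - 4 * complex_of_real lam * z + 4"

text \<open>
  The real part of \<open>\<xi>\<close> at z, given a square root \<open>\<zeta>\<close> of Zsq lam z; the choice of the logarithms
  is immaterial since lam is real. Replacing \<open>\<zeta>\<close> by its negative changes the sign of
  Re \<open>\<xi>\<close>(z) - Re \<open>\<xi>\<close>(zplus), so that the level set below does not depend on the choice of \<open>\<zeta>\<close>.
\<close>

definition re_xi :: "real \<Rightarrow> complex \<Rightarrow> complex \<Rightarrow> real" where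
  "re_xi lam \<zeta> z = Re \<zeta> / 2 - lam * ln (cmod (\<zeta> + z - 2 * complex_of_real lam))
                   - ln (cmod ((\<zeta> - complex_of_real lam * z + 2) / z))"

definition level_set :: "real \<Rightarrow> complex set" where
  "level_set lam = {z \<in> Cplus. \<exists>\<zeta>. \<zeta> ^ 2 = Zsq lam z \<and> re_xi lam \<zeta> z = re_xi lam 0 (zplus lam)}"

definition Sm1 :: "real \<Rightarrow> complex set" where
  "Sm1 lam = {z \<in> Cplus - level_set lam.
      bounded (connected_component_set (Cplus - level_set lam) z) \<and>
      0 \<in> closure (connected_component_set (Cplus - level_set lam) z)}"

definition S0 :: "real \<Rightarrow> complex set" where
  "S0 lam = {z. \<exists>R. \<forall>x\<ge>R. connected_component (Cplus - level_set lam) z (complex_of_real x)}"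

definition S1 :: "real \<Rightarrow> complex set" where
  "S1 lam = {z. \<exists>R. \<forall>x\<ge>R. connected_component (Cplus - level_set lam) z (- complex_of_real x)}"

definition gamma2 :: "real \<Rightarrow> complex set" where
  "gamma2 lam = Cplus \<inter> closure (Sm1 lam) \<inter> closure (S1 lam)"

definition gamma3 :: "real \<Rightarrow> complex set" where
  "gamma3 lam = Cplus \<inter> closure (Sm1 lam) \<inter> closure (S0 lam)"

definition Zset3 :: "real \<Rightarrow> real \<Rightarrow> complex set" where
  "Zset3 lam \<delta> = {z \<in> Cplus. infdist z (gamma3 lam) \<ge> \<delta>}"

text \<open>
  The branch, continuous on the cut domain, of the multivalued function whose values at z are
  the w with R z w, selected by a condition P on its values on the positive real axis.
  (Outside the cut domain it is set to 0, which makes it unique as a HOL function.)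
\<close>

definition principal_branch ::
    "real \<Rightarrow> (complex \<Rightarrow> complex \<Rightarrow> bool) \<Rightarrow> (complex \<Rightarrow> bool) \<Rightarrow> complex \<Rightarrow> complex" where
  "principal_branch lam R P = (THE g.
      continuous_on (Cplus - gamma2 lam) g \<and>
      (\<forall>z \<in> Cplus - gamma2 lam. R z (g z)) \<and>
      (\<forall>x::real. x > 0 \<longrightarrow> P (g (complex_of_real x))) \<and>
      (\<forall>z. z \<notin> Cplus - gamma2 lam \<longrightarrow> g z = 0))"

definition Zfun :: "real \<Rightarrow> complex \<Rightarrow> complex" where
  "Zfun lam = principal_branch lam (\<lambda>z w. w ^ 2 = Zsq lam z) (\<lambda>w. w \<in> \<real> \<and> Re w > 0)"

definition xi :: "real \<Rightarrow> complex \<Rightarrow> complex" where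
  "xi lam = principal_branch lam
     (\<lambda>z w. \<exists>a b. exp a = Zfun lam z + z - 2 * complex_of_real lam \<and>
                  exp b = (Zfun lam z - complex_of_real lam * z + 2) / z \<and>
                  w = Zfun lam z / 2 - complex_of_real lam * a - b)
     (\<lambda>w. w \<in> \<real>)"

definition sqrt_zZ :: "real \<Rightarrow> complex \<Rightarrow> complex" where
  "sqrt_zZ lam = principal_branch lam (\<lambda>z w. w ^ 2 = z / Zfun lam z) (\<lambda>w. w \<in> \<real> \<and> Re w > 0)"

text \<open>
  Derivatives are taken within the cut domain, as this contains points of the real axis,
  which are boundary points.
\<close>

definition dz_within :: "complex set \<Rightarrow> (complex \<Rightarrow> complex) \<Rightarrow> complex \<Rightarrow> complex" where
  "dz_within A f z = (THE D. (f has_field_derivative D) (at z within A))"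

text \<open>The value at index 0 is a dummy. For s = 1 the sum is empty, which gives the rule for index 2.\<close>

fun Fhat :: "real \<Rightarrow> nat \<Rightarrow> complex \<Rightarrow> complex" where
  "Fhat lam 0 = (\<lambda>z. 0)"
| "Fhat lam (Suc 0) = (\<lambda>z.
     - (z * (z ^ 3 - 16 * z + 4 * complex_of_real lam ^ 2 * z + 16 * complex_of_real lam))
       / (2 * Zfun lam z ^ 6))"
| "Fhat lam (Suc (Suc m)) = (let s = Suc m in (\<lambda>z.
     - (z / Zfun lam z) * dz_within (Cplus - gamma2 lam) (Fhat lam s) z
     - 1/2 * (\<Sum>j\<in>{1..<s}. Fhat lam j z * Fhat lam (s - j) z)))"

definition Ghat :: "real \<Rightarrow> nat \<Rightarrow> nat \<Rightarrow> complex \<Rightarrow> complex" where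
  "Ghat lam n s z = (\<Sum>k\<in>{s..<n}. Fhat lam k z * Fhat lam (s + n - k - 1) z)"

text \<open>
  The improper integral from infinity to z: the limit of the integrals along paths in the cut
  domain that end at z, as their initial points recede to infinity.
\<close>

definition Ehat :: "real \<Rightarrow> nat \<Rightarrow> complex \<Rightarrow> complex" where
  "Ehat lam s z = (THE E. \<forall>\<epsilon>>0. \<exists>R. \<forall>g.
      valid_path g \<and> path_image g \<subseteq> Cplus - gamma2 lam \<and> pathfinish g = z \<and>
      cmod (pathstart g) \<ge> R \<longrightarrow>
      cmod (1/2 * contour_integral g (\<lambda>t. Zfun lam t * Fhat lam s t / t) - E) < \<epsilon>)"

text \<open>
  The analytic continuation of a function from S1 across gamma2 into Sm1, i.e. the branch on the
  half plane cut along gamma3 (rather than gamma2) that agrees with the given one on S1.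
\<close>

definition continuation :: "real \<Rightarrow> (complex \<Rightarrow> complex) \<Rightarrow> complex \<Rightarrow> complex" where
  "continuation lam f = (THE h.
      continuous_on (Cplus - gamma3 lam) h \<and>
      h holomorphic_on interior (Cplus - gamma3 lam) \<and>
      (\<forall>z \<in> S1 lam. h z = f z) \<and>
      (\<forall>z. z \<notin> Cplus - gamma3 lam \<longrightarrow> h z = 0))"

text \<open>
  For a principal value f, the value meant in the theorem. On gamma2 itself, where the principal
  value is not defined, this is the limit from S1.
\<close>

definition val3 :: "real \<Rightarrow> (complex \<Rightarrow> complex) \<Rightarrow> complex \<Rightarrow> complex" where
  "val3 lam f z = (if z \<in> Sm1 lam \<union> gamma2 lam then continuation lam f z else f z)"

definition R2_arc_on :: "real set \<Rightarrow> (real \<Rightarrow> complex) \<Rightarrow> bool" where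
  "R2_arc_on I p \<longleftrightarrow> (\<exists>p' p''. continuous_on I p'' \<and>
     (\<forall>\<tau>\<in>I. (p has_vector_derivative p' \<tau>) (at \<tau> within I) \<and> p' \<tau> \<noteq> 0 \<and>
            (p' has_vector_derivative p'' \<tau>) (at \<tau> within I)))"

text \<open>
  A path consisting of N arcs is parametrized over the interval (0, N], the k-th arc (k = 0, ..., N - 1)
  over [k, k + 1], except that the parameter 0 is left out since it corresponds to the point
  at infinity at the end of the negative real axis.
\<close>

definition progressive_path3 ::
    "real \<Rightarrow> real \<Rightarrow> complex \<Rightarrow> nat \<Rightarrow> (real \<Rightarrow> complex) \<Rightarrow> bool" where
  "progressive_path3 lam \<delta> z N p \<longleftrightarrow>
     N \<ge> 1 \<and>
     filterlim p at_infinity (at_right 0) \<and> ((\<lambda>\<tau>. Arg (p \<tau>)) \<longlongrightarrow> pi) (at_right 0) \<and>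
     p (real N) = z \<and>
     (\<forall>\<tau>\<in>{0<..real N}. p \<tau> \<in> Cplus - gamma3 lam) \<and>
     (\<forall>k<N. R2_arc_on ({real k..real (Suc k)} \<inter> {0<..}) p) \<and>
     (mono_on {0<..real N} (\<lambda>\<tau>. Re (val3 lam (xi lam) (p \<tau>))) \<or>
      antimono_on {0<..real N} (\<lambda>\<tau>. Re (val3 lam (xi lam) (p \<tau>)))) \<and>
     (\<forall>\<tau>\<in>{0<..real N}. cmod (p \<tau> - zplus lam) \<ge> \<delta>)"

text \<open>
  The integral of |h(t) dt| along a path as above. As the path comes from infinity and is otherwise
  arbitrary there, the value may be infinite. In omega3 and varpi3 the choice of branch is immaterial:
  replacing Z by its negative changes the integrands at most by a sign.
\<close>

definition abs_path_integral :: "nat \<Rightarrow> (real \<Rightarrow> complex) \<Rightarrow> (complex \<Rightarrow> complex) \<Rightarrow> ennreal" where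
  "abs_path_integral N p h =
     (\<integral>\<^sup>+\<tau>\<in>{0<..real N}. ennreal (cmod (h (p \<tau>) * vector_derivative p (at \<tau>))) \<partial>lborel)"

definition omega3 :: "real \<Rightarrow> nat \<Rightarrow> real \<Rightarrow> nat \<Rightarrow> (real \<Rightarrow> complex) \<Rightarrow> ennreal" where
  "omega3 lam n \<mu> N p =
     abs_path_integral N p (val3 lam (\<lambda>t. Zfun lam t * Fhat lam n t / t)) +
     (\<Sum>s\<in>{1..<n}. ennreal (1 / (2 * \<mu> ^ s)) *
        abs_path_integral N p (val3 lam (\<lambda>t. Zfun lam t * Ghat lam n s t / t)))"

definition varpi3 :: "real \<Rightarrow> nat \<Rightarrow> real \<Rightarrow> nat \<Rightarrow> (real \<Rightarrow> complex) \<Rightarrow> ennreal" where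
  "varpi3 lam n \<mu> N p =
     (\<Sum>s\<in>{..<n - 1}. ennreal (2 / \<mu> ^ s) *
        abs_path_integral N p (val3 lam (\<lambda>t. Zfun lam t * Fhat lam (s + 1) t / t)))"

end

(*
The Liouville-Green approximation V multiplies the Whittaker function by a slowly varying factor
1 + eta. With respect to xi, eta and G = d eta / d xi satisfy the linear system eta' = G,
G' = rho (1 + eta) - (2 mu + psi) G, where rho is the residual of the truncated formal solution of the
Riccati equation, so that the integrals of |rho d xi| and |psi d xi| are bounded by omega and varpi.
Along a progressive path Re xi increases, so the term -2 mu G is damping and a Gronwall argument bounds
eta by its initial data, which vanish at the end of the negative real axis by the asymptotics that
characterise W. The multivalued functions are all single-valued holomorphic functions of
u = Z + z - 2 lam on a slit plane; the two cuts of the half plane merely select different values of u.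
*)
theory Submission
  imports Defs "HOL-Real_Asymp.Real_Asymp"
begin

text \<open>Several obstacles shape the argument. The initial data sit at infinity, where the path
  is arbitrary, so the Gronwall estimate is first applied from a parameter \<open>a > 0\<close> with
  the actual values of the error as data, and only then does \<open>a\<close> tend to 0. Since
  \<open>W\<close> is given by a definite description, its existence and uniqueness have to be
  shown; existence uses the same Gronwall estimate, applied to the leading form
  \<open>z^k e^(-z/2)\<close>. The regions are connected components of the complement of a level
  set; they become usable once they are described by sign conditions on the real part of
  \<open>xi\<close>, which rests on its monotonicity along rays, arcs and lines. Points of the real
  axis belong to the domain but lie on its boundary, hence the derivatives within a set and the
  identity theorem on half balls. The factor \<open>exp (2 \<mu> xi)\<close> is never estimated by
  its size, only by its monotonicity. The parameter \<open>r\<close> enters by algebra alone: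
  approximations of orders \<open>n\<close> and \<open>n + r\<close> differ by an explicit
  exponential, so the bound at order \<open>n + r\<close> with no extra terms implies the general
  one.\<close>

section \<open>An error estimate along a path\<close>

text \<open>The exponential \<open>exp (2 \<mu> X)\<close> is an integrating factor for the damping
  term, and since \<open>Re X\<close> does not decrease, the ratio of its moduli at an earlier and a
  later point is at most 1. In the derivative of \<open>H + G / (2 \<mu>)\<close> the terms free of
  \<open>\<rho>\<close> and \<open>\<psi>\<close> cancel, which gains the factor
  \<open>1 / \<mu>\<close> in the bound of \<open>H\<close>. The finite set \<open>K\<close> is
  meant for the corners of a path.\<close>

lemma liouville_green_gronwall:
  fixes X X' H G \<rho> \<psi> :: "real \<Rightarrow> complex" and \<mu> a b :: real
  assumes ab: "a \<le> b" and K: "finite K" and mu: "\<mu> > 0"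
    and cX: "continuous_on {a..b} X" and cH: "continuous_on {a..b} H" and cG: "continuous_on {a..b} G"
    and dX: "\<And>t. t \<in> {a<..<b} - K \<Longrightarrow> (X has_vector_derivative X' t) (at t)"
    and dH: "\<And>t. t \<in> {a<..<b} - K \<Longrightarrow> (H has_vector_derivative G t * X' t) (at t)"
    and dG: "\<And>t. t \<in> {a<..<b} - K \<Longrightarrow>
      (G has_vector_derivative (\<rho> t * (1 + H t) - (2 * of_real \<mu> + \<psi> t) * G t) * X' t) (at t)"
    and mono: "mono_on {a..b} (\<lambda>t. Re (X t))"
    and iA: "(\<lambda>t. cmod (\<rho> t * X' t)) integrable_on {a..b}"
    and iB: "(\<lambda>t. cmod (\<psi> t * X' t)) integrable_on {a..b}"
    and kA: "\<And>t. t \<in> {a<..<b} - K \<Longrightarrow> isCont (\<lambda>t. cmod (\<rho> t * X' t)) t"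
    and kB: "\<And>t. t \<in> {a<..<b} - K \<Longrightarrow> isCont (\<lambda>t. cmod (\<psi> t * X' t)) t"
  defines "IA \<equiv> integral {a..b} (\<lambda>t. cmod (\<rho> t * X' t))"
    and "IB \<equiv> integral {a..b} (\<lambda>t. cmod (\<psi> t * X' t))"
    and "g0 \<equiv> cmod (G a)" and "a0 \<equiv> cmod (H a) + cmod (G a) / \<mu>"
  defines "J \<equiv> ((1 + a0) * IA + g0 * IB) * exp (IA / \<mu> + IB)"
  shows "cmod (G b) \<le> g0 + J" and "cmod (H b) \<le> a0 + J / \<mu>"
proof -
  define A where "A = (\<lambda>t. cmod (\<rho> t * X' t))"
  define B where "B = (\<lambda>t. cmod (\<psi> t * X' t))"
  \<comment> \<open>Majorant of the perturbation \<open>(\<rho> (1 + H) - \<psi> G) X'\<close>; the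
    bounds of \<open>G\<close> and \<open>H\<close> below are both expressed by its running integral
    \<open>I j\<close>.\<close>
  define j where "j = (\<lambda>t. cmod (1 + H t) * A t + cmod (G t) * B t)"
  have AB0: "A t \<ge> 0" "B t \<ge> 0" "j t \<ge> 0" for t by (auto simp: A_def B_def j_def)
  have prod_int: "(\<lambda>t. cmod (f t) * g t) integrable_on {a..b}"
    if f: "continuous_on {a..b} f" and g: "g integrable_on {a..b}" "\<And>t. g t \<ge> 0"
    for f :: "real \<Rightarrow> complex" and g :: "real \<Rightarrow> real"
  proof -
    have c: "continuous_on {a..b} (\<lambda>t. cmod (f t))" by (intro continuous_intros f)
    have "(\<lambda>t. cmod (f t) * g t) absolutely_integrable_on {a..b}"
    proof (rule absolutely_integrable_bounded_measurable_product_real)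
      show "(\<lambda>t. cmod (f t)) \<in> borel_measurable (lebesgue_on {a..b})"
        by (rule continuous_imp_measurable_on_sets_lebesgue[OF c]) simp
      show "bounded ((\<lambda>t. cmod (f t)) ` {a..b})"
        by (intro compact_imp_bounded compact_continuous_image c) simp
      show "g absolutely_integrable_on {a..b}"
        by (intro nonnegative_absolutely_integrable_1 g)
    qed simp
    then show ?thesis using absolutely_integrable_on_def by blast
  qed
  have iAB: "A integrable_on {a..b}" "B integrable_on {a..b}"
    using iA iB by (simp_all add: A_def B_def)
  have ij: "j integrable_on {a..b}"
    unfolding j_def
    by (intro integrable_add prod_int iAB AB0 continuous_intros cH cG)
  have cont: "isCont A t" "isCont B t" "isCont j t" if "t \<in> {a<..<b} - K" for t
  proof -
    show *: "isCont A t" "isCont B t" using kA kB that by (auto simp: A_def B_def)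
    have "isCont H t" "isCont G t"
      using dH[OF that] dG[OF that] has_vector_derivative_continuous by blast+
    then show "isCont j t" unfolding j_def by (intro continuous_intros *)
  qed
  define I where "I = (\<lambda>f t. integral {a..t} (f :: real \<Rightarrow> real))"
  have cI: "continuous_on {a..b} (I f)" if "f integrable_on {a..b}" for f
    unfolding I_def using indefinite_integral_continuous_1[OF that] .
  have dI: "(I f has_vector_derivative f t) (at t)"
    if "f integrable_on {a..b}" "isCont f t" "t \<in> {a<..<b}" for f t
  proof -
    have "(I f has_vector_derivative f t) (at t within ({a..b} - {}))"
      unfolding I_def
      by (rule integral_has_vector_derivative_continuous_at)
         (use that in \<open>auto intro: continuous_at_imp_continuous_at_within\<close>)
    moreover have "at t within {a..b} = at t"
      using that(3) by (intro at_within_interior) auto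
    ultimately show ?thesis by simp
  qed
  have sub: "f integrable_on {a..t}" if "f integrable_on {a..b}" "t \<in> {a..b}" for f :: "real \<Rightarrow> real" and t
    using integrable_subinterval_real[OF that(1), of a t] that(2) by auto
  have bound: "cmod (f t - f a) \<le> c * I j t"
    if t: "t \<in> {a..b}" and cf: "continuous_on {a..b} f"
      and df: "\<And>s. s \<in> {a<..<b} - K \<Longrightarrow> (f has_vector_derivative f' s) (at s)"
      and le: "\<And>s. s \<in> {a<..<t} - K \<Longrightarrow> cmod (f' s) \<le> c * j s" and c: "c \<ge> 0"
    for f f' :: "real \<Rightarrow> complex" and t c
  proof -
    \<comment> \<open>The derivative is set to 0 at the exceptional points, so that the pointwise
      bound holds on the whole interval.\<close>
    define f'' where "f'' = (\<lambda>s. if s \<in> K \<union> {a, t} then 0 else f' s)"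
    have "(f'' has_integral (f t - f a)) {a..t}"
      by (rule fundamental_theorem_of_calculus_interior_strong[where S = "K \<union> {a, t}"])
         (use t K df cf in \<open>auto simp: f''_def intro: continuous_on_subset\<close>)
    then have *: "f t - f a = integral {a..t} f''" "f'' integrable_on {a..t}"
      by (auto simp: integral_unique has_integral_integrable)
    have "cmod (integral {a..t} f'') \<le> integral {a..t} (\<lambda>s. c * j s)"
    proof (rule integral_norm_bound_integral)
      show "(\<lambda>s. c * j s) integrable_on {a..t}"
        by (intro integrable_on_mult_right sub[OF ij t])
      show "cmod (f'' s) \<le> c * j s" if "s \<in> {a..t}" for s
        using that le[of s] AB0 c by (auto simp: f''_def)
    qed (use * in auto)
    then show ?thesis using * by (simp add: I_def)
  qed
  have Gle: "cmod (G t) \<le> g0 + I j t" if t: "t \<in> {a..b}" for t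
  proof -
    define f where "f = (\<lambda>s. exp (2 * of_real \<mu> * X s) * G s)"
    define f' where "f' = (\<lambda>s. exp (2 * of_real \<mu> * X s) * ((\<rho> s * (1 + H s) - \<psi> s * G s) * X' s))"
    have Xle: "Re (X s) \<le> Re (X t)" if "s \<in> {a..t}" for s
      using mono that t by (auto simp: mono_on_def)
    have "cmod (f t - f a) \<le> exp (2 * \<mu> * Re (X t)) * I j t"
    proof (rule bound[OF t])
      show "continuous_on {a..b} f" unfolding f_def by (intro continuous_intros cX cG)
      show "(f has_vector_derivative f' s) (at s)" if "s \<in> {a<..<b} - K" for s
      proof -
        have 1: "((\<lambda>s. exp (2 * of_real \<mu> * X s)) has_vector_derivative
            (X' s * (2 * of_real \<mu>)) * exp (2 * of_real \<mu> * X s)) (at s)"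
        proof -
          have "((\<lambda>x. exp (2 * of_real \<mu> * x)) has_field_derivative
              (2 * of_real \<mu>) * exp (2 * of_real \<mu> * X s)) (at (X s))"
            by (auto intro!: derivative_eq_intros)
          from field_vector_diff_chain_at[OF dX[OF that] this] show ?thesis
            by (simp add: o_def mult.assoc)
        qed
        show ?thesis unfolding f_def f'_def
          by (rule has_vector_derivative_eq_rhs[OF has_vector_derivative_mult[OF 1 dG[OF that]]])
             (simp add: algebra_simps)
      qed
      show "cmod (f' s) \<le> exp (2 * \<mu> * Re (X t)) * j s" if "s \<in> {a<..<t} - K" for s
      proof -
        have "cmod ((\<rho> s * (1 + H s) - \<psi> s * G s) * X' s)
            = cmod ((1 + H s) * (\<rho> s * X' s) - G s * (\<psi> s * X' s))"
          by (simp add: algebra_simps)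
        also have "\<dots> \<le> j s"
          unfolding j_def A_def B_def norm_mult[symmetric] by (rule norm_triangle_ineq4)
        finally have "cmod (f' s) \<le> exp (2 * \<mu> * Re (X s)) * j s"
          unfolding f'_def norm_mult[of "exp _"] by (simp add: norm_exp_eq_Re mult_left_mono)
        also have "\<dots> \<le> exp (2 * \<mu> * Re (X t)) * j s"
          using Xle[of s] that mu AB0 by (intro mult_right_mono) auto
        finally show ?thesis .
      qed
    qed simp
    moreover have "cmod (f t) = exp (2 * \<mu> * Re (X t)) * cmod (G t)"
      by (simp add: f_def norm_mult norm_exp_eq_Re)
    moreover have "cmod (f a) \<le> exp (2 * \<mu> * Re (X t)) * g0"
      using Xle[of a] t mu by (simp add: f_def norm_mult norm_exp_eq_Re g0_def mult_right_mono)
    moreover have "cmod (f t) \<le> cmod (f a) + cmod (f t - f a)"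
      by (metis add.commute norm_triangle_sub)
    ultimately have "exp (2 * \<mu> * Re (X t)) * cmod (G t) \<le> exp (2 * \<mu> * Re (X t)) * (g0 + I j t)"
      by (simp add: algebra_simps)
    then show ?thesis by simp
  qed
  have Hle: "cmod (H t) \<le> a0 + I j t / \<mu>" if t: "t \<in> {a..b}" for t
  proof -
    define f where "f = (\<lambda>s. H s + G s / (2 * of_real \<mu>))"
    define f' where "f' = (\<lambda>s. ((\<rho> s * (1 + H s) - \<psi> s * G s) * X' s) / (2 * of_real \<mu>))"
    have "cmod (f t - f a) \<le> (1 / (2 * \<mu>)) * I j t"
    proof (rule bound[OF t])
      show "continuous_on {a..b} f" unfolding f_def using mu by (intro continuous_intros cH cG) auto
      show "(f has_vector_derivative f' s) (at s)" if "s \<in> {a<..<b} - K" for s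
        unfolding f_def f'_def
        by (rule has_vector_derivative_eq_rhs[OF has_vector_derivative_add[OF dH[OF that]
              has_vector_derivative_divide[OF dG[OF that]]]])
           (use mu in \<open>simp add: field_simps\<close>)
      show "cmod (f' s) \<le> (1 / (2 * \<mu>)) * j s" if "s \<in> {a<..<t} - K" for s
      proof -
        have "cmod ((\<rho> s * (1 + H s) - \<psi> s * G s) * X' s)
            = cmod ((1 + H s) * (\<rho> s * X' s) - G s * (\<psi> s * X' s))"
          by (simp add: algebra_simps)
        also have "\<dots> \<le> j s"
          unfolding j_def A_def B_def norm_mult[symmetric] by (rule norm_triangle_ineq4)
        finally show ?thesis using mu by (simp add: f'_def norm_divide divide_simps norm_mult)
      qed
    qed (use mu in simp)
    moreover have "cmod (H t) \<le> cmod (f t) + cmod (G t) / (2 * \<mu>)"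
      using norm_triangle_ineq4[of "f t" "G t / (2 * of_real \<mu>)"] mu
      by (simp add: f_def norm_divide norm_mult)
    moreover have "cmod (f a) \<le> cmod (H a) + g0 / (2 * \<mu>)"
      using norm_triangle_ineq[of "H a" "G a / (2 * of_real \<mu>)"] mu
      by (simp add: f_def norm_divide norm_mult g0_def)
    moreover have "cmod (f t) \<le> cmod (f a) + cmod (f t - f a)"
      by (metis add.commute norm_triangle_sub)
    moreover have "cmod (G t) / (2 * \<mu>) \<le> (g0 + I j t) / (2 * \<mu>)"
      using Gle[OF t] mu by (intro divide_right_mono) auto
    ultimately have "cmod (H t) \<le> cmod (H a) + g0 / (2 * \<mu>) + (1 / (2 * \<mu>)) * I j t + (g0 + I j t) / (2 * \<mu>)"
      by linarith
    also have "\<dots> = a0 + I j t / \<mu>" using mu by (simp add: a0_def g0_def field_simps)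
    finally show ?thesis .
  qed
  have I0: "I f a = 0" for f by (simp add: I_def)
  have a0: "a0 \<ge> 0" "g0 \<ge> 0" using mu by (auto simp: a0_def g0_def)
  define \<Phi> where "\<Phi> = (\<lambda>t. I A t / \<mu> + I B t)"
  \<comment> \<open>Gronwall's argument: \<open>\<Phi>\<close> is the primitive of the coefficient
    of \<open>I j\<close> in the estimate of \<open>j\<close>, so \<open>D\<close> starts at 0 and
    has a nonpositive derivative off the corners. In the inhomogeneous part the factor
    \<open>exp (- \<Phi>) \<le> 1\<close> is given away.\<close>
  define D where "D = (\<lambda>t. I j t * exp (- \<Phi> t) - ((1 + a0) * I A t + g0 * I B t))"
  define D' where "D' = (\<lambda>t. (j t - I j t * (A t / \<mu> + B t)) * exp (- \<Phi> t) - ((1 + a0) * A t + g0 * B t))"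
  have Ipos: "I f t \<ge> 0" if "t \<in> {a..b}" "f integrable_on {a..b}" "\<And>s. f s \<ge> 0" for f t
    unfolding I_def by (rule integral_nonneg[OF sub[OF that(2,1)] that(3)])
  have "D b \<le> 0"
  proof -
    define D'' where "D'' = (\<lambda>s. if s \<in> K \<union> {a, b} then 0 else D' s)"
    have "(D'' has_integral (D b - D a)) {a..b}"
    proof (rule fundamental_theorem_of_calculus_interior_strong[where S = "K \<union> {a, b}"])
      show "continuous_on {a..b} D" unfolding D_def \<Phi>_def
        by (intro continuous_intros cI ij iAB) (use mu in auto)
      fix t assume t: "t \<in> {a<..<b} - (K \<union> {a, b})"
      then have t': "t \<in> {a<..<b} - K" "t \<in> {a<..<b}" by auto
      note d = dI[OF iAB(1) cont(1)[OF t'(1)] t'(2)] dI[OF iAB(2) cont(2)[OF t'(1)] t'(2)]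
        dI[OF ij cont(3)[OF t'(1)] t'(2)]
      note d' = d[folded has_real_derivative_iff_has_vector_derivative]
      have "(D has_real_derivative D' t) (at t)"
      proof -
        have dPhi: "(\<Phi> has_real_derivative A t / \<mu> + B t) (at t)"
          unfolding \<Phi>_def by (intro DERIV_add DERIV_cdivide d')
        show ?thesis unfolding D_def D'_def
          by (rule DERIV_cong[OF DERIV_diff[OF DERIV_mult'[OF d'(3) DERIV_fun_exp[OF DERIV_minus[OF dPhi]]]
                DERIV_add[OF DERIV_cmult[OF d'(1)] DERIV_cmult[OF d'(2)]]]])
             (simp add: algebra_simps)
      qed
      then show "(D has_vector_derivative D'' t) (at t)"
        using t by (simp add: D''_def has_real_derivative_iff_has_vector_derivative)
    qed (use ab K in auto)
    moreover have "D'' t \<le> 0" if "t \<in> {a..b}" for t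
    proof (cases "t \<in> K \<union> {a, b}")
      case False
      have "j t \<le> (1 + a0 + I j t / \<mu>) * A t + (g0 + I j t) * B t"
      proof -
        have "cmod (1 + H t) \<le> 1 + cmod (H t)" by (metis norm_one norm_triangle_ineq)
        then have "cmod (1 + H t) \<le> 1 + a0 + I j t / \<mu>" using Hle[OF that] by simp
        then show ?thesis
          using add_mono[OF mult_right_mono[OF _ AB0(1)] mult_right_mono[OF Gle[OF that] AB0(2)]]
          by (metis j_def)
      qed
      then have "j t - I j t * (A t / \<mu> + B t) \<le> (1 + a0) * A t + g0 * B t"
        by (simp add: algebra_simps)
      then have "(j t - I j t * (A t / \<mu> + B t)) * exp (- \<Phi> t) \<le> ((1 + a0) * A t + g0 * B t) * exp (- \<Phi> t)"
        by (intro mult_right_mono) auto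
      also have "\<dots> \<le> ((1 + a0) * A t + g0 * B t) * 1"
      proof (rule mult_left_mono)
          have "\<Phi> t \<ge> 0" unfolding \<Phi>_def
            using Ipos[OF that iAB(1)] Ipos[OF that iAB(2)] AB0 mu by simp
          then show "exp (- \<Phi> t) \<le> 1" by simp
        qed (use AB0 a0 in auto)
      finally show ?thesis using False by (simp add: D''_def D'_def)
    qed (simp add: D''_def)
    ultimately have "D b - D a \<le> 0"
      using has_integral_le[of D'' "D b - D a" "{a..b}" "\<lambda>_. 0" 0] by auto
    then show ?thesis by (simp add: D_def I0)
  qed
  then have "I j b * exp (- \<Phi> b) \<le> (1 + a0) * IA + g0 * IB"
    by (simp add: D_def IA_def IB_def I_def A_def B_def)
  then have "I j b * exp (- \<Phi> b) * exp (\<Phi> b) \<le> ((1 + a0) * IA + g0 * IB) * exp (\<Phi> b)"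
    by (intro mult_right_mono) auto
  moreover have "I j b * exp (- \<Phi> b) * exp (\<Phi> b) = I j b"
    by (simp add: mult.assoc exp_minus_inverse[of "- \<Phi> b", simplified])
  moreover have "\<Phi> b = IA / \<mu> + IB" by (simp add: \<Phi>_def IA_def IB_def I_def A_def B_def)
  ultimately have "I j b \<le> J" by (metis J_def)
  then show "cmod (G b) \<le> g0 + J" "cmod (H b) \<le> a0 + J / \<mu>"
    using Gle[of b] Hle[of b] ab mu divide_right_mono[of "I j b" J \<mu>] by auto
qed

section \<open>The Whittaker function\<close>

fun linear_ode_coeff :: "(nat \<Rightarrow> complex) \<Rightarrow> complex \<Rightarrow> complex \<Rightarrow> nat \<Rightarrow> complex" where
  "linear_ode_coeff q c0 c1 0 = c0"
| "linear_ode_coeff q c0 c1 (Suc 0) = c1"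
| "linear_ode_coeff q c0 c1 (Suc (Suc n)) =
     (\<Sum>k\<le>n. q k * linear_ode_coeff q c0 c1 (n - k)) / (of_nat (n + 1) * of_nat (n + 2))"

text \<open>These are the Taylor coefficients of a solution of \<open>h'' = q h\<close>. Once the
  denominator \<open>(m + 1) (m + 2)\<close> exceeds \<open>R^2 S\<close>, the recursion cannot
  raise the maximum of the weighted coefficients, so the finitely many earlier ones bound all of
  them.\<close>

lemma linear_ode_coeff_bounded:
  assumes q: "summable (\<lambda>k. cmod (q k) * R ^ k)" and R: "R > 0"
  shows "\<exists>M. \<forall>n. cmod (linear_ode_coeff q c0 c1 n) * R ^ n \<le> M"
proof -
  let ?a = "linear_ode_coeff q c0 c1"
  define S where "S = (\<Sum>k. cmod (q k) * R ^ k)"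
  have S: "(\<Sum>k\<le>n. cmod (q k) * R ^ k) \<le> S" for n
    unfolding S_def using q R by (intro sum_le_suminf) auto
  obtain n0 :: nat where n0: "R\<^sup>2 * S \<le> n0" using real_arch_simple by blast
  define M where "M = Max ((\<lambda>n. cmod (?a n) * R ^ n) ` {..n0 + 2})"
  have M: "cmod (?a n) * R ^ n \<le> M" if "n \<le> n0 + 2" for n
    unfolding M_def using that by (intro Max_ge) auto
  have M0: "M \<ge> 0" using M[of 0] by (meson norm_ge_zero R mult_nonneg_nonneg order_trans zero_le_power less_imp_le le0)
  have "cmod (?a n) * R ^ n \<le> M" for n
  proof (induction n rule: less_induct)
    case (less n)
    show ?case
    proof (cases "n \<le> n0 + 2")
      case False
      define m where "m = n - 2"
      with False have m: "n = Suc (Suc m)" "m \<ge> n0" by auto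
      have "cmod (\<Sum>k\<le>m. q k * ?a (m - k)) * R ^ m \<le> (\<Sum>k\<le>m. cmod (q k * ?a (m - k))) * R ^ m"
        using R by (intro mult_right_mono norm_sum) auto
      also have "\<dots> = (\<Sum>k\<le>m. cmod (q k) * R ^ k * (cmod (?a (m - k)) * R ^ (m - k)))"
        unfolding sum_distrib_right
      proof (rule sum.cong[OF refl])
        fix k assume "k \<in> {..m}"
        then have "R ^ m = R ^ k * R ^ (m - k)" by (simp flip: power_add)
        then show "cmod (q k * ?a (m - k)) * R ^ m = cmod (q k) * R ^ k * (cmod (?a (m - k)) * R ^ (m - k))"
          by (simp add: norm_mult)
      qed
      also have "\<dots> \<le> (\<Sum>k\<le>m. cmod (q k) * R ^ k * M)"
        using R m less by (intro sum_mono mult_left_mono) auto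
      also have "\<dots> \<le> S * M" unfolding sum_distrib_right[symmetric] using S M0 by (intro mult_right_mono)
      finally have "cmod (\<Sum>k\<le>m. q k * ?a (m - k)) * R ^ m * R\<^sup>2 \<le> (S * M) * R\<^sup>2"
        using R by (intro mult_right_mono) auto
      also have "\<dots> \<le> real n0 * M" using n0 M0 mult_right_mono[OF n0 M0] by (simp add: mult_ac)
      also have "\<dots> \<le> (real (m + 1) * real (m + 2)) * M"
      proof (rule mult_right_mono[OF _ M0])
        have "real n0 * 1 \<le> real (m + 1) * real (m + 2)" using m by (intro mult_mono) auto
        then show "real n0 \<le> real (m + 1) * real (m + 2)" by simp
      qed
      finally have *: "cmod (\<Sum>k\<le>m. q k * ?a (m - k)) * R ^ m * R\<^sup>2 \<le> (real (m + 1) * real (m + 2)) * M" .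
      have "cmod (?a n) * R ^ n = cmod (\<Sum>k\<le>m. q k * ?a (m - k)) * R ^ m * R\<^sup>2 / (real (m + 1) * real (m + 2))"
        unfolding m(1) linear_ode_coeff.simps norm_divide norm_mult norm_of_nat
        by (simp add: power2_eq_square)
      also have "\<dots> \<le> M" using * by (subst pos_divide_le_eq) (auto simp: mult_ac)
      finally show ?thesis .
    qed (use M in auto)
  qed
  then show ?thesis by blast
qed

text \<open>Boundedness of the weighted coefficients at radius \<open>2 r\<close> gives geometric
  domination at radius \<open>r\<close>, hence an infinite radius of convergence; the differential
  equation is then an identity of formal power series about \<open>w0\<close>.\<close>

lemma entire_linear_ode_solution:
  fixes q :: "complex \<Rightarrow> complex"
  assumes q: "q holomorphic_on UNIV"
  obtains h where "h holomorphic_on UNIV" "\<And>w. deriv (deriv h) w = q w * h w" "h w0 = c0" "deriv h w0 = c1"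
proof -
  define q0 where "q0 = (\<lambda>w. q (w0 + w))"
  have q0: "q0 holomorphic_on UNIV" unfolding q0_def
    by (rule holomorphic_on_compose_gen[of "\<lambda>w. w0 + w" UNIV q UNIV, unfolded o_def])
       (auto intro!: holomorphic_intros q)
  define Q where "Q = fps_expansion q0 0"
  have Qrad: "fps_conv_radius Q = \<infinity>"
    unfolding Q_def using q0 by (intro conv_radius_fps_expansion ereal_infty_less_eq[THEN iffD1])
      (auto intro!: antisym conv_radius_fps_expansion holomorphic_on_subset[OF q0] simp: eball_def)
  have Qev: "eval_fps Q w = q0 w" for w
    unfolding Q_def using eval_fps_expansion'[of q0 0 \<infinity> w] q0 
    by (auto simp: eball_def intro: holomorphic_on_subset)
  define a where "a = linear_ode_coeff (fps_nth Q) c0 c1"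
  define F where "F = Abs_fps a"
  have Frad: "fps_conv_radius F = \<infinity>"
  proof (rule antisym)
    show "\<infinity> \<le> fps_conv_radius F"
      unfolding fps_conv_radius_def
    proof (rule conv_radius_geI_ex)
      fix r :: real assume r: "0 < r"
      have "summable (\<lambda>k. cmod (fps_nth Q k) * (2 * r) ^ k)"
      proof -
        have "summable (\<lambda>k. fps_nth Q k * of_real (3 * r) ^ k)"
          by (rule summable_in_conv_radius) (use r Qrad in \<open>simp_all add: fps_conv_radius_def\<close>)
        then have "summable (\<lambda>k. cmod (fps_nth Q k * of_real (2 * r) ^ k))"
          by (rule powser_insidea) (use r in simp)
        then show ?thesis using r by (simp add: norm_mult norm_power)
      qed
      from linear_ode_coeff_bounded[OF this, of c0 c1] r
      obtain M where M: "\<And>n. cmod (a n) * (2 * r) ^ n \<le> M" unfolding a_def by auto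
      have "summable (\<lambda>n. a n * of_real r ^ n)"
      proof (rule summable_comparison_test'[where g = "\<lambda>n. M * (1/2) ^ n" and N = 0])
        fix n
        have "cmod (a n * of_real r ^ n) = cmod (a n) * (2 * r) ^ n * (1/2) ^ n"
          using r by (simp add: norm_mult norm_power power_divide power_mult_distrib)
        also have "\<dots> \<le> M * (1/2) ^ n" using M by (intro mult_right_mono) auto
        finally show "cmod (a n * of_real r ^ n) \<le> M * (1/2) ^ n" .
      qed (intro summable_mult summable_geometric, simp)
      then show "\<exists>z. norm z = r \<and> summable (\<lambda>n. fps_nth F n * z ^ n)"
        using r by (intro exI[of _ "of_real r"]) (simp add: F_def)
    qed
  qed simp
  have F2: "fps_deriv (fps_deriv F) = Q * F"
  proof (rule fps_ext)
    fix n
    have "fps_nth (fps_deriv (fps_deriv F)) n = of_nat (n + 1) * (of_nat (n + 2) * a (n + 2))"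
      by (simp add: F_def)
    also have "\<dots> = (\<Sum>k\<le>n. fps_nth Q k * a (n - k))"
      by (simp add: a_def del: of_nat_Suc of_nat_add)
    also have "\<dots> = fps_nth (Q * F) n"
      by (simp add: fps_mult_nth F_def atLeast0AtMost)
    finally show "fps_nth (fps_deriv (fps_deriv F)) n = fps_nth (Q * F) n" .
  qed
  have F'rad: "fps_conv_radius (fps_deriv F) = \<infinity>"
    using Frad fps_conv_radius_deriv[of F] by simp
  define h where "h = (\<lambda>w. eval_fps F (w - w0))"
  have d1: "(h has_field_derivative eval_fps (fps_deriv F) (w - w0)) (at w)" for w
    unfolding h_def
    by (rule DERIV_cong[OF DERIV_chain'[where g = "eval_fps F", OF _ has_field_derivative_eval_fps]])
       (auto intro!: derivative_eq_intros simp: Frad)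
  have d2: "((\<lambda>w. eval_fps (fps_deriv F) (w - w0)) has_field_derivative eval_fps (fps_deriv (fps_deriv F)) (w - w0)) (at w)" for w
    by (rule DERIV_cong[OF DERIV_chain'[where g = "eval_fps (fps_deriv F)", OF _ has_field_derivative_eval_fps]])
       (auto intro!: derivative_eq_intros simp: F'rad)
  have dh: "deriv h = (\<lambda>w. eval_fps (fps_deriv F) (w - w0))"
    using DERIV_imp_deriv[OF d1] by auto
  show ?thesis
  proof
    show "h holomorphic_on UNIV" using d1 by (auto simp: holomorphic_on_open)
    show "deriv (deriv h) w = q w * h w" for w
    proof -
      have "deriv (deriv h) w = eval_fps (Q * F) (w - w0)"
        unfolding dh using DERIV_imp_deriv[OF d2, of w] by (simp add: F2)
      also have "\<dots> = q w * h w"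
        by (subst eval_fps_mult) (auto simp: Frad Qrad Qev q0_def h_def)
      finally show ?thesis .
    qed
    show "h w0 = c0" by (simp add: h_def eval_fps_at_0 F_def a_def)
    show "deriv h w0 = c1" by (simp add: dh eval_fps_at_0 F_def a_def)
  qed
qed


section \<open>The Whittaker equation in the logarithmic coordinate\<close>

definition whittaker_solution :: "real \<Rightarrow> real \<Rightarrow> (complex \<Rightarrow> complex) \<Rightarrow> bool" where
  "whittaker_solution k \<mu> g \<longleftrightarrow> g holomorphic_on UNIV \<and>
     (\<forall>w. deriv (deriv g) w - deriv g w =
        (of_real \<mu> ^ 2 - 1/4 - of_real k * exp w + exp w ^ 2 / 4) * g w)"

text \<open>Exponent of the leading form \<open>z^k e^(-z/2)\<close> at \<open>z = e^w\<close>; the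
  slope is its derivative in \<open>w\<close>, and the ratio is the quotient whose limit 1
  normalises \<open>W\<close>.\<close>

definition whittaker_phase :: "real \<Rightarrow> complex \<Rightarrow> complex" where
  "whittaker_phase k w = of_real k * w - exp w / 2"

definition whittaker_slope :: "real \<Rightarrow> complex \<Rightarrow> complex" where
  "whittaker_slope k w = of_real k - exp w / 2"

definition whittaker_ratio :: "real \<Rightarrow> (complex \<Rightarrow> complex) \<Rightarrow> complex \<Rightarrow> complex" where
  "whittaker_ratio k g w = g w * exp (- whittaker_phase k w)"

lemma entire_has_derivs:
  assumes "g holomorphic_on UNIV"
  shows "(g has_field_derivative deriv g w) (at w within A)"
    and "(deriv g has_field_derivative deriv (deriv g) w) (at w within A)"
  using assms holomorphic_derivI[of g UNIV w] holomorphic_derivI[of "deriv g" UNIV w] holomorphic_deriv[of g UNIV]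
    has_field_derivative_at_within by blast+

text \<open>For \<open>z = e^w\<close> one has \<open>z^2 y'' = g'' - g'\<close>; multiplication by
  \<open>z^2\<close> clears the denominators and leaves entire coefficients.\<close>

lemma is_whittaker_W_iff:
  "is_whittaker_W k \<mu> g \<longleftrightarrow> whittaker_solution k \<mu> g \<and>
     (\<forall>\<delta>>0. (whittaker_ratio k g \<longlongrightarrow> 1)
        (inf (filtercomap Re at_top) (principal {w. \<bar>Im w\<bar> \<le> 3 / 2 * pi - \<delta>})))"
proof -
  have 1: "d_dz (d_dz g) w = (deriv (deriv g) w - deriv g w) / exp w ^ 2" if "g holomorphic_on UNIV" for w
  proof -
    have "((\<lambda>w. deriv g w / exp w) has_field_derivative (deriv (deriv g) w - deriv g w) / exp w) (at w)"
      by (rule derivative_eq_intros entire_has_derivs[OF that] refl | simp)+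
         (simp add: field_simps)
    then show ?thesis
      unfolding d_dz_def by (subst DERIV_imp_deriv) (auto simp: power2_eq_square)
  qed
  have 2: "(X / exp w ^ 2 = ((of_real \<mu> ^ 2 - 1/4) / exp w ^ 2 - of_real k / exp w + 1/4) * Y) \<longleftrightarrow>
     X = (of_real \<mu> ^ 2 - 1/4 - of_real k * exp w + exp w ^ 2 / 4) * Y" for X Y w :: complex
  proof -
    have "((of_real \<mu> ^ 2 - 1/4) / exp w ^ 2 - of_real k / exp w + 1/4) * Y
        = (of_real \<mu> ^ 2 - 1/4 - of_real k * exp w + exp w ^ 2 / 4) * Y / exp w ^ 2"
      by (simp add: field_simps power2_eq_square)
    then show ?thesis by simp
  qed
  have 3: "(\<lambda>w. g w / (exp (of_real k * w) * exp (- exp w / 2))) = whittaker_ratio k g"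
    by (auto simp: whittaker_ratio_def whittaker_phase_def field_simps simp flip: exp_add exp_minus)
  show ?thesis
    unfolding is_whittaker_W_def whittaker_solution_def 3
    using 1 2 by auto
qed

lemma whittaker_solution_combination:
  assumes "whittaker_solution k \<mu> f" "whittaker_solution k \<mu> g"
  shows "whittaker_solution k \<mu> (\<lambda>w. \<alpha> * f w + \<beta> * g w)"
    and "deriv (\<lambda>w. \<alpha> * f w + \<beta> * g w) = (\<lambda>w. \<alpha> * deriv f w + \<beta> * deriv g w)"
proof -
  have fg: "f holomorphic_on UNIV" "g holomorphic_on UNIV" using assms by (auto simp: whittaker_solution_def)
  show 1: "deriv (\<lambda>w. \<alpha> * f w + \<beta> * g w) = (\<lambda>w. \<alpha> * deriv f w + \<beta> * deriv g w)"
    by (rule ext, rule DERIV_imp_deriv) (auto intro!: derivative_eq_intros entire_has_derivs fg)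
  have 2: "deriv (\<lambda>w. \<alpha> * deriv f w + \<beta> * deriv g w) = (\<lambda>w. \<alpha> * deriv (deriv f) w + \<beta> * deriv (deriv g) w)"
    by (rule ext, rule DERIV_imp_deriv) (auto intro!: derivative_eq_intros entire_has_derivs fg)
  have "\<alpha> * deriv (deriv f) w + \<beta> * deriv (deriv g) w - (\<alpha> * deriv f w + \<beta> * deriv g w)
     = \<alpha> * (deriv (deriv f) w - deriv f w) + \<beta> * (deriv (deriv g) w - deriv g w)" for w
    by (simp add: algebra_simps)
  then show "whittaker_solution k \<mu> (\<lambda>w. \<alpha> * f w + \<beta> * g w)"
    using assms fg unfolding whittaker_solution_def 1 2
    by (auto intro!: holomorphic_intros simp: algebra_simps)
qed

text \<open>Abel's formula: the first-order term of the equation is \<open>g'\<close> with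
  coefficient 1, so the Wronskian equals its own derivative.\<close>

lemma whittaker_wronskian:
  assumes "whittaker_solution k \<mu> f" "whittaker_solution k \<mu> g"
  obtains c where "\<And>w. f w * deriv g w - deriv f w * g w = c * exp w"
proof -
  have fg: "f holomorphic_on UNIV" "g holomorphic_on UNIV" using assms by (auto simp: whittaker_solution_def)
  define P where "P = (\<lambda>w. (of_real \<mu> ^ 2 - 1/4 - of_real k * exp w + exp w ^ 2 / 4 :: complex))"
  have eq: "deriv (deriv f) w = deriv f w + P w * f w" "deriv (deriv g) w = deriv g w + P w * g w" for w
    using assms by (simp_all add: whittaker_solution_def P_def algebra_simps)
  have "((\<lambda>w. (f w * deriv g w - deriv f w * g w) * exp (- w)) has_field_derivative 0) (at w)" for w
    by (rule derivative_eq_intros entire_has_derivs fg refl | simp)+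
       (simp add: eq algebra_simps)
  then have "\<forall>x\<in>UNIV. ((\<lambda>w. (f w * deriv g w - deriv f w * g w) * exp (- w)) has_field_derivative 0) (at x within UNIV)"
    by simp
  then obtain c where c: "\<And>w. (f w * deriv g w - deriv f w * g w) * exp (- w) = c"
    using has_field_derivative_zero_constant[of UNIV "\<lambda>w. (f w * deriv g w - deriv f w * g w) * exp (- w)"] by auto
  have "f w * deriv g w - deriv f w * g w = c * exp w" for w
    using c[of w] by (simp add: exp_minus field_simps)
  then show ?thesis by (rule that)
qed

lemma whittaker_solution_exists:
  obtains g where "whittaker_solution k \<mu> g" "g w0 = c0" "deriv g w0 = c1"
proof -
  \<comment> \<open>The substitution \<open>g = exp (w / 2) h\<close> removes the first derivative
    and at the same time cancels the \<open>- 1/4\<close> in the coefficient.\<close>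
  define q where "q = (\<lambda>w. of_real \<mu> ^ 2 - of_real k * exp w + exp w ^ 2 / 4 :: complex)"
  have "q holomorphic_on UNIV" unfolding q_def by (intro holomorphic_intros) auto
  from entire_linear_ode_solution[OF this, of w0 "exp (- w0 / 2) * c0" "exp (- w0 / 2) * (c1 - c0 / 2)"]
  obtain h where h: "h holomorphic_on UNIV" "\<And>w. deriv (deriv h) w = q w * h w"
    "h w0 = exp (- w0 / 2) * c0" "deriv h w0 = exp (- w0 / 2) * (c1 - c0 / 2)" by blast
  define g where "g = (\<lambda>w. exp (w / 2) * h w)"
  have 1: "deriv g = (\<lambda>w. exp (w / 2) * (deriv h w + h w / 2))"
    unfolding g_def
    by (rule ext, rule DERIV_imp_deriv)
       (rule derivative_eq_intros entire_has_derivs h(1) refl | simp add: algebra_simps)+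
  have 2: "deriv (deriv g) = (\<lambda>w. exp (w / 2) * (deriv (deriv h) w + deriv h w + h w / 4))"
    unfolding 1
    by (rule ext, rule DERIV_imp_deriv)
       (auto intro!: derivative_eq_intros entire_has_derivs h(1) simp: field_simps)
  show ?thesis
  proof
    show "whittaker_solution k \<mu> g"
      unfolding whittaker_solution_def 2 unfolding 1
      by (auto simp: g_def h(2) q_def algebra_simps intro!: holomorphic_intros h(1))
    show "g w0 = c0" by (simp add: g_def h(3) flip: exp_add mult.assoc)
    show "deriv g w0 = c1"
      by (simp add: 1 h(3,4) distrib_left right_diff_distrib flip: exp_add mult.assoc)
  qed
qed

lemma whittaker_ratio_deriv:
  assumes "whittaker_solution k \<mu> g"
  shows "(whittaker_ratio k g has_field_derivative
            (deriv g w - whittaker_slope k w * g w) * exp (- whittaker_phase k w)) (at w within A)"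
proof -
  have "g holomorphic_on UNIV" using assms by (simp add: whittaker_solution_def)
  then show ?thesis
    unfolding whittaker_ratio_def whittaker_phase_def whittaker_slope_def
    by (auto intro!: derivative_eq_intros entire_has_derivs simp: algebra_simps)
qed

section \<open>Estimates for the relative error of the leading form\<close>

text \<open>
  The ratio of a solution to its Liouville-Green approximation, together with its derivative with
  respect to the phase, as a first-order system to which the Gronwall estimate applies.
\<close>

definition whittaker_dratio :: "real \<Rightarrow> (complex \<Rightarrow> complex) \<Rightarrow> complex \<Rightarrow> complex" where
  "whittaker_dratio k g w = (deriv g w - whittaker_slope k w * g w) * exp (- whittaker_phase k w) / whittaker_slope k w"

lemma whittaker_dratio_deriv:
  assumes "whittaker_solution k \<mu> g" and s: "whittaker_slope k w \<noteq> 0"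
  shows "(whittaker_dratio k g has_field_derivative
      (of_real (\<mu>\<^sup>2 - 1/4 - k\<^sup>2 + k) / whittaker_slope k w ^ 2 * whittaker_ratio k g w -
        (2 - of_real k / whittaker_slope k w ^ 2) * whittaker_dratio k g w) * whittaker_slope k w) (at w)"
proof -
  have hol: "g holomorphic_on UNIV" using assms by (simp add: whittaker_solution_def)
  define E where "E = exp (- whittaker_phase k w)"
  define s where "s = whittaker_slope k w"
  have s0: "s \<noteq> 0" using assms by (simp add: s_def)
  have e: "exp w = 2 * (of_real k - s)" by (simp add: s_def whittaker_slope_def)
  have "deriv (deriv g) w = deriv g w + (of_real \<mu> ^ 2 - 1/4 - of_real k * exp w + exp w ^ 2 / 4) * g w"
    using assms by (simp add: whittaker_solution_def algebra_simps)
  \<comment> \<open>Completing the square in the slope leaves a constant, so after division by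
    \<open>s^2\<close> the residual is small where the slope is large.\<close>
  moreover have "of_real \<mu> ^ 2 - 1/4 - of_real k * exp w + exp w ^ 2 / 4 = of_real (\<mu>\<^sup>2 - 1/4) - of_real k ^ 2 + s ^ 2"
    unfolding e by (simp add: power2_eq_square field_simps)
  ultimately have eq: "deriv (deriv g) w = deriv g w + (of_real (\<mu>\<^sup>2 - 1/4) - of_real k ^ 2 + s ^ 2) * g w"
    by simp
  have ds: "(whittaker_slope k has_field_derivative (s - of_real k)) (at w)"
    unfolding whittaker_slope_def s_def by (auto intro!: derivative_eq_intros)
  have dE: "((\<lambda>w. exp (- whittaker_phase k w)) has_field_derivative - s * E) (at w)"
    unfolding whittaker_slope_def s_def whittaker_phase_def E_def
    by (auto intro!: derivative_eq_intros simp: algebra_simps)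
  have "(whittaker_dratio k g has_field_derivative
      (((deriv (deriv g) w - ((s - of_real k) * g w + s * deriv g w)) * E
         + (deriv g w - s * g w) * (- s * E)) * s - (deriv g w - s * g w) * E * (s - of_real k)) / (s * s)) (at w)"
    unfolding whittaker_dratio_def
  proof -
    have d1: "((\<lambda>w. deriv g w - whittaker_slope k w * g w) has_field_derivative
        deriv (deriv g) w - ((s - of_real k) * g w + deriv g w * s)) (at w)"
      unfolding s_def
      by (intro DERIV_diff DERIV_mult entire_has_derivs[OF hol] ds[unfolded s_def])
    show "((\<lambda>w. (deriv g w - whittaker_slope k w * g w) * exp (- whittaker_phase k w) / whittaker_slope k w)
        has_field_derivative
      (((deriv (deriv g) w - ((s - of_real k) * g w + s * deriv g w)) * E
         + (deriv g w - s * g w) * (- s * E)) * s - (deriv g w - s * g w) * E * (s - of_real k)) / (s * s)) (at w)"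
      by (rule DERIV_cong[OF DERIV_divide[OF DERIV_mult[OF d1 dE] ds]])
         (use s0 in \<open>simp_all add: s_def[symmetric] E_def[symmetric] mult.commute\<close>)
  qed
  moreover have "(((deriv (deriv g) w - ((s - of_real k) * g w + s * deriv g w)) * E
         + (deriv g w - s * g w) * (- s * E)) * s - (deriv g w - s * g w) * E * (s - of_real k)) / (s * s)
    = (of_real (\<mu>\<^sup>2 - 1/4 - k\<^sup>2 + k) / s ^ 2 * (g w * E) -
        (2 - of_real k / s ^ 2) * ((deriv g w - s * g w) * E / s)) * s"
  proof -
    have "((a + (m - x\<^sup>2 + s\<^sup>2) * b - ((s - x) * b + s * a)) * E
         + (a - s * b) * (- s * E)) * s - (a - s * b) * E * (s - x)
       = (m - x\<^sup>2 + x) * (b * E) * s - (2 * s\<^sup>2 - x) * ((a - s * b) * E)"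
      for a b x m :: complex
      by (simp add: algebra_simps power2_eq_square)
    moreover have "(r / s ^ 2 * b - (2 - x / s ^ 2) * (c / s)) * s = (r * b * s - (2 * s\<^sup>2 - x) * c) / (s * s)"
      for r b c x :: complex
    proof -
      define i where "i = inverse s"
      have "s * i = 1" using s0 by (simp add: i_def)
      then have "(r * i ^ 2 * b - (2 - x * i ^ 2) * (c * i)) * s = (r * b * s - (2 * s\<^sup>2 - x) * c) * (i * i)"
        by algebra
      then show ?thesis by (simp add: i_def divide_inverse power_inverse)
    qed
    ultimately show ?thesis
      unfolding eq by simp
  qed
  ultimately show ?thesis
    by (simp add: s_def E_def whittaker_ratio_def whittaker_dratio_def)
qed


text \<open>The Gronwall estimate with damping constant 1 on a segment along which the real part of
  the phase does not decrease. With \<open>e\<close> and \<open>e'\<close> at most 1 the accumulated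
  term is at most \<open>3 e' * exp 1 \<le> 9 e'\<close>; the constant 30 is generous.\<close>

lemma whittaker_ratio_step:
  assumes g: "whittaker_solution k \<mu> g"
    and s0: "\<And>t. t \<in> {0..1} \<Longrightarrow> whittaker_slope k (p + of_real t * d) \<noteq> 0"
    and mono: "\<And>t. t \<in> {0..1} \<Longrightarrow> Re (whittaker_slope k (p + of_real t * d) * d) \<ge> 0"
    and B: "(B has_integral I) {0..1}"
    and le: "\<And>t. t \<in> {0..1} \<Longrightarrow>
      (\<bar>\<mu>\<^sup>2 - 1/4 - k\<^sup>2 + k\<bar> + \<bar>k\<bar>) * cmod d / cmod (whittaker_slope k (p + of_real t * d)) \<le> B t"
    and start: "cmod (whittaker_ratio k g p - 1) \<le> e" "cmod (whittaker_dratio k g p) \<le> e"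
    and e: "e \<le> 1" and I: "I \<le> e'" "e' \<le> 1"
  shows "cmod (whittaker_ratio k g (p + d) - 1) \<le> 2 * e + 30 * e'"
    and "cmod (whittaker_dratio k g (p + d)) \<le> e + 30 * e'"
proof -
  define w where "w = (\<lambda>t. p + of_real t * d)"
  define s where "s = (\<lambda>t. whittaker_slope k (w t))"
  define \<rho>0 where "\<rho>0 = \<mu>\<^sup>2 - 1/4 - k\<^sup>2 + k"
  define X where "X = (\<lambda>t. whittaker_phase k (w t))"
  define X' where "X' = (\<lambda>t. s t * d)"
  define H where "H = (\<lambda>t. whittaker_ratio k g (w t) - 1)"
  define G where "G = (\<lambda>t. whittaker_dratio k g (w t))"
  define \<rho> where "\<rho> = (\<lambda>t. complex_of_real \<rho>0 / s t ^ 2)"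
  define \<psi> where "\<psi> = (\<lambda>t. - (complex_of_real k / s t ^ 2))"
  have s0': "s t \<noteq> 0" if "t \<in> {0..1}" for t using s0[OF that] by (simp add: s_def w_def)
  have dw: "(w has_vector_derivative d) (at t within A)" for t A
    unfolding w_def by (auto intro!: derivative_eq_intros)
  have cw: "continuous_on A w" for A unfolding w_def by (intro continuous_intros)
  have cs: "continuous_on A s" for A unfolding s_def whittaker_slope_def by (intro continuous_intros cw) auto
  have chain: "((\<lambda>t. f (w t)) has_vector_derivative f' * d) (at t within A)"
    if "(f has_field_derivative f') (at (w t))" for f f' t A
    using field_vector_diff_chain_within[OF dw[of t A] has_field_derivative_at_within[OF that]]
    by (simp add: o_def mult.commute)
  have dphase: "(whittaker_phase k has_field_derivative whittaker_slope k z) (at z)" for z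
    unfolding whittaker_phase_def whittaker_slope_def by (auto intro!: derivative_eq_intros)
  have dX: "(X has_vector_derivative X' t) (at t within A)" for t A
    unfolding X_def X'_def s_def by (rule chain[OF dphase])
  have dH: "(H has_vector_derivative G t * X' t) (at t within A)" if "t \<in> {0..1}" for t A
  proof -
    have "(H has_vector_derivative (deriv g (w t) - s t * g (w t)) * exp (- whittaker_phase k (w t)) * d - 0) (at t within A)"
      unfolding H_def s_def
      by (intro has_vector_derivative_diff chain whittaker_ratio_deriv[OF g] has_vector_derivative_const)
    then show ?thesis
      using s0'[OF that] by (simp add: G_def X'_def whittaker_dratio_def s_def mult.assoc)
  qed
  have dG: "(G has_vector_derivative (\<rho> t * (1 + H t) - (2 * of_real 1 + \<psi> t) * G t) * X' t) (at t within A)"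
    if "t \<in> {0..1}" for t A
    using chain[OF whittaker_dratio_deriv[OF g], of t A] s0'[OF that]
    by (simp add: G_def \<rho>_def \<psi>_def H_def X'_def s_def \<rho>0_def mult.assoc)
  have norms: "cmod (\<rho> t * X' t) = \<bar>\<rho>0\<bar> * cmod d / cmod (s t)"
    "cmod (\<psi> t * X' t) = \<bar>k\<bar> * cmod d / cmod (s t)" if "t \<in> {0..1}" for t
    using s0'[OF that]
    by (simp_all add: \<rho>_def \<psi>_def X'_def norm_mult norm_divide norm_power power2_eq_square)
  have cA: "continuous_on {0..1} (\<lambda>t. cmod (\<rho> t * X' t))" "continuous_on {0..1} (\<lambda>t. cmod (\<psi> t * X' t))"
    unfolding \<rho>_def \<psi>_def X'_def using s0' by (intro continuous_intros cs; auto)+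
  have iA: "(\<lambda>t. cmod (\<rho> t * X' t)) integrable_on {0..1}" "(\<lambda>t. cmod (\<psi> t * X' t)) integrable_on {0..1}"
    by (intro integrable_continuous_real cA)+
  have "integral {0..1} (\<lambda>t. cmod (\<rho> t * X' t)) + integral {0..1} (\<lambda>t. cmod (\<psi> t * X' t))
      = integral {0..1} (\<lambda>t. cmod (\<rho> t * X' t) + cmod (\<psi> t * X' t))"
    by (rule integral_add[symmetric]) (rule iA)+
  also have "\<dots> \<le> integral {0..1} B"
  proof (rule integral_le)
    fix t :: real assume t: "t \<in> {0..1}"
    show "cmod (\<rho> t * X' t) + cmod (\<psi> t * X' t) \<le> B t"
      using le[OF t] unfolding norms[OF t] by (simp add: s_def w_def \<rho>0_def algebra_simps add_divide_distrib)
  qed (use B iA in \<open>auto intro: integrable_add has_integral_integrable\<close>)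
  also have "\<dots> = I" using B by (rule integral_unique)
  finally have sum: "integral {0..1} (\<lambda>t. cmod (\<rho> t * X' t)) + integral {0..1} (\<lambda>t. cmod (\<psi> t * X' t)) \<le> e'"
    using I by simp
  define a where "a = integral {0..1} (\<lambda>t. cmod (\<rho> t * X' t))"
  define b where "b = integral {0..1} (\<lambda>t. cmod (\<psi> t * X' t))"
  have ab: "a \<ge> 0" "b \<ge> 0" unfolding a_def b_def by (intro integral_nonneg iA; simp)+
  have monoX: "mono_on {0..1} (\<lambda>t. Re (X t))"
  proof (rule mono_onI)
    fix t u :: real assume tu: "t \<in> {0..1}" "u \<in> {0..1}" "t \<le> u"
    show "Re (X t) \<le> Re (X u)"
    proof (rule DERIV_nonneg_imp_nondecreasing[OF tu(3)])
      fix x assume x: "t \<le> x" "x \<le> u"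
      have "((\<lambda>t. Re (X t)) has_real_derivative Re (X' x)) (at x)"
        unfolding has_real_derivative_iff_has_vector_derivative
        by (intro bounded_linear.has_vector_derivative[OF bounded_linear_Re] dX)
      moreover have "Re (X' x) \<ge> 0" using mono[of x] x tu by (simp add: X'_def s_def w_def)
      ultimately show "\<exists>y. ((\<lambda>t. Re (X t)) has_real_derivative y) (at x) \<and> 0 \<le> y" by blast
    qed
  qed
  have c: "continuous_on {0..1} X" "continuous_on {0..1} H" "continuous_on {0..1} G"
    using dX dH dG by (intro continuous_on_vector_derivative; blast)+
  have isc: "isCont (\<lambda>t. cmod (\<rho> t * X' t)) t" "isCont (\<lambda>t. cmod (\<psi> t * X' t)) t" if "t \<in> {0<..<1} - {}" for t
    using cA that by (auto intro: continuous_on_interior)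
  have GW: "cmod (G 1) \<le> cmod (G 0) + ((1 + (cmod (H 0) + cmod (G 0) / 1)) * a + cmod (G 0) * b) * exp (a / 1 + b)"
    "cmod (H 1) \<le> cmod (H 0) + cmod (G 0) / 1 + ((1 + (cmod (H 0) + cmod (G 0) / 1)) * a + cmod (G 0) * b) * exp (a / 1 + b) / 1"
    unfolding a_def b_def
    by (rule liouville_green_gronwall[where a = 0 and b = 1 and K = "{}" and \<mu> = 1 and X = X and X' = X'
          and H = H and G = G and \<rho> = \<rho> and \<psi> = \<psi>];
        use c dX dH dG monoX iA isc in auto)+
  have e0: "cmod (H 0) \<le> e" "cmod (G 0) \<le> e" using start by (simp_all add: H_def G_def w_def)
  have e1: "0 \<le> e" using e0 norm_ge_zero order_trans by blast
  have "(1 + (cmod (H 0) + cmod (G 0) / 1)) * a + cmod (G 0) * b \<le> 3 * a + 1 * b"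
    using e0 e ab by (intro add_mono mult_right_mono) auto
  also have "\<dots> \<le> 3 * e'" using sum ab by (simp add: a_def b_def)
  finally have "((1 + (cmod (H 0) + cmod (G 0) / 1)) * a + cmod (G 0) * b) * exp (a / 1 + b) \<le> 3 * e' * 3"
  proof (intro mult_mono)
    have "exp (a / 1 + b) \<le> exp 1" using sum I by (simp add: a_def b_def)
    then show "exp (a / 1 + b) \<le> 3" using exp_le by (rule order_trans)
  qed (use sum ab in \<open>auto simp: a_def b_def\<close>)
  also have "\<dots> \<le> 30 * e'" using sum ab by (simp add: a_def b_def)
  finally have J: "((1 + (cmod (H 0) + cmod (G 0) / 1)) * a + cmod (G 0) * b) * exp (a / 1 + b) \<le> 30 * e'" .
  show "cmod (whittaker_ratio k g (p + d) - 1) \<le> 2 * e + 30 * e'"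
    using GW(2) J e0 by (simp add: H_def w_def)
  show "cmod (whittaker_dratio k g (p + d)) \<le> e + 30 * e'"
    using GW(1) J e0 by (simp add: G_def w_def)
qed

lemma whittaker_slope_bound:
  assumes "exp (Re w) \<ge> 4 * \<bar>k\<bar>"
  shows "cmod (whittaker_slope k w) \<ge> exp (Re w) / 4" and "whittaker_slope k w \<noteq> 0"
proof -
  have "cmod (exp w / 2) - cmod (of_real k) \<le> cmod (of_real k - exp w / 2)"
    by (metis norm_minus_commute norm_triangle_ineq2)
  then show *: "cmod (whittaker_slope k w) \<ge> exp (Re w) / 4"
    using assms by (simp add: whittaker_slope_def norm_divide)
  then show "whittaker_slope k w \<noteq> 0" using exp_gt_zero[of "Re w"] by (metis norm_zero not_less divide_pos_pos zero_less_numeral)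
qed

lemma mult_divide_exp_quarter: "K * x / (exp y / 4) = 4 * K * exp (- y) * x" for K x y :: real
proof -
  have "exp (- y) = 1 / exp y" by (rule exp_minus[unfolded inverse_eq_divide])
  then show ?thesis
    by (simp only: times_divide_eq_right times_divide_eq_left mult_1_right divide_divide_eq_right mult_ac)
qed

text \<open>On the real axis the slope is negative because \<open>k \<le> 0\<close>, so the phase
  increases to the left. The bound does not depend on the far point \<open>n\<close> at which the
  solution matches its leading form; this uniformity is what later allows \<open>n\<close> to tend
  to infinity.\<close>

lemma whittaker_ratio_bound_real:
  fixes n \<rho> :: real
  assumes g: "whittaker_solution k \<mu> g" "whittaker_ratio k g (of_real n) = 1" "whittaker_dratio k g (of_real n) = 0"
    and k: "k \<le> 0" and \<rho>: "\<rho> \<le> n" "exp \<rho> \<ge> 4 * \<bar>k\<bar>"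
  defines "C \<equiv> 4 * (\<bar>\<mu>\<^sup>2 - 1/4 - k\<^sup>2 + k\<bar> + \<bar>k\<bar>)"
  assumes small: "C * exp (- \<rho>) \<le> 1"
  shows "cmod (whittaker_ratio k g (of_real \<rho>) - 1) \<le> 30 * (C * exp (- \<rho>))"
    and "cmod (whittaker_dratio k g (of_real \<rho>)) \<le> 30 * (C * exp (- \<rho>))"
proof -
  define d where "d = \<rho> - n"
  define I where "I = C * (exp (- \<rho>) - exp (- n))"
  have w: "of_real n + of_real t * of_real d = complex_of_real (n + t * d)" for t by simp
  have nt: "n + t * d \<ge> \<rho>" if "t \<in> {0..1}" for t
  proof -
    have "n + t * d - \<rho> = (n - \<rho>) * (1 - t)" by (simp add: d_def algebra_simps)
    then show ?thesis using that \<rho> by (smt (verit) atLeastAtMost_iff mult_nonneg_nonneg)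
  qed
  have e4: "exp (n + t * d) \<ge> 4 * \<bar>k\<bar>" if "t \<in> {0..1}" for t
    using nt[OF that] \<rho> by (meson exp_le_cancel_iff order_trans)
  have s0: "whittaker_slope k (of_real n + of_real t * of_real d) \<noteq> 0"
    and mono: "0 \<le> Re (whittaker_slope k (of_real n + of_real t * of_real d) * of_real d)"
    and le: "(\<bar>\<mu>\<^sup>2 - 1/4 - k\<^sup>2 + k\<bar> + \<bar>k\<bar>) * cmod (of_real d) / cmod (whittaker_slope k (of_real n + of_real t * of_real d))
      \<le> C * exp (- (n + t * d)) * (- d)"
    if t: "t \<in> {0..1}" for t
  proof -
    have e: "exp (Re (of_real n + of_real t * of_real d)) \<ge> 4 * \<bar>k\<bar>" using e4[OF t] by simp
    note sb = whittaker_slope_bound[OF e]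
    show "whittaker_slope k (of_real n + of_real t * of_real d) \<noteq> 0" by (rule sb)
    have "(k - exp (n + t * d) / 2) * d \<ge> 0"
      using k \<rho> by (intro mult_nonpos_nonpos) (auto simp: d_def intro: order_trans[of _ 0])
    moreover have "whittaker_slope k (of_real n + of_real t * of_real d) * of_real d = of_real ((k - exp (n + t * d) / 2) * d)"
      unfolding w by (simp only: whittaker_slope_def exp_of_real of_real_diff of_real_mult of_real_divide of_real_numeral)
    ultimately show "0 \<le> Re (whittaker_slope k (of_real n + of_real t * of_real d) * of_real d)"
      by (simp only: Re_complex_of_real)
    have "(\<bar>\<mu>\<^sup>2 - 1/4 - k\<^sup>2 + k\<bar> + \<bar>k\<bar>) * cmod (of_real d) / cmod (whittaker_slope k (of_real n + of_real t * of_real d))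
      \<le> (\<bar>\<mu>\<^sup>2 - 1/4 - k\<^sup>2 + k\<bar> + \<bar>k\<bar>) * cmod (of_real d) / (exp (n + t * d) / 4)"
      using sb by (intro divide_left_mono) auto
    also have "\<dots> = C * exp (- (n + t * d)) * (- d)"
    proof -
      have "cmod (of_real d) = - d" using \<rho>(1) unfolding norm_of_real by (simp add: d_def)
      then show ?thesis by (simp only: C_def mult_divide_exp_quarter)
    qed
    finally show "(\<bar>\<mu>\<^sup>2 - 1/4 - k\<^sup>2 + k\<bar> + \<bar>k\<bar>) * cmod (of_real d) / cmod (whittaker_slope k (of_real n + of_real t * of_real d))
      \<le> C * exp (- (n + t * d)) * (- d)" .
  qed
  have "((\<lambda>t. C * exp (- (n + t * d)) * (- d)) has_integral (C * exp (- (n + 1 * d)) - C * exp (- (n + 0 * d)))) {0..1}"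
    by (rule fundamental_theorem_of_calculus)
       (auto simp flip: has_real_derivative_iff_has_vector_derivative intro!: derivative_eq_intros)
  then have B: "((\<lambda>t. C * exp (- (n + t * d)) * (- d)) has_integral I) {0..1}"
    by (simp add: I_def d_def algebra_simps)
  have I: "I \<le> C * exp (- \<rho>)" by (simp add: I_def C_def algebra_simps)
  have "cmod (whittaker_ratio k g (of_real n + of_real d) - 1) \<le> 2 * 0 + 30 * (C * exp (- \<rho>))"
    by (rule whittaker_ratio_step(1)[OF g(1) _ _ B _ _ _ _ I small]) (rule s0 mono le, assumption | simp add: g)+
  then show "cmod (whittaker_ratio k g (of_real \<rho>) - 1) \<le> 30 * (C * exp (- \<rho>))"
    by (simp add: d_def)
  have "cmod (whittaker_dratio k g (of_real n + of_real d)) \<le> 0 + 30 * (C * exp (- \<rho>))"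
    by (rule whittaker_ratio_step(2)[OF g(1) _ _ B _ _ _ _ I small]) (rule s0 mono le, assumption | simp add: g)+
  then show "cmod (whittaker_dratio k g (of_real \<rho>)) \<le> 30 * (C * exp (- \<rho>))"
    by (simp add: d_def)
qed


text \<open>On a vertical segment starting at the real axis the phase changes at the rate
  \<open>\<theta> exp \<rho> sin (t \<theta>) / 2\<close>, which is nonnegative up to argument
  \<open>\<pi>\<close>. The segment has length below 4 and the slope is at least
  \<open>exp \<rho> / 4\<close>, hence the constant \<open>2 * 30 + 30 * 4 = 180\<close>.\<close>

lemma whittaker_ratio_bound_half_plane:
  fixes n \<rho> \<theta> :: real
  assumes g: "whittaker_solution k \<mu> g" "whittaker_ratio k g (of_real n) = 1" "whittaker_dratio k g (of_real n) = 0"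
    and k: "k \<le> 0" and \<rho>: "\<rho> \<le> n" "exp \<rho> \<ge> 4 * \<bar>k\<bar>" and \<theta>: "\<bar>\<theta>\<bar> \<le> pi"
  defines "C \<equiv> 4 * (\<bar>\<mu>\<^sup>2 - 1/4 - k\<^sup>2 + k\<bar> + \<bar>k\<bar>)"
  assumes small: "30 * (C * exp (- \<rho>)) \<le> 1"
  shows "cmod (whittaker_ratio k g (Complex \<rho> \<theta>) - 1) \<le> 180 * (C * exp (- \<rho>))"
    and "cmod (whittaker_dratio k g (Complex \<rho> \<theta>)) \<le> 180 * (C * exp (- \<rho>))"
proof -
  have C0: "C \<ge> 0" by (simp add: C_def)
  define c where "c = C * exp (- \<rho>)"
  have c0: "c \<ge> 0" using C0 by (simp add: c_def)
  define d where "d = \<i> * of_real \<theta>"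
  have e: "exp (Re (of_real \<rho> + of_real t * d)) \<ge> 4 * \<bar>k\<bar>" for t using \<rho> by (simp add: d_def)
  note sb = whittaker_slope_bound[OF e]
  have mono: "0 \<le> Re (whittaker_slope k (of_real \<rho> + of_real t * d) * d)" if t: "t \<in> {0..1}" for t
  proof -
    have "Re (whittaker_slope k (of_real \<rho> + of_real t * d) * d) = \<theta> * (exp \<rho> * sin (t * \<theta>)) / 2"
      by (simp add: whittaker_slope_def d_def Im_exp)
    moreover have "\<theta> * sin (t * \<theta>) \<ge> 0"
    proof (cases "\<theta> \<ge> 0")
      case True
      then have "0 \<le> t * \<theta>" "t * \<theta> \<le> pi" using t \<theta> mult_mono[of t 1 \<theta> pi] by auto
      then have "sin (t * \<theta>) \<ge> 0" by (intro sin_ge_zero)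
      then show ?thesis using True by simp
    next
      case False
      then have "0 \<le> t * (- \<theta>)" "t * (- \<theta>) \<le> pi" using t \<theta> mult_mono[of t 1 "- \<theta>" pi] by (auto intro: mult_nonneg_nonpos)
      then have "sin (t * (- \<theta>)) \<ge> 0" by (intro sin_ge_zero)
      then show ?thesis using False by (intro mult_nonpos_nonpos) auto
    qed
    ultimately show ?thesis by (simp only: mult.left_commute[of \<theta>]) (simp only: zero_le_mult_iff zero_le_divide_iff exp_ge_zero, simp)
  qed
  have le: "(\<bar>\<mu>\<^sup>2 - 1/4 - k\<^sup>2 + k\<bar> + \<bar>k\<bar>) * cmod d / cmod (whittaker_slope k (of_real \<rho> + of_real t * d)) \<le> 4 * c" for t
  proof -
    have "(\<bar>\<mu>\<^sup>2 - 1/4 - k\<^sup>2 + k\<bar> + \<bar>k\<bar>) * cmod d / cmod (whittaker_slope k (of_real \<rho> + of_real t * d))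
       \<le> (\<bar>\<mu>\<^sup>2 - 1/4 - k\<^sup>2 + k\<bar> + \<bar>k\<bar>) * 4 / (exp \<rho> / 4)"
    proof (rule frac_le)
      show "exp \<rho> / 4 \<le> cmod (whittaker_slope k (of_real \<rho> + of_real t * d))"
        using sb(1)[of t] by (simp add: d_def)
      have "cmod d \<le> 4" using \<theta> pi_less_4 by (simp add: d_def norm_mult)
      then show "(\<bar>\<mu>\<^sup>2 - 1/4 - k\<^sup>2 + k\<bar> + \<bar>k\<bar>) * cmod d \<le> (\<bar>\<mu>\<^sup>2 - 1/4 - k\<^sup>2 + k\<bar> + \<bar>k\<bar>) * 4"
        by (intro mult_left_mono) auto
    qed auto
    also have "\<dots> = 4 * c" unfolding mult_divide_exp_quarter by (simp add: c_def C_def)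
    finally show ?thesis .
  qed
  have B: "((\<lambda>t. 4 * c) has_integral 4 * c) {0..1::real}"
    using has_integral_const_real[of "4 * c" 0 1] by simp
  have s1: "C * exp (- \<rho>) \<le> 1" "30 * c \<le> 1" "4 * c \<le> 1" using small c0 by (simp_all add: c_def)
  note start = whittaker_ratio_bound_real[OF g k \<rho>, folded C_def, OF s1(1), folded c_def]
  have w: "of_real \<rho> + d = Complex \<rho> \<theta>" by (simp add: d_def complex_eq_iff)
  have "cmod (whittaker_ratio k g (of_real \<rho> + d) - 1) \<le> 2 * (30 * c) + 30 * (4 * c)"
    by (rule whittaker_ratio_step(1)[OF g(1) sb(2) mono B le start s1(2) order_refl s1(3)])
  then show "cmod (whittaker_ratio k g (Complex \<rho> \<theta>) - 1) \<le> 180 * (C * exp (- \<rho>))"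
    unfolding w c_def[symmetric] by simp
  have "cmod (whittaker_dratio k g (of_real \<rho> + d)) \<le> 30 * c + 30 * (4 * c)"
    by (rule whittaker_ratio_step(2)[OF g(1) sb(2) mono B le start s1(2) order_refl s1(3)])
  then show "cmod (whittaker_dratio k g (Complex \<rho> \<theta>)) \<le> 180 * (C * exp (- \<rho>))"
    unfolding w c_def[symmetric] using c0 by simp
qed

text \<open>
  Beyond argument \<open>\<pi>\<close> the phase increases along the curves of constant slope M in the logarithmic
  plane, provided that M is large compared with 1 / sin \<open>\<delta>\<close>.
\<close>

lemma whittaker_ratio_bound_sector:
  fixes n \<rho> \<theta> \<delta> :: real
  assumes k: "k \<le> 0" and \<delta>: "0 < \<delta>" "\<delta> \<le> pi / 2"
  shows "\<exists>K R. \<forall>g n \<rho> \<theta>. whittaker_solution k \<mu> g \<longrightarrow> whittaker_ratio k g (of_real n) = 1 \<longrightarrow>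
    whittaker_dratio k g (of_real n) = 0 \<longrightarrow> R \<le> \<rho> \<longrightarrow> \<rho> \<le> n \<longrightarrow> \<bar>\<theta>\<bar> \<le> 3/2 * pi - \<delta> \<longrightarrow>
    cmod (whittaker_ratio k g (Complex \<rho> \<theta>) - 1) \<le> K * exp (- \<rho>) \<and>
    cmod (whittaker_dratio k g (Complex \<rho> \<theta>)) \<le> K * exp (- \<rho>)"
proof -
  define C where "C = 4 * (\<bar>\<mu>\<^sup>2 - 1/4 - k\<^sup>2 + k\<bar> + \<bar>k\<bar>)"
  have C0: "C \<ge> 0" by (simp add: C_def)
  have sd: "0 < sin \<delta>" using \<delta> by (intro sin_gt_zero) auto
  \<comment> \<open>With \<open>M sin \<delta> = 2\<close> one gets
    \<open>M cos a - sin a \<ge> 1\<close> for every excess angle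
    \<open>0 \<le> a \<le> \<pi> / 2 - \<delta>\<close>, so that the phase grows along the slanted
    segments used below.\<close>
  define M where "M = 2 / sin \<delta>"
  have M: "M \<ge> 2" "M > 0" using sd by (auto simp: M_def field_simps)
  \<comment> \<open>Loss factor: a slanted segment has height at most 4 and so starts at a real part
    of at least \<open>\<rho> - 4 M\<close>. \<open>K\<close> is
    \<open>2 * 180 + 30 * 4 (M + 1)\<close> times \<open>C\<close> times this loss, and
    \<open>R\<close> makes the smallness conditions hold already at
    \<open>\<rho> - 4 M\<close>.\<close>
  define D where "D = exp (4 * M)"
  have D: "D \<ge> 1" using M by (simp add: D_def)
  define K where "K = (360 * C + 120 * (M + 1) * C) * D"
  define R where "R = ln (1 + (4 * \<bar>k\<bar> * M + 180 * C + 4 * (M + 1) * C) * D)"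
  have KC: "180 * C \<le> K"
  proof -
    have "180 * C * 1 \<le> (360 * C + 120 * (M + 1) * C) * D" using C0 M D by (intro mult_mono) auto
    then show ?thesis by (simp add: K_def)
  qed
  have expR: "(4 * \<bar>k\<bar> * M + 180 * C + 4 * (M + 1) * C) * D \<le> exp \<rho>" if "R \<le> \<rho>" for \<rho>
  proof -
    have "exp R = 1 + (4 * \<bar>k\<bar> * M + 180 * C + 4 * (M + 1) * C) * D"
      unfolding R_def using C0 M D by (intro exp_ln add_pos_nonneg mult_nonneg_nonneg add_nonneg_nonneg) auto
    then show ?thesis using that by (smt (verit) exp_le_cancel_iff)
  qed
  have "cmod (whittaker_ratio k g (Complex \<rho> \<theta>) - 1) \<le> K * exp (- \<rho>) \<and>
    cmod (whittaker_dratio k g (Complex \<rho> \<theta>)) \<le> K * exp (- \<rho>)"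
    if g: "whittaker_solution k \<mu> g" "whittaker_ratio k g (of_real n) = 1" "whittaker_dratio k g (of_real n) = 0"
      and R: "R \<le> \<rho>" and n: "\<rho> \<le> n" and \<theta>: "\<bar>\<theta>\<bar> \<le> 3/2 * pi - \<delta>" for g n \<rho> \<theta>
  proof -
    have pre: "exp \<rho>' \<ge> 4 * \<bar>k\<bar> * M \<and> 180 * (C * exp (- \<rho>')) \<le> 1 \<and> 4 * (M + 1) * (C * exp (- \<rho>')) \<le> 1"
      if "\<rho> - 4 * M \<le> \<rho>'" for \<rho>'
    proof -
      have "exp \<rho> \<le> exp (\<rho>' + 4 * M)" using that by simp
      then have "(4 * \<bar>k\<bar> * M + 180 * C + 4 * (M + 1) * C) * D \<le> exp \<rho>' * D"
        using expR[OF R] unfolding exp_add D_def by (rule order_trans[rotated])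
      then have *: "4 * \<bar>k\<bar> * M + 180 * C + 4 * (M + 1) * C \<le> exp \<rho>'"
        by (rule mult_right_le_imp_le) (use D in simp)
      have nn: "0 \<le> 4 * \<bar>k\<bar> * M" "0 \<le> 180 * C" "0 \<le> 4 * (M + 1) * C" using C0 M by auto
      have aux: "x * (C * exp (- \<rho>')) \<le> 1" if "x * C \<le> exp \<rho>'" for x
      proof -
        have "x * C * exp (- \<rho>') \<le> exp \<rho>' * exp (- \<rho>')" using that by (intro mult_right_mono) auto
        then show ?thesis by (simp add: mult.assoc flip: exp_add)
      qed
      have "4 * \<bar>k\<bar> * M \<le> exp \<rho>'" "180 * C \<le> exp \<rho>'" "4 * (M + 1) * C \<le> exp \<rho>'"
        using * nn by linarith+
      then show ?thesis by (intro conjI aux)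
    qed
    have k1: "4 * \<bar>k\<bar> \<le> 4 * \<bar>k\<bar> * M" using M by (simp add: mult_le_cancel_left1)
    show ?thesis
    proof (cases "\<bar>\<theta>\<bar> \<le> pi")
      case True
      have p: "exp \<rho> \<ge> 4 * \<bar>k\<bar>" "30 * (C * exp (- \<rho>)) \<le> 1"
        using pre[of \<rho>] M k1 C0 zero_le_mult_iff[of C "exp (- \<rho>)"] by auto
      have "180 * (C * exp (- \<rho>)) \<le> K * exp (- \<rho>)" using KC by (simp add: mult.assoc[symmetric])
      then show ?thesis
        using whittaker_ratio_bound_half_plane[OF g k n p(1) True, folded C_def, OF p(2)] by linarith
    next
      case False
      define \<sigma> where "\<sigma> = sgn \<theta>"
      have \<sigma>: "\<sigma> * \<sigma> = 1" "\<bar>\<sigma>\<bar> = 1" "\<sigma> * \<bar>\<theta>\<bar> = \<theta>" using False pi_gt_zero by (auto simp: \<sigma>_def sgn_if)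
      define h where "h = \<bar>\<theta>\<bar> - pi"
      have h: "0 < h" "h \<le> pi / 2 - \<delta>" "h \<le> 4" using False \<theta> \<delta> pi_less_4 by (auto simp: h_def)
      define \<rho>0 where "\<rho>0 = \<rho> - M * h"
      define p where "p = Complex \<rho>0 (\<sigma> * pi)"
      define d where "d = of_real h * Complex M \<sigma>"
      have Mh: "0 \<le> M * h" "M * h \<le> 4 * M" using h M by auto
      have \<rho>0: "\<rho>0 \<le> n" "\<rho> - 4 * M \<le> \<rho>0" using n Mh by (auto simp: \<rho>0_def)
      define c where "c = C * exp (- \<rho>0)"
      have c0: "c \<ge> 0" using C0 by (simp add: c_def)
      have p0: "exp \<rho>0 \<ge> 4 * \<bar>k\<bar>" "30 * (C * exp (- \<rho>0)) \<le> 1" "180 * c \<le> 1" "4 * (M + 1) * c \<le> 1"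
        using pre[OF \<rho>0(2)] k1 c0 by (auto simp: c_def)
      note start = whittaker_ratio_bound_half_plane[OF g k \<rho>0(1) p0(1), of "\<sigma> * pi", folded C_def, OF _ p0(2), folded c_def p_def]
      have pd: "p + d = Complex \<rho> \<theta>"
        using \<sigma> by (simp add: p_def d_def complex_eq_iff \<rho>0_def h_def algebra_simps)
      have Re: "Re (p + of_real t * d) = \<rho>0 + t * (M * h)" and Im: "Im (p + of_real t * d) = \<sigma> * (pi + t * h)" for t
        by (simp_all add: p_def d_def algebra_simps)
      have ge: "\<rho>0 \<le> Re (p + of_real t * d)" if "t \<in> {0..1}" for t using that Mh unfolding Re by simp
      have e: "exp (Re (p + of_real t * d)) \<ge> 4 * \<bar>k\<bar>" if "t \<in> {0..1}" for t
        using ge[OF that] p0(1) by (smt (verit) exp_le_cancel_iff)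
      note sb = whittaker_slope_bound[OF e]
      have mono: "0 \<le> Re (whittaker_slope k (p + of_real t * d) * d)" if t: "t \<in> {0..1}" for t
      proof -
        define E where "E = exp (Re (p + of_real t * d))"
        define a where "a = t * h"
        have a: "0 \<le> a" "a \<le> pi / 2 - \<delta>" using h t mult_mono[of t 1 h "pi / 2 - \<delta>"] by (auto simp: a_def)
        have cs: "cos (\<sigma> * (pi + a)) = - cos a" "sin (\<sigma> * (pi + a)) = - \<sigma> * sin a"
        proof -
          have "cos (pi + a) = - cos a" "sin (pi + a) = - sin a" by simp_all
          moreover have "\<sigma> = 1 \<or> \<sigma> = - 1" using \<sigma>(2) by linarith
          ultimately show "cos (\<sigma> * (pi + a)) = - cos a" "sin (\<sigma> * (pi + a)) = - \<sigma> * sin a"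
            by (auto simp only: mult_minus1 mult_1 cos_minus sin_minus minus_minus)
        qed
        have sl: "Re (whittaker_slope k z) = k - exp (Re z) * cos (Im z) / 2"
          "Im (whittaker_slope k z) = - (exp (Re z) * sin (Im z) / 2)" for z
          by (simp_all add: whittaker_slope_def Re_exp Im_exp)
        have dd: "Re d = h * M" "Im d = h * \<sigma>" by (simp_all add: d_def)
        have "Re (whittaker_slope k (p + of_real t * d) * d)
            = h * (M * (k - E * cos (\<sigma> * (pi + a)) / 2) + \<sigma> * (E * sin (\<sigma> * (pi + a))) / 2)"
          unfolding times_complex.sel sl dd Im a_def[symmetric] E_def[symmetric] by (simp add: field_simps)
        also have "\<dots> = h * (M * k + E / 2 * (M * cos a - \<sigma> * \<sigma> * sin a))"
          unfolding cs by (simp add: algebra_simps)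
        also have "\<dots> \<ge> 0"
        proof (rule mult_nonneg_nonneg)
          have "cos (pi / 2 - \<delta>) \<le> cos a" using a \<delta> by (intro cos_monotone_0_pi_le) auto
          then have "M * sin \<delta> \<le> M * cos a" using M by (simp add: cos_diff)
          then have "2 \<le> M * cos a" using sd by (simp add: M_def)
          then have "M * cos a - \<sigma> * \<sigma> * sin a \<ge> 1" using sin_le_one[of a] unfolding \<sigma> by linarith
          then have "E / 2 * 1 \<le> E / 2 * (M * cos a - \<sigma> * \<sigma> * sin a)"
            by (intro mult_left_mono) (auto simp: E_def)
          moreover have "exp \<rho>0 \<le> E" using ge[OF t] by (simp add: E_def)
          moreover have "4 * \<bar>k\<bar> * M \<le> exp \<rho>0" using pre[OF \<rho>0(2)] by simp
          moreover have "\<bar>k\<bar> * M = - (M * k)" "M * k \<le> 0" using k M by (auto simp: mult_nonneg_nonpos)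
          ultimately show "0 \<le> M * k + E / 2 * (M * cos a - \<sigma> * \<sigma> * sin a)" by linarith
        qed (use h in simp)
        finally show ?thesis .
      qed
      have le: "(\<bar>\<mu>\<^sup>2 - 1/4 - k\<^sup>2 + k\<bar> + \<bar>k\<bar>) * cmod d / cmod (whittaker_slope k (p + of_real t * d)) \<le> 4 * (M + 1) * c"
        if t: "t \<in> {0..1}" for t
      proof -
        have "(\<bar>\<mu>\<^sup>2 - 1/4 - k\<^sup>2 + k\<bar> + \<bar>k\<bar>) * cmod d / cmod (whittaker_slope k (p + of_real t * d))
           \<le> (\<bar>\<mu>\<^sup>2 - 1/4 - k\<^sup>2 + k\<bar> + \<bar>k\<bar>) * (4 * (M + 1)) / (exp \<rho>0 / 4)"
        proof (rule frac_le)
          show "exp \<rho>0 / 4 \<le> cmod (whittaker_slope k (p + of_real t * d))"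
            using sb(1)[OF t] ge[OF t] by (smt (verit) exp_le_cancel_iff divide_right_mono)
          have "cmod (Complex M \<sigma>) \<le> M + 1"
            using cmod_le[of "Complex M \<sigma>"] M \<sigma> by simp
          then have "cmod d \<le> 4 * (M + 1)"
            unfolding d_def norm_mult using h M by (intro mult_mono) auto
          then show "(\<bar>\<mu>\<^sup>2 - 1/4 - k\<^sup>2 + k\<bar> + \<bar>k\<bar>) * cmod d \<le> (\<bar>\<mu>\<^sup>2 - 1/4 - k\<^sup>2 + k\<bar> + \<bar>k\<bar>) * (4 * (M + 1))"
            by (intro mult_left_mono) auto
        qed (use M in auto)
        also have "\<dots> = 4 * (M + 1) * c" unfolding mult_divide_exp_quarter by (simp add: c_def C_def)
        finally show ?thesis .
      qed
      have B: "((\<lambda>t. 4 * (M + 1) * c) has_integral 4 * (M + 1) * c) {0..1::real}"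
        using has_integral_const_real[of "4 * (M + 1) * c" 0 1] by simp
      have st: "cmod (whittaker_ratio k g p - 1) \<le> 180 * c" "cmod (whittaker_dratio k g p) \<le> 180 * c"
        using start \<sigma> by (auto simp: abs_mult)
      have "exp (- \<rho>0) \<le> D * exp (- \<rho>)"
        using Mh by (simp add: D_def \<rho>0_def flip: exp_add)
      then have "c \<le> C * (D * exp (- \<rho>))" unfolding c_def using C0 by (intro mult_left_mono)
      then have "(360 + 120 * (M + 1)) * c \<le> (360 + 120 * (M + 1)) * (C * (D * exp (- \<rho>)))"
        using M by (intro mult_left_mono) auto
      also have "\<dots> = K * exp (- \<rho>)" by (simp add: K_def algebra_simps)
      finally have fin: "360 * c + 120 * (M + 1) * c \<le> K * exp (- \<rho>)" by (simp add: algebra_simps)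
      have "cmod (whittaker_ratio k g (p + d) - 1) \<le> 2 * (180 * c) + 30 * (4 * (M + 1) * c)"
        by (rule whittaker_ratio_step(1)[OF g(1) _ _ B _ st p0(3) order_refl p0(4)]) (rule sb(2) mono le, assumption)+
      moreover have "cmod (whittaker_dratio k g (p + d)) \<le> 180 * c + 30 * (4 * (M + 1) * c)"
        by (rule whittaker_ratio_step(2)[OF g(1) _ _ B _ st p0(3) order_refl p0(4)]) (rule sb(2) mono le, assumption)+
      moreover have "2 * (180 * c) + 30 * (4 * (M + 1) * c) = 360 * c + 120 * (M + 1) * c" by simp
      ultimately show ?thesis unfolding pd using fin c0 by linarith
    qed
  qed
  then show ?thesis by blast
qed


section \<open>Existence and uniqueness of the Whittaker function\<close>

text \<open>A compactness argument in the two-dimensional space of solutions. The solution that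
  matches the leading form at the real point \<open>R + m\<close> obeys bounds independent of
  \<open>m\<close>, so its coordinates stay bounded; the limit of a convergent subsequence inherits
  the bounds in every sector.\<close>

lemma whittaker_W_exists:
  assumes k: "k \<le> 0"
  shows "\<exists>g. is_whittaker_W k \<mu> g"
proof -
  define bounded_by where "bounded_by = (\<lambda>\<delta> K R. \<forall>g n \<rho> \<theta>. whittaker_solution k \<mu> g \<longrightarrow> whittaker_ratio k g (of_real n) = 1 \<longrightarrow>
    whittaker_dratio k g (of_real n) = 0 \<longrightarrow> R \<le> \<rho> \<longrightarrow> \<rho> \<le> n \<longrightarrow> \<bar>\<theta>\<bar> \<le> 3/2 * pi - \<delta> \<longrightarrow>
    cmod (whittaker_ratio k g (Complex \<rho> \<theta>) - 1) \<le> K * exp (- \<rho>) \<and>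
    cmod (whittaker_dratio k g (Complex \<rho> \<theta>)) \<le> K * exp (- \<rho>))"
  have bnd: "\<exists>K R. bounded_by \<delta> K R" if "0 < \<delta>" "\<delta> \<le> pi / 2" for \<delta>
    unfolding bounded_by_def by (rule whittaker_ratio_bound_sector[OF k that])
  obtain K R0 where KR0: "bounded_by (pi / 2) K R0" using bnd[of "pi / 2"] by auto
  define R where "R = max R0 (ln (4 * \<bar>k\<bar> + 1))"
  have slope: "whittaker_slope k (of_real x) \<noteq> 0" if "R \<le> x" for x
  proof (rule whittaker_slope_bound(2))
    have "exp (ln (4 * \<bar>k\<bar> + 1)) = 4 * \<bar>k\<bar> + 1" by (rule exp_ln) simp
    moreover have "exp (ln (4 * \<bar>k\<bar> + 1)) \<le> exp x" unfolding exp_le_cancel_iff using that by (simp add: R_def)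
    ultimately have "4 * \<bar>k\<bar> \<le> exp x" by linarith
    then show "4 * \<bar>k\<bar> \<le> exp (Re (of_real x))" by simp
  qed
  obtain A where A: "whittaker_solution k \<mu> A" "A (of_real R) = 1" "deriv A (of_real R) = 0"
    using whittaker_solution_exists by blast
  obtain B where B: "whittaker_solution k \<mu> B" "B (of_real R) = 0" "deriv B (of_real R) = 1"
    using whittaker_solution_exists by blast
  obtain c where c: "\<And>w. A w * deriv B w - deriv A w * B w = c * exp w"
    using whittaker_wronskian[OF A(1) B(1)] by blast
  have c0: "c \<noteq> 0" using c[of "of_real R"] A B by auto
  define comb where "comb = (\<lambda>\<alpha> \<beta> w. \<alpha> * A w + \<beta> * B w)"
  have comb: "whittaker_solution k \<mu> (comb \<alpha> \<beta>)" "deriv (comb \<alpha> \<beta>) = (\<lambda>w. \<alpha> * deriv A w + \<beta> * deriv B w)" for \<alpha> \<beta>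
    unfolding comb_def by (rule whittaker_solution_combination[OF A(1) B(1)])+
  have "\<exists>\<alpha> \<beta>. whittaker_ratio k (comb \<alpha> \<beta>) (of_real x) = 1 \<and> whittaker_dratio k (comb \<alpha> \<beta>) (of_real x) = 0" for x :: real
  proof -
    define w where "w = complex_of_real x"
    define v where "v = exp (whittaker_phase k w)"
    define v' where "v' = whittaker_slope k w * v"
    define W where "W = A w * deriv B w - deriv A w * B w"
    \<comment> \<open>Cramer's rule for the solution with prescribed value and derivative at
      \<open>w\<close>; the Wronskian is \<open>c exp w\<close> with
      \<open>c \<noteq> 0\<close>.\<close>
    define \<alpha> where "\<alpha> = (v * deriv B w - v' * B w) / W"
    define \<beta> where "\<beta> = (A w * v' - deriv A w * v) / W"
    have W: "W \<noteq> 0" using c[of w] c0 by (simp add: W_def)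
    have "comb \<alpha> \<beta> w = ((v * deriv B w - v' * B w) * A w + (A w * v' - deriv A w * v) * B w) / W"
      by (simp add: comb_def \<alpha>_def \<beta>_def add_divide_distrib)
    also have "\<dots> = (v * W) / W" by (simp add: W_def algebra_simps)
    finally have 1: "comb \<alpha> \<beta> w = v" using W by simp
    have "deriv (comb \<alpha> \<beta>) w = ((v * deriv B w - v' * B w) * deriv A w + (A w * v' - deriv A w * v) * deriv B w) / W"
      by (simp add: comb(2) \<alpha>_def \<beta>_def add_divide_distrib)
    also have "\<dots> = (v' * W) / W" by (simp add: W_def algebra_simps)
    finally have 2: "deriv (comb \<alpha> \<beta>) w = v'" using W by simp
    have "whittaker_ratio k (comb \<alpha> \<beta>) w = 1" "whittaker_dratio k (comb \<alpha> \<beta>) w = 0"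
      unfolding whittaker_ratio_def whittaker_dratio_def 1 2 v'_def
      by (simp_all add: v_def flip: exp_add)
    then show ?thesis unfolding w_def by blast
  qed
  then obtain \<alpha> \<beta> where ab: "\<And>x. whittaker_ratio k (comb (\<alpha> x) (\<beta> x)) (of_real x) = 1"
    "\<And>x. whittaker_dratio k (comb (\<alpha> x) (\<beta> x)) (of_real x) = 0" by metis
  define f where "f = (\<lambda>m. (\<alpha> (R + real m), \<beta> (R + real m)))"
  \<comment> \<open>At the base point \<open>R\<close> the coordinates of a solution are its value
    and its derivative, which the uniform bounds control.\<close>
  have "bounded (range f)"
  proof -
    define E where "E = cmod (exp (whittaker_phase k (of_real R)))"
    define S where "S = cmod (whittaker_slope k (of_real R))"
    define C where "C = K * exp (- R)"
    have "cmod (\<alpha> x) \<le> E * (1 + C) \<and> cmod (\<beta> x) \<le> E * S * (1 + 2 * C)" if "R \<le> x" for x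
    proof -
      let ?g = "comb (\<alpha> x) (\<beta> x)"
      have "cmod (whittaker_ratio k ?g (Complex R 0) - 1) \<le> K * exp (- R) \<and>
            cmod (whittaker_dratio k ?g (Complex R 0)) \<le> K * exp (- R)"
        using KR0[unfolded bounded_by_def, rule_format, OF comb(1) ab(1,2)[of x], of R 0] that by (simp add: R_def)
      then have b: "cmod (whittaker_ratio k ?g (of_real R) - 1) \<le> C" "cmod (whittaker_dratio k ?g (of_real R)) \<le> C"
        by (simp_all add: C_def complex_of_real_def)
      have r: "cmod (whittaker_ratio k ?g (of_real R)) \<le> 1 + C"
        using norm_triangle_ineq2[of "whittaker_ratio k ?g (of_real R)" 1] b by simp
      have "\<alpha> x = ?g (of_real R)" "\<beta> x = deriv ?g (of_real R)"
        using A B by (simp add: comb_def) (simp only: comb(2) A B, simp)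
      moreover have "?g (of_real R) = exp (whittaker_phase k (of_real R)) * whittaker_ratio k ?g (of_real R)"
        by (simp add: whittaker_ratio_def mult.left_commute flip: exp_add)
      moreover have "deriv ?g (of_real R) = exp (whittaker_phase k (of_real R)) * whittaker_slope k (of_real R) *
          (whittaker_ratio k ?g (of_real R) + whittaker_dratio k ?g (of_real R))"
      proof -
        have "exp (whittaker_phase k (of_real R)) * exp (- whittaker_phase k (of_real R)) = 1"
          by (simp flip: exp_add)
        then show ?thesis
          using slope[of R] unfolding whittaker_ratio_def whittaker_dratio_def
          by (simp add: field_simps)
      qed
      ultimately have eq: "\<alpha> x = exp (whittaker_phase k (of_real R)) * whittaker_ratio k ?g (of_real R)"
        "\<beta> x = exp (whittaker_phase k (of_real R)) * whittaker_slope k (of_real R) *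
          (whittaker_ratio k ?g (of_real R) + whittaker_dratio k ?g (of_real R))" by simp_all
      have "cmod (whittaker_ratio k ?g (of_real R) + whittaker_dratio k ?g (of_real R)) \<le> 1 + 2 * C"
        using norm_triangle_ineq[of "whittaker_ratio k ?g (of_real R)" "whittaker_dratio k ?g (of_real R)"] r b by simp
      then have "cmod (\<beta> x) \<le> E * S * (1 + 2 * C)"
        by (subst eq(2)) (auto simp: norm_mult E_def S_def intro!: mult_left_mono)
      moreover have "cmod (\<alpha> x) \<le> E * (1 + C)"
        using r by (subst eq(1)) (auto simp: norm_mult E_def intro!: mult_left_mono)
      ultimately show ?thesis by simp
    qed
    then have "range f \<subseteq> cball 0 (E * (1 + C)) \<times> cball 0 (E * S * (1 + 2 * C))"
      by (auto simp: f_def)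
    then show ?thesis by (rule bounded_subset[rotated]) (intro bounded_Times bounded_cball)
  qed
  then obtain l r where lr: "strict_mono (r :: nat \<Rightarrow> nat)" "(f \<circ> r) \<longlonglongrightarrow> l"
    using bounded_imp_convergent_subsequence by blast
  define g where "g = comb (fst l) (snd l)"
  define gn where "gn = (\<lambda>m. comb (fst (f (r m))) (snd (f (r m))))"
  have lim: "(\<lambda>m. fst (f (r m))) \<longlonglongrightarrow> fst l" "(\<lambda>m. snd (f (r m))) \<longlonglongrightarrow> snd l"
    using lr(2) by (auto simp: o_def intro: tendsto_fst tendsto_snd)
  have limr: "(\<lambda>m. whittaker_ratio k (gn m) w) \<longlonglongrightarrow> whittaker_ratio k g w" for w
    unfolding whittaker_ratio_def gn_def g_def comb_def by (intro tendsto_intros lim)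
  have le: "cmod (whittaker_ratio k g (Complex \<rho> \<theta>) - 1) \<le> K' * exp (- \<rho>)"
    if b: "bounded_by \<delta> K' R'" and R': "R' \<le> \<rho>" and \<theta>: "\<bar>\<theta>\<bar> \<le> 3/2 * pi - \<delta>" for \<delta> K' R' \<rho> \<theta>
  proof (rule LIMSEQ_le_const2)
    show "(\<lambda>m. cmod (whittaker_ratio k (gn m) (Complex \<rho> \<theta>) - 1)) \<longlonglongrightarrow> cmod (whittaker_ratio k g (Complex \<rho> \<theta>) - 1)"
      by (intro tendsto_intros limr)
    obtain m0 :: nat where m0: "\<rho> - R \<le> m0" using real_arch_simple by blast
    show "\<exists>N. \<forall>m\<ge>N. cmod (whittaker_ratio k (gn m) (Complex \<rho> \<theta>) - 1) \<le> K' * exp (- \<rho>)"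
    proof (intro exI[of _ m0] allI impI)
      fix m assume "m \<ge> m0"
      then have "real m0 \<le> real (r m)" using seq_suble[OF lr(1), of m] by simp
      then have "\<rho> \<le> R + real (r m)" using m0 by linarith
      then show "cmod (whittaker_ratio k (gn m) (Complex \<rho> \<theta>) - 1) \<le> K' * exp (- \<rho>)"
        using b[unfolded bounded_by_def, rule_format, OF comb(1) ab(1,2)[of "R + real (r m)"] R' _ \<theta>]
        by (simp add: gn_def f_def)
    qed
  qed
  have "(whittaker_ratio k g \<longlongrightarrow> 1) (inf (filtercomap Re at_top) (principal {w. \<bar>Im w\<bar> \<le> 3 / 2 * pi - \<delta>}))"
    if \<delta>: "\<delta> > 0" for \<delta>
  proof -
    define \<delta>' where "\<delta>' = min \<delta> (pi / 2)"
    have "0 < \<delta>'" "\<delta>' \<le> pi / 2" using \<delta> by (simp_all add: \<delta>'_def)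
    then obtain K' R' where b: "bounded_by \<delta>' K' R'" using bnd[of \<delta>'] by blast
    have le': "cmod (whittaker_ratio k g w - 1) \<le> K' * exp (- Re w)" if "R' \<le> Re w" "\<bar>Im w\<bar> \<le> 3/2 * pi - \<delta>" for w
      using le[OF b that(1), of "Im w"] that(2) by (simp add: \<delta>'_def)
    show ?thesis
    proof (rule tendstoI)
      fix e :: real assume e: "e > 0"
      have "((\<lambda>x. K' * exp (- x)) \<longlongrightarrow> 0) at_top" by real_asymp
      then have "eventually (\<lambda>x. K' * exp (- x) < e) at_top" using e by (rule order_tendstoD)
      then have "eventually (\<lambda>x. K' * exp (- x) < e \<and> R' \<le> x) at_top"
        using eventually_ge_at_top eventually_conj by blast
      then have "eventually (\<lambda>w. K' * exp (- Re w) < e \<and> R' \<le> Re w) (filtercomap Re at_top)"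
        by (rule eventually_filtercomapI)
      then show "\<forall>\<^sub>F w in inf (filtercomap Re at_top) (principal {w. \<bar>Im w\<bar> \<le> 3 / 2 * pi - \<delta>}).
          dist (whittaker_ratio k g w) 1 < e"
        unfolding eventually_inf_principal
        by eventually_elim (use le' in \<open>force simp: dist_norm\<close>)
    qed
  qed
  moreover have "whittaker_solution k \<mu> g" unfolding g_def by (rule comb)
  ultimately show ?thesis unfolding is_whittaker_W_iff by blast
qed

text \<open>The derivative is controlled by Cauchy's inequality on unit circles; these stay inside
  the wider strip of half-width \<open>\<pi>\<close>, where the ratio is known to tend to 1.\<close>

lemma whittaker_ratio_asymptotics:
  assumes "is_whittaker_W k \<mu> g"
  shows "(whittaker_ratio k g \<longlongrightarrow> 1) (inf (filtercomap Re at_top) (principal {w. \<bar>Im w\<bar> \<le> 1}))"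
    and "(deriv (whittaker_ratio k g) \<longlongrightarrow> 0) (inf (filtercomap Re at_top) (principal {w. \<bar>Im w\<bar> \<le> 1}))"
proof -
  have lim: "(whittaker_ratio k g \<longlongrightarrow> 1) (inf (filtercomap Re at_top) (principal {w. \<bar>Im w\<bar> \<le> 3 / 2 * pi - pi / 2}))"
    and sol: "whittaker_solution k \<mu> g"
    using assms[unfolded is_whittaker_W_iff] by (auto dest!: spec[of _ "pi / 2"])
  have hol: "whittaker_ratio k g holomorphic_on UNIV"
    using whittaker_ratio_deriv[OF sol] by (auto simp: holomorphic_on_def field_differentiable_def)
  have ev: "\<exists>X. \<forall>w. Re w \<ge> X \<longrightarrow> \<bar>Im w\<bar> \<le> 3 / 2 * pi - pi / 2 \<longrightarrow> cmod (whittaker_ratio k g w - 1) < e" if "e > 0" for e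
  proof -
    have "eventually (\<lambda>w. \<bar>Im w\<bar> \<le> 3 / 2 * pi - pi / 2 \<longrightarrow> cmod (whittaker_ratio k g w - 1) < e) (filtercomap Re at_top)"
      using tendstoD[OF lim that] unfolding eventually_inf_principal by (simp add: dist_norm)
    then obtain X where "\<And>w. Re w \<ge> X \<Longrightarrow> \<bar>Im w\<bar> \<le> 3 / 2 * pi - pi / 2 \<longrightarrow> cmod (whittaker_ratio k g w - 1) < e"
      unfolding eventually_filtercomap_at_top_linorder by blast
    then show ?thesis by blast
  qed
  have pi3: "3 / 2 * pi - pi / 2 \<ge> 2" using pi_gt3 by simp
  have ev2: "eventually P (inf (filtercomap Re at_top) (principal {w. \<bar>Im w\<bar> \<le> 1}))"
    if "\<And>w. Re w \<ge> X \<Longrightarrow> \<bar>Im w\<bar> \<le> 1 \<Longrightarrow> P w" for P X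
    unfolding eventually_inf_principal eventually_filtercomap_at_top_linorder using that by blast
  show "(whittaker_ratio k g \<longlongrightarrow> 1) (inf (filtercomap Re at_top) (principal {w. \<bar>Im w\<bar> \<le> 1}))"
  proof (rule tendstoI)
    fix e :: real assume "e > 0"
    then obtain X where X: "\<And>w. Re w \<ge> X \<Longrightarrow> \<bar>Im w\<bar> \<le> 3 / 2 * pi - pi / 2 \<Longrightarrow> cmod (whittaker_ratio k g w - 1) < e"
      using ev by blast
    show "\<forall>\<^sub>F w in inf (filtercomap Re at_top) (principal {w. \<bar>Im w\<bar> \<le> 1}). dist (whittaker_ratio k g w) 1 < e"
      by (rule ev2[of X]) (use X pi3 in \<open>auto simp: dist_norm\<close>)
  qed
  show "(deriv (whittaker_ratio k g) \<longlongrightarrow> 0) (inf (filtercomap Re at_top) (principal {w. \<bar>Im w\<bar> \<le> 1}))"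
  proof (rule tendstoI)
    fix e :: real assume e: "e > 0"
    then obtain X where X: "\<And>w. Re w \<ge> X \<Longrightarrow> \<bar>Im w\<bar> \<le> 3 / 2 * pi - pi / 2 \<Longrightarrow> cmod (whittaker_ratio k g w - 1) < e / 2"
      using ev[of "e / 2"] by auto
    show "\<forall>\<^sub>F w in inf (filtercomap Re at_top) (principal {w. \<bar>Im w\<bar> \<le> 1}). dist (deriv (whittaker_ratio k g) w) 0 < e"
    proof (rule ev2[of "X + 1"])
      fix w assume w: "Re w \<ge> X + 1" "\<bar>Im w\<bar> \<le> 1"
      have "norm ((deriv ^^ 1) (\<lambda>z. whittaker_ratio k g z - 1) w) \<le> fact 1 * (e / 2) / 1 ^ 1"
      proof (rule Cauchy_inequality)
        fix z assume "cmod (w - z) = 1"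
        then have "\<bar>Re (w - z)\<bar> \<le> 1" "\<bar>Im (w - z)\<bar> \<le> 1" by (metis abs_Re_le_cmod, metis abs_Im_le_cmod)
        then have "Re z \<ge> X" "\<bar>Im z\<bar> \<le> 2" using w by auto
        then show "cmod (whittaker_ratio k g z - 1) \<le> e / 2" using X[of z] pi3 by auto
      qed (auto intro!: holomorphic_intros holomorphic_on_subset[OF hol] holomorphic_on_imp_continuous_on)
      moreover have "deriv (\<lambda>z. whittaker_ratio k g z - 1) w = deriv (whittaker_ratio k g) w"
        using holomorphic_derivI[OF hol open_UNIV, of w] by (intro DERIV_imp_deriv) (auto intro!: derivative_eq_intros)
      ultimately show "dist (deriv (whittaker_ratio k g) w) 0 < e" using e by simp
    qed
  qed
qed

text \<open>Written with the two ratios, the Wronskian constant \<open>c\<close> times an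
  exponential tends to 0 along the positive axis. That exponential has modulus at least 1 there
  because \<open>k \<le> 0\<close>, so \<open>c = 0\<close>. The quotient of the ratios is then
  constant on a half strip and tends to 1.\<close>

lemma whittaker_W_unique:
  assumes k: "k \<le> 0" and f: "is_whittaker_W k \<mu> f" and g: "is_whittaker_W k \<mu> g"
  shows "f = g"
proof -
  define F where "F = inf (filtercomap Re at_top) (principal {w. \<bar>Im w\<bar> \<le> 1})"
  have sol: "whittaker_solution k \<mu> f" "whittaker_solution k \<mu> g" using f g by (auto simp: is_whittaker_W_iff)
  let ?a = "whittaker_ratio k f" and ?b = "whittaker_ratio k g"
  note lim = whittaker_ratio_asymptotics[OF f, folded F_def] whittaker_ratio_asymptotics[OF g, folded F_def]
  obtain c where c: "\<And>w. f w * deriv g w - deriv f w * g w = c * exp w"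
    using whittaker_wronskian[OF sol] by blast
  have da: "deriv ?a w = (deriv f w - whittaker_slope k w * f w) * exp (- whittaker_phase k w)"
    and db: "deriv ?b w = (deriv g w - whittaker_slope k w * g w) * exp (- whittaker_phase k w)" for w
    by (rule DERIV_imp_deriv whittaker_ratio_deriv[OF sol(1)] whittaker_ratio_deriv[OF sol(2)])+
  have cw: "?a w * deriv ?b w - deriv ?a w * ?b w = c * exp w * exp (- whittaker_phase k w) ^ 2" for w
    unfolding da db by (simp add: whittaker_ratio_def power2_eq_square algebra_simps flip: c)
  have xF: "filterlim of_real F at_top"
    unfolding F_def filterlim_inf filterlim_principal filterlim_filtercomap_iff by (simp add: o_def filterlim_ident)
  have "((\<lambda>x::real. ?a (of_real x) * deriv ?b (of_real x) - deriv ?a (of_real x) * ?b (of_real x)) \<longlongrightarrow> 1 * 0 - 0 * 1) at_top"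
    by (intro tendsto_intros filterlim_compose[OF lim(1) xF] filterlim_compose[OF lim(2) xF]
        filterlim_compose[OF lim(3) xF] filterlim_compose[OF lim(4) xF])
  then have "((\<lambda>x::real. cmod (c * exp (of_real x) * exp (- whittaker_phase k (of_real x)) ^ 2)) \<longlongrightarrow> 0) at_top"
    unfolding cw by (intro tendsto_norm_zero) simp
  moreover have "cmod c \<le> cmod (c * exp (of_real x) * exp (- whittaker_phase k (of_real x)) ^ 2)" if "x \<ge> 0" for x
  proof -
    have "cmod (exp (of_real x) * exp (- whittaker_phase k (of_real x)) ^ 2) = exp (x + 2 * (exp x / 2 - k * x))"
      by (simp add: norm_mult norm_power whittaker_phase_def exp_double[symmetric] exp_add Re_exp)
    moreover have "x + 2 * (exp x / 2 - k * x) \<ge> 0"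
    proof -
      have "x + 2 * (exp x / 2 - k * x) = x + exp x - 2 * (k * x)" by simp
      then show ?thesis using mult_nonpos_nonneg[OF k that] exp_ge_zero[of x] that by linarith
    qed
    ultimately have "cmod (exp (of_real x) * exp (- whittaker_phase k (of_real x)) ^ 2) \<ge> 1" by simp
    then show ?thesis unfolding mult.assoc norm_mult[of c] by (simp add: mult_le_cancel_left1)
  qed
  ultimately have "cmod c \<le> 0"
    by (intro tendsto_lowerbound[where F = at_top and a = "cmod c"])
       (auto intro: eventually_mono[OF eventually_ge_at_top[of 0]])
  then have c0: "c = 0" by simp
  have "eventually (\<lambda>w. dist (?a w) 1 < 1) F" by (rule tendstoD[OF lim(1)]) simp
  then obtain X where X: "\<And>w. Re w \<ge> X \<Longrightarrow> \<bar>Im w\<bar> \<le> 1 \<Longrightarrow> dist (?a w) 1 < 1"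
    unfolding F_def eventually_inf_principal eventually_filtercomap_at_top_linorder by blast
  have a0: "?a w \<noteq> 0" if "Re w \<ge> X" "\<bar>Im w\<bar> \<le> 1" for w using X[OF that] by (auto simp: dist_norm)
  \<comment> \<open>A half strip on which \<open>?a\<close> has no zero; the identity theorem
    carries equality from there to the plane.\<close>
  define S where "S = {w. Re w > X} \<inter> {w. Im w < 1} \<inter> {w. Im w > -1}"
  have S: "open S" "convex S" unfolding S_def
    by (intro open_Int open_halfspace_Re_gt open_halfspace_Im_lt open_halfspace_Im_gt
          convex_Int convex_halfspace_Re_gt convex_halfspace_Im_lt convex_halfspace_Im_gt)+
  have "((\<lambda>w. ?b w / ?a w) has_field_derivative 0) (at w within S)" if "w \<in> S" for w
  proof -
    have nz: "?a w \<noteq> 0" using a0 that by (auto simp: S_def)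
    have da': "(?a has_field_derivative deriv ?a w) (at w within S)" "(?b has_field_derivative deriv ?b w) (at w within S)"
      unfolding da db by (rule whittaker_ratio_deriv[OF sol(1)] whittaker_ratio_deriv[OF sol(2)])+
    show ?thesis
      by (rule DERIV_cong[OF DERIV_divide[OF da'(2,1) nz]]) (use cw[of w] c0 in \<open>simp add: mult.commute\<close>)
  qed
  then obtain d where d: "\<And>w. w \<in> S \<Longrightarrow> ?b w / ?a w = d"
    using has_field_derivative_zero_constant[OF S(2)] by metis
  have "((\<lambda>x::real. ?b (of_real x) / ?a (of_real x)) \<longlongrightarrow> 1 / 1) at_top"
    by (intro tendsto_intros filterlim_compose[OF lim(1) xF] filterlim_compose[OF lim(3) xF]) auto
  moreover have "eventually (\<lambda>x::real. ?b (of_real x) / ?a (of_real x) = d) at_top"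
    by (rule eventually_mono[OF eventually_gt_at_top[of X]]) (auto intro!: d simp: S_def)
  ultimately have "((\<lambda>x::real. d) \<longlongrightarrow> 1) at_top" using tendsto_cong by fastforce
  then have "d = 1" using tendsto_const_iff trivial_limit_at_top_linorder by blast
  then have fg: "f w = g w" if "w \<in> S" for w
    using d[OF that] a0[of w] that by (auto simp: S_def whittaker_ratio_def)
  have ne: "S \<noteq> {}"
    by (rule ex_in_conv[THEN iffD1, OF exI[of _ "complex_of_real (X + 1)"]]) (simp add: S_def)
  have hol: "f holomorphic_on UNIV" "g holomorphic_on UNIV"
    using sol unfolding whittaker_solution_def by blast+
  have "f w = g w" for w
    by (rule analytic_continuation_open[OF S(1) open_UNIV ne connected_UNIV subset_UNIV hol fg UNIV_I])
  then show ?thesis by auto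
qed

lemma is_whittaker_W_whittaker_W:
  assumes "k \<le> 0"
  shows "is_whittaker_W k \<mu> (whittaker_W k \<mu>)"
  unfolding whittaker_W_def
proof -
  obtain g where g: "is_whittaker_W k \<mu> g" using whittaker_W_exists[OF assms] by blast
  show "is_whittaker_W k \<mu> (THE g. is_whittaker_W k \<mu> g)"
    using theI[of "is_whittaker_W k \<mu>", OF g whittaker_W_unique[OF assms _ g]] by blast
qed

section \<open>The phase on the two sides of the turning point\<close>

lemma isCont_csqrt: "w \<notin> \<real>\<^sub>\<le>\<^sub>0 \<or> w = 0 \<Longrightarrow> isCont csqrt w"
proof -
  have "(csqrt \<longlongrightarrow> 0) (at 0)"
    by (rule tendsto_norm_zero_cancel) (auto intro!: tendsto_eq_intros)
  then have "isCont csqrt 0" by (simp add: isCont_def)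
  then show "w \<notin> \<real>\<^sub>\<le>\<^sub>0 \<or> w = 0 \<Longrightarrow> isCont csqrt w"
    using continuous_at_csqrt by blast
qed

text \<open>The square roots with branch cut along the lower and upper half of the imaginary axis.\<close>

definition sqrt_up :: "complex \<Rightarrow> complex" where
  "sqrt_up w = Complex (1 / sqrt 2) (1 / sqrt 2) * csqrt (- \<i> * w)"

definition sqrt_down :: "complex \<Rightarrow> complex" where
  "sqrt_down w = Complex (1 / sqrt 2) (- (1 / sqrt 2)) * csqrt (\<i> * w)"

lemma not_nonpos_Reals_rotate:
  "w \<noteq> 0 \<Longrightarrow> Im w \<ge> 0 \<Longrightarrow> - \<i> * w \<notin> \<real>\<^sub>\<le>\<^sub>0"
  "w \<noteq> 0 \<Longrightarrow> Im w \<le> 0 \<Longrightarrow> \<i> * w \<notin> \<real>\<^sub>\<le>\<^sub>0"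
  by (auto simp: complex_nonpos_Reals_iff complex_eq_iff)

lemma sqrt_up_down_power2 [simp]: "sqrt_up w ^ 2 = w" "sqrt_down w ^ 2 = w"
proof -
  have a: "Complex (1 / sqrt 2) (1 / sqrt 2) ^ 2 = \<i>" "Complex (1 / sqrt 2) (- (1 / sqrt 2)) ^ 2 = - \<i>"
    by (simp_all add: complex_eq_iff power2_eq_square)
  show "sqrt_up w ^ 2 = w" "sqrt_down w ^ 2 = w"
    unfolding sqrt_up_def sqrt_down_def power_mult_distrib a power2_csqrt by simp_all
qed

lemma sqrt_up_down_eq_0 [simp]: "sqrt_up w = 0 \<longleftrightarrow> w = 0" "sqrt_down w = 0 \<longleftrightarrow> w = 0"
  by (metis sqrt_up_down_power2(1) zero_eq_power2, metis sqrt_up_down_power2(2) zero_eq_power2)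

lemma sqrt_up_deriv:
  assumes "w \<noteq> 0" "Im w \<ge> 0"
  shows "(sqrt_up has_field_derivative 1 / (2 * sqrt_up w)) (at w)"
proof -
  have "(sqrt_up has_field_derivative
      Complex (1 / sqrt 2) (1 / sqrt 2) * ((- \<i>) / (2 * csqrt (- \<i> * w)))) (at w)"
    unfolding sqrt_up_def[abs_def]
    using not_nonpos_Reals_rotate(1)[OF assms] by (auto intro!: derivative_eq_intros)
  moreover have "Complex (1 / sqrt 2) (1 / sqrt 2) * ((- \<i>) / (2 * csqrt (- \<i> * w))) = 1 / (2 * sqrt_up w)"
  proof -
    have "Complex (1 / sqrt 2) (1 / sqrt 2) ^ 2 = \<i>" by (simp add: complex_eq_iff power2_eq_square)
    then have "Complex (1 / sqrt 2) (1 / sqrt 2) * (- \<i>) * Complex (1 / sqrt 2) (1 / sqrt 2) = 1"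
      by (simp add: power2_eq_square mult.commute mult.left_commute)
    moreover have "X * j = 1 / X" if "X * j * X = 1" for X j :: complex
      using that by (metis mult_zero_right nonzero_eq_divide_eq zero_neq_one)
    ultimately have "Complex (1 / sqrt 2) (1 / sqrt 2) * (- \<i>) = 1 / (Complex (1 / sqrt 2) (1 / sqrt 2))" by blast
    then show ?thesis unfolding sqrt_up_def times_divide_eq_right by simp
  qed
  ultimately show ?thesis by simp
qed

lemma sqrt_down_deriv:
  assumes "w \<noteq> 0" "Im w \<le> 0"
  shows "(sqrt_down has_field_derivative 1 / (2 * sqrt_down w)) (at w)"
proof -
  have "(sqrt_down has_field_derivative
      Complex (1 / sqrt 2) (- (1 / sqrt 2)) * (\<i> / (2 * csqrt (\<i> * w)))) (at w)"
    unfolding sqrt_down_def[abs_def]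
    using not_nonpos_Reals_rotate(2)[OF assms] by (auto intro!: derivative_eq_intros)
  moreover have "Complex (1 / sqrt 2) (- (1 / sqrt 2)) * (\<i> / (2 * csqrt (\<i> * w))) = 1 / (2 * sqrt_down w)"
  proof -
    have "Complex (1 / sqrt 2) (- (1 / sqrt 2)) ^ 2 = - \<i>" by (simp add: complex_eq_iff power2_eq_square)
    then have "Complex (1 / sqrt 2) (- (1 / sqrt 2)) * \<i> * Complex (1 / sqrt 2) (- (1 / sqrt 2)) = 1"
      by (simp add: power2_eq_square mult.commute mult.left_commute)
    moreover have "X * j = 1 / X" if "X * j * X = 1" for X j :: complex
      using that by (metis mult_zero_right nonzero_eq_divide_eq zero_neq_one)
    ultimately have "Complex (1 / sqrt 2) (- (1 / sqrt 2)) * \<i> = 1 / (Complex (1 / sqrt 2) (- (1 / sqrt 2)))" by blast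
    then show ?thesis unfolding sqrt_down_def times_divide_eq_right by simp
  qed
  ultimately show ?thesis by simp
qed

lemma continuous_on_sqrt_up_down:
  "continuous_on {w. Im w \<ge> 0} sqrt_up" "continuous_on {w. Im w \<le> 0} sqrt_down"
proof -
  have "isCont sqrt_up w" if "Im w \<ge> 0" for w
    unfolding sqrt_up_def
    by (intro continuous_intros isCont_o2[OF _ isCont_csqrt]) (use not_nonpos_Reals_rotate(1)[OF _ that] in auto)
  moreover have "isCont sqrt_down w" if "Im w \<le> 0" for w
    unfolding sqrt_down_def
    by (intro continuous_intros isCont_o2[OF _ isCont_csqrt]) (use not_nonpos_Reals_rotate(2)[OF _ that] in auto)
  ultimately show "continuous_on {w. Im w \<ge> 0} sqrt_up" "continuous_on {w. Im w \<le> 0} sqrt_down"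
    by (auto intro: continuous_at_imp_continuous_on)
qed

lemma abs_Im_le_Re_sqrt:
  fixes s v :: complex
  assumes "s ^ 2 = v" "Re s \<ge> 0" "Re v \<ge> 0"
  shows "\<bar>Im s\<bar> \<le> Re s"
proof -
  have "Re v = (Re s)\<^sup>2 - (Im s)\<^sup>2" using assms(1) by (auto simp: power2_eq_square)
  then have "(Im s)\<^sup>2 \<le> (Re s)\<^sup>2" using assms(3) by simp
  then show ?thesis using abs_le_square_iff[of "Im s" "Re s"] assms(2) by simp
qed

text \<open>The inner root lies in the sector \<open>|Im| \<le> Re\<close>, and the constant factor
  rotates it by \<open>\<pi> / 4\<close> into the closed first quadrant.\<close>

lemma sqrt_up_quadrant:
  assumes "Im w \<ge> 0"
  shows "Re (sqrt_up w) \<ge> 0" "Im (sqrt_up w) \<ge> 0" "csqrt w = sqrt_up w"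
proof -
  define s where "s = csqrt (- \<i> * w)"
  have "\<bar>Im s\<bar> \<le> Re s"
    by (rule abs_Im_le_Re_sqrt[of s "- \<i> * w"]) (use assms Re_csqrt in \<open>auto simp: s_def simp del: csqrt.simps\<close>)
  then show re: "Re (sqrt_up w) \<ge> 0" and im: "Im (sqrt_up w) \<ge> 0"
    unfolding sqrt_up_def s_def[symmetric] by (auto simp: field_simps)
  show "csqrt w = sqrt_up w"
    by (rule csqrt_unique) (use re im in auto)
qed

lemma sqrt_down_quadrant:
  assumes "Im w \<le> 0"
  shows "Re (sqrt_down w) \<ge> 0" "Im (sqrt_down w) \<le> 0" "w \<notin> \<real>\<^sub>\<le>\<^sub>0 \<Longrightarrow> csqrt w = sqrt_down w"
proof -
  define s where "s = csqrt (\<i> * w)"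
  have "\<bar>Im s\<bar> \<le> Re s"
    by (rule abs_Im_le_Re_sqrt[of s "\<i> * w"]) (use assms Re_csqrt in \<open>auto simp: s_def simp del: csqrt.simps\<close>)
  then show re: "Re (sqrt_down w) \<ge> 0" and im: "Im (sqrt_down w) \<le> 0"
    unfolding sqrt_down_def s_def[symmetric] by (auto simp: field_simps)
  assume w: "w \<notin> \<real>\<^sub>\<le>\<^sub>0"
  have "Re (sqrt_down w) \<noteq> 0"
  proof
    assume "Re (sqrt_down w) = 0"
    then have "sqrt_down w ^ 2 = of_real (- ((Im (sqrt_down w))\<^sup>2))"
      unfolding power2_eq_square by (simp add: complex_eq_iff)
    then have "w = of_real (- ((Im (sqrt_down w))\<^sup>2))" by (simp only: sqrt_up_down_power2)
    then show False using w by (metis neg_le_0_iff_le nonpos_Reals_of_real_iff zero_le_power2)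
  qed
  then show "csqrt w = sqrt_down w"
    by (intro csqrt_unique) (use re in auto)
qed

section \<open>The derivative of the real part of xi along a path\<close>

text \<open>Only moduli of the arguments of the logarithms enter \<open>re_xi\<close>, so no branch
  has to be followed; this is the real part of the logarithmic derivative.\<close>

lemma ln_cmod_has_deriv:
  assumes f: "(f has_vector_derivative f') (at t)" and nz: "f t \<noteq> 0"
  shows "((\<lambda>t. ln (cmod (f t))) has_real_derivative Re (f' / f t)) (at t)"
proof -
  have re: "((\<lambda>t. Re (f t)) has_real_derivative Re f') (at t)" and im: "((\<lambda>t. Im (f t)) has_real_derivative Im f') (at t)"
    unfolding has_real_derivative_iff_has_vector_derivative
    by (intro bounded_linear.has_vector_derivative[OF bounded_linear_Re f]
          bounded_linear.has_vector_derivative[OF bounded_linear_Im f])+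
  define n where "n = (Re (f t))\<^sup>2 + (Im (f t))\<^sup>2"
  have n: "n > 0" using nz unfolding n_def by (simp add: complex_eq_iff sum_power2_gt_zero_iff)
  have "((\<lambda>t. ln ((Re (f t))\<^sup>2 + (Im (f t))\<^sup>2) / 2) has_real_derivative
      ((2 * Re (f t) * Re f' + 2 * Im (f t) * Im f') / n) / 2) (at t)"
  proof -
    have "((\<lambda>t. (Re (f t))\<^sup>2 + (Im (f t))\<^sup>2) has_real_derivative 2 * Re (f t) * Re f' + 2 * Im (f t) * Im f') (at t)"
      by (rule DERIV_cong[OF DERIV_add[OF DERIV_power[OF re, of 2] DERIV_power[OF im, of 2]]]) simp
    from DERIV_chain2[OF DERIV_ln_divide this] n
    have "((\<lambda>t. ln ((Re (f t))\<^sup>2 + (Im (f t))\<^sup>2)) has_real_derivative 1 / n * (2 * Re (f t) * Re f' + 2 * Im (f t) * Im f')) (at t)"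
      by (simp add: n_def)
    from DERIV_cdivide[OF this, of 2] show ?thesis by simp
  qed
  moreover have "(\<lambda>t. ln (cmod (f t))) = (\<lambda>t. ln ((Re (f t))\<^sup>2 + (Im (f t))\<^sup>2) / 2)"
  proof
    fix t show "ln (cmod (f t)) = ln ((Re (f t))\<^sup>2 + (Im (f t))\<^sup>2) / 2"
      by (cases "f t = 0") (auto simp: cmod_def ln_sqrt sum_power2_gt_zero_iff complex_eq_iff)
  qed
  moreover have "Re (f' / f t) = ((2 * Re (f t) * Re f' + 2 * Im (f t) * Im f') / n) / 2"
    unfolding Re_divide n_def[symmetric] using n by (simp add: field_simps)
  ultimately show ?thesis by (simp only:)
qed

lemma ln_cmod_mult: "a \<noteq> 0 \<Longrightarrow> b \<noteq> 0 \<Longrightarrow> ln (cmod a) + ln (cmod b) = ln (cmod (a * b))"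
  by (simp add: norm_mult ln_mult)

lemma Re_divide_pos:
  assumes "Re a * Re b + Im a * Im b > 0"
  shows "Re (a / (2 * b)) > 0"
proof -
  have "b \<noteq> 0" using assms by auto
  then have "(Re b)\<^sup>2 + (Im b)\<^sup>2 > 0" by (simp add: complex_eq_iff sum_power2_gt_zero_iff)
  then have "Re (a / b) > 0" using assms by (simp add: Re_divide)
  moreover have "a / (2 * b) = a / b / 2" by simp
  ultimately show ?thesis by (simp only: Re_divide_numeral)
qed

text \<open>Multiplying the expressions for \<open>\<zeta>\<close> and \<open>- \<zeta>\<close>
  eliminates the root and leaves a nonzero constant, in the second case times \<open>z^2\<close>.
  Hence the arguments of both logarithms in \<open>re_xi\<close> have no zeros for
  \<open>z \<noteq> 0\<close>.\<close>

lemma Zsq_factor_nonzero: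
  assumes l: "0 \<le> lam" "lam < 1" and \<zeta>: "\<zeta> ^ 2 = Zsq lam z"
  shows "\<zeta> + z - 2 * of_real lam \<noteq> 0" and "z \<noteq> 0 \<Longrightarrow> \<zeta> - of_real lam * z + 2 \<noteq> 0"
    and "(\<zeta> + z - 2 * of_real lam) * (- \<zeta> + z - 2 * of_real lam) = - of_real (4 * (1 - lam\<^sup>2))"
    and "(\<zeta> - of_real lam * z + 2) * (- \<zeta> - of_real lam * z + 2) = - of_real (1 - lam\<^sup>2) * z ^ 2"
proof -
  have l2: "1 - lam\<^sup>2 > 0" using l by (simp add: abs_square_less_1)
  show 1: "(\<zeta> + z - 2 * of_real lam) * (- \<zeta> + z - 2 * of_real lam) = - of_real (4 * (1 - lam\<^sup>2))"
    using \<zeta> by (simp add: Zsq_def power2_eq_square algebra_simps)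
  show 2: "(\<zeta> - of_real lam * z + 2) * (- \<zeta> - of_real lam * z + 2) = - of_real (1 - lam\<^sup>2) * z ^ 2"
    using \<zeta> by (simp add: Zsq_def power2_eq_square algebra_simps)
  show "\<zeta> + z - 2 * of_real lam \<noteq> 0"
    using 1 l2 by (metis less_irrefl mult_zero_left neg_equal_0_iff_equal of_real_eq_0_iff mult_eq_0_iff zero_neq_numeral)
  show "\<zeta> - of_real lam * z + 2 \<noteq> 0" if "z \<noteq> 0"
    using 2 l2 that by (metis less_irrefl mult_zero_left neg_equal_0_iff_equal of_real_eq_0_iff mult_eq_0_iff power_eq_0_iff)
qed

text \<open>The relation \<open>d xi / dz = Z / (2 z)\<close> along a path, in real form. By
  \<open>\<zeta>^2 = Zsq\<close> the logarithmic derivatives of the two numerators simplify to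
  \<open>p' / \<zeta>\<close> and \<open>(\<zeta> - 2) p' / (p \<zeta>)\<close>, and the terms then
  add up.\<close>

lemma re_xi_has_deriv:
  assumes l: "0 \<le> lam" "lam < 1" and p: "(p has_vector_derivative p') (at t)"
    and \<zeta>: "(\<zeta> has_vector_derivative ((p t - 2 * of_real lam) * p' / \<zeta> t)) (at t)"
    and sq: "\<zeta> t ^ 2 = Zsq lam (p t)" and nz: "\<zeta> t \<noteq> 0" "p t \<noteq> 0"
  shows "((\<lambda>t. re_xi lam (\<zeta> t) (p t)) has_real_derivative Re (\<zeta> t / (2 * p t) * p')) (at t)"
proof -
  note f = Zsq_factor_nonzero[OF l sq]
  define q where "q = p t"
  define e where "e = \<zeta> t"
  define \<zeta>' where "\<zeta>' = (q - 2 * of_real lam) * p' / e"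
  have nz': "e \<noteq> 0" "q \<noteq> 0" "e + q - 2 * of_real lam \<noteq> 0" "e - of_real lam * q + 2 \<noteq> 0"
    using nz f by (auto simp: e_def q_def)
  have sq': "e ^ 2 = q ^ 2 - 4 * of_real lam * q + 4" using sq by (simp add: e_def q_def Zsq_def)
  have \<zeta>'': "(\<zeta> has_vector_derivative \<zeta>') (at t)" using \<zeta> by (simp add: \<zeta>'_def e_def q_def)
  have d1: "((\<lambda>t. Re (\<zeta> t) / 2) has_real_derivative Re \<zeta>' / 2) (at t)"
    unfolding has_real_derivative_iff_has_vector_derivative
    by (intro has_vector_derivative_divide bounded_linear.has_vector_derivative[OF bounded_linear_Re] \<zeta>'')
  have d2: "((\<lambda>t. ln (cmod (\<zeta> t + p t - 2 * of_real lam))) has_real_derivative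
      Re ((\<zeta>' + p' - 0) / (\<zeta> t + p t - 2 * of_real lam))) (at t)"
    using nz' by (intro ln_cmod_has_deriv has_vector_derivative_diff has_vector_derivative_add \<zeta>'' p
        has_vector_derivative_const) (auto simp: e_def q_def)
  have d3: "((\<lambda>t. ln (cmod (\<zeta> t - of_real lam * p t + 2))) has_real_derivative
      Re ((\<zeta>' - of_real lam * p' + 0) / (\<zeta> t - of_real lam * p t + 2))) (at t)"
    using nz' by (intro ln_cmod_has_deriv has_vector_derivative_diff has_vector_derivative_add \<zeta>'' p
        has_vector_derivative_const has_vector_derivative_mult_right) (auto simp: e_def q_def)
  have d4: "((\<lambda>t. ln (cmod (p t))) has_real_derivative Re (p' / p t)) (at t)"
    by (rule ln_cmod_has_deriv[OF p nz(2)])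
  have "((\<lambda>t. Re (\<zeta> t) / 2 - lam * ln (cmod (\<zeta> t + p t - 2 * of_real lam))
        - (ln (cmod (\<zeta> t - of_real lam * p t + 2)) - ln (cmod (p t)))) has_real_derivative
      Re \<zeta>' / 2 - lam * Re ((\<zeta>' + p' - 0) / (\<zeta> t + p t - 2 * of_real lam))
        - (Re ((\<zeta>' - of_real lam * p' + 0) / (\<zeta> t - of_real lam * p t + 2)) - Re (p' / p t))) (at t)"
    by (intro DERIV_diff DERIV_cmult d1 d2 d3 d4)
  moreover have "Re \<zeta>' / 2 - lam * Re ((\<zeta>' + p' - 0) / (\<zeta> t + p t - 2 * of_real lam))
        - (Re ((\<zeta>' - of_real lam * p' + 0) / (\<zeta> t - of_real lam * p t + 2)) - Re (p' / p t))
      = Re (\<zeta> t / (2 * p t) * p')"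
  proof -
    have a: "(\<zeta>' + p') / (e + q - 2 * of_real lam) = p' / e"
    proof -
      have "\<zeta>' + p' = (e + q - 2 * of_real lam) * p' / e" using nz' by (simp add: \<zeta>'_def field_simps)
      then show ?thesis using nz' by simp
    qed
    have b: "(\<zeta>' - of_real lam * p') / (e - of_real lam * q + 2) = (e - 2) / (q * e) * p'"
    proof -
      have "(q - 2 * of_real lam - of_real lam * e) * q = (e - 2) * (e - of_real lam * q + 2)"
        using sq' by (simp add: power2_eq_square algebra_simps)
      then have *: "q - 2 * of_real lam - of_real lam * e = (e - 2) / q * (e - of_real lam * q + 2)"
        using nz' by (simp add: eq_divide_eq)
      have "\<zeta>' - of_real lam * p' = (q - 2 * of_real lam - of_real lam * e) * p' / e"
        using nz' by (simp add: \<zeta>'_def field_simps)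
      also have "\<dots> = (e - 2) / (q * e) * p' * (e - of_real lam * q + 2)" unfolding * by simp
      finally show ?thesis using nz' by simp
    qed
    have "\<zeta>' / 2 - of_real lam * (p' / e) - ((e - 2) / (q * e) * p' - p' / q) = e / (2 * q) * p'"
    proof -
      have "q * (q - 2 * of_real lam) - 2 * of_real lam * q - 2 * (e - 2) + 2 * e = e ^ 2"
        using sq' by (simp add: power2_eq_square algebra_simps)
      then have "(q * (q - 2 * of_real lam) - 2 * of_real lam * q - 2 * (e - 2) + 2 * e) * p' / (2 * q * e) = e ^ 2 * p' / (2 * q * e)"
        by simp
      moreover have "\<zeta>' / 2 - of_real lam * (p' / e) - ((e - 2) / (q * e) * p' - p' / q)
         = (q * (q - 2 * of_real lam) - 2 * of_real lam * q - 2 * (e - 2) + 2 * e) * p' / (2 * q * e)"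
        using nz' by (simp add: \<zeta>'_def field_simps)
      ultimately show ?thesis using nz' by (simp add: power2_eq_square)
    qed
    from arg_cong[OF this, of Re]
    have "Re \<zeta>' / 2 - lam * Re (p' / e) - (Re ((e - 2) / (q * e) * p') - Re (p' / q)) = Re (e / (2 * q) * p')"
      by (simp del: times_divide_eq_right times_divide_eq_left)
    then show ?thesis
      unfolding e_def[symmetric] q_def[symmetric] diff_zero add_0_right a b .
  qed
  moreover have ev: "eventually (\<lambda>s. re_xi lam (\<zeta> s) (p s) = Re (\<zeta> s) / 2 - lam * ln (cmod (\<zeta> s + p s - 2 * of_real lam))
        - (ln (cmod (\<zeta> s - of_real lam * p s + 2)) - ln (cmod (p s)))) (nhds t)"
  proof -
    have "isCont p t" "isCont (\<lambda>s. \<zeta> s - of_real lam * p s + 2) t"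
      using has_vector_derivative_continuous[OF p] has_vector_derivative_continuous[OF \<zeta>]
      by (auto intro!: continuous_intros)
    then have "eventually (\<lambda>s. p s \<noteq> 0) (nhds t)" "eventually (\<lambda>s. \<zeta> s - of_real lam * p s + 2 \<noteq> 0) (nhds t)"
      using nz' unfolding isCont_def eventually_nhds_conv_at e_def q_def
      by (auto intro: tendsto_imp_eventually_ne)
    then show ?thesis
      by eventually_elim (simp add: re_xi_def norm_divide ln_div)
  qed
  ultimately show ?thesis
    using DERIV_cong_ev[OF refl ev refl] by simp
qed


lemma continuous_on_re_xi:
  assumes l: "0 \<le> lam" "lam < 1" and \<zeta>: "continuous_on S \<zeta>"
    and S: "\<And>z. z \<in> S \<Longrightarrow> z \<noteq> 0" "\<And>z. z \<in> S \<Longrightarrow> \<zeta> z ^ 2 = Zsq lam z"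
  shows "continuous_on S (\<lambda>z. re_xi lam (\<zeta> z) z)"
  unfolding re_xi_def
  by (intro continuous_intros \<zeta>) (use S Zsq_factor_nonzero[OF l S(2)] in auto)

section \<open>Signs of the root and monotonicity of the phase\<close>

locale turning_point =
  fixes lam :: real
  assumes lam0: "0 \<le> lam" and lam1: "lam < 1"
begin

definition ic :: real where "ic = 2 * sqrt (1 - lam\<^sup>2)"
text \<open>The imaginary part of \<open>Zsq\<close> changes sign on the vertical line through the
  turning point, so each side of it gets the root that is continuous there up to the
  boundary.\<close>

definition ZR :: "complex \<Rightarrow> complex" where "ZR z = sqrt_up (Zsq lam z)"
definition ZL :: "complex \<Rightarrow> complex" where "ZL z = sqrt_down (Zsq lam z)"
definition level0 :: real where "level0 = re_xi lam 0 (zplus lam)"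
definition phR :: "complex \<Rightarrow> real" where "phR z = re_xi lam (ZR z) z - level0"
definition phL :: "complex \<Rightarrow> real" where "phL z = re_xi lam (ZL z) z - level0"

lemma lam2: "1 - lam\<^sup>2 > 0" using lam0 lam1 by (simp add: abs_square_less_1)

lemma ic: "ic > 0" "ic\<^sup>2 = 4 * (1 - lam\<^sup>2)"
  using lam2 by (simp_all add: ic_def power_mult_distrib)

lemma zplus: "Re (zplus lam) = 2 * lam" "Im (zplus lam) = ic" by (simp_all add: zplus_def ic_def)

lemma Zsq_parts:
  "Re (Zsq lam z) = (Re z - 2 * lam)\<^sup>2 - (Im z)\<^sup>2 + ic\<^sup>2" "Im (Zsq lam z) = 2 * (Re z - 2 * lam) * Im z"
  unfolding ic(2) by (simp_all add: Zsq_def power2_eq_square algebra_simps)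

lemma Zsq_eq_0_iff: "Im z \<ge> 0 \<Longrightarrow> Zsq lam z = 0 \<longleftrightarrow> z = zplus lam"
proof
  assume z: "Im z \<ge> 0" "Zsq lam z = 0"
  then have "(Re z - 2 * lam) * Im z = 0" "(Re z - 2 * lam)\<^sup>2 - (Im z)\<^sup>2 + ic\<^sup>2 = 0"
    using Zsq_parts[of z] by (auto simp: complex_eq_iff)
  then have "Re z = 2 * lam" "(Im z)\<^sup>2 = ic\<^sup>2"
    using ic(1) by (auto simp: add_nonneg_eq_0_iff)
  then show "z = zplus lam" using z ic(1) zplus by (simp add: complex_eq_iff)
next
  show "Zsq lam z = 0" if "z = zplus lam"
    using that Zsq_parts[of z] zplus by (simp add: complex_eq_iff)
qed

lemma ZR_ZL_power2 [simp]: "ZR z ^ 2 = Zsq lam z" "ZL z ^ 2 = Zsq lam z"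
  by (simp_all add: ZR_def ZL_def)

lemma Zsq_side:
  "Im z \<ge> 0 \<Longrightarrow> Re z \<ge> 2 * lam \<Longrightarrow> Im (Zsq lam z) \<ge> 0"
  "Im z \<ge> 0 \<Longrightarrow> Re z \<le> 2 * lam \<Longrightarrow> Im (Zsq lam z) \<le> 0"
  by (auto simp: Zsq_parts mult_nonpos_nonneg)

text \<open>The sign of \<open>Re Z\<close> governs the growth of the phase along rays, that of
  \<open>Im Z\<close> its growth along circles about 0. A vanishing real part would make
  \<open>Zsq\<close> real and nonpositive, which happens only on the vertical line at or above the
  turning point.\<close>

lemma ZR_quadrant:
  assumes "Im z \<ge> 0" "Re z \<ge> 2 * lam"
  shows "Re (ZR z) \<ge> 0" "Im (ZR z) \<ge> 0" "csqrt (Zsq lam z) = ZR z"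
    and "Re z > 2 * lam \<or> Im z < ic \<Longrightarrow> Re (ZR z) > 0"
    and "Re z > 2 * lam \<Longrightarrow> Im z > 0 \<Longrightarrow> Im (ZR z) > 0"
proof -
  show re: "Re (ZR z) \<ge> 0" and im: "Im (ZR z) \<ge> 0" and "csqrt (Zsq lam z) = ZR z"
    unfolding ZR_def by (intro sqrt_up_quadrant Zsq_side assms)+
  have sq: "Re (Zsq lam z) = (Re (ZR z))\<^sup>2 - (Im (ZR z))\<^sup>2" "Im (Zsq lam z) = 2 * Re (ZR z) * Im (ZR z)"
    unfolding ZR_ZL_power2(1)[symmetric] by (simp_all add: power2_eq_square)
  show "Re (ZR z) > 0" if h: "Re z > 2 * lam \<or> Im z < ic"
  proof (rule ccontr)
    assume "\<not> Re (ZR z) > 0"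
    then have "Re (ZR z) = 0" using re by simp
    then have "Im (Zsq lam z) = 0" "Re (Zsq lam z) \<le> 0" using sq by simp_all
    then have 1: "Re z = 2 * lam \<or> Im z = 0" "(Re z - 2 * lam)\<^sup>2 + ic\<^sup>2 \<le> (Im z)\<^sup>2" by (auto simp: Zsq_parts)
    then have "Im z \<noteq> 0" using ic(1) sum_power2_gt_zero_iff[of "Re z - 2 * lam" ic] by auto
    then have "ic\<^sup>2 \<le> (Im z)\<^sup>2" "Re z = 2 * lam" using 1 by auto
    then have "ic \<le> Im z" using assms(1) ic(1) by (simp add: power2_le_iff_abs_le)
    then show False using h \<open>Re z = 2 * lam\<close> by simp
  qed
  show "Im (ZR z) > 0" if "Re z > 2 * lam" "Im z > 0"
  proof -
    have "Im (Zsq lam z) > 0" using that by (simp add: Zsq_parts)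
    then show ?thesis using sq(2) im by (cases "Im (ZR z) = 0") auto
  qed
qed

lemma ZL_quadrant:
  assumes "Im z \<ge> 0" "Re z \<le> 2 * lam"
  shows "Re (ZL z) \<ge> 0" "Im (ZL z) \<le> 0"
    and "Re z < 2 * lam \<or> Im z < ic \<Longrightarrow> Re (ZL z) > 0"
    and "Re z < 2 * lam \<or> Im z < ic \<Longrightarrow> csqrt (Zsq lam z) = ZL z"
    and "Re z < 2 * lam \<Longrightarrow> Im z > 0 \<Longrightarrow> Im (ZL z) < 0"
proof -
  show re: "Re (ZL z) \<ge> 0" and im: "Im (ZL z) \<le> 0"
    unfolding ZL_def by (intro sqrt_down_quadrant Zsq_side assms)+
  have sq: "Re (Zsq lam z) = (Re (ZL z))\<^sup>2 - (Im (ZL z))\<^sup>2" "Im (Zsq lam z) = 2 * Re (ZL z) * Im (ZL z)"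
    unfolding ZR_ZL_power2(2)[of z, symmetric] by (simp_all add: power2_eq_square)
  show *: "Re (ZL z) > 0" if h: "Re z < 2 * lam \<or> Im z < ic"
  proof (rule ccontr)
    assume "\<not> Re (ZL z) > 0"
    then have "Re (ZL z) = 0" using re by simp
    then have "Im (Zsq lam z) = 0" "Re (Zsq lam z) \<le> 0" using sq by simp_all
    then have 1: "Re z = 2 * lam \<or> Im z = 0" "(Re z - 2 * lam)\<^sup>2 + ic\<^sup>2 \<le> (Im z)\<^sup>2" by (auto simp: Zsq_parts)
    then have "Im z \<noteq> 0" using ic(1) sum_power2_gt_zero_iff[of "Re z - 2 * lam" ic] by auto
    then have "ic\<^sup>2 \<le> (Im z)\<^sup>2" "Re z = 2 * lam" using 1 by auto
    then have "ic \<le> Im z" using assms(1) ic(1) by (simp add: power2_le_iff_abs_le)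
    then show False using h \<open>Re z = 2 * lam\<close> by simp
  qed
  show "csqrt (Zsq lam z) = ZL z" if h: "Re z < 2 * lam \<or> Im z < ic"
    by (rule csqrt_unique) (use *[OF h] in auto)
  show "Im (ZL z) < 0" if "Re z < 2 * lam" "Im z > 0"
  proof -
    have "Im (Zsq lam z) < 0" using that by (simp add: Zsq_parts mult_neg_pos)
    then show ?thesis using sq(2) im by (cases "Im (ZL z) = 0") auto
  qed
qed

text \<open>For the roots \<open>\<zeta>\<close> and \<open>- \<zeta>\<close> the arguments of
  corresponding logarithms have products of constant modulus, so the sum does not depend on
  \<open>z\<close>; at the turning point both roots are 0, which gives its value.\<close>

lemma re_xi_minus:
  assumes "z \<noteq> 0" "\<zeta> ^ 2 = Zsq lam z"
  shows "re_xi lam \<zeta> z + re_xi lam (- \<zeta>) z = 2 * level0"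
proof -
  have *: "re_xi lam \<zeta> z + re_xi lam (- \<zeta>) z = - lam * ln (ic\<^sup>2) - ln (1 - lam\<^sup>2)"
    if "z \<noteq> 0" "\<zeta> ^ 2 = Zsq lam z" for z \<zeta>
  proof -
    note f = Zsq_factor_nonzero[OF lam0 lam1 that(2)]
    note f' = Zsq_factor_nonzero[OF lam0 lam1, of "- \<zeta>" z, unfolded power2_minus, OF that(2)]
    have "ln (cmod (\<zeta> + z - 2 * of_real lam)) + ln (cmod (- \<zeta> + z - 2 * of_real lam)) = ln (ic\<^sup>2)"
    proof -
      have "cmod ((\<zeta> + z - 2 * of_real lam) * (- \<zeta> + z - 2 * of_real lam)) = ic\<^sup>2"
        unfolding f(3) norm_minus_cancel norm_of_real using lam2 by (simp add: ic(2))
      then show ?thesis by (simp only: ln_cmod_mult[OF f(1) f'(1)])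
    qed
    moreover have "ln (cmod ((\<zeta> - of_real lam * z + 2) / z)) + ln (cmod ((- \<zeta> - of_real lam * z + 2) / z)) = ln (1 - lam\<^sup>2)"
    proof -
      have "cmod ((\<zeta> - of_real lam * z + 2) * (- \<zeta> - of_real lam * z + 2)) = (1 - lam\<^sup>2) * cmod z ^ 2"
        unfolding f(4) norm_mult norm_minus_cancel norm_of_real norm_power using lam2 by simp
      then have "cmod ((\<zeta> - of_real lam * z + 2) / z * ((- \<zeta> - of_real lam * z + 2) / z)) = 1 - lam\<^sup>2"
        using that(1) by (simp add: norm_mult norm_divide field_simps power2_eq_square)
      moreover have "(\<zeta> - of_real lam * z + 2) / z \<noteq> 0" "(- \<zeta> - of_real lam * z + 2) / z \<noteq> 0"
        using f(2) f'(2) that(1) by simp_all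
      note ln_cmod_mult[OF this]
      ultimately show ?thesis by (simp only:)
    qed
    moreover have "lam * a + lam * b = lam * c" if "a + b = c" for a b c :: real
      using that by (simp flip: distrib_left)
    ultimately have "lam * ln (cmod (\<zeta> + z - 2 * of_real lam)) + lam * ln (cmod (- \<zeta> + z - 2 * of_real lam)) = lam * ln (ic\<^sup>2)
      \<and> ln (cmod ((\<zeta> - of_real lam * z + 2) / z)) + ln (cmod ((- \<zeta> - of_real lam * z + 2) / z)) = ln (1 - lam\<^sup>2)"
      by blast
    then show ?thesis unfolding re_xi_def uminus_complex.sel mult_minus_left by linarith
  qed
  have "zplus lam \<noteq> 0" using zplus ic(1) by (auto simp: complex_eq_iff)
  moreover have "Zsq lam (zplus lam) = 0" using Zsq_eq_0_iff[of "zplus lam"] zplus ic(1) by simp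
  ultimately have "re_xi lam 0 (zplus lam) + re_xi lam (- 0) (zplus lam) = - lam * ln (ic\<^sup>2) - ln (1 - lam\<^sup>2)"
    by (intro *) auto
  then show ?thesis using *[OF assms] by (simp add: level0_def)
qed

lemma Zsq_deriv: "(Zsq lam has_field_derivative 2 * (z - 2 * of_real lam)) (at z within A)"
  unfolding Zsq_def by (auto intro!: derivative_eq_intros)

lemma continuous_on_Zsq: "continuous_on A (Zsq lam)"
  unfolding Zsq_def by (intro continuous_intros)

lemma continuous_on_ZR: "continuous_on {z. Im z \<ge> 0 \<and> Re z \<ge> 2 * lam} ZR"
  and continuous_on_ZL: "continuous_on {z. Im z \<ge> 0 \<and> Re z \<le> 2 * lam} ZL"
  unfolding ZR_def ZL_def
  by (auto intro!: continuous_on_compose2[OF continuous_on_sqrt_up_down(1) continuous_on_Zsq]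
      continuous_on_compose2[OF continuous_on_sqrt_up_down(2) continuous_on_Zsq] Zsq_side)

lemma continuous_on_phR: "continuous_on {z. Im z \<ge> 0 \<and> Re z \<ge> 2 * lam \<and> z \<noteq> 0} phR"
  and continuous_on_phL: "continuous_on {z. Im z \<ge> 0 \<and> Re z \<le> 2 * lam \<and> z \<noteq> 0} phL"
  unfolding phR_def phL_def
  by (intro continuous_intros continuous_on_re_xi lam0 lam1 continuous_on_subset[OF continuous_on_ZR]
       continuous_on_subset[OF continuous_on_ZL]; auto)+

lemma phR_deriv:
  assumes p: "(p has_vector_derivative p') (at t)" and "Im (p t) \<ge> 0" "Re (p t) \<ge> 2 * lam" "p t \<noteq> 0" "p t \<noteq> zplus lam"
  shows "((\<lambda>t. phR (p t)) has_real_derivative Re (ZR (p t) / (2 * p t) * p')) (at t)"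
proof -
  have nz: "Zsq lam (p t) \<noteq> 0" using assms Zsq_eq_0_iff by auto
  have "(ZR has_field_derivative (p t - 2 * of_real lam) / ZR (p t)) (at (p t))"
  proof -
    have e: "1 / (2 * a) * (2 * b) = b / a" for a b :: complex by simp
    show ?thesis
      unfolding ZR_def[abs_def]
      by (rule DERIV_cong[OF DERIV_chain2[OF sqrt_up_deriv Zsq_deriv] e]) (use assms nz in \<open>auto intro: Zsq_side\<close>)
  qed
  from field_vector_diff_chain_at[OF p this]
  have "((\<lambda>t. ZR (p t)) has_vector_derivative ((p t - 2 * of_real lam) * p' / ZR (p t))) (at t)"
    by (simp add: o_def mult.commute)
  from re_xi_has_deriv[OF lam0 lam1 p this] nz assms
  have "((\<lambda>t. re_xi lam (ZR (p t)) (p t)) has_real_derivative Re (ZR (p t) / (2 * p t) * p')) (at t)"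
    by (simp add: ZR_def)
  then show ?thesis unfolding phR_def by (auto intro!: derivative_eq_intros)
qed

lemma phL_deriv:
  assumes p: "(p has_vector_derivative p') (at t)" and "Im (p t) \<ge> 0" "Re (p t) \<le> 2 * lam" "p t \<noteq> 0" "p t \<noteq> zplus lam"
  shows "((\<lambda>t. phL (p t)) has_real_derivative Re (ZL (p t) / (2 * p t) * p')) (at t)"
proof -
  have nz: "Zsq lam (p t) \<noteq> 0" using assms Zsq_eq_0_iff by auto
  have "(ZL has_field_derivative (p t - 2 * of_real lam) / ZL (p t)) (at (p t))"
  proof -
    have e: "1 / (2 * a) * (2 * b) = b / a" for a b :: complex by simp
    show ?thesis
      unfolding ZL_def[abs_def]
      by (rule DERIV_cong[OF DERIV_chain2[OF sqrt_down_deriv Zsq_deriv] e]) (use assms nz in \<open>auto intro: Zsq_side\<close>)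
  qed
  from field_vector_diff_chain_at[OF p this]
  have "((\<lambda>t. ZL (p t)) has_vector_derivative ((p t - 2 * of_real lam) * p' / ZL (p t))) (at t)"
    by (simp add: o_def mult.commute)
  from re_xi_has_deriv[OF lam0 lam1 p this] nz assms
  have "((\<lambda>t. re_xi lam (ZL (p t)) (p t)) has_real_derivative Re (ZL (p t) / (2 * p t) * p')) (at t)"
    by (simp add: ZL_def)
  then show ?thesis unfolding phL_def by (auto intro!: derivative_eq_intros)
qed

text \<open>The root and the point both lie in the closed first quadrant and have positive real
  parts, so \<open>Z / z\<close> has positive real part.\<close>

lemma phR_horizontal:
  assumes "2 * lam \<le> x1" "x1 < x2" "y \<ge> 0" "x1 > 0 \<or> y > 0"
  shows "phR (Complex x1 y) < phR (Complex x2 y)"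
proof (rule DERIV_pos_imp_increasing_open[OF assms(2)])
  fix x assume x: "x1 < x" "x < x2"
  define z where "z = Complex x y"
  have p: "(Complex x y \<noteq> 0)" using x assms lam0 by (auto simp: complex_eq_iff)
  have d: "((\<lambda>t. Complex t y) has_vector_derivative 1) (at x)"
    unfolding Complex_eq by (auto intro!: derivative_eq_intros)
  have "((\<lambda>t. phR (Complex t y)) has_real_derivative Re (ZR z / (2 * z) * 1)) (at x)"
    unfolding z_def by (rule phR_deriv[OF d]) (use x assms p zplus in \<open>auto simp: complex_eq_iff\<close>)
  moreover have "Re (ZR z / (2 * z) * 1) > 0"
  proof -
    have q: "Re (ZR z) > 0" "Im (ZR z) \<ge> 0" using x assms by (auto simp: z_def intro!: ZR_quadrant)
    have "Re z > 0" "Im z \<ge> 0" using x assms lam0 by (auto simp: z_def)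
    then have "Re (ZR z) * Re z + Im (ZR z) * Im z > 0" using q by (intro add_pos_nonneg mult_pos_pos mult_nonneg_nonneg)
    then show ?thesis unfolding mult_1_right by (rule Re_divide_pos)
  qed
  ultimately show "\<exists>y'. ((\<lambda>t. phR (Complex t y)) has_real_derivative y') (at x) \<and> 0 < y'" by blast
next
  show "continuous_on {x1..x2} (\<lambda>t. phR (Complex t y))"
    by (rule continuous_on_compose2[OF continuous_on_phR])
       (use assms lam0 in \<open>auto simp: Complex_eq complex_eq_iff intro!: continuous_intros\<close>)
qed

text \<open>Along a ray \<open>z d xi / dz = Z / 2\<close>, so the rate of change has the sign of
  \<open>Re Z\<close>.\<close>

lemma phR_radial:
  assumes "0 < t1" "t1 < t2" "z \<noteq> 0" "Im z \<ge> 0" "\<And>t. t1 \<le> t \<Longrightarrow> t \<le> t2 \<Longrightarrow> t * Re z \<ge> 2 * lam"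
    and "\<And>t. t1 < t \<Longrightarrow> t < t2 \<Longrightarrow> t * Re z > 2 * lam \<or> t * Im z < ic"
  shows "phR (of_real t1 * z) < phR (of_real t2 * z)"
proof (rule DERIV_pos_imp_increasing_open[OF assms(2)])
  fix t assume t: "t1 < t" "t < t2"
  have d: "((\<lambda>t. of_real t * z) has_vector_derivative z) (at t)" by (auto intro!: derivative_eq_intros)
  have q: "Re (ZR (of_real t * z)) > 0"
    using t assms by (intro ZR_quadrant) auto
  have "((\<lambda>t. phR (of_real t * z)) has_real_derivative Re (ZR (of_real t * z) / (2 * (of_real t * z)) * z)) (at t)"
    by (rule phR_deriv[OF d]) (use t assms zplus in \<open>force simp: complex_eq_iff\<close>)+
  moreover have "ZR (of_real t * z) / (2 * (of_real t * z)) * z = ZR (of_real t * z) / of_real (2 * t)"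
    using assms t by (simp add: field_simps)
  ultimately show "\<exists>y'. ((\<lambda>t. phR (of_real t * z)) has_real_derivative y') (at t) \<and> 0 < y'"
    using q t assms(1) by (auto simp: Re_divide_of_real)
next
  show "continuous_on {t1..t2} (\<lambda>t. phR (of_real t * z))"
    by (rule continuous_on_compose2[OF continuous_on_phR])
       (use assms in \<open>auto intro!: continuous_intros\<close>)
qed

lemma phL_radial:
  assumes "0 < t1" "t1 < t2" "z \<noteq> 0" "Im z \<ge> 0" "\<And>t. t1 \<le> t \<Longrightarrow> t \<le> t2 \<Longrightarrow> t * Re z \<le> 2 * lam"
    and "\<And>t. t1 < t \<Longrightarrow> t < t2 \<Longrightarrow> t * Re z < 2 * lam"
  shows "phL (of_real t1 * z) < phL (of_real t2 * z)"
proof (rule DERIV_pos_imp_increasing_open[OF assms(2)])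
  fix t assume t: "t1 < t" "t < t2"
  have d: "((\<lambda>t. of_real t * z) has_vector_derivative z) (at t)" by (auto intro!: derivative_eq_intros)
  have q: "Re (ZL (of_real t * z)) > 0"
    using t assms by (intro ZL_quadrant) auto
  have "((\<lambda>t. phL (of_real t * z)) has_real_derivative Re (ZL (of_real t * z) / (2 * (of_real t * z)) * z)) (at t)"
    by (rule phL_deriv[OF d]) (use t assms zplus in \<open>force simp: complex_eq_iff\<close>)+
  moreover have "ZL (of_real t * z) / (2 * (of_real t * z)) * z = ZL (of_real t * z) / of_real (2 * t)"
    using assms t by (simp add: field_simps)
  ultimately show "\<exists>y'. ((\<lambda>t. phL (of_real t * z)) has_real_derivative y') (at t) \<and> 0 < y'"
    using q t assms(1) by (auto simp: Re_divide_of_real)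
next
  show "continuous_on {t1..t2} (\<lambda>t. phL (of_real t * z))"
    by (rule continuous_on_compose2[OF continuous_on_phL])
       (use assms in \<open>auto intro!: continuous_intros\<close>)
qed

lemma cis_path_deriv: "((\<lambda>\<theta>. of_real r * cis \<theta>) has_vector_derivative \<i> * (of_real r * cis \<theta>)) (at \<theta>)"
proof -
  have "((\<lambda>\<theta>. of_real r * cis \<theta>) has_vector_derivative of_real r * (\<i> * cis \<theta>)) (at \<theta>)"
    unfolding cis_conv_exp
    by (rule has_vector_derivative_mult_right)
       (auto intro!: derivative_eq_intros field_vector_diff_chain_at[of "\<lambda>t. \<i> * of_real t" _ _ exp, unfolded o_def])
  then show ?thesis by (simp add: mult.left_commute)
qed

text \<open>Along a circle \<open>dz = i z d\<theta>\<close>, so the rate of change is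
  \<open>- Im Z / 2\<close>, and the left root has negative imaginary part.\<close>

lemma phL_rotate:
  assumes r: "r > 0" and th: "0 \<le> \<theta>1" "\<theta>1 < \<theta>2" "\<theta>2 \<le> pi" and l: "r * cos \<theta>1 \<le> 2 * lam"
  shows "phL (of_real r * cis \<theta>1) < phL (of_real r * cis \<theta>2)"
proof (rule DERIV_pos_imp_increasing_open[OF th(2)])
  have cle: "r * cos \<theta> < 2 * lam" if "\<theta>1 < \<theta>" "\<theta> \<le> pi" for \<theta>
  proof -
    have "cos \<theta> < cos \<theta>1" using that th by (intro cos_monotone_0_pi) auto
    then show ?thesis using l r by (meson less_le_trans mult_strict_left_mono)
  qed
  {
    fix \<theta> assume t: "\<theta>1 < \<theta>" "\<theta> < \<theta>2"
    define z where "z = of_real r * cis \<theta>"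
    have z: "Re z < 2 * lam" "Im z > 0" using t th r cle[of \<theta>] by (auto simp: z_def intro!: mult_pos_pos sin_gt_zero)
    then have z0: "z \<noteq> 0" "z \<noteq> zplus lam" using zplus by auto
    have "((\<lambda>\<theta>. phL (of_real r * cis \<theta>)) has_real_derivative Re (ZL z / (2 * z) * (\<i> * z))) (at \<theta>)"
      unfolding z_def by (rule phL_deriv[OF cis_path_deriv]) (use z z0 in \<open>auto simp: z_def\<close>)
    moreover have "ZL z / (2 * z) * (\<i> * z) = \<i> * ZL z / 2" using z0 by simp
    moreover have "Re (\<i> * ZL z / 2) > 0" using ZL_quadrant(5)[of z] z by simp
    ultimately show "\<exists>y'. ((\<lambda>\<theta>. phL (of_real r * cis \<theta>)) has_real_derivative y') (at \<theta>) \<and> 0 < y'"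
      by metis
  }
  show "continuous_on {\<theta>1..\<theta>2} (\<lambda>\<theta>. phL (of_real r * cis \<theta>))"
  proof (rule continuous_on_compose2[OF continuous_on_phL])
    show "(\<lambda>\<theta>. of_real r * cis \<theta>) ` {\<theta>1..\<theta>2} \<subseteq> {z. Im z \<ge> 0 \<and> Re z \<le> 2 * lam \<and> z \<noteq> 0}"
    proof (clarify)
      fix \<theta> assume "\<theta> \<in> {\<theta>1..\<theta>2}"
      then have "sin \<theta> \<ge> 0" "r * cos \<theta> \<le> 2 * lam"
        using th l cle[of \<theta>] by (force intro!: sin_ge_zero, cases "\<theta> = \<theta>1", auto intro: less_imp_le)
      then show "0 \<le> Im (of_real r * cis \<theta>) \<and> Re (of_real r * cis \<theta>) \<le> 2 * lam \<and> of_real r * cis \<theta> \<noteq> 0"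
        using r by (simp add: cis_neq_zero)
    qed
  qed (auto intro!: continuous_intros)
qed

lemma phR_rotate:
  assumes r: "r > 0" and th: "0 \<le> \<theta>1" "\<theta>1 < \<theta>2" "\<theta>2 \<le> pi / 2" and l: "r * cos \<theta>2 \<ge> 2 * lam"
  shows "phR (of_real r * cis \<theta>2) < phR (of_real r * cis \<theta>1)"
proof -
  have cle: "r * cos \<theta> > 2 * lam" if "0 \<le> \<theta>" "\<theta> < \<theta>2" for \<theta>
  proof -
    have "cos \<theta>2 < cos \<theta>" using that th pi_gt_zero by (intro cos_monotone_0_pi) auto
    then show ?thesis using l r by (meson le_less_trans mult_strict_left_mono)
  qed
  have "- phR (of_real r * cis \<theta>1) < - phR (of_real r * cis \<theta>2)"
  proof (rule DERIV_pos_imp_increasing_open[OF th(2)])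
    fix \<theta> assume t: "\<theta>1 < \<theta>" "\<theta> < \<theta>2"
    define z where "z = of_real r * cis \<theta>"
    have z: "Re z > 2 * lam" "Im z > 0" using t th r cle[of \<theta>] pi_gt_zero
      by (auto simp: z_def intro!: mult_pos_pos sin_gt_zero)
    then have z0: "z \<noteq> 0" "z \<noteq> zplus lam" using zplus by auto
    have "((\<lambda>\<theta>. phR (of_real r * cis \<theta>)) has_real_derivative Re (ZR z / (2 * z) * (\<i> * z))) (at \<theta>)"
      unfolding z_def by (rule phR_deriv[OF cis_path_deriv]) (use z z0 in \<open>auto simp: z_def\<close>)
    moreover have "ZR z / (2 * z) * (\<i> * z) = \<i> * ZR z / 2" using z0 by simp
    moreover have "Re (\<i> * ZR z / 2) < 0" using ZR_quadrant(5)[of z] z by simp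
    ultimately show "\<exists>y'. ((\<lambda>\<theta>. - phR (of_real r * cis \<theta>)) has_real_derivative y') (at \<theta>) \<and> 0 < y'"
      by (metis DERIV_minus neg_0_less_iff_less)
  next
    show "continuous_on {\<theta>1..\<theta>2} (\<lambda>\<theta>. - phR (of_real r * cis \<theta>))"
    proof (intro continuous_on_minus continuous_on_compose2[OF continuous_on_phR])
      show "(\<lambda>\<theta>. of_real r * cis \<theta>) ` {\<theta>1..\<theta>2} \<subseteq> {z. Im z \<ge> 0 \<and> Re z \<ge> 2 * lam \<and> z \<noteq> 0}"
      proof (clarify)
        fix \<theta> assume "\<theta> \<in> {\<theta>1..\<theta>2}"
        then have "sin \<theta> \<ge> 0" "r * cos \<theta> \<ge> 2 * lam"
          using th l cle[of \<theta>] pi_gt_zero by (force intro!: sin_ge_zero, cases "\<theta> = \<theta>2", auto intro: less_imp_le)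
        then show "0 \<le> Im (of_real r * cis \<theta>) \<and> 2 * lam \<le> Re (of_real r * cis \<theta>) \<and> of_real r * cis \<theta> \<noteq> 0"
          using r by (simp add: cis_neq_zero)
      qed
    qed (auto intro!: continuous_intros)
  qed
  then show ?thesis by simp
qed


text \<open>On the vertical line \<open>Zsq\<close> is the real number
  \<open>ic^2 - (Im z)^2\<close>. Where it is positive, both roots are its positive square root;
  where it is negative, they lie on opposite halves of the imaginary axis.\<close>

lemma level_line:
  assumes "Re z = 2 * lam" "Im z \<ge> 0"
  shows "Im z \<le> ic \<Longrightarrow> ZL z = ZR z" and "Im z \<ge> ic \<Longrightarrow> ZL z = - ZR z"
proof -
  have w: "Zsq lam z = of_real (ic\<^sup>2 - (Im z)\<^sup>2)" using assms by (simp add: complex_eq_iff Zsq_parts)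
  have "ZL z ^ 2 = ZR z ^ 2" by simp
  then have cases: "ZL z = ZR z \<or> ZL z = - ZR z" by (rule power2_eq_iff[THEN iffD1])
  have q: "Re (ZR z) \<ge> 0" "Im (ZR z) \<ge> 0" "Re (ZL z) \<ge> 0" "Im (ZL z) \<le> 0"
    using assms ZR_quadrant(1,2) ZL_quadrant(1,2) by auto
  show "ZL z = ZR z" if "Im z \<le> ic"
  proof (cases "Im z = ic")
    case True
    then have "ZR z ^ 2 = 0" "ZL z ^ 2 = 0" using w by (simp_all only: ZR_ZL_power2) simp_all
    then show ?thesis unfolding zero_eq_power2 by simp
  next
    case False
    then have "Re (ZR z) > 0" "Re (ZL z) > 0" using that assms by (auto intro: ZR_quadrant ZL_quadrant)
    then show ?thesis using cases by auto
  qed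
  show "ZL z = - ZR z" if "Im z \<ge> ic"
  proof -
    have "ic\<^sup>2 - (Im z)\<^sup>2 \<le> 0" using that ic(1) by (simp add: power_mono)
    moreover have "Re (ZR z ^ 2) = ic\<^sup>2 - (Im z)\<^sup>2" "Im (ZR z ^ 2) = 0" by (simp_all only: ZR_ZL_power2 w) simp_all
    ultimately have "(Re (ZR z))\<^sup>2 \<le> (Im (ZR z))\<^sup>2" "Re (ZR z) * Im (ZR z) = 0"
      by (auto simp: power2_eq_square)
    then have "Re (ZR z) = 0" by auto
    then show ?thesis using cases q by (auto simp: complex_eq_iff)
  qed
qed

lemma phR_zplus: "phR (zplus lam) = 0"
proof -
  have "Zsq lam (zplus lam) = 0" using Zsq_eq_0_iff[of "zplus lam"] zplus ic(1) by simp
  then have "ZR (zplus lam) = 0" by (metis ZR_ZL_power2(1) zero_eq_power2)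
  then show ?thesis by (simp add: phR_def level0_def)
qed

lemma phL_line:
  assumes "Re z = 2 * lam" "Im z \<ge> 0" "z \<noteq> 0"
  shows "Im z \<le> ic \<Longrightarrow> phL z = phR z" and "Im z \<ge> ic \<Longrightarrow> phL z = - phR z"
  using level_line[OF assms(1,2)] re_xi_minus[OF assms(3), of "ZR z"] by (simp_all add: phL_def phR_def)

lemma vertical_deriv:
  assumes "y > 0" "y \<noteq> ic"
  shows "((\<lambda>y. phR (Complex (2 * lam) y)) has_real_derivative
    Re (ZR (Complex (2 * lam) y) / (2 * Complex (2 * lam) y) * \<i>)) (at y)"
proof (rule phR_deriv)
  show "((\<lambda>y. Complex (2 * lam) y) has_vector_derivative \<i>) (at y)"
    unfolding Complex_eq by (auto intro!: derivative_eq_intros)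
qed (use assms zplus in \<open>auto simp: complex_eq_iff\<close>)

lemma continuous_on_vertical:
  "continuous_on {y. y \<ge> 0 \<and> (y > 0 \<or> lam > 0)} (\<lambda>y. phR (Complex (2 * lam) y))"
  by (rule continuous_on_compose2[OF continuous_on_phR])
     (use lam0 in \<open>auto simp: Complex_eq complex_eq_iff intro!: continuous_intros\<close>)

text \<open>Below the turning point \<open>Z\<close> is real and positive, so the phase increases
  upwards until it reaches 0 there.\<close>

lemma phR_vertical_below:
  assumes "0 \<le> y" "y < ic" "y > 0 \<or> lam > 0"
  shows "phR (Complex (2 * lam) y) < 0"
proof -
  have "phR (Complex (2 * lam) y) < phR (Complex (2 * lam) ic)"
  proof (rule DERIV_pos_imp_increasing_open[OF assms(2)])
    fix t assume t: "y < t" "t < ic"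
    define z where "z = Complex (2 * lam) t"
    have z: "Re z = 2 * lam" "Im z = t" "t > 0" using t assms by (simp_all add: z_def)
    have "Im (ZL z) \<le> 0" "ZL z = ZR z" "Im (ZR z) \<ge> 0" "Re (ZR z) > 0"
      using ZL_quadrant[of z] ZR_quadrant[of z] level_line[of z] z t by auto
    then have "Im (ZR z) = 0" "Re (ZR z) > 0" by auto
    then have "Re (ZR z * \<i>) * Re z + Im (ZR z * \<i>) * Im z > 0" using z by simp
    then have "Re (ZR z * \<i> / (2 * z)) > 0" by (rule Re_divide_pos)
    then show "\<exists>d. ((\<lambda>y. phR (Complex (2 * lam) y)) has_real_derivative d) (at t) \<and> 0 < d"
      using vertical_deriv[of t] t z(3) unfolding z_def by auto
  next
    show "continuous_on {y..ic} (\<lambda>y. phR (Complex (2 * lam) y))"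
      by (rule continuous_on_subset[OF continuous_on_vertical]) (use assms in auto)
  qed
  moreover have "Complex (2 * lam) ic = zplus lam" using zplus by (simp add: complex_eq_iff)
  ultimately show ?thesis by (simp add: phR_zplus)
qed

text \<open>Above the turning point \<open>Z\<close> is purely imaginary, and the rate of change
  carries a factor \<open>lam\<close>. For \<open>lam = 0\<close> this ray is itself a level curve,
  which is why the first inequality is weak.\<close>

lemma phR_vertical_above:
  assumes "y > ic"
  shows "phR (Complex (2 * lam) y) \<le> 0" and "lam > 0 \<Longrightarrow> phR (Complex (2 * lam) y) < 0"
proof -
  have cont: "continuous_on {ic..y} (\<lambda>y. phR (Complex (2 * lam) y))"
    by (rule continuous_on_subset[OF continuous_on_vertical]) (use assms ic(1) in auto)
  have zp: "phR (Complex (2 * lam) ic) = 0"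
  proof -
    have "Complex (2 * lam) ic = zplus lam" using zplus by (simp add: complex_eq_iff)
    then show ?thesis by (simp add: phR_zplus)
  qed
  have d: "\<exists>d. ((\<lambda>y. phR (Complex (2 * lam) y)) has_real_derivative d) (at t) \<and> d \<le> 0 \<and> (lam > 0 \<longrightarrow> d < 0)"
    if t: "ic < t" "t < y" for t
  proof -
    define z where "z = Complex (2 * lam) t"
    have z: "Re z = 2 * lam" "Im z = t" "t > 0" using t ic(1) by (simp_all add: z_def)
    have "Re (ZL z) \<ge> 0" "ZL z = - ZR z" "Im (ZR z) \<ge> 0" "Re (ZR z) \<ge> 0"
      using ZL_quadrant[of z] ZR_quadrant[of z] level_line[of z] z t by auto
    then have re: "Re (ZR z) = 0" "Im (ZR z) \<ge> 0" by auto
    have "z \<noteq> zplus lam" using z zplus t by auto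
    then have "ZR z \<noteq> 0" using Zsq_eq_0_iff[of z] z by (metis ZR_ZL_power2(1) less_imp_le zero_eq_power2)
    then have im: "Im (ZR z) > 0" using re by (auto simp: complex_eq_iff)
    have "ZR z * \<i> = of_real (- Im (ZR z))" using re by (simp add: complex_eq_iff)
    then have "ZR z / (2 * z) * \<i> = of_real (- Im (ZR z) / 2) / z" by simp
    moreover have "Re (of_real a / z) = a * (2 * lam) / ((2 * lam)\<^sup>2 + t\<^sup>2)" for a
      by (simp add: Re_divide z)
    ultimately have "Re (ZR z / (2 * z) * \<i>) = - Im (ZR z) / 2 * (2 * lam) / ((2 * lam)\<^sup>2 + t\<^sup>2)"
      by (simp only:)
    then have eq: "Re (ZR z / (2 * z) * \<i>) = - (Im (ZR z) * lam / ((2 * lam)\<^sup>2 + t\<^sup>2))"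
      by (rule trans) simp
    have den: "(2 * lam)\<^sup>2 + t\<^sup>2 > 0" using z by (simp add: add_nonneg_pos)
    have "Re (ZR z / (2 * z) * \<i>) \<le> 0" "lam > 0 \<longrightarrow> Re (ZR z / (2 * z) * \<i>) < 0"
      unfolding eq using lam0 im den by (simp_all add: divide_nonneg_pos)
    then show ?thesis using vertical_deriv[of t] t z(3) unfolding z_def by blast
  qed
  have "phR (Complex (2 * lam) y) \<le> phR (Complex (2 * lam) ic)"
    by (rule DERIV_nonpos_imp_decreasing_open[OF less_imp_le[OF assms] _ cont]) (use d in blast)
  then show "phR (Complex (2 * lam) y) \<le> 0" using zp by simp
  show "phR (Complex (2 * lam) y) < 0" if "lam > 0"
  proof -
    have "phR (Complex (2 * lam) y) < phR (Complex (2 * lam) ic)"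
      by (rule DERIV_neg_imp_decreasing_open[OF assms _ cont]) (use d that in blast)
    then show ?thesis using zp by simp
  qed
qed

text \<open>At 0 either root tends to 2, so \<open>\<zeta> + z - 2 lam\<close> and
  \<open>\<zeta> - lam z + 2\<close> have nonzero limits, while the remaining term
  \<open>ln |z|\<close> tends to minus infinity.\<close>

lemma ph_neg_near_0:
  "\<exists>\<epsilon>>0. \<forall>z. z \<noteq> 0 \<and> cmod z < \<epsilon> \<and> Im z \<ge> 0 \<longrightarrow>
     (Re z \<ge> 2 * lam \<longrightarrow> phR z < 0) \<and> (Re z \<le> 2 * lam \<longrightarrow> phL z < 0)"
proof -
  have ev: "eventually (\<lambda>z. re_xi lam (f (Zsq lam z)) z - level0 < 0) (at 0)"
    if f: "isCont f 4" "f 4 = 2" for f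
  proof -
    have Z: "((\<lambda>z. f (Zsq lam z)) \<longlongrightarrow> 2) (at 0)"
    proof -
      have "(Zsq lam \<longlongrightarrow> Zsq lam 0) (at 0)"
        using continuous_on_Zsq[of UNIV] by (simp add: continuous_on_eq_continuous_at isCont_def)
      then show ?thesis using f isCont_tendsto_compose[OF f(1), of "Zsq lam" "at 0"] by (simp add: Zsq_def)
    qed
    have pos: "2 - 2 * lam > 0" using lam1 by simp
    have "2 + 0 - 2 * complex_of_real lam = complex_of_real (2 - 2 * lam)" by simp
    then have nz: "2 + 0 - 2 * complex_of_real lam \<noteq> 0" using pos by (metis of_real_eq_0_iff less_irrefl)
    have "((\<lambda>z. Re (f (Zsq lam z)) / 2 - lam * ln (cmod (f (Zsq lam z) + z - 2 * of_real lam))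
            - ln (cmod (f (Zsq lam z) - of_real lam * z + 2))) \<longlongrightarrow>
          Re 2 / 2 - lam * ln (cmod (2 + 0 - 2 * of_real lam)) - ln (cmod (2 - of_real lam * 0 + 2))) (at 0)"
      using nz by (intro tendsto_intros Z) auto
    then obtain K where K: "eventually (\<lambda>z. Re (f (Zsq lam z)) / 2 - lam * ln (cmod (f (Zsq lam z) + z - 2 * of_real lam))
            - ln (cmod (f (Zsq lam z) - of_real lam * z + 2)) < K) (at 0)"
      using order_tendstoD(2) less_add_one by blast
    have "filterlim (\<lambda>z::complex. ln (cmod z)) at_bot (at 0)"
      by (rule filterlim_compose[OF ln_at_0]) (auto simp: filterlim_at intro!: tendsto_eq_intros eventually_at_filter[THEN iffD2])
    then have "eventually (\<lambda>z::complex. ln (cmod z) < level0 - K) (at 0)"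
      by (auto simp: filterlim_at_bot_dense)
    moreover have "eventually (\<lambda>z. f (Zsq lam z) - of_real lam * z + 2 \<noteq> 0) (at 0)"
    proof (rule tendsto_imp_eventually_ne)
      show "((\<lambda>z. f (Zsq lam z) - of_real lam * z + 2) \<longlongrightarrow> 2 - of_real lam * 0 + 2) (at 0)"
        by (intro tendsto_intros Z)
    qed simp
    moreover have "eventually (\<lambda>z::complex. z \<noteq> 0) (at 0)" by (simp add: eventually_at_filter)
    ultimately show ?thesis using K
      by eventually_elim (simp add: re_xi_def norm_divide ln_div)
  qed
  have 4: "sqrt_up 4 = 2" "sqrt_down 4 = 2"
  proof -
    have "csqrt 4 = 2" by (rule csqrt_unique) (auto simp: power2_eq_square)
    then show "sqrt_up 4 = 2" "sqrt_down 4 = 2"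
      using sqrt_up_quadrant(3)[of 4] sqrt_down_quadrant(3)[of 4] by (auto simp: complex_nonpos_Reals_iff)
  qed
  have c4: "isCont sqrt_up 4" "isCont sqrt_down 4"
    using sqrt_up_deriv[of 4] sqrt_down_deriv[of 4] DERIV_isCont by auto
  have "eventually (\<lambda>z. phR z < 0 \<and> phL z < 0) (at 0)"
    using ev[OF c4(1) 4(1)] ev[OF c4(2) 4(2)]
    by eventually_elim (simp add: phR_def phL_def ZR_def ZL_def)
  then obtain \<epsilon> where "\<epsilon> > 0" "\<And>z. z \<noteq> 0 \<Longrightarrow> cmod z < \<epsilon> \<Longrightarrow> phR z < 0 \<and> phL z < 0"
    unfolding eventually_at by (auto simp: dist_norm)
  then show ?thesis by blast
qed

lemma phR_pos_far: "\<exists>X. \<forall>z. Re z \<ge> X \<longrightarrow> 0 \<le> Im z \<longrightarrow> Im z \<le> ic \<longrightarrow> phR z > 0"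
proof -
  \<comment> \<open>A lower bound of \<open>phR\<close> in terms of \<open>t = Re z - 2 lam\<close>:
    the root has real part at least \<open>t\<close>, and the arguments of the two logarithms have
    modulus at most \<open>2 t + 3 ic\<close> and \<open>6 + 4 ic\<close>.\<close>
  define g where "g = (\<lambda>t. t / 2 - lam * ln (2 * t + 3 * ic) - ln (6 + 4 * ic) - level0)"
  have "filterlim g at_top at_top"
    unfolding g_def using ic(1) lam0 by real_asymp
  then obtain T where T: "\<And>t. t \<ge> T \<Longrightarrow> g t > 0"
    by (auto simp: filterlim_at_top_dense eventually_at_top_linorder)
  have "phR z > 0" if z: "Re z \<ge> max T 1 + 2 * lam" "0 \<le> Im z" "Im z \<le> ic" for z
  proof -
    define t where "t = Re z - 2 * lam"
    have t: "t \<ge> T" "t \<ge> 1" using z by (auto simp: t_def)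
    have z0: "z \<noteq> 0" "Re z \<ge> 1" "cmod z \<ge> 1" using t lam0 abs_Re_le_cmod[of z] by (auto simp: t_def)
    have w: "cmod (z - 2 * of_real lam) \<le> t + ic"
      using cmod_le[of "z - 2 * of_real lam"] z t by (simp add: t_def)
    have "cmod (Zsq lam z) \<le> (t + 2 * ic)\<^sup>2"
    proof -
      have "Zsq lam z = (z - 2 * of_real lam) ^ 2 + of_real (ic\<^sup>2)"
        by (simp add: complex_eq_iff Zsq_parts power2_eq_square)
      then have "cmod (Zsq lam z) \<le> cmod (z - 2 * of_real lam) ^ 2 + ic\<^sup>2"
        by (metis norm_of_real norm_power norm_triangle_ineq abs_power2)
      also have "\<dots> \<le> (t + ic)\<^sup>2 + ic\<^sup>2" using w by (simp add: power_mono)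
      also have "\<dots> \<le> (t + 2 * ic)\<^sup>2" using t ic(1) by (simp add: power2_eq_square algebra_simps)
      finally show ?thesis .
    qed
    then have "cmod (ZR z) ^ 2 \<le> (t + 2 * ic)\<^sup>2"
      by (simp flip: norm_power)
    then have Zn: "cmod (ZR z) \<le> t + 2 * ic" using t ic(1) by (simp add: power2_le_iff_abs_le)
    have Zre: "Re (ZR z) \<ge> t"
    proof -
      have "Re (ZR z ^ 2) = t\<^sup>2 - (Im z)\<^sup>2 + ic\<^sup>2" by (simp only: ZR_ZL_power2 Zsq_parts t_def)
      moreover have "(Im z)\<^sup>2 \<le> ic\<^sup>2" using z by (intro power_mono)
      ultimately have "t\<^sup>2 \<le> (Re (ZR z))\<^sup>2 - (Im (ZR z))\<^sup>2" by (simp add: power2_eq_square)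
      then have "t\<^sup>2 \<le> (Re (ZR z))\<^sup>2" by (smt (verit) zero_le_power2)
      moreover have "Re (ZR z) \<ge> 0" using ZR_quadrant(1)[of z] z t by (simp add: t_def)
      ultimately show ?thesis using t by (simp add: power2_le_iff_abs_le)
    qed
    note f = Zsq_factor_nonzero[OF lam0 lam1 ZR_ZL_power2(1), of z]
    have "cmod (ZR z + z - 2 * of_real lam) \<le> 2 * t + 3 * ic"
      using norm_triangle_ineq[of "ZR z" "z - 2 * of_real lam"] Zn w by (simp add: add_diff_eq)
    then have 1: "lam * ln (cmod (ZR z + z - 2 * of_real lam)) \<le> lam * ln (2 * t + 3 * ic)"
      using f(1) lam0 by (intro mult_left_mono) (auto intro!: ln_mono)
    have 2: "ln (cmod ((ZR z - of_real lam * z + 2) / z)) \<le> ln (6 + 4 * ic)"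
    proof (rule ln_mono)
      show "0 < cmod ((ZR z - of_real lam * z + 2) / z)" using f(2) z0 by simp
      have tz: "t \<le> cmod z" using complex_Re_le_cmod[of z] lam0 by (simp add: t_def)
      have "cmod (ZR z - of_real lam * z + 2) \<le> cmod (ZR z) + lam * cmod z + 2"
        using norm_triangle_ineq[of "ZR z - of_real lam * z" 2] norm_triangle_ineq4[of "ZR z" "of_real lam * z"] lam0
        by (simp add: norm_mult)
      also have "\<dots> \<le> (cmod z + 2 * ic * cmod z) + 1 * cmod z + 2 * cmod z"
      proof (intro add_mono)
        have "2 * ic * 1 \<le> 2 * ic * cmod z" using z0 ic(1) by (intro mult_left_mono) auto
        then show "cmod (ZR z) \<le> cmod z + 2 * ic * cmod z" using Zn tz by simp
      qed (use z0 lam1 in \<open>auto intro: mult_right_mono\<close>)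
      also have "\<dots> \<le> (6 + 4 * ic) * cmod z" using ic(1) by (simp add: algebra_simps)
      finally show "cmod ((ZR z - of_real lam * z + 2) / z) \<le> 6 + 4 * ic"
        using z0 by (simp add: norm_divide divide_le_eq)
    qed
    have "g t \<le> phR z" unfolding g_def phR_def re_xi_def using 1 2 Zre by linarith
    then show ?thesis using T[OF t(1)] by simp
  qed
  then show ?thesis by blast
qed

text \<open>The turning point has modulus 2, so the circle through \<open>z\<close> meets the
  vertical line above it. There \<open>phL = - phR \<ge> 0\<close>, and \<open>phL\<close> increases
  strictly when rotating on to \<open>z\<close>.\<close>

lemma phL_pos_far:
  assumes "z \<noteq> 0" "Im z \<ge> 0" "Re z < 2 * lam" "cmod z > 2"
  shows "phL z > 0"
proof -
  define r where "r = cmod z"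
  define \<theta> where "\<theta> = Arg z"
  have r: "r > 2" using assms by (simp add: r_def)
  have z: "z = of_real r * cis \<theta>" unfolding r_def \<theta>_def by (metis rcis_cmod_Arg rcis_def)
  have th: "0 \<le> \<theta>" "\<theta> \<le> pi" using assms Arg_le_pi[of z] by (auto simp: \<theta>_def Arg_less_0)
  define \<theta>0 where "\<theta>0 = arccos (2 * lam / r)"
  have l: "0 \<le> 2 * lam / r" "2 * lam / r < 1" using lam0 lam1 r by (auto simp: field_simps)
  have th0: "0 \<le> \<theta>0" "\<theta>0 \<le> pi" "cos \<theta>0 = 2 * lam / r"
    using l by (auto simp: \<theta>0_def arccos_lbound arccos_ubound)
  define v where "v = of_real r * cis \<theta>0"
  have v: "Re v = 2 * lam" "Im v \<ge> 0" "cmod v = r" using th0 r by (auto simp: v_def norm_mult sin_ge_zero)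
  have "(Im v)\<^sup>2 = r\<^sup>2 - (2 * lam)\<^sup>2" using v cmod_power2[of v] by simp
  moreover have "r\<^sup>2 > 2\<^sup>2" using r by (intro power_strict_mono) auto
  ultimately have "(Im v)\<^sup>2 > ic\<^sup>2" unfolding ic(2) by (simp add: power_mult_distrib)
  then have Imv: "Im v > ic" using v ic(1) by (simp add: power_less_imp_less_base)
  have "cos \<theta> < cos \<theta>0"
  proof -
    have "r * cos \<theta> < 2 * lam" using assms(3) unfolding z by simp
    then have "cos \<theta> < 2 * lam / r" using r by (simp add: pos_less_divide_eq mult.commute)
    then show ?thesis by (simp add: th0)
  qed
  then have "\<theta>0 < \<theta>" using th th0 cos_monotone_0_pi_le[of \<theta> \<theta>0] by force
  then have "phL v < phL z" unfolding v_def z by (intro phL_rotate) (use r th th0 in auto)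
  moreover have "phL v = - phR v" using v Imv r by (intro phL_line) auto
  moreover have "phR v \<le> 0"
  proof -
    have "Complex (2 * lam) (Im v) = v" using v by (simp add: complex_eq_iff)
    then show ?thesis using phR_vertical_above(1)[OF Imv] by simp
  qed
  ultimately show ?thesis by simp
qed

end

section \<open>Regions bounded by the level curves\<close>

lemma connected_component_clopen:
  assumes A: "connected A" "A \<subseteq> U" and op: "openin (top_of_set U) A" "openin (top_of_set U) (U - A)" and z: "z \<in> A"
  shows "connected_component_set U z = A"
proof
  show "A \<subseteq> connected_component_set U z" by (rule connected_component_maximal[OF z A])
  let ?T = "connected_component_set U z"
  have T: "connected ?T" "?T \<subseteq> U" by (simp_all add: connected_component_subset)
  have zT: "z \<in> ?T" using z A by auto
  obtain P Q where P: "open P" "A = U \<inter> P" and Q: "open Q" "U - A = U \<inter> Q"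
    using op by (auto simp: openin_open)
  have "?T \<subseteq> P \<union> Q" "P \<inter> Q \<inter> ?T = {}" using P Q T by blast+
  then have "P \<inter> ?T = {} \<or> Q \<inter> ?T = {}" using connectedD[OF T(1) P(1) Q(1)] by blast
  then show "?T \<subseteq> A" using P Q zT z T(2) by blast
qed

lemma connected_component_image:
  assumes "connected I" "continuous_on I f" "f ` I \<subseteq> S" "a \<in> I" "b \<in> I"
  shows "connected_component S (f a) (f b)"
  unfolding connected_component_def
  using connected_continuous_image[OF assms(2,1)] assms(3-5) by blast

lemma openin_sublevel:
  fixes f :: "'a::topological_space \<Rightarrow> real"
  assumes D: "openin (top_of_set C) D" and f: "continuous_on D f"
  shows "openin (top_of_set C) {z \<in> D. f z < a}" "openin (top_of_set C) {z \<in> D. f z > a}"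
proof -
  have "openin (top_of_set D) (D \<inter> f -` {..<a})" "openin (top_of_set D) (D \<inter> f -` {a<..})"
    by (intro continuous_openin_preimage_gen f; simp)+
  moreover have "D \<inter> f -` {..<a} = {z \<in> D. f z < a}" "D \<inter> f -` {a<..} = {z \<in> D. f z > a}" by auto
  ultimately show "openin (top_of_set C) {z \<in> D. f z < a}" "openin (top_of_set C) {z \<in> D. f z > a}"
    using D openin_trans by metis+
qed

lemma Cplus_polar:
  assumes "z \<in> Cplus"
  shows "z = of_real (cmod z) * cis (Arg z)" "0 \<le> Arg z" "Arg z \<le> pi" "cmod z > 0"
proof -
  show "z = of_real (cmod z) * cis (Arg z)" by (metis rcis_cmod_Arg rcis_def)
  show "0 \<le> Arg z" using assms Arg_less_0[of z] by (simp add: Cplus_def)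
  show "Arg z \<le> pi" by (rule Arg_le_pi)
  show "cmod z > 0" using assms by (simp add: Cplus_def)
qed

lemma cis_in_Cplus: "r > 0 \<Longrightarrow> 0 \<le> \<theta> \<Longrightarrow> \<theta> \<le> pi \<Longrightarrow> of_real r * cis \<theta> \<in> Cplus"
  by (simp add: Cplus_def sin_ge_zero)

context turning_point
begin

text \<open>
  phR and phL are the real part of \<open>\<xi>\<close>, minus its value at the turning point, to the right and to the
  left of the line Re z = 2 lam. SA, SB, SC are the regions \<open>S\<^sub>-\<^sub>1\<close>, \<open>S\<^sub>1\<close>, \<open>S\<^sub>0\<close>, and G2, G3 the curves
  \<open>\<gamma>\<^sub>2\<close>, \<open>\<gamma>\<^sub>3\<close>.
\<close>

definition SA :: "complex set" where
  "SA = {z \<in> Cplus. (Re z < 2 * lam \<and> phL z < 0) \<or> (2 * lam \<le> Re z \<and> Im z < ic \<and> phR z < 0)}"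
definition SB :: "complex set" where
  "SB = {z \<in> Cplus. (Re z < 2 * lam \<and> phL z > 0) \<or> (2 * lam \<le> Re z \<and> Im z > ic \<and> phR z < 0)}"
definition SC :: "complex set" where
  "SC = {z \<in> Cplus. 2 * lam \<le> Re z \<and> phR z > 0}"
definition G2 :: "complex set" where
  "G2 = insert (zplus lam) {z \<in> Cplus. Re z < 2 * lam \<and> phL z = 0}"
definition G3 :: "complex set" where
  "G3 = insert (zplus lam) {z \<in> Cplus. 2 * lam \<le> Re z \<and> Im z < ic \<and> phR z = 0}"

lemma Cplus_iff: "z \<in> Cplus \<longleftrightarrow> z \<noteq> 0 \<and> Im z \<ge> 0" by (simp add: Cplus_def)

lemma zplus_Cplus: "zplus lam \<in> Cplus" using zplus ic(1) by (auto simp: Cplus_iff complex_eq_iff)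

lemma norm_zplus: "cmod (zplus lam) = 2"
proof -
  have "(cmod (zplus lam))\<^sup>2 = 2\<^sup>2" unfolding cmod_power2 zplus ic(2) by (simp add: power_mult_distrib)
  then show ?thesis by (rule power2_eq_imp_eq) simp_all
qed

text \<open>By \<open>re_xi_minus\<close> the values at the two roots lie symmetrically about
  \<open>level0\<close>, so both are on the level or neither is, and the root of the respective side
  can be used for the test.\<close>

lemma level_set_eq: "level_set lam = {z \<in> Cplus. (Re z < 2 * lam \<and> phL z = 0) \<or> (2 * lam \<le> Re z \<and> phR z = 0)}"
proof -
  have *: "(\<exists>\<zeta>. \<zeta> ^ 2 = Zsq lam z \<and> re_xi lam \<zeta> z = level0) \<longleftrightarrow> re_xi lam w z = level0"
    if "z \<noteq> 0" "w ^ 2 = Zsq lam z" for z w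
  proof
    assume "\<exists>\<zeta>. \<zeta> ^ 2 = Zsq lam z \<and> re_xi lam \<zeta> z = level0"
    then obtain \<zeta> where \<zeta>: "\<zeta> ^ 2 = Zsq lam z" "re_xi lam \<zeta> z = level0" by blast
    have "\<zeta> = w \<or> \<zeta> = - w" using \<zeta>(1) that(2) by (metis power2_eq_iff)
    then show "re_xi lam w z = level0" using \<zeta>(2) re_xi_minus[OF that] by auto
  qed (use that in blast)
  have "(\<exists>\<zeta>. \<zeta> ^ 2 = Zsq lam z \<and> re_xi lam \<zeta> z = level0) \<longleftrightarrow>
      (Re z < 2 * lam \<and> phL z = 0) \<or> (2 * lam \<le> Re z \<and> phR z = 0)" if "z \<noteq> 0" for z
    using *[OF that ZR_ZL_power2(1)] *[OF that ZR_ZL_power2(2)] unfolding phL_def phR_def by force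
  then show ?thesis unfolding level_set_def level0_def[symmetric] by (auto simp: Cplus_iff)
qed

lemma phR_at_ic: "Re z \<ge> 2 * lam \<Longrightarrow> Im z = ic \<Longrightarrow> z \<noteq> zplus lam \<Longrightarrow> phR z > 0"
proof -
  assume z: "Re z \<ge> 2 * lam" "Im z = ic" "z \<noteq> zplus lam"
  then have "2 * lam < Re z" using zplus by (auto simp: complex_eq_iff)
  then have "phR (Complex (2 * lam) ic) < phR (Complex (Re z) ic)"
    using ic(1) by (intro phR_horizontal) auto
  moreover have "Complex (2 * lam) ic = zplus lam" "Complex (Re z) ic = z" using zplus z by (auto simp: complex_eq_iff)
  ultimately show ?thesis using phR_zplus by simp
qed

lemma line_cases:
  assumes "z \<in> Cplus" "Re z = 2 * lam"
  shows "Im z < ic \<Longrightarrow> phR z < 0" "Im z > ic \<Longrightarrow> phR z \<le> 0" "phR z \<le> 0"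
proof -
  have z: "Complex (2 * lam) (Im z) = z" using assms by (simp add: complex_eq_iff)
  show 1: "phR z < 0" if "Im z < ic"
    using phR_vertical_below[of "Im z"] that assms lam0 unfolding z by (auto simp: Cplus_iff complex_eq_iff)
  show 2: "phR z \<le> 0" if "Im z > ic"
    using phR_vertical_above(1)[OF that] unfolding z .
  show "phR z \<le> 0"
  proof (cases "Im z = ic")
    case True
    then have "z = zplus lam" using assms zplus by (simp add: complex_eq_iff)
    then show ?thesis using phR_zplus by simp
  qed (use 1 2 in linarith)
qed

lemma SABC_cover: "Cplus - level_set lam = SA \<union> SB \<union> SC"
proof -
  have "phR z \<ge> 0" if "z \<in> Cplus" "2 * lam \<le> Re z" "Im z = ic" for z
    using phR_at_ic[OF that(2,3)] phR_zplus by (cases "z = zplus lam") auto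
  note ge = this
  show ?thesis
  proof (intro set_eqI)
    fix z
    show "z \<in> Cplus - level_set lam \<longleftrightarrow> z \<in> SA \<union> SB \<union> SC"
      unfolding level_set_eq SA_def SB_def SC_def
      by (cases "Re z < 2 * lam"; cases "Im z < ic"; cases "Im z = ic"; use ge[of z] in auto)
  qed
qed

lemma SABC_disjoint: "SA \<inter> SB = {}" "SA \<inter> SC = {}" "SB \<inter> SC = {}"
  by (auto simp: SA_def SB_def SC_def)

lemma openin_Cplus: "open T \<Longrightarrow> openin (top_of_set Cplus) {z \<in> Cplus. z \<in> T}"
  by (auto simp: openin_open)

lemma halves:
  "openin (top_of_set Cplus) {z \<in> Cplus. Re z < 2 * lam}"
  "openin (top_of_set Cplus) {z \<in> Cplus. Re z > 2 * lam}"
  "openin (top_of_set Cplus) {z \<in> Cplus. Re z < 2 * lam \<or> Im z < ic}"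
  "openin (top_of_set Cplus) {z \<in> Cplus. Im z > ic}"
  using openin_Cplus[OF open_halfspace_Re_lt[of "2 * lam"]] openin_Cplus[OF open_halfspace_Re_gt[of "2 * lam"]]
    openin_Cplus[OF open_Un[OF open_halfspace_Re_lt[of "2 * lam"] open_halfspace_Im_lt[of ic]]]
    openin_Cplus[OF open_halfspace_Im_gt[of ic]] by simp_all

text \<open>Continuous across the vertical line: below the turning point \<open>phL\<close> and
  \<open>phR\<close> agree on it, above they are opposite. Both functions serve to show that the
  regions are relatively open.\<close>

definition phM :: "complex \<Rightarrow> real" where "phM z = (if Re z \<le> 2 * lam then phL z else phR z)"
definition phN :: "complex \<Rightarrow> real" where "phN z = (if Re z \<le> 2 * lam then - phL z else phR z)"

lemma continuous_on_phM: "continuous_on {z \<in> Cplus. Re z < 2 * lam \<or> Im z < ic} phM"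
  unfolding phM_def
  by (rule continuous_on_cases_le)
     (auto intro!: continuous_on_subset[OF continuous_on_phL] continuous_on_subset[OF continuous_on_phR] continuous_intros
        phL_line simp: Cplus_iff)

lemma continuous_on_phN: "continuous_on {z \<in> Cplus. Im z > ic} phN"
proof -
  have "phL z = - phR z" if "z \<in> Cplus" "Im z > ic" "Re z = 2 * lam" for z
    using that by (intro phL_line) (auto simp: Cplus_iff)
  then show ?thesis unfolding phN_def
    by (intro continuous_on_cases_le continuous_on_minus continuous_on_subset[OF continuous_on_phL]
         continuous_on_subset[OF continuous_on_phR] continuous_intros) (auto simp: Cplus_iff)
qed

lemma openin_SA: "openin (top_of_set Cplus) SA"
proof -
  have "SA = {z \<in> {z \<in> Cplus. Re z < 2 * lam \<or> Im z < ic}. phM z < 0}"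
    unfolding SA_def phM_def by (auto simp: Cplus_iff phL_line)
  then show ?thesis using openin_sublevel(1)[OF halves(3) continuous_on_phM] by simp
qed

lemma openin_SB: "openin (top_of_set Cplus) SB"
proof -
  have line: "phL z = - phR z" if "z \<in> Cplus" "Im z > ic" "Re z = 2 * lam" for z
    using that by (intro phL_line) (auto simp: Cplus_iff)
  have "SB = {z \<in> {z \<in> Cplus. Re z < 2 * lam}. phL z > 0} \<union> {z \<in> {z \<in> Cplus. Im z > ic}. phN z < 0}"
  proof (intro set_eqI)
    fix z
    show "z \<in> SB \<longleftrightarrow> z \<in> {z \<in> {z \<in> Cplus. Re z < 2 * lam}. phL z > 0} \<union> {z \<in> {z \<in> Cplus. Im z > ic}. phN z < 0}"
      unfolding SB_def phN_def
      by (cases "Re z < 2 * lam"; cases "Re z = 2 * lam"; use line[of z] in auto)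
  qed
  moreover have "continuous_on {z \<in> Cplus. Re z < 2 * lam} phL"
    by (rule continuous_on_subset[OF continuous_on_phL]) (auto simp: Cplus_iff)
  ultimately show ?thesis
    using openin_sublevel(2)[OF halves(1), of phL 0] openin_sublevel(1)[OF halves(4) continuous_on_phN, of 0]
    by (simp add: openin_Un)
qed

lemma openin_SC: "openin (top_of_set Cplus) SC"
proof -
  have "SC = {z \<in> {z \<in> Cplus. Re z > 2 * lam}. phR z > 0}"
    unfolding SC_def using line_cases(3) by force
  moreover have "continuous_on {z \<in> Cplus. Re z > 2 * lam} phR"
    by (rule continuous_on_subset[OF continuous_on_phR]) (auto simp: Cplus_iff)
  ultimately show ?thesis using openin_sublevel(2)[OF halves(2), of phR 0] by simp
qed

section \<open>Connectedness of the three regions\<close>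

text \<open>The phase decreases along rays towards 0. A ray starting on the right may cross the
  vertical line; its imaginary part only shrinks, so it does this below the turning point, where the
  phases of the two sides agree.\<close>

lemma SA_radial:
  assumes z: "z \<in> SA" and t: "0 < t" "t < 1"
  shows "of_real t * z \<in> SA"
proof -
  have zC: "z \<noteq> 0" "Im z \<ge> 0" using z by (auto simp: SA_def Cplus_iff)
  have tC: "of_real t * z \<in> Cplus" using zC t by (simp add: Cplus_iff)
  show ?thesis
  proof (cases "Re z < 2 * lam")
    case True
    then have "phL z < 0" using z by (auto simp: SA_def)
    have le: "s * Re z < 2 * lam" if "0 < s" "s \<le> 1" for s
    proof (cases "Re z \<le> 0")
      case True
      show ?thesis
      proof (cases "Re z = 0")
        case True then show ?thesis using \<open>Re z < 2 * lam\<close> by simp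
      next
        case False
        then have "s * Re z < 0" using \<open>Re z \<le> 0\<close> that by (simp add: mult_pos_neg)
        then show ?thesis using lam0 by linarith
      qed
    next
      case False
      then have "s * Re z \<le> 1 * Re z" using that by (intro mult_right_mono) auto
      then show ?thesis using True by simp
    qed
    have "phL (of_real t * z) < phL (of_real 1 * z)"
      by (rule phL_radial) (use t zC le in \<open>auto intro: less_imp_le\<close>)
    then show ?thesis using \<open>phL z < 0\<close> le[of t] t tC by (simp add: SA_def)
  next
    case False
    then have h: "2 * lam \<le> Re z" "Im z < ic" "phR z < 0" using z by (auto simp: SA_def)
    have im: "s * Im z < ic" if "0 < s" "s \<le> 1" for s
      using that zC h mult_right_mono[of s 1 "Im z"] by simp
    show ?thesis
    proof (cases "2 * lam \<le> t * Re z")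
      case True
      have "Re z \<ge> 0" using h lam0 by linarith
      then have "s * Re z \<ge> 2 * lam" if "t \<le> s" for s using True mult_right_mono[OF that, of "Re z"] by linarith
      then have "phR (of_real t * z) < phR (of_real 1 * z)"
        by (intro phR_radial) (use t zC im in auto)
      then show ?thesis using h im[of t] t tC True by (simp add: SA_def)
    next
      case False
      have pos: "lam > 0" "Re z > 0"
      proof -
        have "Re z \<ge> 0" using h lam0 by linarith
        then have "t * Re z \<ge> 0" using t by simp
        then show "lam > 0" using False by linarith
        then show "Re z > 0" using h by linarith
      qed
      define s where "s = 2 * lam / Re z"
      have s: "t < s" "s \<le> 1" "s * Re z = 2 * lam" using False h pos by (auto simp: s_def field_simps)
      have sz: "of_real s * z \<noteq> 0" "Im (of_real s * z) < ic" "Re (of_real s * z) = 2 * lam" "of_real s * z \<in> Cplus"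
        using s t zC im[of s] by (auto simp: Cplus_iff)
      have "phR (of_real s * z) < 0" by (rule line_cases(1)[OF sz(4,3,2)])
      then have "phL (of_real s * z) < 0" using phL_line(1)[OF sz(3) _ sz(1)] sz s t zC by simp
      moreover have "phL (of_real t * z) < phL (of_real s * z)"
      proof (rule phL_radial)
        show "u * Re z \<le> 2 * lam" if "u \<le> s" for u using mult_right_mono[OF that, of "Re z"] pos s by simp
        show "u * Re z < 2 * lam" if "u < s" for u using mult_strict_right_mono[OF that, of "Re z"] pos s by simp
      qed (use s t zC in auto)
      ultimately show ?thesis using tC False by (simp add: SA_def)
    qed
  qed
qed

lemma half_disc_subset_SA: obtains \<epsilon> where "\<epsilon> > 0" "\<And>z. z \<in> Cplus \<Longrightarrow> cmod z < \<epsilon> \<Longrightarrow> z \<in> SA"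
proof -
  obtain \<epsilon> where \<epsilon>: "\<epsilon> > 0" "\<And>z. z \<noteq> 0 \<Longrightarrow> cmod z < \<epsilon> \<Longrightarrow> Im z \<ge> 0 \<Longrightarrow>
     (Re z \<ge> 2 * lam \<longrightarrow> phR z < 0) \<and> (Re z \<le> 2 * lam \<longrightarrow> phL z < 0)"
    using ph_neg_near_0 by blast
  have "z \<in> SA" if "z \<in> Cplus" "cmod z < min \<epsilon> ic" for z
    using \<epsilon>(2)[of z] that abs_Im_le_cmod[of z] by (force simp: SA_def Cplus_iff)
  then show ?thesis using that[of "min \<epsilon> ic"] \<epsilon>(1) ic(1) by simp
qed

text \<open>Rays lead into a small half disc about 0 that belongs to the region; within it an arc
  and a real segment lead to a common point.\<close>

lemma connected_SA: "connected SA"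
proof -
  obtain \<epsilon> where \<epsilon>: "\<epsilon> > 0" "\<And>z. z \<in> Cplus \<Longrightarrow> cmod z < \<epsilon> \<Longrightarrow> z \<in> SA"
    using half_disc_subset_SA by blast
  have base: "connected_component SA z (of_real (\<epsilon> / 2))" if z: "z \<in> SA" for z
  proof -
    have zC: "z \<in> Cplus" using z by (simp add: SA_def)
    note pol = Cplus_polar[OF zC]
    define t where "t = min (1/2) (\<epsilon> / (2 * cmod z))"
    have t: "0 < t" "t < 1" "t * cmod z < \<epsilon>"
      using \<epsilon>(1) pol(4) by (auto simp: t_def min_mult_distrib_right min_less_iff_disj)
    define r where "r = t * cmod z"
    have r: "0 < r" "r < \<epsilon>" using t pol by (simp_all add: r_def)
    have "connected_component SA (of_real 1 * z) (of_real t * z)"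
    proof (rule connected_component_image[where I = "{t..1}"])
      show "(\<lambda>s. complex_of_real s * z) ` {t..1} \<subseteq> SA"
      proof clarify
        fix s assume "s \<in> {t..1}"
        then show "of_real s * z \<in> SA" using SA_radial[OF z, of s] z t by (cases "s = 1") auto
      qed
    qed (use t in \<open>auto intro!: continuous_intros\<close>)
    moreover have "of_real t * z = of_real r * cis (Arg z)" by (subst pol(1)) (simp add: r_def)
    moreover have "connected_component SA (of_real r * cis (Arg z)) (of_real r * cis 0)"
    proof (rule connected_component_image[where I = "{0..pi}"])
      show "(\<lambda>s. complex_of_real r * cis s) ` {0..pi} \<subseteq> SA"
      proof clarify
        fix s assume "s \<in> {0..pi}"
        then show "of_real r * cis s \<in> SA" using r by (intro \<epsilon>(2) cis_in_Cplus) (auto simp: norm_mult)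
      qed
    qed (use pol in \<open>auto intro!: continuous_intros\<close>)
    moreover have "connected_component SA (of_real r) (of_real (\<epsilon> / 2))"
    proof (rule connected_component_image[where I = "{0<..<\<epsilon>}"])
      show "complex_of_real ` {0<..<\<epsilon>} \<subseteq> SA"
        by (auto intro!: \<epsilon>(2) simp: Cplus_iff)
    qed (use r \<epsilon>(1) in \<open>auto intro!: continuous_intros\<close>)
    ultimately show ?thesis by (auto intro: connected_component_trans)
  qed
  show ?thesis
    unfolding connected_iff_connected_component
    using base connected_component_trans connected_component_sym by metis
qed

text \<open>Rotation towards the negative axis and motion outwards along it both increase
  \<open>phL\<close>, so the region is never left.\<close>

lemma SB_left_arc:
  assumes z: "z \<in> Cplus" "z \<in> SB" "Re z \<le> 2 * lam" "phL z > 0"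
  shows "\<And>\<theta>. Arg z \<le> \<theta> \<Longrightarrow> \<theta> \<le> pi \<Longrightarrow> of_real (cmod z) * cis \<theta> \<in> SB"
    and "\<And>x. cmod z \<le> x \<Longrightarrow> connected_component SB z (- of_real x)"
proof -
  note pol = Cplus_polar[OF z(1)]
  have cosz: "cmod z * cos (Arg z) \<le> 2 * lam"
    using z(3) arg_cong[OF pol(1), of Re] by simp
  have more: "of_real (cmod z) * cis \<theta> \<in> SB \<and> phL (of_real (cmod z) * cis \<theta>) > 0 " if "Arg z < \<theta>" "\<theta> \<le> pi" for \<theta>
  proof -
    have "cos \<theta> < cos (Arg z)" using that pol by (intro cos_monotone_0_pi) auto
    then have "cmod z * cos \<theta> < cmod z * cos (Arg z)" using pol by simp
    then have "cmod z * cos \<theta> < 2 * lam" using cosz by linarith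
    moreover have "phL (of_real (cmod z) * cis (Arg z)) < phL (of_real (cmod z) * cis \<theta>)"
      by (rule phL_rotate) (use pol that cosz in auto)
    then have "phL (of_real (cmod z) * cis \<theta>) > 0" using z(4) by (simp flip: pol(1))
    ultimately show ?thesis
      using pol that cis_in_Cplus[of "cmod z" \<theta>] by (simp add: SB_def)
  qed
  show arc: "of_real (cmod z) * cis \<theta> \<in> SB" if "Arg z \<le> \<theta>" "\<theta> \<le> pi" for \<theta>
    using more[of \<theta>] that z pol(1) by (cases "\<theta> = Arg z") auto
  have "connected_component SB (of_real (cmod z) * cis (Arg z)) (of_real (cmod z) * cis pi)"
    by (rule connected_component_image[where I = "{Arg z..pi}"])
       (use arc pol in \<open>auto intro!: continuous_intros\<close>)
  then have 1: "connected_component SB z (- of_real (cmod z))" by (simp flip: pol(1))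
  have neg: "- x < 2 * lam \<and> - x \<le> 2 * lam" if "cmod z \<le> x" for x using pol(4) lam0 that by linarith
  have r: "phL (- of_real (cmod z)) > 0 \<and> Re (- complex_of_real (cmod z)) < 2 * lam"
  proof (cases "Arg z = pi")
    case True
    then have "z = - of_real (cmod z)" using pol(1) by simp
    then have "phL (- of_real (cmod z)) > 0" using z(4) by simp
    then show ?thesis using neg[of "cmod z"] by simp
  next
    case False
    then show ?thesis using more[of pi] pol neg[of "cmod z"] by simp
  qed
  show "connected_component SB z (- of_real x)" if x: "cmod z \<le> x" for x
  proof -
    have "connected_component SB (- of_real (cmod z)) (- of_real x)"
    proof (rule connected_component_image[where I = "{cmod z..x}" and f = "\<lambda>s. - of_real s"])
      show "(\<lambda>s. - complex_of_real s) ` {cmod z..x} \<subseteq> SB"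
      proof clarify
        fix s assume s: "s \<in> {cmod z..x}"
        have "phL (- of_real s) > 0"
        proof (cases "s = cmod z")
          case False
          have "phL (of_real (cmod z) * (- 1)) < phL (of_real s * (- 1))"
            by (rule phL_radial) (use False s pol neg in auto)
          then show ?thesis using r by simp
        qed (use r in simp)
        then show "- of_real s \<in> SB" using s pol neg[of s] by (auto simp: SB_def Cplus_iff)
      qed
    qed (use x in \<open>auto intro!: continuous_intros\<close>)
    then show ?thesis using 1 connected_component_trans by metis
  qed
qed

text \<open>A point on the right side first moves horizontally to the vertical line:
  \<open>phR\<close> decreases on the way, and above the turning point it equals
  \<open>- phL\<close> on the line, so that \<open>SB_left_arc\<close> takes over.\<close>

lemma SB_to_neg:
  assumes z: "z \<in> SB"
  obtains R where "\<And>x. R \<le> x \<Longrightarrow> connected_component SB z (- of_real x)"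
proof (cases "Re z < 2 * lam")
  case True
  then show ?thesis using z that SB_left_arc(2)[of z] by (auto simp: SB_def)
next
  case False
  then have h: "z \<in> Cplus" "2 * lam \<le> Re z" "Im z > ic" "phR z < 0" using z by (auto simp: SB_def)
  define P where "P = Complex (2 * lam) (Im z)"
  have seg: "Complex x (Im z) \<in> SB \<and> phR (Complex x (Im z)) < 0" if "2 * lam \<le> x" "x \<le> Re z" for x
  proof (cases "x = Re z")
    case False
    then have "phR (Complex x (Im z)) < phR (Complex (Re z) (Im z))"
      using that h ic(1) by (intro phR_horizontal) auto
    then show ?thesis using h that ic(1) by (auto simp: SB_def Cplus_iff complex_eq_iff)
  qed (use z h in simp)
  have P: "P \<in> SB" "phR P < 0" "Re P = 2 * lam" "Im P = Im z" "P \<in> Cplus"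
    using seg[of "2 * lam"] h by (auto simp: P_def SB_def)
  have "phL P = - phR P" using P h ic(1) by (intro phL_line) (auto simp: Cplus_iff)
  then have "phL P > 0" using P by simp
  then have 1: "connected_component SB P (- of_real x)" if "cmod P \<le> x" for x
    using SB_left_arc(2)[OF P(5,1)] P that by simp
  have "connected_component SB (Complex (Re z) (Im z)) (Complex (2 * lam) (Im z))"
  proof (rule connected_component_image[where I = "{2 * lam..Re z}" and f = "\<lambda>x. Complex x (Im z)"])
    show "(\<lambda>x. Complex x (Im z)) ` {2 * lam..Re z} \<subseteq> SB" using seg by auto
  qed (use h in \<open>auto simp: Complex_eq intro!: continuous_intros\<close>)
  then have "connected_component SB z P" by (simp add: P_def)
  then show ?thesis using 1 that connected_component_trans by metis
qed

text \<open>Rotation towards the positive axis and motion outwards along it both increase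
  \<open>phR\<close>; the angle is at most \<open>\<pi> / 2\<close> since
  \<open>Re z > 2 lam \<ge> 0\<close>.\<close>

lemma SC_to_pos:
  assumes z: "z \<in> SC"
  shows "\<And>x. cmod z \<le> x \<Longrightarrow> connected_component SC z (of_real x)"
proof -
  have h: "z \<in> Cplus" "2 * lam < Re z" "phR z > 0"
    using z line_cases(3)[of z] by (force simp: SC_def)+
  note pol = Cplus_polar[OF h(1)]
  have cosz: "cmod z * cos (Arg z) > 2 * lam"
    using h(2) arg_cong[OF pol(1), of Re] by simp
  have ang: "Arg z \<le> pi / 2"
  proof (rule ccontr)
    assume "\<not> ?thesis"
    then have "cos (Arg z) < cos (pi / 2)" using pol by (intro cos_monotone_0_pi) auto
    then have "cmod z * cos (Arg z) < 0" using pol by (simp add: mult_pos_neg)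
    then show False using cosz lam0 by linarith
  qed
  have more: "of_real (cmod z) * cis \<theta> \<in> SC \<and> phR (of_real (cmod z) * cis \<theta>) > 0" if "0 \<le> \<theta>" "\<theta> < Arg z" for \<theta>
  proof -
    have "cos (Arg z) < cos \<theta>" using that pol by (intro cos_monotone_0_pi) auto
    then have "cmod z * cos (Arg z) < cmod z * cos \<theta>" using pol by simp
    then have "cmod z * cos \<theta> > 2 * lam" using cosz by linarith
    moreover have "phR (of_real (cmod z) * cis (Arg z)) < phR (of_real (cmod z) * cis \<theta>)"
      by (rule phR_rotate) (use pol that cosz ang in auto)
    then have "phR (of_real (cmod z) * cis \<theta>) > 0" using h(3) by (simp flip: pol(1))
    ultimately show ?thesis
      using pol that cis_in_Cplus[of "cmod z" \<theta>] by (simp add: SC_def)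
  qed
  have arc: "of_real (cmod z) * cis \<theta> \<in> SC \<and> phR (of_real (cmod z) * cis \<theta>) > 0" if "0 \<le> \<theta>" "\<theta> \<le> Arg z" for \<theta>
    using more[of \<theta>] that z h by (cases "\<theta> = Arg z") (auto simp flip: pol(1))
  have "connected_component SC (of_real (cmod z) * cis (Arg z)) (of_real (cmod z) * cis 0)"
    by (rule connected_component_image[where I = "{0..Arg z}"])
       (use arc pol in \<open>auto intro!: continuous_intros\<close>)
  then have 1: "connected_component SC z (of_real (cmod z))" by (simp flip: pol(1))
  have r: "phR (of_real (cmod z)) > 0" "cmod z \<ge> 2 * lam" using arc[of 0] pol by (auto simp: SC_def)
  show "connected_component SC z (of_real x)" if x: "cmod z \<le> x" for x
  proof -
    have "connected_component SC (of_real (cmod z)) (of_real x)"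
    proof (rule connected_component_image[where I = "{cmod z..x}" and f = "of_real"])
      show "complex_of_real ` {cmod z..x} \<subseteq> SC"
      proof clarify
        fix s assume s: "s \<in> {cmod z..x}"
        have "phR (of_real s) > 0"
        proof (cases "s = cmod z")
          case False
          have "phR (Complex (cmod z) 0) < phR (Complex s 0)"
            by (rule phR_horizontal) (use False s pol r in auto)
          then show ?thesis using r by (simp add: complex_of_real_def)
        qed (use r in simp)
        then show "of_real s \<in> SC" using s pol r by (auto simp: SC_def Cplus_iff)
      qed
    qed (use x in \<open>auto intro!: continuous_intros\<close>)
    then show ?thesis using 1 connected_component_trans by metis
  qed
qed

lemma connected_SB: "connected SB"
  unfolding connected_iff_connected_component
proof (intro ballI)
  fix a b assume "a \<in> SB" "b \<in> SB"
  then obtain R R' where "\<And>x. R \<le> x \<Longrightarrow> connected_component SB a (- of_real x)"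
    "\<And>x. R' \<le> x \<Longrightarrow> connected_component SB b (- of_real x)" using SB_to_neg by metis
  then have "connected_component SB a (- of_real (max R R'))" "connected_component SB b (- of_real (max R R'))" by auto
  then show "connected_component SB a b" using connected_component_trans connected_component_sym by metis
qed

lemma connected_SC: "connected SC"
  unfolding connected_iff_connected_component
proof (intro ballI)
  fix a b assume "a \<in> SC" "b \<in> SC"
  then have "connected_component SC a (of_real (max (cmod a) (cmod b)))"
    "connected_component SC b (of_real (max (cmod a) (cmod b)))" using SC_to_pos by auto
  then show "connected_component SC a b" using connected_component_trans connected_component_sym by metis
qed

lemma far_points:
  obtains X where "X > 2" "\<And>z. z \<in> Cplus \<Longrightarrow> cmod z \<ge> X \<Longrightarrow> Im z \<le> ic \<Longrightarrow> Re z \<ge> 2 * lam \<Longrightarrow> z \<in> SC"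
    "\<And>z. z \<in> Cplus \<Longrightarrow> cmod z > 2 \<Longrightarrow> Re z < 2 * lam \<Longrightarrow> z \<in> SB"
proof -
  obtain X where X: "\<And>z. Re z \<ge> X \<Longrightarrow> 0 \<le> Im z \<Longrightarrow> Im z \<le> ic \<Longrightarrow> phR z > 0" using phR_pos_far by blast
  have "z \<in> SC" if "z \<in> Cplus" "cmod z \<ge> max 3 (X + ic)" "Im z \<le> ic" "Re z \<ge> 2 * lam" for z
  proof -
    have "cmod z \<le> Re z + Im z" using cmod_le[of z] that lam0 by (simp add: Cplus_iff)
    then have "Re z \<ge> X" using that by simp
    then show ?thesis using X that by (simp add: SC_def Cplus_iff)
  qed
  moreover have "z \<in> SB" if "z \<in> Cplus" "cmod z > 2" "Re z < 2 * lam" for z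
    using phL_pos_far[of z] that by (simp add: SB_def Cplus_iff)
  ultimately show ?thesis using that[of "max 3 (X + ic)"] by auto
qed

lemma bounded_SA: "bounded SA"
proof -
  obtain X where X: "X > 2" "\<And>z. z \<in> Cplus \<Longrightarrow> cmod z \<ge> X \<Longrightarrow> Im z \<le> ic \<Longrightarrow> Re z \<ge> 2 * lam \<Longrightarrow> z \<in> SC"
    "\<And>z. z \<in> Cplus \<Longrightarrow> cmod z > 2 \<Longrightarrow> Re z < 2 * lam \<Longrightarrow> z \<in> SB" using far_points by blast
  have "cmod z \<le> X" if z: "z \<in> SA" for z
  proof (rule ccontr)
    assume "\<not> ?thesis"
    then have "z \<in> SB \<union> SC" using X z by (force simp: SA_def)
    then show False using SABC_disjoint z by blast
  qed
  then show ?thesis by (auto simp: bounded_iff)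
qed

lemma openin_U:
  "openin (top_of_set (SA \<union> SB \<union> SC)) SA" "openin (top_of_set (SA \<union> SB \<union> SC)) SB" "openin (top_of_set (SA \<union> SB \<union> SC)) SC"
proof -
  have "SA \<union> SB \<union> SC \<subseteq> Cplus" by (auto simp: SA_def SB_def SC_def)
  then show "openin (top_of_set (SA \<union> SB \<union> SC)) SA" "openin (top_of_set (SA \<union> SB \<union> SC)) SB" "openin (top_of_set (SA \<union> SB \<union> SC)) SC"
    using openin_SA openin_SB openin_SC by (auto intro: openin_subset_trans)
qed

lemma components:
  "z \<in> SA \<Longrightarrow> connected_component_set (Cplus - level_set lam) z = SA"
  "z \<in> SB \<Longrightarrow> connected_component_set (Cplus - level_set lam) z = SB"
  "z \<in> SC \<Longrightarrow> connected_component_set (Cplus - level_set lam) z = SC"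
proof -
  have d: "(SA \<union> SB \<union> SC) - SA = SB \<union> SC" "(SA \<union> SB \<union> SC) - SB = SA \<union> SC" "(SA \<union> SB \<union> SC) - SC = SA \<union> SB"
    using SABC_disjoint by blast+
  show "z \<in> SA \<Longrightarrow> connected_component_set (Cplus - level_set lam) z = SA"
    unfolding SABC_cover by (rule connected_component_clopen[OF connected_SA]) (use openin_U in \<open>auto simp: d intro: openin_Un\<close>)
  show "z \<in> SB \<Longrightarrow> connected_component_set (Cplus - level_set lam) z = SB"
    unfolding SABC_cover by (rule connected_component_clopen[OF connected_SB]) (use openin_U in \<open>auto simp: d intro: openin_Un\<close>)
  show "z \<in> SC \<Longrightarrow> connected_component_set (Cplus - level_set lam) z = SC"
    unfolding SABC_cover by (rule connected_component_clopen[OF connected_SC]) (use openin_U in \<open>auto simp: d intro: openin_Un\<close>)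
qed

lemma far_real: obtains X where "X > 2" "\<And>x. x \<ge> X \<Longrightarrow> complex_of_real x \<in> SC" "\<And>x. x \<ge> X \<Longrightarrow> - complex_of_real x \<in> SB"
proof -
  obtain X where X: "X > 2" "\<And>z. z \<in> Cplus \<Longrightarrow> cmod z \<ge> X \<Longrightarrow> Im z \<le> ic \<Longrightarrow> Re z \<ge> 2 * lam \<Longrightarrow> z \<in> SC"
    "\<And>z. z \<in> Cplus \<Longrightarrow> cmod z > 2 \<Longrightarrow> Re z < 2 * lam \<Longrightarrow> z \<in> SB" using far_points by blast
  have "complex_of_real x \<in> SC" "- complex_of_real x \<in> SB" if "x \<ge> X" for x
    using that X(1) lam0 lam1 ic(1) by (auto intro!: X(2,3) simp: Cplus_iff)
  then show ?thesis using that X(1) by blast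
qed

text \<open>The other two components contain real points of arbitrarily large modulus, so only
  \<open>SA\<close> is bounded.\<close>

lemma Sm1_eq: "Sm1 lam = SA"
proof -
  have "0 \<in> closure SA"
    unfolding closure_approachable
  proof (intro allI impI)
    fix e :: real assume "e > 0"
    obtain \<epsilon> where \<epsilon>: "\<epsilon> > 0" "\<And>z. z \<in> Cplus \<Longrightarrow> cmod z < \<epsilon> \<Longrightarrow> z \<in> SA" using half_disc_subset_SA by blast
    show "\<exists>y\<in>SA. dist y 0 < e"
      by (rule bexI[of _ "of_real (min e \<epsilon> / 2)"]) (use \<epsilon> \<open>e > 0\<close> in \<open>auto intro!: \<epsilon>(2) simp: Cplus_iff\<close>)
  qed
  moreover obtain X where X: "X > 2" "\<And>x. x \<ge> X \<Longrightarrow> complex_of_real x \<in> SC" "\<And>x. x \<ge> X \<Longrightarrow> - complex_of_real x \<in> SB"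
    using far_real by blast
  have "\<not> bounded SB" "\<not> bounded SC"
  proof -
    have "\<exists>w\<in>SB. cmod w > b" for b
      by (rule bexI[OF _ X(3)[of "max X (\<bar>b\<bar> + 1)"]]) auto
    moreover have "\<exists>w\<in>SC. cmod w > b" for b
      by (rule bexI[OF _ X(2)[of "max X (\<bar>b\<bar> + 1)"]]) auto
    ultimately show "\<not> bounded SB" "\<not> bounded SC" unfolding bounded_iff by (meson not_less)+
  qed
  ultimately show ?thesis
    unfolding Sm1_def SABC_cover using components[unfolded SABC_cover] bounded_SA by auto
qed

lemma S0_S1_eq: "S0 lam = SC" "S1 lam = SB"
proof -
  obtain X where X: "X > 2" "\<And>x. x \<ge> X \<Longrightarrow> complex_of_real x \<in> SC" "\<And>x. x \<ge> X \<Longrightarrow> - complex_of_real x \<in> SB"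
    using far_real by blast
  have U: "z \<in> SA \<union> SB \<union> SC" if "connected_component (Cplus - level_set lam) z w" for z w
    using that connected_component_in unfolding SABC_cover by blast
  have comp: "connected_component (Cplus - level_set lam) z w \<longleftrightarrow> w \<in> S"
    if "z \<in> S" "S \<in> {SA, SB, SC}" for z w S
    using components[of z] that by auto
  show "S0 lam = SC"
  proof (intro set_eqI iffI)
    fix z assume "z \<in> S0 lam"
    then obtain R where R: "\<And>x. x \<ge> R \<Longrightarrow> connected_component (Cplus - level_set lam) z (of_real x)" by (auto simp: S0_def)
    have c: "connected_component (Cplus - level_set lam) z (of_real (max R X))" "complex_of_real (max R X) \<in> SC"
      using R X by auto
    show "z \<in> SC"
      using U[OF c(1)] comp[of z SA "of_real (max R X)"] comp[of z SB "of_real (max R X)"] c SABC_disjoint by auto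
  next
    fix z assume "z \<in> SC"
    then show "z \<in> S0 lam" unfolding S0_def using comp[of z SC] X by auto
  qed
  show "S1 lam = SB"
  proof (intro set_eqI iffI)
    fix z assume "z \<in> S1 lam"
    then obtain R where R: "\<And>x. x \<ge> R \<Longrightarrow> connected_component (Cplus - level_set lam) z (- of_real x)" by (auto simp: S1_def)
    have c: "connected_component (Cplus - level_set lam) z (- of_real (max R X))" "- complex_of_real (max R X) \<in> SB"
      using R X by auto
    show "z \<in> SB"
      using U[OF c(1)] comp[of z SA "- of_real (max R X)"] comp[of z SC "- of_real (max R X)"] c SABC_disjoint by auto
  next
    fix z assume "z \<in> SB"
    then show "z \<in> S1 lam" unfolding S1_def using comp[of z SB] X by auto
  qed
qed

section \<open>The curves separating the regions\<close>

lemma closure_openin_disjoint: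
  assumes "openin (top_of_set Cplus) V" "V \<inter> S = {}" "S \<subseteq> Cplus" "z \<in> V"
  shows "z \<notin> closure S"
proof -
  obtain T where T: "open T" "V = Cplus \<inter> T" using assms(1) by (auto simp: openin_open)
  then have "T \<inter> S = {}" using assms by blast
  then have "T \<inter> closure S = {}" using open_Int_closure_eq_empty[OF T(1)] by blast
  then show ?thesis using assms T by blast
qed

lemma SABC_sub: "SA \<subseteq> Cplus" "SB \<subseteq> Cplus" "SC \<subseteq> Cplus"
  by (auto simp: SA_def SB_def SC_def)

text \<open>Such a point has modulus above 2. The points with \<open>Im z > ic\<close> and modulus
  above 2 form a relatively open set that \<open>SA\<close> avoids, on the left side by
  \<open>phL_pos_far\<close>.\<close>

lemma beyond_ic:
  assumes "z \<in> Cplus" "2 * lam \<le> Re z" "Im z > ic"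
  shows "z \<notin> closure SA"
proof (rule closure_openin_disjoint)
  have "(2 * lam)\<^sup>2 + ic\<^sup>2 < (cmod z)\<^sup>2"
    unfolding cmod_power2 using assms lam0 ic(1) by (intro add_le_less_mono power_mono power_strict_mono) auto
  then have "2\<^sup>2 < (cmod z)\<^sup>2" unfolding ic(2) by (simp add: power_mult_distrib)
  then show "z \<in> {z \<in> Cplus. z \<in> {z. Im z > ic} \<inter> {z. cmod z > 2}}"
    using assms power_less_imp_less_base[of 2 2 "cmod z"] by auto
  show "openin (top_of_set Cplus) {z \<in> Cplus. z \<in> {z. Im z > ic} \<inter> {z. cmod z > 2}}"
    by (intro openin_Cplus open_Int open_halfspace_Im_gt open_Collect_less continuous_intros)
  show "{z \<in> Cplus. z \<in> {z. Im z > ic} \<inter> {z. cmod z > 2}} \<inter> SA = {}"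
    using phL_pos_far by (force simp: SA_def Cplus_iff)
qed (rule SABC_sub)

lemma left_not_SC: "z \<in> Cplus \<Longrightarrow> Re z < 2 * lam \<Longrightarrow> z \<notin> closure SC"
  by (rule closure_openin_disjoint[OF halves(1)]) (auto simp: SC_def Cplus_iff)

lemma right_not_SB:
  assumes "z \<in> Cplus" "2 * lam < Re z" "Im z < ic"
  shows "z \<notin> closure SB"
proof (rule closure_openin_disjoint)
  show "openin (top_of_set Cplus) {z \<in> Cplus. z \<in> {z. Re z > 2 * lam} \<inter> {z. Im z < ic}}"
    by (intro openin_Cplus open_Int open_halfspace_Im_lt open_halfspace_Re_gt)
qed (use assms in \<open>auto simp: SB_def Cplus_iff\<close>)

text \<open>Each region is relatively open and disjoint from the others, so its points lie in the
  closure of no other region.\<close>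

lemma closure_level:
  assumes "z \<in> Cplus" "z \<in> closure S" "z \<in> closure T" "S \<noteq> T" "S \<in> {SA, SB, SC}" "T \<in> {SA, SB, SC}"
  shows "z \<notin> SA \<union> SB \<union> SC"
proof -
  have d: "SB \<inter> SA = {}" "SC \<inter> SA = {}" "SC \<inter> SB = {}" using SABC_disjoint by blast+
  have "z \<notin> S'" if "S' \<in> {SA, SB, SC}" for S'
  proof
    assume z: "z \<in> S'"
    have "z \<notin> closure S''" if "S'' \<in> {SA, SB, SC}" "S'' \<noteq> S'" for S''
      by (rule closure_openin_disjoint[of S'])
         (use \<open>S' \<in> {SA, SB, SC}\<close> that z openin_SA openin_SB openin_SC SABC_disjoint d SABC_sub in auto)
    then show False using assms by metis
  qed
  then show ?thesis by blast
qed

lemma seq_closure: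
  fixes f :: "real \<Rightarrow> complex"
  assumes "isCont f a" "f a = z" "\<And>\<epsilon>. \<epsilon> > 0 \<Longrightarrow> \<exists>t. \<bar>t - a\<bar> < \<epsilon> \<and> f t \<in> S"
  shows "z \<in> closure S"
  unfolding closure_approachable
proof (intro allI impI)
  fix e :: real assume "e > 0"
  then obtain d where d: "d > 0" "\<And>t. \<bar>t - a\<bar> < d \<Longrightarrow> dist (f t) (f a) < e"
    using assms(1) unfolding continuous_at_eps_delta by (auto simp: dist_real_def)
  then show "\<exists>y\<in>S. dist y z < e" using assms(3)[OF d(1)] d(2) assms(2) by blast
qed

lemma isCont_Complex: "isCont (\<lambda>x. Complex x y) a" "isCont (\<lambda>x. Complex y x) a"
  unfolding Complex_eq by (intro continuous_intros)+

text \<open>The phase is strictly monotone along the ray through \<open>z\<close>: points slightly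
  closer to 0 lie in \<open>SA\<close>, points slightly further out in \<open>SB\<close>.\<close>

lemma left_level_closure:
  assumes z: "z \<in> Cplus" "Re z < 2 * lam" "phL z = 0"
  shows "z \<in> closure SA" "z \<in> closure SB"
proof -
  have "((\<lambda>t. t * Re z) \<longlongrightarrow> 1 * Re z) (at 1)" by (intro tendsto_intros)
  then have "eventually (\<lambda>t. t * Re z < 2 * lam) (at 1)"
    using z(2) by (intro order_tendstoD) auto
  then obtain d where d: "d > 0" "\<And>t. t \<noteq> 1 \<Longrightarrow> \<bar>t - 1\<bar> < d \<Longrightarrow> t * Re z < 2 * lam"
    unfolding eventually_at by (auto simp: dist_real_def)
  have d': "t * Re z < 2 * lam" if "\<bar>t - 1\<bar> < d" for t using d(2)[of t] that z(2) by (cases "t = 1") auto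
  have zC: "z \<noteq> 0" "Im z \<ge> 0" using z by (auto simp: Cplus_iff)
  show "z \<in> closure SA"
  proof (rule seq_closure[where f = "\<lambda>t. of_real t * z" and a = 1])
    fix \<epsilon> :: real assume "\<epsilon> > 0"
    define t where "t = 1 - min (1/2) (min \<epsilon> d) / 2"
    have t: "0 < t" "t < 1" "\<bar>t - 1\<bar> < \<epsilon>" "\<bar>t - 1\<bar> < d" using \<open>\<epsilon> > 0\<close> d(1) by (auto simp: t_def)
    have "phL (of_real t * z) < phL (of_real 1 * z)"
      by (rule phL_radial) (use t zC in \<open>auto intro!: d' less_imp_le[OF d']\<close>)
    then have "of_real t * z \<in> SA" using z zC t d'[of t] by (simp add: SA_def Cplus_iff)
    then show "\<exists>t. \<bar>t - 1\<bar> < \<epsilon> \<and> of_real t * z \<in> SA" using t by blast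
  qed (auto intro!: continuous_intros)
  show "z \<in> closure SB"
  proof (rule seq_closure[where f = "\<lambda>t. of_real t * z" and a = 1])
    fix \<epsilon> :: real assume "\<epsilon> > 0"
    define t where "t = 1 + min \<epsilon> d / 2"
    have t: "1 < t" "\<bar>t - 1\<bar> < \<epsilon>" "\<bar>t - 1\<bar> < d" using \<open>\<epsilon> > 0\<close> d(1) by (auto simp: t_def)
    have "phL (of_real 1 * z) < phL (of_real t * z)"
      by (rule phL_radial) (use t zC in \<open>auto intro!: d' less_imp_le[OF d']\<close>)
    then have "of_real t * z \<in> SB" using z zC t d'[of t] by (simp add: SB_def Cplus_iff)
    then show "\<exists>t. \<bar>t - 1\<bar> < \<epsilon> \<and> of_real t * z \<in> SB" using t by blast
  qed (auto intro!: continuous_intros)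
qed

text \<open>On this side horizontal motion is used: slightly to the right lies \<open>SC\<close>,
  and below the height of the turning point \<open>SA\<close> lies slightly to the left.\<close>

lemma right_level_closure:
  assumes z: "z \<in> Cplus" "2 * lam \<le> Re z" "phR z = 0"
  shows "z \<in> closure SC" "Im z < ic \<Longrightarrow> z \<in> closure SA"
proof -
  have zz: "Complex (Re z) (Im z) = z" by simp
  show "z \<in> closure SC"
  proof (rule seq_closure[where f = "\<lambda>x. Complex x (Im z)" and a = "Re z"])
    fix \<epsilon> :: real assume e: "\<epsilon> > 0"
    have "phR (Complex (Re z) (Im z)) < phR (Complex (Re z + \<epsilon> / 2) (Im z))"
      by (rule phR_horizontal) (use z e lam0 in \<open>auto simp: Cplus_iff complex_eq_iff\<close>)
    then have "Complex (Re z + \<epsilon> / 2) (Im z) \<in> SC"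
      using z e lam0 by (auto simp: SC_def Cplus_iff complex_eq_iff)
    then show "\<exists>x. \<bar>x - Re z\<bar> < \<epsilon> \<and> Complex x (Im z) \<in> SC" using e by (intro exI[of _ "Re z + \<epsilon> / 2"]) auto
  qed (auto intro: isCont_Complex)
  assume im: "Im z < ic"
  then have re: "2 * lam < Re z" using line_cases(1)[of z] z by force
  show "z \<in> closure SA"
  proof (rule seq_closure[where f = "\<lambda>x. Complex x (Im z)" and a = "Re z"])
    fix \<epsilon> :: real assume e: "\<epsilon> > 0"
    define x where "x = Re z - min \<epsilon> (Re z - 2 * lam) / 2"
    have x: "2 * lam < x" "x < Re z" "\<bar>x - Re z\<bar> < \<epsilon>" using e re by (auto simp: x_def min_def field_simps)
    have "phR (Complex x (Im z)) < phR (Complex (Re z) (Im z))"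
      by (rule phR_horizontal) (use z x lam0 in \<open>auto simp: Cplus_iff complex_eq_iff\<close>)
    then have "Complex x (Im z) \<in> SA"
      using z x im lam0 by (auto simp: SA_def Cplus_iff complex_eq_iff)
    then show "\<exists>x. \<bar>x - Re z\<bar> < \<epsilon> \<and> Complex x (Im z) \<in> SA" using x by blast
  qed (auto intro: isCont_Complex)
qed

lemma zplus_closure: "zplus lam \<in> closure SA" "zplus lam \<in> closure SB" "zplus lam \<in> closure SC"
proof -
  show "zplus lam \<in> closure SC" using right_level_closure(1)[OF zplus_Cplus] zplus phR_zplus by simp
  have zp: "Complex (2 * lam) ic = zplus lam" using zplus by (simp add: complex_eq_iff)
  show "zplus lam \<in> closure SA"
  proof (rule seq_closure[where f = "\<lambda>y. Complex (2 * lam) y" and a = ic])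
    fix \<epsilon> :: real assume e: "\<epsilon> > 0"
    define y where "y = ic - min \<epsilon> ic / 2"
    have y: "0 < y" "y < ic" "\<bar>y - ic\<bar> < \<epsilon>" using e ic(1) by (auto simp: y_def)
    then have "Complex (2 * lam) y \<in> SA" using phR_vertical_below[of y] by (auto simp: SA_def Cplus_iff complex_eq_iff)
    then show "\<exists>y. \<bar>y - ic\<bar> < \<epsilon> \<and> Complex (2 * lam) y \<in> SA" using y by blast
  qed (use zp in \<open>auto intro: isCont_Complex\<close>)
  \<comment> \<open>The direction \<open>(- 1, 4 / ic)\<close> leaves the disc of radius 2 at the
    turning point: the squared modulus grows by \<open>s (8 - 4 lam)\<close> to first order, so
    \<open>phL_pos_far\<close> applies.\<close>
  have c: "isCont (\<lambda>s. Complex (2 * lam - s) (ic + 4 / ic * s)) 0"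
    unfolding Complex_eq using ic(1) by (intro continuous_intros) auto
  show "zplus lam \<in> closure SB"
  proof (rule seq_closure[where f = "\<lambda>s. Complex (2 * lam - s) (ic + 4 / ic * s)" and a = 0])
    fix \<epsilon> :: real assume e: "\<epsilon> > 0"
    define s where "s = \<epsilon> / 2"
    have s: "0 < s" "\<bar>s - 0\<bar> < \<epsilon>" using e by (auto simp: s_def)
    define z where "z = Complex (2 * lam - s) (ic + 4 / ic * s)"
    define k where "k = 4 / ic * s"
    have "ic * k = 4 * s" using ic(1) by (simp add: k_def)
    then have "(2 * lam - s)\<^sup>2 + (ic + k)\<^sup>2 = (2 * lam)\<^sup>2 + ic\<^sup>2 + s * (8 - 4 * lam) + s\<^sup>2 + k\<^sup>2"
      by (simp add: power2_eq_square algebra_simps)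
    then have "(cmod z)\<^sup>2 = (2 * lam)\<^sup>2 + ic\<^sup>2 + s * (8 - 4 * lam) + s\<^sup>2 + k\<^sup>2"
      by (simp add: z_def cmod_power2 k_def)
    moreover have "(2 * lam)\<^sup>2 + ic\<^sup>2 = 2\<^sup>2" unfolding ic(2) by (simp add: power_mult_distrib)
    moreover have "s * (8 - 4 * lam) > 0" using s lam1 by simp
    ultimately have "2\<^sup>2 < (cmod z)\<^sup>2" by (simp add: add_pos_nonneg)
    then have "cmod z > 2" by (rule power_less_imp_less_base) simp
    then have "phL z > 0" using s ic(1) by (intro phL_pos_far) (auto simp: z_def)
    moreover have "z \<noteq> 0" using \<open>cmod z > 2\<close> by auto
    moreover have "Re z < 2 * lam" "Im z \<ge> 0" using s ic(1) by (simp_all add: z_def)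
    ultimately have "z \<in> SB" by (simp add: SB_def Cplus_iff)
    then show "\<exists>s. \<bar>s - 0\<bar> < \<epsilon> \<and> Complex (2 * lam - s) (ic + 4 / ic * s) \<in> SB" using s unfolding z_def by blast
  qed (use zp c in simp_all)
qed

text \<open>Right of the vertical line a common boundary point cannot lie above the height
  \<open>ic\<close>, where \<open>SA\<close> is far, nor below it, where \<open>SB\<close> is far;
  at that height the level set contains only the turning point.\<close>

lemma gamma2_eq: "gamma2 lam = G2"
proof (intro set_eqI iffI)
  fix z assume "z \<in> gamma2 lam"
  then have z: "z \<in> Cplus" "z \<in> closure SA" "z \<in> closure SB" by (auto simp: gamma2_def Sm1_eq S0_S1_eq)
  have "SA \<noteq> SB" using half_disc_subset_SA SABC_disjoint far_real by (metis inf.idem empty_iff order_refl)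
  then have "z \<notin> SA \<union> SB \<union> SC" using closure_level[OF z] by auto
  then have lev: "z \<in> level_set lam" using SABC_cover z by blast
  show "z \<in> G2"
  proof (cases "Re z < 2 * lam")
    case True then show ?thesis using lev by (auto simp: level_set_eq G2_def)
  next
    case False
    then have h: "2 * lam \<le> Re z" "phR z = 0" using lev by (auto simp: level_set_eq)
    have "\<not> Im z > ic" using beyond_ic[OF z(1) h(1)] z by blast
    moreover have "\<not> Im z < ic"
    proof
      assume im: "Im z < ic"
      then have "2 * lam < Re z" using line_cases(1)[OF z(1)] h by force
      then show False using right_not_SB[OF z(1) _ im] z by blast
    qed
    ultimately have "Im z = ic" by linarith
    then show ?thesis using phR_at_ic[OF h(1)] h by (force simp: G2_def)
  qed
next
  fix z assume "z \<in> G2"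
  then show "z \<in> gamma2 lam"
    using left_level_closure zplus_closure zplus_Cplus by (auto simp: G2_def gamma2_def Sm1_eq S0_S1_eq)
qed

lemma gamma3_eq: "gamma3 lam = G3"
proof (intro set_eqI iffI)
  fix z assume "z \<in> gamma3 lam"
  then have z: "z \<in> Cplus" "z \<in> closure SA" "z \<in> closure SC" by (auto simp: gamma3_def Sm1_eq S0_S1_eq)
  have "SA \<noteq> SC" using half_disc_subset_SA SABC_disjoint far_real by (metis inf.idem empty_iff order_refl)
  then have "z \<notin> SA \<union> SB \<union> SC" using closure_level[OF z] by auto
  then have lev: "z \<in> level_set lam" using SABC_cover z by blast
  have h: "2 * lam \<le> Re z" using left_not_SC[OF z(1)] z by force
  then have h2: "phR z = 0" using lev by (auto simp: level_set_eq)
  have "\<not> Im z > ic" using beyond_ic[OF z(1) h(1)] z by blast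
  then show "z \<in> G3"
    using phR_at_ic[OF h(1)] h h2 z by (cases "Im z = ic") (force simp: G3_def)+
next
  fix z assume "z \<in> G3"
  then show "z \<in> gamma3 lam"
    using right_level_closure zplus_closure zplus_Cplus by (auto simp: G3_def gamma3_def Sm1_eq S0_S1_eq)
qed

definition D2 :: "complex set" where "D2 = Cplus - gamma2 lam"
definition D3 :: "complex set" where "D3 = Cplus - gamma3 lam"

lemma openin_D2_D3: "openin (top_of_set Cplus) D2" "openin (top_of_set Cplus) D3"
proof -
  have "D2 = {z \<in> Cplus. z \<in> - (closure SA \<inter> closure SB)}" "D3 = {z \<in> Cplus. z \<in> - (closure SA \<inter> closure SC)}"
    unfolding D2_def D3_def gamma2_def gamma3_def Sm1_eq S0_S1_eq by blast+
  then show "openin (top_of_set Cplus) D2" "openin (top_of_set Cplus) D3"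
    by (simp_all only:) (intro openin_Cplus open_Compl closed_Int closed_closure)+
qed

lemma SABC_D: "SA \<subseteq> D2" "SB \<subseteq> D2" "SC \<subseteq> D2" "SA \<subseteq> D3" "SB \<subseteq> D3" "SC \<subseteq> D3"
  unfolding D2_def D3_def gamma2_eq gamma3_eq G2_def G3_def
  using SABC_sub phR_zplus zplus by (auto simp: SA_def SB_def SC_def)

lemma D_closure: "D2 \<subseteq> closure (SA \<union> SB \<union> SC)" "D3 \<subseteq> closure (SA \<union> SB \<union> SC)"
proof -
  have "z \<in> closure (SA \<union> SB \<union> SC)" if "z \<in> Cplus" for z
  proof (cases "z \<in> level_set lam")
    case True
    then have "z \<in> closure SA \<or> z \<in> closure SC"
      using left_level_closure(1)[OF that] right_level_closure(1)[OF that] by (auto simp: level_set_eq)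
    then show ?thesis by (auto simp: closure_Un)
  next
    case False
    then have "z \<in> SA \<union> SB \<union> SC" using that SABC_cover by blast
    then show ?thesis using closure_subset[of "SA \<union> SB \<union> SC"] by (rule subsetD[rotated])
  qed
  then show "D2 \<subseteq> closure (SA \<union> SB \<union> SC)" "D3 \<subseteq> closure (SA \<union> SB \<union> SC)" by (auto simp: D2_def D3_def)
qed

lemma connected_union3:
  assumes "connected A" "connected B" "connected C" "connected P" "connected Q"
    "P \<inter> A \<noteq> {}" "P \<inter> C \<noteq> {} \<or> P \<inter> B \<noteq> {}" "Q \<inter> B \<noteq> {}" "Q \<inter> C \<noteq> {}"
  shows "connected (A \<union> B \<union> C \<union> P \<union> Q)"
proof -
  have "connected (B \<union> Q)" by (rule connected_Un[OF assms(2,5)]) (use assms(8) in blast)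
  then have "connected (B \<union> Q \<union> C)" by (rule connected_Un[OF _ assms(3)]) (use assms(9) in blast)
  moreover have "connected (A \<union> P)" by (rule connected_Un[OF assms(1,4)]) (use assms(6) in blast)
  ultimately have "connected ((B \<union> Q \<union> C) \<union> (A \<union> P))" by (rule connected_Un) (use assms(7) in blast)
  moreover have "(B \<union> Q \<union> C) \<union> (A \<union> P) = A \<union> B \<union> C \<union> P \<union> Q" by blast
  ultimately show ?thesis by simp
qed

text \<open>On the part of the positive axis left of \<open>2 lam\<close> the phase
  \<open>phL\<close> increases to a negative value at \<open>2 lam\<close>, so it has no zero
  there.\<close>

lemma pos_real_D2:
  assumes "x > 0"
  shows "complex_of_real x \<in> D2"
proof -
  have nz: "complex_of_real x \<noteq> zplus lam"
    by (metis Im_complex_of_real zplus(2) ic(1) less_irrefl)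
  have "complex_of_real x \<notin> G2"
  proof
    assume "complex_of_real x \<in> G2"
    then have "x < 2 * lam" "phL (of_real x) = 0" using nz by (auto simp: G2_def)
    then have l: "lam > 0" using assms by simp
    have "phL (of_real x * 1) < phL (of_real (2 * lam) * 1)"
      by (rule phL_radial) (use \<open>x < 2 * lam\<close> assms in auto)
    moreover have "phL (of_real (2 * lam)) = phR (of_real (2 * lam))" using l ic(1) by (intro phL_line) auto
    moreover have "phR (of_real (2 * lam)) < 0" using l ic(1) by (intro line_cases) (auto simp: Cplus_iff)
    ultimately show False using \<open>phL (of_real x) = 0\<close> by simp
  qed
  then show ?thesis using assms by (auto simp: D2_def gamma2_eq Cplus_iff)
qed

text \<open>A large half circle joins \<open>SB\<close> and \<open>SC\<close>. The real half axis
  that avoids the cut joins \<open>SA\<close> to \<open>SC\<close> in one case and to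
  \<open>SB\<close> in the other. The remaining points of the domain lie in the closure of this
  connected set.\<close>

lemma connected_D: "connected D2" "connected D3"
proof -
  obtain X where X: "X > 2" "\<And>z. z \<in> Cplus \<Longrightarrow> cmod z \<ge> X \<Longrightarrow> Im z \<le> ic \<Longrightarrow> Re z \<ge> 2 * lam \<Longrightarrow> z \<in> SC"
    "\<And>z. z \<in> Cplus \<Longrightarrow> cmod z > 2 \<Longrightarrow> Re z < 2 * lam \<Longrightarrow> z \<in> SB" using far_points by blast
  define Q where "Q = (\<lambda>\<theta>. of_real X * cis \<theta>) ` {0..pi}"
  have Q: "connected Q" unfolding Q_def by (intro connected_continuous_image continuous_intros) auto
  have QC: "Q \<subseteq> Cplus" using X(1) by (auto simp: Q_def intro!: cis_in_Cplus)
  have Qn: "cmod z = X" if "z \<in> Q" for z using that X(1) by (auto simp: Q_def norm_mult)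
  have QD2: "Q \<subseteq> D2"
  proof
    fix z assume z: "z \<in> Q"
    have "z \<notin> G2"
    proof
      assume "z \<in> G2"
      then have "z = zplus lam \<or> (z \<in> SB \<and> phL z = 0 \<and> Re z < 2 * lam)" using X Qn[OF z] by (auto simp: G2_def)
      then show False using Qn[OF z] X(1) norm_zplus by (auto simp: SB_def)
    qed
    then show "z \<in> D2" using z QC by (auto simp: D2_def gamma2_eq)
  qed
  have QD3: "Q \<subseteq> D3"
  proof
    fix z assume z: "z \<in> Q"
    have "z \<notin> G3"
    proof
      assume "z \<in> G3"
      then have "z = zplus lam \<or> (z \<in> SC \<and> phR z = 0)" using X Qn[OF z] by (auto simp: G3_def)
      then show False using Qn[OF z] X(1) norm_zplus by (auto simp: SC_def)
    qed
    then show "z \<in> D3" using z QC by (auto simp: D3_def gamma3_eq)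
  qed
  have "of_real X \<in> Q" "- of_real X \<in> Q"
    unfolding Q_def by (rule image_eqI[of _ _ 0]; simp) (rule image_eqI[of _ _ pi]; simp)
  moreover have "complex_of_real X \<in> SC" "- complex_of_real X \<in> SB"
    using X lam0 lam1 ic(1) by (auto intro!: X(2,3) simp: Cplus_iff)
  ultimately have Qi: "Q \<inter> SB \<noteq> {}" "Q \<inter> SC \<noteq> {}" by blast+
  obtain \<epsilon> where \<epsilon>: "\<epsilon> > 0" "\<And>z. z \<in> Cplus \<Longrightarrow> cmod z < \<epsilon> \<Longrightarrow> z \<in> SA" using half_disc_subset_SA by blast
  define P where "P = complex_of_real ` {0<..}"
  define N where "N = (\<lambda>x. - complex_of_real x) ` {0<..}"
  have PN: "connected P" "connected N" unfolding P_def N_def by (intro connected_continuous_image continuous_intros; simp)+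
  have e: "complex_of_real (\<epsilon> / 2) \<in> P" "- complex_of_real (\<epsilon> / 2) \<in> N"
    unfolding P_def N_def using \<epsilon>(1) by (intro imageI; simp)+
  have e': "complex_of_real (\<epsilon> / 2) \<in> SA" "- complex_of_real (\<epsilon> / 2) \<in> SA"
    using \<epsilon>(1) by (intro \<epsilon>(2); simp add: Cplus_iff)+
  have XP: "complex_of_real X \<in> P" "- complex_of_real X \<in> N" using X(1) by (auto simp: P_def N_def)
  have nz: "complex_of_real x \<noteq> zplus lam" "- complex_of_real x \<noteq> zplus lam" for x
    by (metis Im_complex_of_real zplus(2) ic(1) less_irrefl)
       (metis Im_complex_of_real uminus_complex.sel(2) neg_equal_0_iff_equal zplus(2) ic(1) less_irrefl)
  have PD: "P \<subseteq> D2" using pos_real_D2 by (auto simp: P_def)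
  have ND: "N \<subseteq> D3" using lam0 nz by (auto simp: N_def D3_def gamma3_eq G3_def Cplus_iff)
  have XS: "complex_of_real X \<in> SC" "- complex_of_real X \<in> SB"
    using X lam0 lam1 ic(1) by (auto intro!: X(2,3) simp: Cplus_iff)
  have c2: "connected (SA \<union> SB \<union> SC \<union> P \<union> Q)"
    by (rule connected_union3[OF connected_SA connected_SB connected_SC PN(1) Q _ _ Qi]) (use e e' XP XS in blast)+
  have c3: "connected (SA \<union> SB \<union> SC \<union> N \<union> Q)"
    by (rule connected_union3[OF connected_SA connected_SB connected_SC PN(2) Q _ _ Qi]) (use e e' XP XS in blast)+
  show "connected D2"
    by (rule connected_intermediate_closure[OF c2])
       (use PD QD2 SABC_D D_closure closure_mono[of "SA \<union> SB \<union> SC" "SA \<union> SB \<union> SC \<union> P \<union> Q"] in blast)+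
  show "connected D3"
    by (rule connected_intermediate_closure[OF c3])
       (use ND QD3 SABC_D D_closure closure_mono[of "SA \<union> SB \<union> SC" "SA \<union> SB \<union> SC \<union> N \<union> Q"] in blast)+
qed

end

section \<open>Uniformization of the square root\<close>

lemma continuous_on_local:
  fixes f :: "complex \<Rightarrow> complex"
  assumes "\<And>z. z \<in> S \<Longrightarrow> \<exists>V. openin (top_of_set C) V \<and> z \<in> V \<and> continuous_on (V \<inter> S) f" "S \<subseteq> C"
  shows "continuous_on S f"
  unfolding continuous_on_eq_continuous_within
proof
  fix z assume z: "z \<in> S"
  then obtain V where V: "openin (top_of_set C) V" "z \<in> V" "continuous_on (V \<inter> S) f" using assms by blast
  then obtain T where T: "open T" "V = C \<inter> T" by (auto simp: openin_open)
  have "at z within (V \<inter> S) = at z within S"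
    by (rule at_within_nhd[of z T]) (use T V assms(2) in auto)
  then show "continuous (at z within S) f"
    using V z by (metis IntI continuous_on_eq_continuous_within)
qed

text \<open>Connected sets with more than one point are uncountable. Quotients or differences of two
  branches of a multivalued function take values in a countable set, so on a connected domain the
  value at one point decides the branch.\<close>

lemma connected_countable_range_const:
  fixes f :: "complex \<Rightarrow> complex"
  assumes "connected S" "continuous_on S f" "countable (f ` S)" "x \<in> S" "y \<in> S"
  shows "f x = f y"
  using connected_uncountable[OF connected_continuous_image[OF assms(2,1)], of "f x" "f y"] assms by blast

text \<open>The logarithm with branch cut along the negative imaginary axis.\<close>

definition Ln_up :: "complex \<Rightarrow> complex" where
  "Ln_up w = Ln (- \<i> * w) + \<i> * of_real (pi / 2)"

lemma up_domain: "Re w \<noteq> 0 \<or> Im w > 0 \<longleftrightarrow> - \<i> * w \<notin> \<real>\<^sub>\<le>\<^sub>0"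
  by (auto simp: complex_nonpos_Reals_iff)

lemma exp_Ln_up: "w \<noteq> 0 \<Longrightarrow> exp (Ln_up w) = w"
proof -
  assume "w \<noteq> 0"
  moreover have "exp (\<i> * of_real (pi / 2)) = \<i>" by (metis cis_conv_exp cis_pi_half)
  ultimately have "exp (Ln_up w) = - \<i> * w * \<i>" unfolding Ln_up_def exp_add by simp
  also have "\<dots> = w" by (simp add: mult.commute[of _ \<i>])
  finally show ?thesis .
qed

lemma Ln_up_deriv:
  assumes "Re w \<noteq> 0 \<or> Im w > 0"
  shows "(Ln_up has_field_derivative 1 / w) (at w within A)"
proof -
  have n: "- \<i> * w \<notin> \<real>\<^sub>\<le>\<^sub>0" using assms up_domain by blast
  then have "w \<noteq> 0" by auto
  have "(Ln_up has_field_derivative (inverse (- \<i> * w) * (- \<i> * 1) + 0)) (at w)"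
    unfolding Ln_up_def[abs_def]
    by (intro DERIV_add DERIV_chain2[of Ln _ "\<lambda>w. - \<i> * w", OF has_field_derivative_Ln[OF n]] DERIV_cmult DERIV_ident DERIV_const)
  moreover have "inverse (- \<i> * w) * (- \<i> * 1) + 0 = 1 / w" using \<open>w \<noteq> 0\<close> by (simp add: field_simps)
  ultimately show ?thesis using has_field_derivative_at_within by metis
qed

lemma Ln_up_eq_Ln:
  assumes "w \<noteq> 0" "Im w \<ge> 0"
  shows "Ln_up w = Ln w"
proof -
  have "- \<i> * w \<noteq> 0" using assms by simp
  then have "Re (- \<i> * w) \<ge> 0" using assms by simp
  have e: "exp (Ln_up w) = w" using assms by (rule_tac exp_Ln_up)
  have "\<bar>Im (Ln (- \<i> * w))\<bar> \<le> pi / 2"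
    using \<open>Re (- \<i> * w) \<ge> 0\<close> \<open>- \<i> * w \<noteq> 0\<close> Re_Ln_pos_le by blast
  moreover have "Im (Ln_up w) = Im (Ln (- \<i> * w)) + pi / 2" unfolding Ln_up_def by simp
  ultimately have "- pi < Im (Ln_up w)" "Im (Ln_up w) \<le> pi" using pi_gt_zero unfolding abs_le_iff by linarith+
  then show ?thesis using Ln_unique[OF e] by simp
qed

context turning_point
begin

text \<open>\<open>Zp\<close> is the root that is continuous off \<open>gamma2\<close>,
  \<open>Z3\<close> the one that is continuous off \<open>gamma3\<close>. They are opposite on
  \<open>SA\<close> and agree at the other points off both cuts.\<close>

definition Zp :: "complex \<Rightarrow> complex" where
  "Zp z = (if Re z < 2 * lam then (if phL z > 0 then - ZL z else ZL z) else ZR z)"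
definition Z3 :: "complex \<Rightarrow> complex" where
  "Z3 z = (if Re z < 2 * lam then - ZL z else if Im z < ic \<and> phR z < 0 then - ZR z else ZR z)"

lemma continuous_on_ZM: "continuous_on {z \<in> Cplus. Re z < 2 * lam \<or> Im z < ic} (\<lambda>z. if Re z \<le> 2 * lam then ZL z else ZR z)"
  by (rule continuous_on_cases_le)
     (auto intro!: continuous_on_subset[OF continuous_on_ZL] continuous_on_subset[OF continuous_on_ZR] continuous_intros
        level_line simp: Cplus_iff)

lemma continuous_on_ZN: "continuous_on {z \<in> Cplus. Im z > ic} (\<lambda>z. if Re z \<le> 2 * lam then - ZL z else ZR z)"
proof -
  have "ZL z = - ZR z" if "z \<in> Cplus" "Im z > ic" "Re z = 2 * lam" for z
    using that by (intro level_line) (auto simp: Cplus_iff)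
  then show ?thesis
    by (intro continuous_on_cases_le continuous_on_minus continuous_on_subset[OF continuous_on_ZL]
         continuous_on_subset[OF continuous_on_ZR] continuous_intros) (auto simp: Cplus_iff)
qed

lemma beyond_norm: "z \<in> Cplus \<Longrightarrow> Re z = 2 * lam \<Longrightarrow> Im z > ic \<Longrightarrow> cmod z > 2"
proof -
  assume z: "z \<in> Cplus" "Re z = 2 * lam" "Im z > ic"
  have "(2 * lam)\<^sup>2 + ic\<^sup>2 < (cmod z)\<^sup>2"
    unfolding cmod_power2 using z lam0 ic(1) by (intro add_le_less_mono power_mono power_strict_mono) auto
  then have "2\<^sup>2 < (cmod z)\<^sup>2" unfolding ic(2) by (simp add: power_mult_distrib)
  then show ?thesis using power_less_imp_less_base[of 2 2 "cmod z"] by simp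
qed

lemma eq_zplus: "Re z = 2 * lam \<Longrightarrow> Im z = ic \<Longrightarrow> z = zplus lam"
  using zplus by (simp add: complex_eq_iff)

text \<open>Four relatively open patches cover the domain, each with one continuous formula: the
  left side beyond \<open>gamma2\<close>, the region \<open>SA\<close>, the right side, and the
  points above the height \<open>ic\<close> outside the disc of radius 2.\<close>

lemma continuous_on_Zp: "continuous_on D2 Zp"
proof (rule continuous_on_local[where C = Cplus])
  fix z assume "z \<in> D2"
  then have z: "z \<in> Cplus" "z \<notin> G2" by (auto simp: D2_def gamma2_eq)
  define V1 where "V1 = {z \<in> {z \<in> Cplus. Re z < 2 * lam}. phL z > 0}"
  define V4 where "V4 = {z \<in> Cplus. z \<in> {z. Im z > ic} \<inter> {z. cmod z > 2}}"
  have o1: "openin (top_of_set Cplus) V1" unfolding V1_def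
    by (intro openin_sublevel halves continuous_on_subset[OF continuous_on_phL]) (auto simp: Cplus_iff)
  have o4: "openin (top_of_set Cplus) V4" unfolding V4_def
    by (intro openin_Cplus open_Int open_halfspace_Im_gt open_Collect_less continuous_intros)
  have c1: "continuous_on V1 Zp"
  proof (rule continuous_on_eq)
    show "continuous_on V1 (\<lambda>z. - ZL z)"
      by (intro continuous_on_minus continuous_on_subset[OF continuous_on_ZL]) (auto simp: V1_def Cplus_iff)
  qed (auto simp: V1_def Zp_def)
  have c2: "continuous_on SA Zp"
  proof (rule continuous_on_eq)
    show "continuous_on SA (\<lambda>z. if Re z \<le> 2 * lam then ZL z else ZR z)"
      by (rule continuous_on_subset[OF continuous_on_ZM]) (auto simp: SA_def)
  qed (auto simp: SA_def Zp_def level_line Cplus_iff)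
  have c3: "continuous_on {z \<in> Cplus. Re z > 2 * lam} Zp"
  proof (rule continuous_on_eq)
    show "continuous_on {z \<in> Cplus. Re z > 2 * lam} ZR"
      by (rule continuous_on_subset[OF continuous_on_ZR]) (auto simp: Cplus_iff)
  qed (auto simp: Zp_def)
  have c4: "continuous_on V4 Zp"
  proof (rule continuous_on_eq)
    show "continuous_on V4 (\<lambda>z. if Re z \<le> 2 * lam then - ZL z else ZR z)"
      by (rule continuous_on_subset[OF continuous_on_ZN]) (auto simp: V4_def)
    fix z assume z: "z \<in> V4"
    have "Re z < 2 * lam \<Longrightarrow> phL z > 0" using z by (intro phL_pos_far) (auto simp: V4_def Cplus_iff)
    moreover have "Re z = 2 * lam \<Longrightarrow> ZL z = - ZR z" using z by (intro level_line) (auto simp: V4_def Cplus_iff)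
    ultimately show "(if Re z \<le> 2 * lam then - ZL z else ZR z) = Zp z" by (auto simp: Zp_def)
  qed
  consider "z \<in> V1" | "z \<in> SA" | "Re z > 2 * lam" | "z \<in> V4"
  proof -
    have "Re z < 2 * lam \<Longrightarrow> phL z \<noteq> 0" using z by (auto simp: G2_def)
    moreover have "Re z = 2 * lam \<Longrightarrow> Im z < ic \<Longrightarrow> z \<in> SA" using line_cases(1)[OF z(1)] z by (auto simp: SA_def)
    moreover have "Re z = 2 * lam \<Longrightarrow> Im z \<noteq> ic" using eq_zplus[of z] z by (auto simp: G2_def)
    moreover have "Re z = 2 * lam \<Longrightarrow> Im z > ic \<Longrightarrow> z \<in> V4" using beyond_norm[OF z(1)] z by (auto simp: V4_def)
    moreover have "Re z < 2 * lam \<Longrightarrow> phL z > 0 \<Longrightarrow> z \<in> V1" "Re z < 2 * lam \<Longrightarrow> phL z < 0 \<Longrightarrow> z \<in> SA"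
      using z by (simp_all add: V1_def SA_def)
    ultimately have "z \<in> V1 \<or> z \<in> SA \<or> Re z > 2 * lam \<or> z \<in> V4" by (meson linorder_neqE_linordered_idom)
    then show ?thesis using that by blast
  qed
  then show "\<exists>V. openin (top_of_set Cplus) V \<and> z \<in> V \<and> continuous_on (V \<inter> D2) Zp"
  proof cases
    case 1 then show ?thesis using o1 continuous_on_subset[OF c1, of "V1 \<inter> D2"] by blast
  next
    case 2 then show ?thesis using openin_SA continuous_on_subset[OF c2, of "SA \<inter> D2"] by blast
  next
    case 3 then show ?thesis using halves(2) z continuous_on_subset[OF c3, of "{z \<in> Cplus. Re z > 2 * lam} \<inter> D2"] by blast
  next
    case 4 then show ?thesis using o4 continuous_on_subset[OF c4, of "V4 \<inter> D2"] by blast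
  qed
qed (auto simp: D2_def)

text \<open>With the cut on \<open>gamma3\<close> no sign change occurs on the left side; it happens
  on the right side between \<open>SA\<close> and \<open>SC\<close>, and again each patch carries
  one continuous formula.\<close>

lemma continuous_on_Z3: "continuous_on D3 Z3"
proof (rule continuous_on_local[where C = Cplus])
  fix z assume "z \<in> D3"
  then have z: "z \<in> Cplus" "z \<notin> G3" by (auto simp: D3_def gamma3_eq)
  have c1: "continuous_on {z \<in> Cplus. Re z < 2 * lam} Z3"
  proof (rule continuous_on_eq)
    show "continuous_on {z \<in> Cplus. Re z < 2 * lam} (\<lambda>z. - ZL z)"
      by (intro continuous_on_minus continuous_on_subset[OF continuous_on_ZL]) (auto simp: Cplus_iff)
  qed (auto simp: Z3_def)
  have c2: "continuous_on SA Z3"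
  proof (rule continuous_on_eq)
    show "continuous_on SA (\<lambda>z. - (if Re z \<le> 2 * lam then ZL z else ZR z))"
      by (rule continuous_on_minus, rule continuous_on_subset[OF continuous_on_ZM]) (auto simp: SA_def)
  qed (auto simp: SA_def Z3_def level_line Cplus_iff)
  have c3: "continuous_on SC Z3"
  proof (rule continuous_on_eq)
    show "continuous_on SC ZR"
      by (rule continuous_on_subset[OF continuous_on_ZR]) (auto simp: Cplus_iff SC_def)
  qed (auto simp: Z3_def SC_def)
  have c4: "continuous_on {z \<in> Cplus. Im z > ic} Z3"
  proof (rule continuous_on_eq[OF continuous_on_ZN])
    fix z assume z: "z \<in> {z \<in> Cplus. Im z > ic}"
    have "Re z = 2 * lam \<Longrightarrow> ZL z = - ZR z" using z by (intro level_line) (auto simp: Cplus_iff)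
    then show "(if Re z \<le> 2 * lam then - ZL z else ZR z) = Z3 z" using z by (auto simp: Z3_def)
  qed
  consider "Re z < 2 * lam" | "z \<in> SA" | "z \<in> SC" | "Im z > ic"
  proof -
    have "2 * lam \<le> Re z \<Longrightarrow> Im z = ic \<Longrightarrow> z \<in> SC"
      using phR_at_ic[of z] z by (auto simp: SC_def G3_def)
    moreover have "2 * lam \<le> Re z \<Longrightarrow> Im z < ic \<Longrightarrow> phR z \<noteq> 0" using z by (auto simp: G3_def)
    moreover have "2 * lam \<le> Re z \<Longrightarrow> phR z > 0 \<Longrightarrow> z \<in> SC"
      "2 * lam \<le> Re z \<Longrightarrow> Im z < ic \<Longrightarrow> phR z < 0 \<Longrightarrow> z \<in> SA"
      using z by (simp_all add: SA_def SC_def)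
    ultimately have "Re z < 2 * lam \<or> z \<in> SA \<or> z \<in> SC \<or> Im z > ic" by (meson linorder_neqE_linordered_idom not_less)
    then show ?thesis using that by blast
  qed
  then show "\<exists>V. openin (top_of_set Cplus) V \<and> z \<in> V \<and> continuous_on (V \<inter> D3) Z3"
  proof cases
    case 1 then show ?thesis using halves(1) z continuous_on_subset[OF c1, of "{z \<in> Cplus. Re z < 2 * lam} \<inter> D3"] by blast
  next
    case 2 then show ?thesis using openin_SA continuous_on_subset[OF c2, of "SA \<inter> D3"] by blast
  next
    case 3 then show ?thesis using openin_SC continuous_on_subset[OF c3, of "SC \<inter> D3"] by blast
  next
    case 4 then show ?thesis using halves(4) z continuous_on_subset[OF c4, of "{z \<in> Cplus. Im z > ic} \<inter> D3"] by blast
  qed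
qed (auto simp: D3_def)

lemma Zp_Z3_power2: "Zp z ^ 2 = Zsq lam z" "Z3 z ^ 2 = Zsq lam z"
  by (auto simp: Zp_def Z3_def)

lemma Z3_eq_Zp: "z \<notin> SA \<Longrightarrow> z \<in> D3 \<Longrightarrow> z \<in> D2 \<Longrightarrow> Z3 z = Zp z"
  by (force simp: Zp_def Z3_def SA_def D2_def D3_def gamma2_eq G2_def)

text \<open>Above the turning point the right root is purely imaginary and nonzero. This supplies
  the condition \<open>line\<close> of the locale below for both cuts.\<close>

lemma line_Im_ZR:
  assumes "z \<in> Cplus" "Re z = 2 * lam" "Im z \<ge> ic" "z \<noteq> zplus lam"
  shows "Im (ZR z) > 0"
proof -
  have "Re (ZL z) \<ge> 0" "ZL z = - ZR z" "Im (ZR z) \<ge> 0" "Re (ZR z) \<ge> 0"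
    using ZL_quadrant[of z] ZR_quadrant[of z] level_line[of z] assms by (auto simp: Cplus_iff)
  then have re: "Re (ZR z) = 0" "Im (ZR z) \<ge> 0" by auto
  have "ZR z \<noteq> 0" using Zsq_eq_0_iff[of z] assms by (metis ZR_ZL_power2(1) Cplus_iff zero_eq_power2)
  then show ?thesis using re by (auto simp: complex_eq_iff)
qed

text \<open>The values of \<open>u\<close> over \<open>z = 0\<close>; those over
  \<open>Z = 0\<close> are \<open>i ic\<close> and \<open>- i ic\<close>.\<close>

definition u1 :: real where "u1 = 2 - 2 * lam"
definition u2 :: real where "u2 = - (2 + 2 * lam)"
text \<open>With \<open>u = Z + (z - 2 lam)\<close> the conjugate expression
  \<open>Z - (z - 2 lam)\<close> equals \<open>ic^2 / u\<close>; half the difference and half the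
  sum of the two recover \<open>z - 2 lam\<close> and \<open>Z\<close>.\<close>

definition zu :: "complex \<Rightarrow> complex" where "zu u = 2 * of_real lam + (u - of_real (ic\<^sup>2) / u) / 2"
definition Zu :: "complex \<Rightarrow> complex" where "Zu u = (u + of_real (ic\<^sup>2) / u) / 2"
definition W :: "complex set" where "W = {u. Re u \<noteq> 0 \<or> Im u > ic}"
definition Wz :: "complex set" where "Wz = {u \<in> W. Im u \<ge> 0 \<and> u \<noteq> of_real u1 \<and> u \<noteq> of_real u2}"

lemma u12: "u1 > 0" "u2 < 0" "u1 * u2 = - ic\<^sup>2" "u1 + u2 = - 4 * lam"
  using lam0 lam1 unfolding ic(2) by (auto simp: u1_def u2_def power2_eq_square algebra_simps)

lemma zu_factor: "u \<noteq> 0 \<Longrightarrow> zu u = (u - of_real u1) * (u - of_real u2) / (2 * u)"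
proof -
  assume u: "u \<noteq> 0"
  have "(u - of_real u1) * (u - of_real u2) = u ^ 2 - of_real (u1 + u2) * u + of_real (u1 * u2)"
    by (simp add: power2_eq_square algebra_simps)
  then show ?thesis using u unfolding u12 zu_def by (simp add: field_simps power2_eq_square)
qed

lemma Zu_factor: "u \<noteq> 0 \<Longrightarrow> Zu u = (u - \<i> * of_real ic) * (u + \<i> * of_real ic) / (2 * u)"
  unfolding Zu_def by (simp add: field_simps power2_eq_square)

lemma W_nz: "u \<in> W \<Longrightarrow> u \<noteq> 0" "u \<in> W \<Longrightarrow> u \<noteq> \<i> * of_real ic" "u \<in> W \<Longrightarrow> u \<noteq> - \<i> * of_real ic"
  using ic(1) by (auto simp: W_def complex_eq_iff)

lemma Zu_nz: "u \<in> W \<Longrightarrow> Zu u \<noteq> 0"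
  using W_nz[of u] Zu_factor[of u] by (simp add: eq_neg_iff_add_eq_0)

lemma Zu_power2: "u \<noteq> 0 \<Longrightarrow> Zu u ^ 2 = Zsq lam (zu u)"
proof -
  assume u: "u \<noteq> 0"
  define b where "b = of_real (ic\<^sup>2) / u"
  have ub: "u * b = of_real (ic\<^sup>2)" using u by (simp add: b_def)
  have "Zsq lam (zu u) = (zu u - 2 * of_real lam) ^ 2 + of_real (ic\<^sup>2)"
    by (simp add: complex_eq_iff Zsq_parts power2_eq_square)
  also have "\<dots> = ((u - b) / 2) ^ 2 + u * b" unfolding ub by (simp add: zu_def b_def)
  also have "\<dots> = ((u + b) / 2) ^ 2" by (simp add: power2_eq_square field_simps)
  finally show ?thesis by (simp add: Zu_def b_def)
qed

lemma zu_deriv: "u \<noteq> 0 \<Longrightarrow> (zu has_field_derivative Zu u / u) (at u within A)"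
proof -
  assume u: "u \<noteq> 0"
  have "(zu has_field_derivative (1 - (- of_real (ic\<^sup>2) * inverse (u ^ 2))) / 2) (at u within A)"
    unfolding zu_def[abs_def] using u by (auto intro!: derivative_eq_intros simp: field_simps power2_eq_square)
  moreover have "(1 - (- of_real (ic\<^sup>2) * inverse (u ^ 2))) / 2 = Zu u / u"
    using u by (simp add: Zu_def field_simps power2_eq_square)
  ultimately show ?thesis by simp
qed

lemma open_W: "open W"
  unfolding W_def Collect_disj_eq
  by (intro open_Un open_Collect_neq open_Collect_less continuous_intros)

text \<open>
  The variable u uniformizes the two-sheeted surface of the square root. On the sheets selected by
  the two cuts, u avoids the segment from 0 to the branch point, so that the slit plane W contains
  the images of both.
\<close>

end

text \<open>Treats the two cut domains at once. The condition \<open>line\<close> fixes the sign of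
  the root on the vertical line above the turning point and thereby keeps \<open>u\<close> off the
  segment from 0 to \<open>i ic\<close>.\<close>

locale lg_branch = turning_point +
  fixes S :: "complex set" and Z :: "complex \<Rightarrow> complex"
  assumes openS: "openin (top_of_set Cplus) S" and contZ: "continuous_on S Z"
    and sq: "\<And>z. z \<in> S \<Longrightarrow> Z z ^ 2 = Zsq lam z"
    and nzp: "zplus lam \<notin> S"
    and line: "\<And>z. z \<in> S \<Longrightarrow> Re z = 2 * lam \<Longrightarrow> Im z \<ge> ic \<Longrightarrow> Im (Z z) > 0"
begin

lemma S_Cplus: "S \<subseteq> Cplus" using openS by (auto simp: openin_open)

lemma Z_nz: "z \<in> S \<Longrightarrow> Z z \<noteq> 0"
  using sq[of z] Zsq_eq_0_iff[of z] nzp S_Cplus by (auto simp: Cplus_iff)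

definition uz :: "complex \<Rightarrow> complex" where "uz z = Z z + z - 2 * of_real lam"

lemma uz_product: "z \<in> S \<Longrightarrow> uz z * (Z z - (z - 2 * of_real lam)) = of_real (ic\<^sup>2)"
  using Zsq_factor_nonzero(3)[OF lam0 lam1 sq[of z]] unfolding uz_def ic(2) by (simp add: algebra_simps)

lemma uz_nz: "z \<in> S \<Longrightarrow> uz z \<noteq> 0"
  using uz_product[of z] ic(1) by auto

lemma uz_inverse:
  assumes "z \<in> S" shows "zu (uz z) = z" "Zu (uz z) = Z z"
proof -
  have "of_real (ic\<^sup>2) / uz z = Z z - (z - 2 * of_real lam)"
    using uz_product[OF assms] uz_nz[OF assms] by (simp add: divide_eq_eq mult.commute)
  then show "zu (uz z) = z" "Zu (uz z) = Z z" unfolding zu_def Zu_def by (simp_all add: uz_def field_simps)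
qed

text \<open>The map \<open>zu\<close> sends the open lower half plane into itself, while
  \<open>z\<close> has nonnegative imaginary part.\<close>

lemma Im_uz:
  assumes "z \<in> S" shows "Im (uz z) \<ge> 0"
proof (rule ccontr)
  assume n: "\<not> Im (uz z) \<ge> 0"
  define u where "u = uz z"
  have u: "u \<noteq> 0" "Im u < 0" "zu u = z" using n uz_nz[OF assms] uz_inverse[OF assms] by (auto simp: u_def)
  have "Im (of_real (ic\<^sup>2) / u) = - (ic\<^sup>2 * Im u) / (cmod u)\<^sup>2"
    by (simp add: Im_divide cmod_power2)
  also have "\<dots> \<ge> 0" using u by (simp add: mult_nonneg_nonpos divide_nonpos_nonneg)
  finally have "Im (zu u) < 0" using u(2) by (simp add: zu_def)
  then show False using u(3) assms S_Cplus by (auto simp: Cplus_iff)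
qed

text \<open>If \<open>u = i y\<close> with \<open>0 < y \<le> ic\<close>, then \<open>z\<close> lies
  on the vertical line at the height \<open>(y + ic^2 / y) / 2 \<ge> ic\<close>, while
  \<open>Im Z = (y - ic^2 / y) / 2 \<le> 0\<close> contradicts \<open>line\<close>.\<close>

lemma uz_Wz:
  assumes "z \<in> S" shows "uz z \<in> Wz"
proof -
  have "uz z \<in> W"
  proof (rule ccontr)
    assume "uz z \<notin> W"
    then have h: "Re (uz z) = 0" "Im (uz z) \<le> ic" by (auto simp: W_def)
    define y where "y = Im (uz z)"
    have u: "uz z = \<i> * of_real y" using h by (simp add: y_def complex_eq_iff)
    have "y \<noteq> 0" using uz_nz[OF assms] u by (metis mult_zero_right of_real_0)
    then have y: "0 < y" "y \<le> ic" using h Im_uz[OF assms] unfolding y_def by simp_all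
    have d: "of_real (ic\<^sup>2) / (\<i> * of_real y) = - \<i> * of_real (ic\<^sup>2 / y)"
    proof -
      have "(- \<i> * a) * (\<i> * b) = a * b" for a b :: complex by (simp add: complex_eq_iff)
      moreover have "complex_of_real (ic\<^sup>2 / y) * of_real y = of_real (ic\<^sup>2)"
        unfolding of_real_mult[symmetric] using y by simp
      ultimately have "(- \<i> * of_real (ic\<^sup>2 / y)) * (\<i> * of_real y) = of_real (ic\<^sup>2)" by (simp only:)
      moreover have "\<i> * complex_of_real y \<noteq> 0" using y by simp
      ultimately show ?thesis by (metis nonzero_mult_div_cancel_right)
    qed
    have "Re (zu (\<i> * of_real y)) = 2 * lam" "Im (zu (\<i> * of_real y)) = (y + ic\<^sup>2 / y) / 2"
      "Im (Zu (\<i> * of_real y)) = (y - ic\<^sup>2 / y) / 2"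
      unfolding zu_def Zu_def d by simp_all
    then have z: "Re z = 2 * lam" "Im z = (y + ic\<^sup>2 / y) / 2" "Im (Z z) = (y - ic\<^sup>2 / y) / 2"
      unfolding uz_inverse[OF assms, unfolded u] .
    have "y * y \<le> ic * ic" using y by (intro mult_mono) auto
    then have yy: "y \<le> ic\<^sup>2 / y" using y by (simp add: pos_le_divide_eq power2_eq_square)
    have "0 \<le> (y - ic)\<^sup>2" by simp
    then have "ic * (2 * y) \<le> y * y + ic\<^sup>2" by (simp add: power2_eq_square algebra_simps)
    then have "ic * (2 * y) / (2 * y) \<le> (y * y + ic\<^sup>2) / (2 * y)" using y by (intro divide_right_mono) auto
    also have "(y * y + ic\<^sup>2) / (2 * y) = (y + ic\<^sup>2 / y) / 2" using y by (simp add: field_simps)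
    finally have "ic \<le> Im z" using y z by simp
    then show False using line[OF assms z(1)] z(3) yy by simp
  qed
  moreover have "uz z \<noteq> of_real u1" "uz z \<noteq> of_real u2"
    using uz_inverse(1)[OF assms] zu_factor[OF uz_nz[OF assms]] assms S_Cplus by (auto simp: Cplus_iff)
  ultimately show ?thesis using Im_uz[OF assms] by (simp add: Wz_def)
qed

text \<open>Real points of \<open>S\<close> are boundary points, so uniqueness of derivatives within
  \<open>S\<close> needs an argument; the points \<open>z + i t\<close> with small
  \<open>t > 0\<close> belong to \<open>S\<close>.\<close>

lemma S_at_nonbot: "z \<in> S \<Longrightarrow> at z within S \<noteq> bot"
proof -
  assume z: "z \<in> S"
  obtain T where T: "open T" "S = Cplus \<inter> T" using openS by (auto simp: openin_open)
  have "z islimpt S"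
    unfolding islimpt_approachable
  proof (intro allI impI)
    fix e :: real assume "e > 0"
    obtain d where d: "d > 0" "ball z d \<subseteq> T" using T z openE by blast
    define w where "w = z + \<i> * of_real (min e d / 2)"
    have m: "min e d / 2 > 0" "\<bar>min e d / 2\<bar> < e" "\<bar>min e d / 2\<bar> < d" using \<open>e > 0\<close> d(1) by auto
    have "dist w z = \<bar>min e d / 2\<bar>" by (simp add: w_def dist_norm norm_mult)
    then have "dist w z < e" "w \<in> T" using m d(2) by (auto simp: dist_commute)
    moreover have "Im z \<ge> 0" using z S_Cplus by (auto simp: Cplus_iff)
    moreover have "Im w = Im z + min e d / 2" by (simp add: w_def)
    ultimately have "Im w > 0" using m(1) by linarith
    then have "w \<in> Cplus" by (auto simp: Cplus_iff)
    moreover have "w \<noteq> z" using m(1) by (auto simp: w_def)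
    moreover note \<open>dist w z < e\<close> \<open>w \<in> T\<close>
    ultimately show "\<exists>w\<in>S. w \<noteq> z \<and> dist w z < e" using T by blast
  qed
  then show ?thesis by (simp add: trivial_limit_within)
qed

text \<open>Differentiability is inherited from the square: the difference quotient of
  \<open>Zsq\<close> divided by \<open>Z y + Z z\<close>, whose limit is nonzero, is the difference
  quotient of \<open>Z\<close>.\<close>

lemma Z_deriv:
  assumes z: "z \<in> S" shows "(Z has_field_derivative (z - 2 * of_real lam) / Z z) (at z within S)"
proof -
  have lim: "(Z \<longlongrightarrow> Z z) (at z within S)" using contZ z by (simp add: continuous_on_def)
  have "((\<lambda>y. Z y + Z z) \<longlongrightarrow> Z z + Z z) (at z within S)" by (intro tendsto_intros lim)
  then have ev: "eventually (\<lambda>y. Z y + Z z \<noteq> 0) (at z within S)"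
    by (rule tendsto_imp_eventually_ne) (use Z_nz[OF z] in auto)
  have "((\<lambda>y. (Zsq lam y - Zsq lam z) / (y - z)) \<longlongrightarrow> 2 * (z - 2 * of_real lam)) (at z within S)"
    using Zsq_deriv[of z S] by (simp add: has_field_derivative_iff)
  then have "((\<lambda>y. (Zsq lam y - Zsq lam z) / (y - z) / (Z y + Z z)) \<longlongrightarrow> 2 * (z - 2 * of_real lam) / (Z z + Z z)) (at z within S)"
    by (intro tendsto_intros lim) (use Z_nz[OF z] in auto)
  moreover have "eventually (\<lambda>y. (Zsq lam y - Zsq lam z) / (y - z) / (Z y + Z z) = (Z y - Z z) / (y - z)) (at z within S)"
    using ev eventually_at_topological[of "\<lambda>y. y \<in> S" z S]
  proof -
    have "eventually (\<lambda>y. y \<in> S) (at z within S)" by (simp add: eventually_at_filter)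
    with ev show ?thesis
    proof eventually_elim
      case (elim y)
      have "Zsq lam y - Zsq lam z = (Z y - Z z) * (Z y + Z z)"
        using sq[of y] sq[of z] elim z by (simp add: power2_eq_square algebra_simps)
      then show ?case using elim by simp
    qed
  qed
  ultimately have "((\<lambda>y. (Z y - Z z) / (y - z)) \<longlongrightarrow> 2 * (z - 2 * of_real lam) / (Z z + Z z)) (at z within S)"
    using tendsto_cong by fastforce
  moreover have "2 * a / (b + b) = a / b" for a b :: complex by (simp flip: mult_2)
  ultimately show ?thesis by (simp only: has_field_derivative_iff)
qed

lemma uz_deriv:
  assumes z: "z \<in> S" shows "(uz has_field_derivative uz z / Z z) (at z within S)"
proof -
  have "(uz has_field_derivative (z - 2 * of_real lam) / Z z + 1 - 0) (at z within S)"
    unfolding uz_def[abs_def] by (intro DERIV_diff DERIV_add Z_deriv z DERIV_ident DERIV_const)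
  moreover have "(z - 2 * of_real lam) / Z z + 1 - 0 = uz z / Z z"
    using Z_nz[OF z] by (simp add: uz_def field_simps)
  ultimately show ?thesis by simp
qed

lemma comp_deriv:
  "z \<in> S \<Longrightarrow> (f has_field_derivative f') (at (uz z)) \<Longrightarrow> ((\<lambda>z. f (uz z)) has_field_derivative f' * (uz z / Z z)) (at z within S)"
  by (rule DERIV_chain2[OF _ uz_deriv])

lemma continuous_on_uz: "continuous_on S uz"
  unfolding uz_def by (intro continuous_intros contZ)

lemma dz_within_eq:
  assumes z: "z \<in> S" and g: "\<And>w. w \<in> S \<Longrightarrow> g w = f (uz w)" and f: "(f has_field_derivative f') (at (uz z))"
  shows "dz_within S g z = f' * (uz z / Z z)"
proof -
  have *: "(g has_field_derivative f' * (uz z / Z z)) (at z within S)"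
    by (rule has_field_derivative_transform_within[OF comp_deriv[OF z f] zero_less_one z]) (use g in auto)
  show ?thesis
    unfolding dz_within_def
  proof (rule the_equality)
    show "(g has_field_derivative f' * (uz z / Z z)) (at z within S)" by (rule *)
    fix D assume "(g has_field_derivative D) (at z within S)"
    with * show "D = f' * (uz z / Z z)"
      using tendsto_unique[OF S_at_nonbot[OF z]] by (auto simp: has_field_derivative_iff)
  qed
qed

end

sublocale turning_point \<subseteq> two: lg_branch lam D2 Zp
proof
  show "openin (top_of_set Cplus) D2" by (rule openin_D2_D3)
  show "continuous_on D2 Zp" by (rule continuous_on_Zp)
  show "zplus lam \<notin> D2" by (simp add: D2_def gamma2_eq G2_def)
  then show "Im (Zp z) > 0" if "z \<in> D2" "Re z = 2 * lam" "ic \<le> Im z" for z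
    using line_Im_ZR[of z] that by (auto simp: Zp_def D2_def)
qed (simp add: Zp_Z3_power2)

sublocale turning_point \<subseteq> three: lg_branch lam D3 Z3
proof
  show "openin (top_of_set Cplus) D3" by (rule openin_D2_D3)
  show "continuous_on D3 Z3" by (rule continuous_on_Z3)
  show "zplus lam \<notin> D3" by (simp add: D3_def gamma3_eq G3_def)
  then show "Im (Z3 z) > 0" if "z \<in> D3" "Re z = 2 * lam" "ic \<le> Im z" for z
    using line_Im_ZR[of z] that by (auto simp: Z3_def D3_def)
qed (simp add: Zp_Z3_power2)

section \<open>Coefficients and their primitives\<close>

text \<open>Cauchy's inequality on the circle of radius \<open>|u| / 2\<close> about
  \<open>u\<close>, which stays in the domain and gains one power of \<open>|u|\<close>.\<close>

lemma cauchy_deriv_decay: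
  assumes f: "f holomorphic_on {u. cmod u > R}" and R: "R > 0"
    and b: "\<And>u. cmod u > R \<Longrightarrow> cmod (f u) \<le> C / cmod u ^ k"
  shows "\<exists>C'. \<forall>u. cmod u > 2 * R \<longrightarrow> cmod (deriv f u) \<le> C' / cmod u ^ (Suc k)"
proof (intro exI allI impI)
  fix u :: complex assume u: "cmod u > 2 * R"
  define r where "r = cmod u / 2"
  have r: "r > 0" "r > R" "cmod u = 2 * r" using u R by (auto simp: r_def)
  have big: "cmod w \<ge> r" if "cmod (u - w) \<le> r" for w
    using that norm_triangle_ineq2[of u w] r by simp
  have "cmod (f (of_real (2 * R))) \<le> C / (2 * R) ^ k" using b[of "of_real (2 * R)"] R by simp
  then have "0 \<le> C / (2 * R) ^ k" using norm_ge_zero order_trans by blast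
  moreover have "0 < (2 * R) ^ k" using R by simp
  ultimately have C: "C \<ge> 0" using divide_neg_pos[of C "(2 * R) ^ k"] by linarith
  have "norm ((deriv ^^ 1) f u) \<le> fact 1 * (C / r ^ k) / r ^ 1"
  proof (rule Cauchy_inequality)
    show "f holomorphic_on ball u r"
    proof (rule holomorphic_on_subset[OF f], clarify)
      fix w assume "w \<in> ball u r"
      then have "cmod w \<ge> r" using big[of w] by (simp add: dist_norm)
      then show "cmod w > R" using r by simp
    qed
    show "continuous_on (cball u r) f"
    proof (rule continuous_on_subset[OF holomorphic_on_imp_continuous_on[OF f]], clarify)
      fix w assume "w \<in> cball u r"
      then have "cmod w \<ge> r" using big[of w] by (simp add: dist_norm)
      then show "cmod w > R" using r by simp
    qed
    fix w assume "cmod (u - w) = r"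
    then have w: "cmod w \<ge> r" using big[of w] by simp
    then have "cmod (f w) \<le> C / cmod w ^ k" using r by (intro b) simp
    also have "\<dots> \<le> C / r ^ k"
    proof -
      have "cmod w > 0" using w r by linarith
      then show ?thesis using w r C by (intro divide_left_mono power_mono mult_pos_pos zero_less_power) auto
    qed
    finally show "cmod (f w) \<le> C / r ^ k" .
  qed (use r in auto)
  also have "fact 1 * (C / r ^ k) / r ^ 1 = C * 2 ^ Suc k / cmod u ^ (Suc k)"
    using r by (simp add: power_mult_distrib field_simps)
  finally show "cmod (deriv f u) \<le> C * 2 ^ Suc k / cmod u ^ (Suc k)" by simp
qed

text \<open>The substitution \<open>t = 1 / u\<close> leads to \<open>- f (1 / t) / t^2\<close>,
  which is bounded near 0 and hence has a removable singularity and a primitive in a disc; its value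
  at \<open>t = 0\<close> is subtracted.\<close>

lemma primitive_at_infinity:
  assumes f: "f holomorphic_on {u. cmod u > R}" and R: "R > 0"
    and b: "\<And>u. cmod u > R \<Longrightarrow> cmod (f u) \<le> C / cmod u ^ 2"
  obtains F where "\<And>u. cmod u > R \<Longrightarrow> (F has_field_derivative f u) (at u)" "(F \<longlongrightarrow> 0) at_infinity"
proof -
  define \<psi> where "\<psi> = (\<lambda>t. - f (1 / t) / t ^ 2)"
  define B where "B = ball (0::complex) (1 / R)"
  have inv: "cmod (1 / t) > R" if "t \<in> B" "t \<noteq> 0" for t
    using that R by (simp add: B_def norm_divide field_simps)
  have "\<psi> holomorphic_on B - {0}"
    unfolding \<psi>_def
    by (intro holomorphic_intros holomorphic_on_compose_gen[OF _ f, of "\<lambda>t. 1 / t", unfolded o_def]) (use inv in auto)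
  moreover have "\<psi> \<in> O[at 0](\<lambda>_. 1)"
  proof (rule landau_o.bigI)
    show "eventually (\<lambda>t. norm (\<psi> t) \<le> (\<bar>C\<bar> + 1) * norm (1 :: complex)) (at 0)"
    proof -
      have "eventually (\<lambda>t. t \<in> B - {0}) (at 0)"
        using R by (intro eventually_at_in_open) (auto simp: B_def)
      then show ?thesis
      proof eventually_elim
        case (elim t)
        have "cmod (f (1 / t)) \<le> C / cmod (1 / t) ^ 2" using elim inv by (intro b) auto
        also have "\<dots> = C * cmod t ^ 2" by (simp add: norm_divide power_divide)
        finally have "cmod (\<psi> t) \<le> C" using elim by (simp add: \<psi>_def norm_divide norm_power divide_le_eq)
        then show ?case by simp
      qed
    qed
  qed simp
  ultimately obtain \<psi>' where \<psi>': "\<psi>' holomorphic_on B" "\<And>t. t \<in> B - {0} \<Longrightarrow> \<psi>' t = \<psi> t"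
    using holomorphic_on_extend[of \<psi> B 0] R by (auto simp: B_def)
  obtain \<Psi> where \<Psi>: "\<And>t. t \<in> B \<Longrightarrow> (\<Psi> has_field_derivative \<psi>' t) (at t within B)"
    using holomorphic_convex_primitive[of B "{}" \<psi>'] \<psi>'(1)
    by (auto simp: B_def holomorphic_on_imp_continuous_on holomorphic_on_imp_differentiable_at)
  then have \<Psi>': "(\<Psi> has_field_derivative \<psi>' t) (at t)" if "t \<in> B" for t
  proof -
    have "at t within B = at t" by (rule at_within_open[OF that]) (simp add: B_def)
    then show ?thesis using \<Psi>[OF that] by (simp only:)
  qed
  define F where "F = (\<lambda>u. \<Psi> (1 / u) - \<Psi> 0)"
  have "(F has_field_derivative f u) (at u)" if u: "cmod u > R" for u
  proof -
    have nz: "u \<noteq> 0" using u R by auto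
    have t: "1 / u \<in> B" "1 / u \<noteq> 0" using u R nz by (auto simp: B_def norm_divide field_simps)
    have "((\<lambda>u. 1 / u) has_field_derivative - (1 / u ^ 2)) (at u)"
      using nz by (auto intro!: derivative_eq_intros simp: power2_eq_square divide_inverse)
    from DERIV_chain2[OF \<Psi>'[OF t(1)] this]
    have "(F has_field_derivative \<psi>' (1 / u) * - (1 / u ^ 2) - 0) (at u)"
      unfolding F_def by (rule DERIV_diff[OF _ DERIV_const])
    moreover have "\<psi>' (1 / u) * - (1 / u ^ 2) - 0 = f u"
      using \<psi>'(2)[of "1 / u"] t nz by (simp add: \<psi>_def power_divide)
    ultimately show ?thesis by simp
  qed
  moreover have "(F \<longlongrightarrow> 0) at_infinity"
  proof -
    have "0 \<in> B" using R by (simp add: B_def)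
    then have "(\<Psi> \<longlongrightarrow> \<Psi> 0) (at 0)" using DERIV_isCont[OF \<Psi>'] by (simp add: isCont_def)
    moreover have "filterlim (\<lambda>u::complex. 1 / u) (at 0) at_infinity"
      using filterlim_inverse_at_infinity[THEN filterlim_compose, of "\<lambda>u. u"] tendsto_inverse_0
      by (auto simp: filterlim_at divide_inverse eventually_at_infinity intro!: exI[of _ 1])
    ultimately have "((\<lambda>u. \<Psi> (1 / u)) \<longlongrightarrow> \<Psi> 0) at_infinity" by (rule filterlim_compose)
    then show ?thesis unfolding F_def by (auto intro: tendsto_eq_intros)
  qed
  ultimately show ?thesis using that by blast
qed

section \<open>The coefficients as functions of u\<close>

context turning_point
begin

text \<open>Each \<open>Fhat s\<close> carries a factor \<open>z\<close>, which is split off here.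
  The integrand \<open>Z Fhat / z\<close> is then holomorphic also over \<open>z = 0\<close>, and in
  \<open>u\<close> only 0 and the branch points remain excluded.\<close>

fun Ku :: "nat \<Rightarrow> complex \<Rightarrow> complex" where
  "Ku 0 = (\<lambda>u. 0)"
| "Ku (Suc 0) = (\<lambda>u. - (zu u ^ 3 - 16 * zu u + 4 * of_real lam ^ 2 * zu u + 16 * of_real lam) / (2 * Zu u ^ 6))"
| "Ku (Suc (Suc m)) = (\<lambda>u. - (u / Zu u ^ 2) * deriv (\<lambda>u. zu u * Ku (Suc m) u) u
     - 1/2 * zu u * (\<Sum>j\<in>{1..<Suc m}. Ku j u * Ku (Suc m - j) u))"

definition Fu :: "nat \<Rightarrow> complex \<Rightarrow> complex" where "Fu s u = zu u * Ku s u"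

definition P0 :: "complex set" where "P0 = - {0, \<i> * of_real ic, - \<i> * of_real ic}"

lemma P0: "open P0" "W \<subseteq> P0" "u \<in> P0 \<Longrightarrow> u \<noteq> 0" "u \<in> P0 \<Longrightarrow> Zu u \<noteq> 0" "cmod u > ic \<Longrightarrow> u \<in> P0"
proof -
  show "open P0" unfolding P0_def by (intro open_Compl finite_imp_closed) simp
  show "W \<subseteq> P0" using W_nz by (auto simp: P0_def)
  show "u \<in> P0 \<Longrightarrow> u \<noteq> 0" by (simp add: P0_def)
  show "u \<in> P0 \<Longrightarrow> Zu u \<noteq> 0" using Zu_factor[of u] by (auto simp: P0_def eq_neg_iff_add_eq_0)
  show "cmod u > ic \<Longrightarrow> u \<in> P0" using ic(1) by (auto simp: P0_def norm_mult)
qed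

lemma zu_Zu_holomorphic: "zu holomorphic_on P0" "Zu holomorphic_on P0"
  unfolding zu_def Zu_def by (auto intro!: holomorphic_intros dest: P0(3))

lemma Ku_holomorphic: "Ku s holomorphic_on P0"
proof (induction s rule: Ku.induct)
  case 2
  then show ?case by (auto intro!: holomorphic_intros zu_Zu_holomorphic simp: P0(4))
next
  case (3 m)
  have IH: "Ku j holomorphic_on P0" if "j \<le> Suc m" for j
    using 3 that by (cases "j = Suc m"; cases "j = 0") auto
  show ?case
    unfolding Ku.simps
    by (intro holomorphic_intros zu_Zu_holomorphic holomorphic_deriv P0(1) IH) (auto simp: P0(4))
qed auto

lemma Fu_holomorphic: "Fu s holomorphic_on P0"
  unfolding Fu_def by (intro holomorphic_intros zu_Zu_holomorphic Ku_holomorphic)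

lemma Fu_deriv: "u \<in> W \<Longrightarrow> (Fu s has_field_derivative deriv (Fu s) u) (at u)"
  using Fu_holomorphic P0 holomorphic_derivI by blast

lemma Fu_Suc_Suc: "u \<noteq> 0 \<Longrightarrow> Zu u \<noteq> 0 \<Longrightarrow> Fu (Suc (Suc m)) u = - (zu u / Zu u) * (deriv (Fu (Suc m)) u * (u / Zu u))
     - 1/2 * (\<Sum>j\<in>{1..<Suc m}. Fu j u * Fu (Suc m - j) u)"
proof -
  assume u: "u \<noteq> 0" "Zu u \<noteq> 0"
  have "(\<Sum>j\<in>{1..<Suc m}. Fu j u * Fu (Suc m - j) u) = zu u * (zu u * (\<Sum>j\<in>{1..<Suc m}. Ku j u * Ku (Suc m - j) u))"
    unfolding Fu_def sum_distrib_left by (intro sum.cong) auto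
  moreover have "deriv (Fu (Suc m)) u = deriv (\<lambda>u. zu u * Ku (Suc m) u) u" by (simp add: Fu_def[abs_def])
  ultimately show ?thesis unfolding Fu_def[of "Suc (Suc m)"] Ku.simps
    using u by (simp add: algebra_simps power2_eq_square)
qed

lemma zu_Zu_bounds: "\<exists>R. R > ic \<and> R \<ge> 1 \<and> (\<forall>u. cmod u > R \<longrightarrow> cmod (zu u) \<le> cmod u \<and> cmod (Zu u) \<le> cmod u \<and> cmod u / 4 \<le> cmod (Zu u))"
proof (intro exI[of _ "5 + 2 * ic"] conjI allI impI)
  fix u :: complex assume u: "cmod u > 5 + 2 * ic"
  define b where "b = of_real (ic\<^sup>2) / u"
  have "cmod b = ic\<^sup>2 / cmod u" unfolding b_def norm_divide norm_of_real by simp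
  also have "\<dots> \<le> ic\<^sup>2 / ic"
  proof (rule divide_left_mono)
    show "ic \<le> cmod u" "0 < cmod u * ic" using u ic(1) by (linarith, intro mult_pos_pos) linarith+
  qed simp
  also have "\<dots> = ic" using ic(1) by (simp add: power2_eq_square)
  finally have b: "cmod b \<le> ic" .
  have l: "cmod (2 * complex_of_real lam) \<le> 2" using lam0 lam1 by (simp add: norm_mult)
  have "cmod (zu u) \<le> cmod (2 * complex_of_real lam) + cmod ((u - b) / 2)"
    unfolding zu_def b_def[symmetric] by (rule norm_triangle_ineq)
  moreover have "cmod ((u - b) / 2) \<le> (cmod u + cmod b) / 2"
    using norm_triangle_ineq4[of u b] by (simp add: norm_divide)
  ultimately show "cmod (zu u) \<le> cmod u" using l b u ic(1) by argo
  have "cmod (Zu u) \<le> (cmod u + cmod b) / 2"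
    unfolding Zu_def b_def[symmetric] using norm_triangle_ineq[of u b] by (simp add: norm_divide)
  then show "cmod (Zu u) \<le> cmod u" using b u ic(1) by argo
  have "cmod u - cmod b \<le> cmod (u + b)" using norm_triangle_ineq2[of u "- b"] by simp
  then have "(cmod u - cmod b) / 2 \<le> cmod (Zu u)"
    unfolding Zu_def b_def[symmetric] by (simp add: norm_divide)
  then show "cmod u / 4 \<le> cmod (Zu u)" using b u ic(1) by argo
qed (use ic(1) in auto)

text \<open>Order \<open>|u|^-3\<close> makes \<open>eu\<close> of order \<open>|u|^-2\<close>,
  which is integrable at infinity. In the recursion the derivative of \<open>zu Ku\<close> gains one
  power by \<open>cauchy_deriv_decay\<close>, and the products are even of order
  \<open>|u|^-5\<close>.\<close>

lemma Ku_decay: "\<exists>R C. R > ic \<and> R \<ge> 1 \<and> (\<forall>u. cmod u > R \<longrightarrow> cmod (Ku s u) \<le> C / cmod u ^ 3)"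
proof (induction s rule: less_induct)
  case (less s)
  obtain R0 where R0: "R0 > ic" "R0 \<ge> 1" "\<And>u. cmod u > R0 \<Longrightarrow> cmod (zu u) \<le> cmod u"
    "\<And>u. cmod u > R0 \<Longrightarrow> cmod u / 4 \<le> cmod (Zu u)" using zu_Zu_bounds by blast
  consider "s = 0" | "s = 1" | m where "s = Suc (Suc m)" by (metis One_nat_def not0_implies_Suc)
  then show ?case
  proof cases
    case 1 then show ?thesis using R0 by (intro exI[of _ R0] exI[of _ 0]) auto
  next
    case 2
    \<comment> \<open>The terms of the numerator contribute \<open>1 + 16 + 4 + 16 = 37\<close>, and
      \<open>4^6\<close> comes from \<open>|Zu u| \<ge> |u| / 4\<close>.\<close>
    have "cmod (Ku s u) \<le> (37 * 4 ^ 6) / cmod u ^ 3" if u: "cmod u > R0" for u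
    proof -
      define x where "x = cmod u"
      have x: "x \<ge> 1" "x > 0" using u R0 by (auto simp: x_def)
      have z: "cmod (zu u) \<le> x" using R0(3)[OF u] by (simp add: x_def)
      have p: "x \<le> x ^ 3" "1 \<le> x ^ 3" using x power_increasing[of 1 3 x] one_le_power[of x 3] by auto
      have l: "lam\<^sup>2 \<le> 1" "lam \<le> 1" "0 \<le> lam\<^sup>2" using lam0 lam1 by (auto simp: power_le_one)
      have "cmod (zu u ^ 3 - 16 * zu u + 4 * of_real lam ^ 2 * zu u + 16 * of_real lam)
          \<le> cmod (zu u ^ 3) + cmod (16 * zu u) + cmod (4 * of_real lam ^ 2 * zu u) + cmod (16 * complex_of_real lam)"
        by (intro norm_triangle_le norm_triangle_le_diff add_right_mono order_refl)
      also have "\<dots> = cmod (zu u) ^ 3 + 16 * cmod (zu u) + 4 * lam\<^sup>2 * cmod (zu u) + 16 * lam"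
        using lam0 by (simp add: norm_mult norm_power)
      also have "\<dots> \<le> x ^ 3 + 16 * x ^ 3 + 4 * 1 * x ^ 3 + 16 * x ^ 3"
        using z p l lam0 by (intro add_mono power_mono mult_mono) auto
      finally have num: "cmod (- (zu u ^ 3 - 16 * zu u + 4 * of_real lam ^ 2 * zu u + 16 * of_real lam)) \<le> 37 * x ^ 3"
        by (simp only: norm_minus_cancel)
      have den: "cmod (2 * Zu u ^ 6) \<ge> (x / 4) ^ 6"
      proof -
        have "(x / 4) ^ 6 \<le> cmod (Zu u) ^ 6" using R0(4)[OF u] x by (intro power_mono) (auto simp: x_def)
        moreover have "0 \<le> cmod (Zu u) ^ 6" by simp
        ultimately show ?thesis unfolding norm_mult norm_power norm_numeral by linarith
      qed
      have "cmod (Ku s u) \<le> 37 * x ^ 3 / (x / 4) ^ 6"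
        unfolding 2 One_nat_def Ku.simps norm_divide using num den x by (intro frac_le) auto
      also have "\<dots> = 37 * 4 ^ 6 / x ^ 3"
      proof -
        have "x ^ 6 = x ^ 3 * x ^ 3" by (simp flip: power_add)
        then have "(x / 4) ^ 6 = x ^ 3 * x ^ 3 / 4 ^ 6" by (simp only: power_divide)
        moreover have "37 * y / (y * y / 4 ^ 6) = 37 * 4 ^ 6 / y" if "y > 0" for y :: real
          using that by (simp add: field_simps)
        ultimately show ?thesis using x by (simp only: zero_less_power)
      qed
      finally show ?thesis by (simp add: x_def)
    qed
    then show ?thesis using R0 by blast
  next
    case (3 m)
    have "\<forall>j\<in>{..Suc m}. \<exists>R C. R > ic \<and> R \<ge> 1 \<and> (\<forall>u. cmod u > R \<longrightarrow> cmod (Ku j u) \<le> C / cmod u ^ 3)"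
      using less 3 by auto
    then obtain R C where RC: "\<And>j. j \<le> Suc m \<Longrightarrow> R j > ic \<and> R j \<ge> 1 \<and> (\<forall>u. cmod u > R j \<longrightarrow> cmod (Ku j u) \<le> C j / cmod u ^ 3)"
      unfolding bchoice_iff by (metis atMost_iff)
    define R1 where "R1 = Max (insert R0 (R ` {..Suc m}))"
    have R1: "R1 \<ge> R0" "\<And>j. j \<le> Suc m \<Longrightarrow> R1 \<ge> R j" unfolding R1_def by (rule Max_ge; auto)+
    have K: "cmod (Ku j u) \<le> C j / cmod u ^ 3" if "j \<le> Suc m" "cmod u > R1" for j u
      using RC[OF that(1)] R1(2)[OF that(1)] that(2) by auto
    have R1p: "R1 > ic" "R1 \<ge> 1" using R1 R0 by auto
    have "Fu (Suc m) holomorphic_on {u. cmod u > R1}"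
      by (rule holomorphic_on_subset[OF Fu_holomorphic]) (use R1p P0(5) in auto)
    moreover have "cmod (Fu (Suc m) u) \<le> C (Suc m) / cmod u ^ 2" if u: "cmod u > R1" for u
    proof -
      have "cmod (Fu (Suc m) u) \<le> cmod u * (C (Suc m) / cmod u ^ 3)"
        unfolding Fu_def norm_mult using R0(3)[of u] R1 u K[of "Suc m" u] by (intro mult_mono) auto
      also have "\<dots> = C (Suc m) / cmod u ^ 2" using u R1p by (simp add: power2_eq_square power3_eq_cube)
      finally show ?thesis .
    qed
    ultimately obtain C' where "\<forall>u. cmod u > 2 * R1 \<longrightarrow> cmod (deriv (Fu (Suc m)) u) \<le> C' / cmod u ^ Suc 2"
      using cauchy_deriv_decay[where R = R1 and f = "Fu (Suc m)" and C = "C (Suc m)" and k = 2] R1p by fastforce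
    moreover have "Suc 2 = 3" by simp
    ultimately have C': "cmod (deriv (Fu (Suc m)) u) \<le> C' / cmod u ^ 3" if "cmod u > 2 * R1" for u
      using that by (simp only:)
    define D where "D = 16 * \<bar>C'\<bar> + (\<Sum>j\<in>{1..<Suc m}. \<bar>C j\<bar> * \<bar>C (Suc m - j)\<bar>)"
    have "cmod (Ku s u) \<le> D / cmod u ^ 3" if u: "cmod u > 2 * R1" for u
    proof -
      define x where "x = cmod u"
      have x: "x > R1" "x \<ge> 1" "x > 0" "x > R0" using u R1p R1 by (auto simp: x_def)
      have "cmod (- (u / Zu u ^ 2) * deriv (\<lambda>u. zu u * Ku (Suc m) u) u) = x / cmod (Zu u) ^ 2 * cmod (deriv (Fu (Suc m)) u)"
        by (simp add: norm_mult norm_divide norm_power x_def Fu_def[abs_def])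
      also have "\<dots> \<le> x / (x / 4) ^ 2 * (\<bar>C'\<bar> / x ^ 3)"
      proof (intro mult_mono divide_left_mono power_mono)
        have "cmod (deriv (Fu (Suc m)) u) \<le> C' / x ^ 3" using C'[OF u] by (simp add: x_def)
        also have "\<dots> \<le> \<bar>C'\<bar> / x ^ 3" using x by (intro divide_right_mono) auto
        finally show "cmod (deriv (Fu (Suc m)) u) \<le> \<bar>C'\<bar> / x ^ 3" .
        show "x / 4 \<le> cmod (Zu u)" using R0(4)[of u] x by (simp add: x_def)
        then have "cmod (Zu u) > 0" using x by linarith
        then show "0 < cmod (Zu u) ^ 2 * (x / 4) ^ 2" using x by (intro mult_pos_pos zero_less_power) auto
      qed (use x in auto)
      also have "\<dots> = 16 * \<bar>C'\<bar> / x ^ 3 / x" using x by (simp add: power2_eq_square)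
      also have "\<dots> \<le> 16 * \<bar>C'\<bar> / x ^ 3" using x by (simp add: divide_le_eq mult_le_cancel_left1)
      finally have 1: "cmod (- (u / Zu u ^ 2) * deriv (\<lambda>u. zu u * Ku (Suc m) u) u) \<le> 16 * \<bar>C'\<bar> / x ^ 3" .
      have "cmod (\<Sum>j\<in>{1..<Suc m}. Ku j u * Ku (Suc m - j) u) \<le> (\<Sum>j\<in>{1..<Suc m}. \<bar>C j\<bar> * \<bar>C (Suc m - j)\<bar> / x ^ 6)"
      proof (rule sum_norm_le)
        fix j assume j: "j \<in> {1..<Suc m}"
        have Kj: "cmod (Ku j u) \<le> \<bar>C j\<bar> / x ^ 3" if "j \<le> Suc m" for j
        proof -
          have "cmod (Ku j u) \<le> C j / x ^ 3" using K[OF that, of u] x by (simp add: x_def)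
          also have "\<dots> \<le> \<bar>C j\<bar> / x ^ 3" using x by (intro divide_right_mono) auto
          finally show ?thesis .
        qed
        have "cmod (Ku j u * Ku (Suc m - j) u) \<le> \<bar>C j\<bar> / x ^ 3 * (\<bar>C (Suc m - j)\<bar> / x ^ 3)"
          unfolding norm_mult using j x by (intro mult_mono Kj) auto
        then show "cmod (Ku j u * Ku (Suc m - j) u) \<le> \<bar>C j\<bar> * \<bar>C (Suc m - j)\<bar> / x ^ 6"
          by (simp flip: power_add)
      qed
      also have "\<dots> = (\<Sum>j\<in>{1..<Suc m}. \<bar>C j\<bar> * \<bar>C (Suc m - j)\<bar>) / x ^ 6" by (rule sum_divide_distrib[symmetric])
      finally have s: "cmod (\<Sum>j\<in>{1..<Suc m}. Ku j u * Ku (Suc m - j) u) \<le> (\<Sum>j\<in>{1..<Suc m}. \<bar>C j\<bar> * \<bar>C (Suc m - j)\<bar>) / x ^ 6" .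
      define T where "T = (\<Sum>j\<in>{1..<Suc m}. \<bar>C j\<bar> * \<bar>C (Suc m - j)\<bar>)"
      have T: "T \<ge> 0" by (simp add: T_def sum_nonneg)
      have "cmod (1/2 * zu u * (\<Sum>j\<in>{1..<Suc m}. Ku j u * Ku (Suc m - j) u)) \<le> 1/2 * x * (T / x ^ 6)"
        unfolding norm_mult T_def using R0(3)[of u] x s by (intro mult_mono) (auto simp: x_def)
      also have "\<dots> \<le> T / x ^ 3"
      proof -
        have "x ^ 6 = x ^ 3 * (x * x\<^sup>2)" by (simp add: power2_eq_square eval_nat_numeral)
        then have "1/2 * x * (T / x ^ 6) = (T / x ^ 3) * (1 / (2 * x\<^sup>2))" using x by simp
        also have "\<dots> \<le> (T / x ^ 3) * 1"
        proof (rule mult_left_mono)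
          have "1 \<le> 2 * x\<^sup>2" using one_le_power[OF x(2), of 2] by simp
          then show "1 / (2 * x\<^sup>2) \<le> 1" by (subst divide_le_eq_1) (intro disjI1 conjI; linarith)
        qed (use T x in auto)
        finally show ?thesis by simp
      qed
      finally have 2: "cmod (1/2 * zu u * (\<Sum>j\<in>{1..<Suc m}. Ku j u * Ku (Suc m - j) u)) \<le> T / x ^ 3" .
      have "cmod (Ku s u) \<le> 16 * \<bar>C'\<bar> / x ^ 3 + T / x ^ 3"
        unfolding 3 Ku.simps by (rule order_trans[OF norm_triangle_ineq4 add_mono[OF 1 2]])
      then show ?thesis by (simp add: D_def T_def x_def add_divide_distrib)
    qed
    moreover have "2 * R1 > ic" "2 * R1 \<ge> 1" using R1p by auto
    ultimately show ?thesis by blast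
  qed
qed

text \<open>The integrand \<open>Z Fhat / (2 z)\<close> of \<open>Ehat\<close> in the variable
  \<open>u\<close>, where \<open>dz = (Z / u) du\<close>.\<close>

definition eu :: "nat \<Rightarrow> complex \<Rightarrow> complex" where "eu s u = Zu u ^ 2 * Ku s u / (2 * u)"

text \<open>The slit plane is starlike, which yields a primitive on all of it; near infinity
  \<open>primitive_at_infinity\<close> yields one that tends to 0. On the connected far region they
  differ by a constant, whose subtraction normalises the former.\<close>

lemma eu_primitive:
  "\<exists>E. (\<forall>u\<in>W. (E has_field_derivative eu s u) (at u)) \<and> (\<forall>\<epsilon>>0. \<exists>R. \<forall>u\<in>W. Im u \<ge> 0 \<longrightarrow> cmod u \<ge> R \<longrightarrow> cmod (E u) < \<epsilon>)"
proof -
  have hol: "eu s holomorphic_on P0"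
    unfolding eu_def by (intro holomorphic_intros zu_Zu_holomorphic Ku_holomorphic) (auto simp: P0(3))
  have star: "starlike W"
    unfolding starlike_def
  \<comment> \<open>The centre lies on the imaginary axis, above the end \<open>i ic\<close> of the
    slit.\<close>
  proof (intro bexI[of _ "\<i> * of_real (ic + 1)"] ballI)
    show "\<i> * of_real (ic + 1) \<in> W" by (simp add: W_def)
    fix u assume u: "u \<in> W"
    show "closed_segment (\<i> * of_real (ic + 1)) u \<subseteq> W"
    proof
      fix w assume "w \<in> closed_segment (\<i> * of_real (ic + 1)) u"
      then obtain t where t: "0 \<le> t" "t \<le> 1" "w = (1 - t) *\<^sub>R (\<i> * of_real (ic + 1)) + t *\<^sub>R u"
        by (auto simp: closed_segment_def)
      have w: "Re w = t * Re u" "Im w = (1 - t) * (ic + 1) + t * Im u" using t(3) by simp_all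
      show "w \<in> W"
      proof (cases "Re w = 0")
        case True
        then have "t = 0 \<or> Re u = 0" using w by simp
        then have "Im w > ic"
        proof
          assume "Re u = 0"
          then have "Im u > ic" using u by (simp add: W_def)
          define m where "m = min (ic + 1) (Im u)"
          have "m > ic" "m \<le> ic + 1" "m \<le> Im u" using \<open>Im u > ic\<close> by (auto simp: m_def)
          then have "(1 - t) * m + t * m \<le> Im w" unfolding w using t by (intro add_mono mult_left_mono) auto
          then show ?thesis using \<open>m > ic\<close> by (simp add: algebra_simps)
        qed (simp add: w)
        then show ?thesis by (simp add: W_def)
      qed (simp add: W_def)
    qed
  qed
  have "\<exists>g. \<forall>x\<in>W. (g has_field_derivative eu s x) (at x)"
  proof (rule holomorphic_starlike_primitive[OF _ star open_W, of _ "{}"])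
    show "continuous_on W (eu s)"
      using holomorphic_on_imp_continuous_on[OF hol] P0(2) continuous_on_subset by blast
    show "eu s field_differentiable at x" if "x \<in> W - {}" for x
      using hol P0(1,2) that holomorphic_on_imp_differentiable_at by blast
  qed simp
  then obtain E where E: "\<And>u. u \<in> W \<Longrightarrow> (E has_field_derivative eu s u) (at u)" by blast
  obtain R C where RC: "R > ic" "R \<ge> 1" "\<And>u. cmod u > R \<Longrightarrow> cmod (Ku s u) \<le> C / cmod u ^ 3"
    using Ku_decay[of s] by blast
  obtain R' where R': "R' > ic" "R' \<ge> 1" "\<And>u. cmod u > R' \<Longrightarrow> cmod (Zu u) \<le> cmod u"
    using zu_Zu_bounds by blast
  define M where "M = max R R'"
  have M: "M > ic" "M \<ge> 1" using RC R' by (auto simp: M_def)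
  have hol': "eu s holomorphic_on {u. cmod u > M}"
    by (rule holomorphic_on_subset[OF hol]) (use M P0(5) in auto)
  have "cmod (eu s u) \<le> \<bar>C\<bar> / cmod u ^ 2" if u: "cmod u > M" for u
  proof -
    define x where "x = cmod u"
    have x: "x > 0" "x > R" "x > R'" using u M by (auto simp: x_def M_def)
    have "cmod (eu s u) = cmod (Zu u) ^ 2 * cmod (Ku s u) / (2 * x)"
      by (simp add: eu_def norm_mult norm_divide norm_power x_def)
    also have "\<dots> \<le> x ^ 2 * (\<bar>C\<bar> / x ^ 3) / (2 * x)"
    proof (intro divide_right_mono mult_mono power_mono)
      have "cmod (Ku s u) \<le> C / x ^ 3" using RC(3)[of u] x by (simp add: x_def)
      also have "\<dots> \<le> \<bar>C\<bar> / x ^ 3" using x by (intro divide_right_mono) auto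
      finally show "cmod (Ku s u) \<le> \<bar>C\<bar> / x ^ 3" .
    qed (use R'(3)[of u] x in \<open>auto simp: x_def\<close>)
    also have "\<dots> = (\<bar>C\<bar> / x ^ 2) / 2" using x by (simp add: power2_eq_square power3_eq_cube)
    also have "\<dots> \<le> \<bar>C\<bar> / x ^ 2"
    proof -
      have h: "a / 2 \<le> a" if "a \<ge> 0" for a :: real using that by simp
      have "0 \<le> \<bar>C\<bar> / x ^ 2" by (intro divide_nonneg_nonneg abs_ge_zero zero_le_power2)
      then show ?thesis by (rule h)
    qed
    finally show ?thesis by (simp add: x_def)
  qed
  then obtain F where F: "\<And>u. cmod u > M \<Longrightarrow> (F has_field_derivative eu s u) (at u)" "(F \<longlongrightarrow> 0) at_infinity"
    using primitive_at_infinity[OF hol', of "\<bar>C\<bar>"] M by auto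
  \<comment> \<open>The far part of the plane without the negative imaginary axis, in polar
    coordinates so that connectedness is evident. It contains all points of \<open>W\<close> of
    modulus above \<open>M\<close>.\<close>
  define Q where "Q = (\<lambda>(r, \<theta>). complex_of_real r * cis \<theta>) ` ({M<..} \<times> {- pi / 2<..<3 * pi / 2})"
  have "connected Q" unfolding Q_def
    by (intro connected_continuous_image connected_Times) (auto simp: case_prod_unfold intro!: continuous_intros)
  have Qsub: "u \<in> Q" if u: "cmod u > M" "Re u \<noteq> 0 \<or> Im u > 0" for u
  proof -
    have pol: "u = of_real (cmod u) * cis (Arg u)" by (metis rcis_cmod_Arg rcis_def)
    have rng: "- pi < Arg u" "Arg u \<le> pi" using mpi_less_Arg Arg_le_pi by auto
    show ?thesis
    proof (cases "Arg u > - pi / 2")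
      case True
      then show ?thesis unfolding Q_def using pol u rng pi_gt_zero
        by (intro image_eqI[of _ _ "(cmod u, Arg u)"]) auto
    next
      case False
      have "Arg u \<noteq> - pi / 2"
      proof
        assume "Arg u = - pi / 2"
        then have "u = - \<i> * of_real (cmod u)" using pol by (simp add: complex_eq_iff)
        then have "Re u = 0" "Im u = - cmod u" by (metis Re_i_times mult_minus_left Re_complex_of_real Im_complex_of_real minus_zero uminus_complex.sel(1) neg_equal_0_iff_equal,
             metis Im_i_times mult_minus_left Re_complex_of_real uminus_complex.sel(2))
        then show False using u(2) by simp
      qed
      then show ?thesis unfolding Q_def using pol u rng False pi_gt_zero
        by (intro image_eqI[of _ _ "(cmod u, Arg u + 2 * pi)"]) (auto simp flip: cis_mult)
    qed
  qed
  have QW: "u \<in> W \<and> cmod u > M" if "u \<in> Q" for u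
  proof -
    from that obtain x where x: "x \<in> {M<..} \<times> {- pi / 2<..<3 * pi / 2}" "u = (\<lambda>(r, \<theta>). complex_of_real r * cis \<theta>) x"
      unfolding Q_def by (elim imageE)
    define r \<theta> where "r = fst x" "\<theta> = snd x"
    have r: "r > M" "- pi / 2 < \<theta>" "\<theta> < 3 * pi / 2" "u = of_real r * cis \<theta>"
      using x by (cases x; simp add: r_\<theta>_def)+
    have "cos \<theta> = 0 \<Longrightarrow> \<theta> = pi / 2"
    proof -
      assume "cos \<theta> = 0"
      then have "sin (\<theta> - pi / 2) = 0" by (simp add: sin_diff)
      then obtain i :: int where i: "\<theta> - pi / 2 = of_int i * pi" by (auto simp: sin_zero_iff_int2)
      have "- 1 < real_of_int i" "real_of_int i < 1"
      proof -
        have "- 1 * pi < real_of_int i * pi" "real_of_int i * pi < 1 * pi" using i r by linarith+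
        then show "- 1 < real_of_int i" "real_of_int i < 1" using pi_gt_zero mult_less_cancel_right_pos by blast+
      qed
      then have "i = 0" by linarith
      then show ?thesis using i by simp
    qed
    then have "cos \<theta> = 0 \<Longrightarrow> sin \<theta> = 1" by (metis sin_pi_half)
    then show ?thesis using r M ic(1) by (cases "cos \<theta> = 0") (auto simp: W_def norm_mult)
  qed
  have Qeq: "Q = {u. cmod u > M} \<inter> ({u. Re u \<noteq> 0} \<union> {u. Im u > 0})"
  proof (intro set_eqI iffI)
    show "u \<in> {u. cmod u > M} \<inter> ({u. Re u \<noteq> 0} \<union> {u. Im u > 0})" if "u \<in> Q" for u
      using QW[OF that] ic(1) by (auto simp: W_def)
  qed (use Qsub in auto)
  have "open Q" unfolding Qeq
    by (intro open_Int open_Un open_Collect_neq open_Collect_less continuous_intros)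
  have d0: "((\<lambda>u. E u - F u) has_field_derivative 0) (at u)" if "u \<in> Q" for u
    using DERIV_diff[OF E F(1), of u] QW[OF that] by simp
  have "continuous_on Q (\<lambda>u. E u - F u)"
    using d0 DERIV_isCont continuous_at_imp_continuous_on by blast
  then obtain L where L: "\<And>u. u \<in> Q \<Longrightarrow> E u - F u = L"
    using DERIV_zero_connected_constant[OF \<open>connected Q\<close> \<open>open Q\<close>, of "{}"] d0 by auto
  show ?thesis
  proof (intro exI[of _ "\<lambda>u. E u - L"] conjI ballI allI impI)
    fix u assume "u \<in> W"
    then show "((\<lambda>u. E u - L) has_field_derivative eu s u) (at u)" using DERIV_diff[OF E DERIV_const] by fastforce
  next
    fix \<epsilon> :: real assume "\<epsilon> > 0"
    then have "eventually (\<lambda>u. dist (F u) 0 < \<epsilon>) at_infinity" by (rule tendstoD[OF F(2)])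
    then obtain B where B: "\<And>u. cmod u \<ge> B \<Longrightarrow> cmod (F u) < \<epsilon>" by (auto simp: eventually_at_infinity dist_norm)
    show "\<exists>R. \<forall>u\<in>W. Im u \<ge> 0 \<longrightarrow> cmod u \<ge> R \<longrightarrow> cmod (E u - L) < \<epsilon>"
    proof (intro exI[of _ "max B (M + 1)"] ballI impI)
      fix u assume u: "u \<in> W" "Im u \<ge> 0" "max B (M + 1) \<le> cmod u"
      then have "u \<in> Q" by (intro Qsub) (use ic(1) in \<open>auto simp: W_def\<close>)
      then have "E u - L = F u" using L[of u] by (simp add: algebra_simps)
      then show "cmod (E u - L) < \<epsilon>" using B u by simp
    qed
  qed
qed

definition Eu :: "nat \<Rightarrow> complex \<Rightarrow> complex" where
  "Eu s = (SOME E. (\<forall>u\<in>W. (E has_field_derivative eu s u) (at u)) \<and> (\<forall>\<epsilon>>0. \<exists>R. \<forall>u\<in>W. Im u \<ge> 0 \<longrightarrow> cmod u \<ge> R \<longrightarrow> cmod (E u) < \<epsilon>))"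

lemma Eu: "u \<in> W \<Longrightarrow> (Eu s has_field_derivative eu s u) (at u)"
  "\<epsilon> > 0 \<Longrightarrow> \<exists>R. \<forall>u\<in>W. Im u \<ge> 0 \<longrightarrow> cmod u \<ge> R \<longrightarrow> cmod (Eu s u) < \<epsilon>"
  using someI_ex[OF eu_primitive[of s]] unfolding Eu_def[symmetric] by blast+

end

section \<open>Principal values and their continuations\<close>

lemma Ln_up_range:
  assumes "w \<noteq> 0"
  shows "- pi / 2 < Im (Ln_up w)" "Im (Ln_up w) \<le> 3 * pi / 2"
proof -
  have "- \<i> * w \<noteq> 0" using assms by simp
  then have "- pi < Im (Ln (- \<i> * w))" "Im (Ln (- \<i> * w)) \<le> pi" using mpi_less_Im_Ln Im_Ln_le_pi by blast+
  then show "- pi / 2 < Im (Ln_up w)" "Im (Ln_up w) \<le> 3 * pi / 2" unfolding Ln_up_def by (simp_all add: field_simps)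
qed

lemma Ln_up_eq_Ln_right:
  assumes "Re w > 0"
  shows "Ln_up w = Ln w"
proof -
  have nz: "w \<noteq> 0" "- \<i> * w \<noteq> 0" using assms by auto
  have "\<not> (0 < Im (Ln (- \<i> * w)) \<and> Im (Ln (- \<i> * w)) < pi)"
    using Im_Ln_pos_lt[OF nz(2)] assms by simp
  moreover have "Im (Ln (- \<i> * w)) \<noteq> pi" using Im_Ln_eq_pi[OF nz(2)] assms by auto
  moreover have "- pi < Im (Ln (- \<i> * w))" "Im (Ln (- \<i> * w)) \<le> pi" using nz mpi_less_Im_Ln Im_Ln_le_pi by blast+
  moreover have "Im (Ln_up w) = Im (Ln (- \<i> * w)) + pi / 2" unfolding Ln_up_def by simp
  ultimately have "- pi < Im (Ln_up w)" "Im (Ln_up w) \<le> pi" using pi_gt_zero by linarith+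
  then show ?thesis using Ln_unique[OF exp_Ln_up[OF nz(1)]] by simp
qed

lemma exp_eq_of_small_Im:
  assumes "exp a = exp b" "\<bar>Im a - Im b\<bar> < 2 * pi"
  shows "a = b"
  using assms exp_complex_eqI by blast

text \<open>Both sides are logarithms of the same number. The imaginary parts of
  \<open>Ln_up u\<close>, \<open>Ln_up (u - a)\<close> and \<open>Ln (1 - a / u)\<close> lie in
  \<open>[0, \<pi>]\<close>, \<open>(- \<pi> / 2, 3 \<pi> / 2]\<close> and
  \<open>(- \<pi> / 2, \<pi> / 2)\<close>, so the two sides differ by less than
  \<open>2 \<pi>\<close>.\<close>

lemma Ln_up_diff:
  assumes u: "Im u \<ge> 0" "cmod a < cmod u"
  shows "Ln_up (u - a) - Ln_up u = Ln (1 - a / u)"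
proof (rule exp_eq_of_small_Im)
  have nz: "u \<noteq> 0" "u - a \<noteq> 0" using u by auto
  have n1: "cmod (a / u) < 1" using u nz by (simp add: norm_divide)
  then have re: "Re (1 - a / u) > 0" using complex_Re_le_cmod[of "a / u"] by simp
  then have "1 - a / u \<noteq> 0" by auto
  then show "exp (Ln_up (u - a) - Ln_up u) = exp (Ln (1 - a / u))"
    using nz exp_Ln_up[of u] exp_Ln_up[of "u - a"] by (simp add: exp_diff diff_divide_distrib)
  have "\<bar>Im (Ln (1 - a / u))\<bar> < pi / 2" using Re_Ln_pos_lt[of "1 - a / u"] re \<open>1 - a / u \<noteq> 0\<close> by blast
  moreover have "0 \<le> Im (Ln_up u)" "Im (Ln_up u) \<le> pi"
    using Im_Ln_pos_le[OF nz(1)] u(1) Ln_up_eq_Ln[OF nz(1) u(1)] by auto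
  moreover note Ln_up_range[OF nz(2)]
  ultimately show "\<bar>Im (Ln_up (u - a) - Ln_up u) - Im (Ln (1 - a / u))\<bar> < 2 * pi"
    unfolding abs_less_iff minus_complex.sel by linarith
qed

lemma holomorphic_zero_on_connected:
  assumes "f holomorphic_on S" "open S" "connected S" "open U" "U \<subseteq> S" "U \<noteq> {}" "\<And>z. z \<in> U \<Longrightarrow> f z = 0" "w \<in> S"
  shows "f w = 0"
  using analytic_continuation_open[OF assms(4,2,6,3,5) assms(1) holomorphic_on_const[of 0], of w] assms(7,8) by auto

lemma Cplus_local_convex:
  assumes S: "openin (top_of_set Cplus) S" and z: "z \<in> S"
  obtains r where "r > 0" "ball z r \<inter> {w. Im w \<ge> 0} \<subseteq> S"
proof -
  obtain T where T: "open T" "S = Cplus \<inter> T" using S by (auto simp: openin_open)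
  have "open (T - {0})" "z \<in> T - {0}" using T z by (auto simp: Cplus_def)
  then obtain r where "r > 0" "ball z r \<subseteq> T - {0}" by (meson openE)
  then show ?thesis using that[of r] T by (auto simp: Cplus_def)
qed

lemma half_ball_point:
  assumes "w \<in> ball z r" "Im w \<ge> 0" "open T" "w \<in> T"
  obtains v where "v \<in> ball z r" "Im v > 0" "v \<in> T"
proof -
  have "open (ball z r \<inter> T)" "w \<in> ball z r \<inter> T" using assms by auto
  then obtain e where e: "e > 0" "ball w e \<subseteq> ball z r \<inter> T" by (meson openE)
  have "w + \<i> * of_real (e / 2) \<in> ball w e" using e by (simp add: dist_norm norm_mult)
  moreover have "Im (w + \<i> * of_real (e / 2)) > 0" using assms(2) e(1) by simp
  ultimately show ?thesis using that e by blast
qed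

text \<open>Real points of S are boundary points, so the identity theorem is applied in the upper halves of small balls.\<close>

lemma half_plane_identity:
  assumes S: "openin (top_of_set Cplus) S" "connected S"
    and cont: "continuous_on S f" and hol: "f holomorphic_on interior S"
    and U: "openin (top_of_set Cplus) U" "U \<subseteq> S" "U \<noteq> {}" "\<And>z. z \<in> U \<Longrightarrow> f z = 0" and b: "b \<in> S"
  shows "f b = 0"
proof -
  \<comment> \<open>Vanishing near a point is propagated through the connected set \<open>S\<close>.
    Two points of one small ball share the property because \<open>f\<close> then vanishes on the
    open half ball \<open>B\<close> and, by continuity, on its real boundary points in the
    ball.\<close>
  define P where "P = (\<lambda>z. \<exists>T. open T \<and> z \<in> T \<and> (\<forall>w\<in>T \<inter> S. f w = 0))"
  obtain a where a: "a \<in> U" using U(3) by blast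
  have "P a"
  proof -
    obtain T where "open T" "U = Cplus \<inter> T" using U(1) by (auto simp: openin_open)
    moreover have "S \<subseteq> Cplus" using S(1) by (auto simp: openin_open)
    ultimately show ?thesis unfolding P_def using a U(4) by (intro exI[of _ T]) auto
  qed
  have "P b"
  proof (rule connected_induction_simple[OF S(2) _ b, of a P])
    show "a \<in> S" using a U by blast
    show "P a" by fact
    fix z assume z: "z \<in> S"
    obtain r where r: "r > 0" "ball z r \<inter> {w. Im w \<ge> 0} \<subseteq> S" using Cplus_local_convex[OF S(1) z] by blast
    define B where "B = ball z r \<inter> {w. Im w > 0}"
    have B: "open B" "connected B" "B \<subseteq> S" unfolding B_def
      using r by (auto intro!: open_halfspace_Im_gt convex_connected convex_Int convex_halfspace_Im_gt)
    then have holB: "f holomorphic_on B" using hol interior_maximal holomorphic_on_subset by metis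
    have Sim: "Im w \<ge> 0" if "w \<in> S" for w using that S(1) by (auto simp: openin_open Cplus_def)
    have step: "P y" if x: "x \<in> ball z r \<inter> S" "P x" and y: "y \<in> ball z r \<inter> S" for x y
    proof -
      obtain T where T: "open T" "x \<in> T" "\<And>w. w \<in> T \<inter> S \<Longrightarrow> f w = 0" using x(2) unfolding P_def by blast
      obtain v where "v \<in> ball z r" "Im v > 0" "v \<in> T" by (rule half_ball_point[of x z r T]) (use x T Sim in auto)
      then have ne: "T \<inter> B \<noteq> {}" by (auto simp: B_def)
      have zero: "f w = 0" if "w \<in> B" for w
        by (rule holomorphic_zero_on_connected[OF holB B(1,2) _ _ ne _ that]) (use T B in auto)
      have "f w = 0" if w: "w \<in> ball z r \<inter> S" for w
      proof (rule ccontr)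
        assume "f w \<noteq> 0"
        then have "open (- {0::complex})" "f w \<in> - {0}" by auto
        then obtain T' where T': "open T'" "w \<in> T'" "\<And>v. v \<in> S \<Longrightarrow> v \<in> T' \<Longrightarrow> f v \<in> - {0}"
          using cont[unfolded continuous_on_topological, rule_format, of w "- {0}"] w by auto
        obtain v where "v \<in> ball z r" "Im v > 0" "v \<in> T'" by (rule half_ball_point[of w z r T']) (use w T' Sim in auto)
        then have "v \<in> B" "v \<in> T'" by (auto simp: B_def)
        then show False using zero T'(3) B(3) by auto
      qed
      then show "P y" unfolding P_def using y by (intro exI[of _ "ball z r"]) auto
    qed
    have "openin (top_of_set S) (ball z r \<inter> S)"
      by (metis Int_commute open_ball openin_open_Int)
    moreover have "z \<in> ball z r \<inter> S" using r(1) z by simp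
    ultimately show "\<exists>T. openin (top_of_set S) T \<and> z \<in> T \<and> (\<forall>x\<in>T. \<forall>y\<in>T. P x \<longrightarrow> P y)"
      using step by blast
  qed
  then show ?thesis using b unfolding P_def by blast
qed

section \<open>The phase and the root of z/Z in the variable u\<close>

context turning_point
begin

text \<open>In terms of \<open>u\<close> the argument \<open>(Z - lam z + 2) / z\<close> of the
  second logarithm is \<open>(1 - lam) (u - u2) / (u - u1)\<close>, and \<open>z / Z\<close> in
  \<open>sigma\<close> is a quotient of linear factors. The cuts of the logarithms used all avoid
  \<open>Wz\<close>.\<close>

definition xiu :: "complex \<Rightarrow> complex" where
  "xiu u = Zu u / 2 - of_real lam * Ln_up u + Ln_up (u - of_real u1) - Ln_up (u - of_real u2) - of_real (ln (1 - lam))"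
definition sigma :: "complex \<Rightarrow> complex" where
  "sigma u = exp ((Ln_up (u - of_real u1) + Ln_up (u - of_real u2) - Ln_up (u - \<i> * of_real ic) - Ln_up (u + \<i> * of_real ic)) / 2)"

lemma Wz_up:
  assumes "u \<in> Wz"
  shows "Re u \<noteq> 0 \<or> Im u > 0" "Re (u - of_real u1) \<noteq> 0 \<or> Im (u - of_real u1) > 0"
    "Re (u - of_real u2) \<noteq> 0 \<or> Im (u - of_real u2) > 0"
    "Re (u - \<i> * of_real ic) \<noteq> 0 \<or> Im (u - \<i> * of_real ic) > 0"
    "Re (u + \<i> * of_real ic) \<noteq> 0 \<or> Im (u + \<i> * of_real ic) > 0"
  using assms ic(1) by (auto simp: Wz_def W_def complex_eq_iff)

lemma Wz_nz:
  assumes "u \<in> Wz"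
  shows "u \<noteq> 0" "Zu u \<noteq> 0" "zu u \<noteq> 0" "u - of_real u1 \<noteq> 0" "u - of_real u2 \<noteq> 0"
    "u - \<i> * of_real ic \<noteq> 0" "u + \<i> * of_real ic \<noteq> 0" "u \<in> W" "Im u \<ge> 0"
proof -
  show W: "u \<in> W" "Im u \<ge> 0" and "u - of_real u1 \<noteq> 0" "u - of_real u2 \<noteq> 0" using assms by (auto simp: Wz_def)
  then show "u \<noteq> 0" "Zu u \<noteq> 0" "u - \<i> * of_real ic \<noteq> 0" "u + \<i> * of_real ic \<noteq> 0"
    using W_nz[OF W(1)] Zu_nz[OF W(1)] by (auto simp: eq_neg_iff_add_eq_0)
  then show "zu u \<noteq> 0" using zu_factor[of u] \<open>u - of_real u1 \<noteq> 0\<close> \<open>u - of_real u2 \<noteq> 0\<close> by simp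
qed

lemma Ln_up_shift_deriv:
  assumes "Re (u - a) \<noteq> 0 \<or> Im (u - a) > 0"
  shows "((\<lambda>u. Ln_up (u - a)) has_field_derivative 1 / (u - a)) (at u)"
proof -
  have "((\<lambda>u. u - a) has_field_derivative 1) (at u)" by (auto intro!: derivative_eq_intros)
  from DERIV_chain2[OF Ln_up_deriv[OF assms] this] show ?thesis by simp
qed

lemma Zu_deriv: "u \<noteq> 0 \<Longrightarrow> (Zu has_field_derivative (1 - of_real (ic\<^sup>2) / u ^ 2) / 2) (at u)"
  unfolding Zu_def[abs_def] by (auto intro!: derivative_eq_intros simp: power2_eq_square)

text \<open>The stated derivative is \<open>d xi / dz = Z / (2 z)\<close> times
  \<open>dz / du = Z / u\<close>; differentiating the logarithms gives its partial fractions in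
  \<open>u\<close>.\<close>

lemma xiu_deriv:
  assumes u: "u \<in> Wz"
  shows "(xiu has_field_derivative Zu u ^ 2 / (2 * zu u * u)) (at u)"
proof -
  note nz = Wz_nz[OF u] and up = Wz_up[OF u]
  define c where "c = complex_of_real (ic\<^sup>2)"
  define l where "l = complex_of_real lam"
  define a b where "a = u - of_real u1" "b = u - of_real u2"
  have c: "c = 4 * (1 - l ^ 2)" unfolding c_def l_def ic(2) by simp
  have ab: "a = u - 2 + 2 * l" "b = u + 2 + 2 * l" by (simp_all add: a_b_def u1_def u2_def l_def)
  have "(xiu has_field_derivative ((1 - c / u ^ 2) / 2 / 2 - l * (1 / u) + 1 / a - 1 / b - 0)) (at u)"
    unfolding xiu_def[abs_def] c_def l_def a_b_def
    by (intro DERIV_diff DERIV_add DERIV_cdivide DERIV_cmult Zu_deriv Ln_up_shift_deriv Ln_up_deriv DERIV_const nz up)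
  moreover have "(1 - c / u ^ 2) / 2 / 2 - l * (1 / u) + 1 / a - 1 / b - 0 = Zu u ^ 2 / (2 * zu u * u)"
  proof -
    have ann: "a \<noteq> 0" "b \<noteq> 0" "u \<noteq> 0" using nz by (simp_all add: a_b_def)
    have "Zu u = (u ^ 2 + c) / (2 * u)" using nz(1) by (simp add: Zu_def c_def power2_eq_square field_simps)
    moreover have "zu u = a * b / (2 * u)" using zu_factor[OF nz(1)] by (simp add: a_b_def)
    ultimately have r: "Zu u ^ 2 / (2 * zu u * u) = (u ^ 2 + c) ^ 2 / (4 * u ^ 2 * (a * b))"
      using ann by (simp add: power_divide power_mult_distrib)
    have "((1 - c / u ^ 2) / 2 / 2 - l * (1 / u) + 1 / a - 1 / b - 0) * (4 * u ^ 2 * (a * b))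
        = (u ^ 2 - c - 4 * l * u) * (a * b) + 4 * u ^ 2 * (b - a)"
      using ann by (simp add: field_simps power2_eq_square)
    also have "\<dots> = (u ^ 2 + c) ^ 2"
      unfolding c ab by (simp add: power2_eq_square algebra_simps)
    finally show ?thesis unfolding r using ann by (simp add: eq_divide_eq)
  qed
  ultimately show ?thesis by simp
qed

lemma exp_half_square: "exp (a / 2) ^ 2 = exp (a :: complex)"
proof -
  have "exp (a / 2) ^ 2 = exp (of_nat 2 * (a / 2))" by (rule exp_of_nat_mult[symmetric])
  then show ?thesis by simp
qed

lemma sigma_square:
  assumes u: "u \<in> Wz"
  shows "sigma u ^ 2 = zu u / Zu u"
proof -
  note nz = Wz_nz[OF u]
  have "sigma u ^ 2 = (u - of_real u1) * (u - of_real u2) / ((u - \<i> * of_real ic) * (u + \<i> * of_real ic))"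
    unfolding sigma_def exp_half_square using nz by (simp add: exp_diff exp_add exp_Ln_up)
  then show ?thesis using nz(1) by (simp add: zu_factor Zu_factor)
qed

lemma sigma_nz: "sigma u \<noteq> 0"
  by (simp add: sigma_def)

lemma sigma_deriv:
  assumes u: "u \<in> Wz"
  shows "(sigma has_field_derivative sigma u * ((1 / (u - of_real u1) + 1 / (u - of_real u2)
      - 1 / (u - \<i> * of_real ic) - 1 / (u + \<i> * of_real ic)) / 2)) (at u)"
proof -
  note up = Wz_up[OF u]
  have "Re (u - - (\<i> * of_real ic)) \<noteq> 0 \<or> Im (u - - (\<i> * of_real ic)) > 0" using up(5) by simp
  from Ln_up_shift_deriv[OF this]
  have p: "((\<lambda>u. Ln_up (u + \<i> * of_real ic)) has_field_derivative 1 / (u + \<i> * of_real ic)) (at u)" by simp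
  have "((\<lambda>u. (Ln_up (u - of_real u1) + Ln_up (u - of_real u2) - Ln_up (u - \<i> * of_real ic) - Ln_up (u + \<i> * of_real ic)) / 2)
      has_field_derivative (1 / (u - of_real u1) + 1 / (u - of_real u2) - 1 / (u - \<i> * of_real ic) - 1 / (u + \<i> * of_real ic)) / 2) (at u)"
    by (intro DERIV_cdivide DERIV_diff DERIV_add Ln_up_shift_deriv up p)
  from DERIV_chain2[OF DERIV_exp this] show ?thesis unfolding sigma_def[abs_def] .
qed

lemma xiu_value:
  assumes u: "u \<in> Wz"
  defines "b \<equiv> Ln_up (u - of_real u2) - Ln_up (u - of_real u1) + of_real (ln (1 - lam))"
  shows "exp (Ln_up u) = Zu u + zu u - 2 * of_real lam"
    "exp b = (Zu u - of_real lam * zu u + 2) / zu u"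
    "xiu u = Zu u / 2 - of_real lam * Ln_up u - b"
proof -
  note nz = Wz_nz[OF u]
  define l where "l = complex_of_real lam"
  define c where "c = complex_of_real (ic\<^sup>2)"
  have c: "c = 4 * (1 - l ^ 2)" unfolding c_def l_def ic(2) by simp
  show "exp (Ln_up u) = Zu u + zu u - 2 * of_real lam"
    using nz(1) by (simp add: exp_Ln_up Zu_def zu_def add_divide_distrib diff_divide_distrib)
  show "xiu u = Zu u / 2 - of_real lam * Ln_up u - b" by (simp add: xiu_def b_def)
  have l1: "exp (complex_of_real (ln (1 - lam))) = 1 - l"
    using lam1 by (simp add: exp_of_real l_def)
  define B where "B = u + 2 + 2 * l"
  have B: "u - of_real u2 = B" by (simp add: u2_def B_def l_def)
  have e: "exp b = B / (u - of_real u1) * (1 - l)"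
    unfolding b_def using nz l1 by (simp add: exp_add exp_diff exp_Ln_up B)
  have "(Zu u - l * zu u + 2) * (2 * u) = (u ^ 2 + c) - l * (4 * l * u + u ^ 2 - c) + 4 * u"
    using nz(1) by (simp add: Zu_def zu_def c_def l_def power2_eq_square field_simps)
  also have "\<dots> = (1 - l) * B ^ 2" unfolding c B_def by (simp add: power2_eq_square algebra_simps)
  finally have "Zu u - l * zu u + 2 = (1 - l) * B ^ 2 / (2 * u)" using nz(1) by (simp add: eq_divide_eq)
  moreover have "zu u = (u - of_real u1) * B / (2 * u)" using zu_factor[OF nz(1)] B by simp
  ultimately have "(Zu u - l * zu u + 2) / zu u = (1 - l) * B ^ 2 / ((u - of_real u1) * B)"
    using nz(1) by simp
  then show "exp b = (Zu u - of_real lam * zu u + 2) / zu u"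
    unfolding e using nz(5) B by (simp add: power2_eq_square l_def)
qed

text \<open>On the positive axis \<open>Zsq\<close> is positive, so the root is real and nonzero and
  by connectedness of constant sign; the point 3 lies right of the vertical line and decides the
  sign. Positivity of \<open>u\<close> and of \<open>zu u\<close> then forces
  \<open>u > u1\<close>.\<close>

lemma real_axis:
  assumes x: "x > 0"
  shows "Zp (of_real x) \<in> \<real>" "Re (Zp (of_real x)) > 0" "two.uz (of_real x) \<in> \<real>" "Re (two.uz (of_real x)) > u1"
proof -
  have real: "Im (Zp (of_real x)) = 0 \<and> Re (Zp (of_real x)) \<noteq> 0" if "x > 0" for x :: real
  proof -
    define w where "w = Zp (of_real x)"
    have w2: "w ^ 2 = of_real ((x - 2 * lam)\<^sup>2 + ic\<^sup>2)"
      unfolding w_def Zp_Z3_power2 ic(2) by (simp add: Zsq_def power2_eq_square algebra_simps)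
    have pos: "(x - 2 * lam)\<^sup>2 + ic\<^sup>2 > 0" using ic(1) by (simp add: add_nonneg_pos)
    have "Re (w ^ 2) > 0" "Im (w ^ 2) = 0" unfolding w2 using pos by simp_all
    then have "(Re w)\<^sup>2 - (Im w)\<^sup>2 > 0" "Re w = 0 \<or> Im w = 0" by (auto simp: power2_eq_square)
    moreover have "0 \<le> (Im w)\<^sup>2" by simp
    ultimately have "(Re w)\<^sup>2 > 0" "Re w = 0 \<or> Im w = 0" by linarith+
    then have "Re w \<noteq> 0" "Im w = 0" by auto
    then show ?thesis by (simp add: w_def)
  qed
  then show r: "Zp (of_real x) \<in> \<real>" using x by (simp add: complex_is_Real_iff)
  have "connected ((\<lambda>x. Re (Zp (of_real x))) ` {0<..})"
    by (intro connected_continuous_image continuous_intros continuous_on_compose2[OF continuous_on_Zp])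
       (auto intro: pos_real_D2)
  moreover have "0 \<notin> (\<lambda>x. Re (Zp (of_real x))) ` {0<..}" using real by force
  moreover have "Re (Zp (of_real 3)) > 0"
    using ZR_quadrant(4)[of "of_real 3"] lam1 by (simp add: Zp_def)
  moreover have "Re (Zp 3) \<in> (\<lambda>x. Re (Zp (of_real x))) ` {0<..}" by (rule image_eqI[of _ _ 3]) auto
  ultimately have no: "\<not> Re (Zp (of_real x)) \<le> 0"
    using connected_contains_Icc[of "(\<lambda>x. Re (Zp (of_real x))) ` {0<..}" "Re (Zp (of_real x))" "Re (Zp (of_real 3))"] x
    by (auto simp: subset_iff)
  then show p: "Re (Zp (of_real x)) > 0" by simp
  define z where "z = complex_of_real x"
  have zD: "z \<in> D2" using pos_real_D2[OF x] by (simp add: z_def)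
  define t where "t = Re (two.uz z)"
  show ur: "two.uz (of_real x) \<in> \<real>" unfolding two.uz_def using r by (intro Reals_diff Reals_add Reals_mult) auto
  then have uz: "two.uz z = of_real t" by (simp add: t_def z_def complex_is_Real_iff complex_eq_iff)
  have "(Re (Zp z))\<^sup>2 = Re (Zp z ^ 2)" using r by (simp add: z_def complex_is_Real_iff power2_eq_square)
  also have "\<dots> = (x - 2 * lam)\<^sup>2 + ic\<^sup>2"
    unfolding Zp_Z3_power2 ic(2) by (simp add: Zsq_def z_def power2_eq_square algebra_simps)
  finally have "(Re (Zp z))\<^sup>2 > (x - 2 * lam)\<^sup>2" using ic(1) by simp
  then have "\<bar>x - 2 * lam\<bar>\<^sup>2 < (Re (Zp z))\<^sup>2" unfolding power2_abs .
  then have "\<bar>x - 2 * lam\<bar> < Re (Zp z)" by (rule power2_less_imp_less) (use p in \<open>simp only: z_def less_imp_le\<close>)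
  moreover have "t = Re (Zp z) + (x - 2 * lam)" unfolding t_def two.uz_def by (simp add: z_def)
  ultimately have t: "t > 0" by argo
  have "of_real x = zu (of_real t)" using two.uz_inverse(1)[OF zD] unfolding uz by (simp only: z_def)
  also have "\<dots> = of_real ((t - u1) * (t - u2) / (2 * t))"
    using t zu_factor[of "of_real t"] by (simp only: of_real_divide of_real_mult of_real_diff of_real_numeral of_real_eq_0_iff less_irrefl simp_thms)
  finally have "x = (t - u1) * (t - u2) / (2 * t)" using of_real_eq_iff by blast
  then have "(t - u1) * (t - u2) > 0" using x t by (simp add: zero_less_divide_iff)
  moreover have "t - u2 > 0" using t u12 by simp
  ultimately have "t > u1" by (simp add: zero_less_mult_iff)
  then show "Re (two.uz (of_real x)) > u1" by (simp add: t_def z_def)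
qed

text \<open>For such real \<open>u\<close> the logarithms of \<open>u + i ic\<close> and
  \<open>u - i ic\<close> are conjugate, so their sum is real; the other logarithms have positive
  arguments.\<close>

lemma real_values:
  assumes t: "t > u1"
  shows "xiu (of_real t) \<in> \<real>" "sigma (of_real t) \<in> \<real>" "Re (sigma (of_real t)) > 0"
proof -
  have tp: "t > 0" "t - u1 > 0" "t - u2 > 0" using t u12 by linarith+
  have L: "Ln_up (of_real s) = of_real (ln s)" if "s > 0" for s :: real
    using that by (simp add: Ln_up_eq_Ln Ln_of_real)
  have "Zu (of_real t) \<in> \<real>" unfolding Zu_def by (auto intro!: Reals_divide Reals_add)
  then show "xiu (of_real t) \<in> \<real>"
    unfolding xiu_def of_real_diff[symmetric] L[OF tp(1)] L[OF tp(2)] L[OF tp(3)]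
    by (intro Reals_divide Reals_add Reals_diff Reals_mult Reals_of_real Reals_numeral)
  define v where "v = complex_of_real t + \<i> * of_real ic"
  have v: "Re v > 0" "complex_of_real t - \<i> * of_real ic = cnj v" using tp by (simp_all add: v_def complex_eq_iff)
  have "cnj (Ln v) = Ln (cnj v)" using v(1) by (intro cnj_Ln) (auto simp: complex_nonpos_Reals_iff)
  then have c: "Ln_up (cnj v) + Ln_up v = of_real (2 * Re (Ln v))"
    using v(1) by (simp add: Ln_up_eq_Ln_right complex_eq_iff)
  have "Ln_up (of_real t - of_real u1) + Ln_up (of_real t - of_real u2) - Ln_up (cnj v) - Ln_up v
      = of_real (ln (t - u1)) + of_real (ln (t - u2)) - (Ln_up (cnj v) + Ln_up v)"
    unfolding of_real_diff[symmetric] L[OF tp(2)] L[OF tp(3)] by (simp only: diff_diff_eq)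
  also have "\<dots> = of_real (ln (t - u1) + ln (t - u2) - 2 * Re (Ln v))" unfolding c by (simp only: of_real_add of_real_diff)
  finally have e: "Ln_up (of_real t - of_real u1) + Ln_up (of_real t - of_real u2) - Ln_up (cnj v) - Ln_up v
      = of_real (ln (t - u1) + ln (t - u2) - 2 * Re (Ln v))" .
  have "sigma (of_real t) = exp (of_real ((ln (t - u1) + ln (t - u2) - 2 * Re (Ln v)) / 2))"
    unfolding sigma_def v(2) v_def[symmetric] e by simp
  then have "sigma (of_real t) = of_real (exp ((ln (t - u1) + ln (t - u2) - 2 * Re (Ln v)) / 2))"
    by (simp only: exp_of_real)
  then show "sigma (of_real t) \<in> \<real>" "Re (sigma (of_real t)) > 0" by simp_all
qed

section \<open>Identification of the principal values\<close>

lemma principal_branch_eqI: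
  assumes "continuous_on D2 g" "\<And>z. z \<in> D2 \<Longrightarrow> R z (g z)" "\<And>x::real. x > 0 \<Longrightarrow> P (g (of_real x))"
    and uniq: "\<And>h z. continuous_on D2 h \<Longrightarrow> (\<And>z. z \<in> D2 \<Longrightarrow> R z (h z)) \<Longrightarrow> (\<And>x::real. x > 0 \<Longrightarrow> P (h (of_real x))) \<Longrightarrow> z \<in> D2 \<Longrightarrow> h z = g z"
  shows "principal_branch lam R P = (\<lambda>z. if z \<in> D2 then g z else 0)"
  unfolding principal_branch_def D2_def[symmetric]
proof (rule the_equality)
  show "continuous_on D2 (\<lambda>z. if z \<in> D2 then g z else 0) \<and> (\<forall>z\<in>D2. R z (if z \<in> D2 then g z else 0)) \<and>
    (\<forall>x>0. P (if complex_of_real x \<in> D2 then g (complex_of_real x) else 0)) \<and> (\<forall>z. z \<notin> D2 \<longrightarrow> (if z \<in> D2 then g z else 0) = 0)"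
    using assms(1-3) pos_real_D2 by (auto cong: continuous_on_cong)
  fix h assume h: "continuous_on D2 h \<and> (\<forall>z\<in>D2. R z (h z)) \<and> (\<forall>x>0. P (h (complex_of_real x))) \<and> (\<forall>z. z \<notin> D2 \<longrightarrow> h z = 0)"
  show "h = (\<lambda>z. if z \<in> D2 then g z else 0)"
  proof
    fix z show "h z = (if z \<in> D2 then g z else 0)" using uniq[of h z] h by auto
  qed
qed

text \<open>The quotient of the two roots takes only the values 1 and -1, hence is constant, and at
  the point 1 it is positive.\<close>

lemma sqrt_branch_unique:
  assumes c: "continuous_on D2 g" "continuous_on D2 h" and sq: "\<And>z. z \<in> D2 \<Longrightarrow> h z ^ 2 = g z ^ 2" "\<And>z. z \<in> D2 \<Longrightarrow> g z \<noteq> 0"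
    and p: "g 1 \<in> \<real>" "Re (g 1) > 0" "h 1 \<in> \<real>" "Re (h 1) > 0" and z: "z \<in> D2"
  shows "h z = g z"
proof -
  have one: "1 \<in> D2" using pos_real_D2[of 1] by simp
  have v: "h w / g w \<in> {1, - 1}" if "w \<in> D2" for w
  proof -
    have "(h w / g w) ^ 2 = 1" using sq that by (simp add: power_divide)
    then show ?thesis by (simp add: power2_eq_1_iff)
  qed
  have "h z / g z = h 1 / g 1"
  proof (rule connected_countable_range_const[OF connected_D(1) _ _ z one])
    show "continuous_on D2 (\<lambda>z. h z / g z)" using c sq(2) by (intro continuous_intros) auto
    have "(\<lambda>z. h z / g z) ` D2 \<subseteq> {1, - 1}" using v by blast
    then show "countable ((\<lambda>z. h z / g z) ` D2)" by (rule countable_subset) simp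
  qed
  also have "\<dots> = 1"
  proof -
    have "h 1 = of_real (Re (h 1))" "g 1 = of_real (Re (g 1))" using p by (simp_all add: complex_is_Real_iff complex_eq_iff)
    then have "h 1 / g 1 = of_real (Re (h 1) / Re (g 1))" by (metis of_real_divide)
    moreover have "Re (h 1) / Re (g 1) > 0" using p by simp
    ultimately show ?thesis using v[OF one] by (metis Re_complex_of_real empty_iff insert_iff not_less_iff_gr_or_eq one_complex.sel(1) uminus_complex.sel(1) neg_less_0_iff_less zero_less_one)
  qed
  finally show ?thesis using sq(2)[OF z] by simp
qed

lemma Zfun_eq: "Zfun lam = (\<lambda>z. if z \<in> D2 then Zp z else 0)"
  unfolding Zfun_def
proof (rule principal_branch_eqI)
  fix h z assume h: "continuous_on D2 h" "\<And>z. z \<in> D2 \<Longrightarrow> h z ^ 2 = Zsq lam z"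
    "\<And>x::real. x > 0 \<Longrightarrow> h (of_real x) \<in> \<real> \<and> 0 < Re (h (of_real x))" "z \<in> D2"
  show "h z = Zp z"
    using real_axis(1,2)[of 1] h(3)[of 1] by (intro sqrt_branch_unique[OF continuous_on_Zp h(1) _ _ _ _ _ _ h(4)])
      (simp_all add: Zp_Z3_power2 two.Z_nz h(2))
qed (use real_axis in \<open>auto simp: continuous_on_Zp Zp_Z3_power2\<close>)

lemma sqrt_zZ_eq: "sqrt_zZ lam = (\<lambda>z. if z \<in> D2 then sigma (two.uz z) else 0)"
  unfolding sqrt_zZ_def
proof (rule principal_branch_eqI)
  have contS: "continuous_on D2 (\<lambda>z. sigma (two.uz z))"
  proof (rule continuous_on_compose2[OF _ two.continuous_on_uz])
    show "continuous_on Wz sigma"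
      using sigma_deriv DERIV_isCont continuous_at_imp_continuous_on by metis
    show "two.uz ` D2 \<subseteq> Wz" using two.uz_Wz by blast
  qed
  then show "continuous_on D2 (\<lambda>z. sigma (two.uz z))" .
  show sq: "sigma (two.uz z) ^ 2 = z / Zfun lam z" if "z \<in> D2" for z
    using sigma_square[OF two.uz_Wz[OF that]] two.uz_inverse[OF that] that by (simp add: Zfun_eq)
  have real: "sigma (two.uz (of_real x)) \<in> \<real> \<and> 0 < Re (sigma (two.uz (of_real x)))" if "x > 0" for x
  proof -
    have "two.uz (of_real x) = of_real (Re (two.uz (of_real x)))"
      using real_axis(3)[OF that] by (simp add: complex_is_Real_iff complex_eq_iff)
    then show ?thesis using real_values(2,3)[OF real_axis(4)[OF that]] by metis
  qed
  then show "sigma (two.uz (of_real x)) \<in> \<real> \<and> 0 < Re (sigma (two.uz (of_real x)))" if "x > 0" for x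
    using that .
  fix h z assume h: "continuous_on D2 h" "\<And>z. z \<in> D2 \<Longrightarrow> h z ^ 2 = z / Zfun lam z"
    "\<And>x::real. x > 0 \<Longrightarrow> h (of_real x) \<in> \<real> \<and> 0 < Re (h (of_real x))" "z \<in> D2"
  show "h z = sigma (two.uz z)"
    using real[of 1] h(3)[of 1] by (intro sqrt_branch_unique[OF contS h(1) _ _ _ _ _ _ h(4)])
      (simp_all add: sq sigma_nz h(2))
qed

lemma xiu_continuous: "continuous_on Wz xiu"
  using xiu_deriv DERIV_isCont continuous_at_imp_continuous_on by metis

text \<open>Two branches differ by an integer combination of \<open>2 \<pi> i\<close> and
  \<open>2 \<pi> i lam\<close>. These values are countable in number, so the difference is constant;
  they are purely imaginary, while at the point 1 the difference is real.\<close>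

lemma xi_eq: "xi lam = (\<lambda>z. if z \<in> D2 then xiu (two.uz z) else 0)"
  unfolding xi_def
proof (rule principal_branch_eqI)
  let ?R = "\<lambda>z w. \<exists>a b. exp a = Zfun lam z + z - 2 * complex_of_real lam \<and>
                  exp b = (Zfun lam z - complex_of_real lam * z + 2) / z \<and>
                  w = Zfun lam z / 2 - complex_of_real lam * a - b"
  show cont: "continuous_on D2 (\<lambda>z. xiu (two.uz z))"
    by (rule continuous_on_compose2[OF xiu_continuous two.continuous_on_uz]) (use two.uz_Wz in blast)
  have R: "?R z (xiu (two.uz z))" if z: "z \<in> D2" for z
  proof -
    have Zf: "Zfun lam z = Zp z" using z by (simp add: Zfun_eq)
    show ?thesis unfolding Zf
      by (rule exI, rule exI, intro conjI, rule xiu_value(1)[OF two.uz_Wz[OF z], unfolded two.uz_inverse[OF z]],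
          rule xiu_value(2)[OF two.uz_Wz[OF z], unfolded two.uz_inverse[OF z]],
          rule xiu_value(3)[OF two.uz_Wz[OF z], unfolded two.uz_inverse[OF z]])
  qed
  then show "?R z (xiu (two.uz z))" if z: "z \<in> D2" for z using that .
  have real: "xiu (two.uz (of_real x)) \<in> \<real>" if "x > 0" for x
  proof -
    have "two.uz (of_real x) = of_real (Re (two.uz (of_real x)))"
      using real_axis(3)[OF that] by (simp add: complex_is_Real_iff complex_eq_iff)
    then show ?thesis using real_values(1)[OF real_axis(4)[OF that]] by metis
  qed
  then show "xiu (two.uz (of_real x)) \<in> \<real>" if "x > 0" for x using that .
  fix h z assume h: "continuous_on D2 h" "\<And>z. z \<in> D2 \<Longrightarrow> ?R z (h z)"
    "\<And>x::real. x > 0 \<Longrightarrow> h (of_real x) \<in> \<real>" "z \<in> D2"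
  define d where "d = (\<lambda>z. h z - xiu (two.uz z))"
  define D where "D = range (\<lambda>(n::int, m::int). - (of_real lam * (of_int (2 * n) * of_real pi * \<i>)) - of_int (2 * m) * of_real pi * \<i>)"
  have dD: "d w \<in> D" if w: "w \<in> D2" for w
  proof -
    obtain a b where a: "exp a = Zfun lam w + w - 2 * complex_of_real lam"
      "exp b = (Zfun lam w - complex_of_real lam * w + 2) / w" "h w = Zfun lam w / 2 - complex_of_real lam * a - b"
      using h(2)[OF w] by blast
    obtain a' b' where a': "exp a' = Zfun lam w + w - 2 * complex_of_real lam"
      "exp b' = (Zfun lam w - complex_of_real lam * w + 2) / w"
      "xiu (two.uz w) = Zfun lam w / 2 - complex_of_real lam * a' - b'"
      using R[OF w] by blast
    obtain n :: int where n: "a = a' + (of_int (2 * n) * pi) * \<i>" using a(1) a'(1) exp_eq[of a a'] by auto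
    obtain m :: int where m: "b = b' + (of_int (2 * m) * pi) * \<i>" using a(2) a'(2) exp_eq[of b b'] by auto
    have "d w = - (of_real lam * (of_int (2 * n) * of_real pi * \<i>)) - of_int (2 * m) * of_real pi * \<i>"
      unfolding d_def a(3) a'(3) n m by (simp add: algebra_simps)
    then show ?thesis unfolding D_def by (intro image_eqI[of _ _ "(n, m)"]) auto
  qed
  have "countable (d ` D2)"
    by (rule countable_subset[of _ D]) (use dD in blast, simp add: D_def)
  moreover have "continuous_on D2 d" unfolding d_def by (intro continuous_intros h(1) cont)
  moreover have one: "1 \<in> D2" using pos_real_D2[of 1] by simp
  ultimately have "d z = d 1" using connected_countable_range_const[OF connected_D(1) _ _ h(4)] by blast
  also have "\<dots> = 0"
  proof -
    have "d 1 \<in> \<real>" unfolding d_def using h(3)[of 1] real[of 1] by (auto intro: Reals_diff)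
    moreover have "Re (d 1) = 0" using dD[OF one] by (auto simp: D_def)
    ultimately show ?thesis by (simp add: complex_is_Real_iff complex_eq_iff)
  qed
  finally show "h z = xiu (two.uz z)" by (simp add: d_def)
qed

text \<open>The derivative within the cut domain, boundary points included, follows from the chain
  rule \<open>dz_within_eq\<close>; this turns the recursion for \<open>Fhat\<close> into the one
  for \<open>Fu\<close>.\<close>

lemma Fhat_eq: "z \<in> D2 \<Longrightarrow> Fhat lam s z = Fu s (two.uz z)"
proof (induction s arbitrary: z rule: Ku.induct)
  case 1
  then show ?case by (simp add: Fu_def)
next
  case 2
  then show ?case
    unfolding Fu_def One_nat_def Ku.simps Fhat.simps Zfun_eq two.uz_inverse[OF 2]
    by (simp only: 2 if_True times_divide_eq_right mult_minus_right)
next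
  case (3 m)
  have IH: "Fhat lam j w = Fu j (two.uz w)" if "j \<le> Suc m" "w \<in> D2" for j w
  proof (cases "j = Suc m")
    case True then show ?thesis using 3 that by simp
  next
    case False
    show ?thesis
    proof (cases "j = 0")
      case False
      then show ?thesis using that \<open>j \<noteq> Suc m\<close> by (intro "3.IH"(2)) auto
    qed (simp add: Fu_def)
  qed
  note z = \<open>z \<in> D2\<close>
  define u where "u = two.uz z"
  have u: "u \<in> Wz" "zu u = z" "Zu u = Zp z" using two.uz_Wz two.uz_inverse z by (simp_all add: u_def)
  have d: "dz_within D2 (Fhat lam (Suc m)) z = deriv (Fu (Suc m)) u * (u / Zp z)"
    unfolding u_def by (rule two.dz_within_eq[OF z IH Fu_deriv]) (use Wz_nz[OF u(1)] in \<open>auto simp: u_def\<close>)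
  have "(\<Sum>j\<in>{1..<Suc m}. Fhat lam j z * Fhat lam (Suc m - j) z) = (\<Sum>j\<in>{1..<Suc m}. Fu j u * Fu (Suc m - j) u)"
    by (intro sum.cong) (use IH z in \<open>auto simp: u_def\<close>)
  then show ?case
    unfolding Fhat.simps Let_def D2_def[symmetric] d using Fu_Suc_Suc[of u m] Wz_nz[OF u(1)] u z
    by (simp add: Zfun_eq flip: u_def)
qed

lemma Ghat_eq: "z \<in> D2 \<Longrightarrow> Ghat lam n s z = (\<Sum>k\<in>{s..<n}. Fu k (two.uz z) * Fu (s + n - k - 1) (two.uz z))"
  unfolding Ghat_def by (simp add: Fhat_eq)

text \<open>Outside \<open>SA\<close> the principal root and \<open>z - 2 lam\<close> lie in the
  same closed quadrant, so adding the root cannot decrease the modulus. In this way \<open>u\<close>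
  tends to infinity with \<open>z\<close>.\<close>

lemma uz_far_ge:
  assumes z: "z \<in> D2" "z \<notin> SA"
  shows "cmod (z - 2 * of_real lam) \<le> cmod (two.uz z)"
proof -
  define a b where "a = Zp z" "b = z - 2 * complex_of_real lam"
  have zC: "Im z \<ge> 0" "z \<in> Cplus" "z \<notin> G2" using z by (auto simp: D2_def Cplus_iff gamma2_eq)
  have "Re a * Re b + Im a * Im b \<ge> 0"
  proof (cases "Re z < 2 * lam")
    case True
    then have "phL z > 0" using zC z(2) by (auto simp: SA_def G2_def)
    then have "a = - ZL z" using True by (simp add: a_b_def Zp_def)
    moreover have "Re (ZL z) \<ge> 0" "Im (ZL z) \<le> 0" using ZL_quadrant(1,2)[OF zC(1)] True by auto
    ultimately have "Re a \<le> 0" "Im a \<ge> 0" by simp_all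
    moreover have "Re b \<le> 0" "Im b \<ge> 0" using True zC(1) by (simp_all add: a_b_def)
    ultimately show ?thesis by (intro add_nonneg_nonneg mult_nonpos_nonpos mult_nonneg_nonneg)
  next
    case False
    then have "Re a \<ge> 0" "Im a \<ge> 0" using ZR_quadrant(1,2)[OF zC(1)] by (simp_all add: a_b_def Zp_def)
    moreover have "Re b \<ge> 0" "Im b \<ge> 0" using False zC(1) by (simp_all add: a_b_def)
    ultimately show ?thesis by (intro add_nonneg_nonneg mult_nonneg_nonneg)
  qed
  moreover have "(cmod (a + b))\<^sup>2 = (cmod a)\<^sup>2 + (cmod b)\<^sup>2 + 2 * (Re a * Re b + Im a * Im b)"
    unfolding cmod_power2 by (simp add: power2_eq_square algebra_simps)
  moreover have "0 \<le> (cmod a)\<^sup>2" by simp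
  ultimately have "(cmod b)\<^sup>2 \<le> (cmod (a + b))\<^sup>2" by argo
  then have "cmod b \<le> cmod (a + b)" by (rule power2_le_imp_le) simp
  then show ?thesis by (simp add: a_b_def two.uz_def add_diff_eq)
qed

lemma SA_bounded: "\<exists>X. \<forall>z\<in>SA. cmod z < X"
proof -
  obtain X where X: "X > 2" "\<And>z. z \<in> Cplus \<Longrightarrow> cmod z \<ge> X \<Longrightarrow> Im z \<le> ic \<Longrightarrow> Re z \<ge> 2 * lam \<Longrightarrow> z \<in> SC"
    "\<And>z. z \<in> Cplus \<Longrightarrow> cmod z > 2 \<Longrightarrow> Re z < 2 * lam \<Longrightarrow> z \<in> SB" using far_points by blast
  have "cmod z < X" if z: "z \<in> SA" for z
  proof (rule ccontr)
    assume "\<not> cmod z < X"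
    then have "z \<in> SB \<or> z \<in> SC" using X z by (cases "Re z < 2 * lam") (auto simp: SA_def)
    then show False using SABC_disjoint z by blast
  qed
  then show ?thesis by blast
qed

text \<open>Without such paths the condition in \<open>Ehat\<close> would hold vacuously for every
  value; their existence makes the limit unique.\<close>

lemma D2_path_from_far:
  assumes z: "z \<in> D2"
  shows "\<exists>g. valid_path g \<and> path_image g \<subseteq> D2 \<and> pathfinish g = z \<and> R \<le> cmod (pathstart g)"
proof (rule connected_induction_simple[OF connected_D(1) _ z, of 1])
  show "1 \<in> D2" using pos_real_D2[of 1] by simp
  define g where "g = linepath (complex_of_real (\<bar>R\<bar> + 1)) 1"
  have "path_image g \<subseteq> D2"
  proof
    fix w assume "w \<in> path_image g"
    then obtain t where t: "0 \<le> t" "t \<le> 1" "w = (1 - t) *\<^sub>R (complex_of_real (\<bar>R\<bar> + 1)) + t *\<^sub>R 1"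
      by (auto simp: g_def closed_segment_def)
    have w: "w = of_real ((1 - t) * (\<bar>R\<bar> + 1) + t)" unfolding t(3) by (simp add: scaleR_conv_of_real)
    have "(1 - t) * 1 + t \<le> (1 - t) * (\<bar>R\<bar> + 1) + t" using t by (intro add_mono mult_left_mono) auto
    then have "(1 - t) * (\<bar>R\<bar> + 1) + t > 0" by simp
    then show "w \<in> D2" unfolding w by (rule pos_real_D2)
  qed
  moreover have "R \<le> cmod (complex_of_real (\<bar>R\<bar> + 1))" unfolding norm_of_real by linarith
  ultimately show "\<exists>g. valid_path g \<and> path_image g \<subseteq> D2 \<and> pathfinish g = 1 \<and> R \<le> cmod (pathstart g)"
    by (intro exI[of _ g]) (simp add: g_def)
next
  fix a assume a: "a \<in> D2"
  obtain r where r: "r > 0" "ball a r \<inter> {w. Im w \<ge> 0} \<subseteq> D2" using Cplus_local_convex[OF openin_D2_D3(1) a] by blast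
  have conv: "convex (ball a r \<inter> {w. Im w \<ge> 0})" by (intro convex_Int convex_ball convex_halfspace_Im_ge)
  have Im0: "Im w \<ge> 0" if "w \<in> D2" for w using that by (auto simp: D2_def Cplus_iff)
  have step: "\<exists>g. valid_path g \<and> path_image g \<subseteq> D2 \<and> pathfinish g = y \<and> R \<le> cmod (pathstart g)"
    if x: "x \<in> D2 \<inter> ball a r" "\<exists>g. valid_path g \<and> path_image g \<subseteq> D2 \<and> pathfinish g = x \<and> R \<le> cmod (pathstart g)"
      and y: "y \<in> D2 \<inter> ball a r" for x y
  proof -
    obtain g where g: "valid_path g" "path_image g \<subseteq> D2" "pathfinish g = x" "R \<le> cmod (pathstart g)" using x(2) by blast
    have "closed_segment x y \<subseteq> ball a r \<inter> {w. Im w \<ge> 0}"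
      by (rule closed_segment_subset[OF _ _ conv]) (use x(1) y Im0 in auto)
    then have "path_image (linepath x y) \<subseteq> D2" using r(2) by auto
    then show ?thesis using g
      by (intro exI[of _ "g +++ linepath x y"]) (auto simp: path_image_join intro: valid_path_join)
  qed
  have "openin (top_of_set D2) (D2 \<inter> ball a r)" by (intro openin_open_Int open_ball)
  moreover have "a \<in> D2 \<inter> ball a r" using r(1) a by simp
  ultimately show "\<exists>T. openin (top_of_set D2) T \<and> a \<in> T \<and> (\<forall>x\<in>T. \<forall>y\<in>T.
      (\<exists>g. valid_path g \<and> path_image g \<subseteq> D2 \<and> pathfinish g = x \<and> R \<le> cmod (pathstart g)) \<longrightarrow>
      (\<exists>g. valid_path g \<and> path_image g \<subseteq> D2 \<and> pathfinish g = y \<and> R \<le> cmod (pathstart g)))"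
    by (intro exI[of _ "D2 \<inter> ball a r"] conjI ballI impI) (assumption+ | erule (1) step)+
qed

text \<open>The function \<open>2 Eu s (uz t)\<close> is a primitive of the integrand within the cut
  domain, so a contour integral is a difference of end values, and the one at the far starting point
  tends to 0.\<close>

lemma Ehat_eq:
  assumes z: "z \<in> D2"
  shows "Ehat lam s z = Eu s (two.uz z)"
proof -
  let ?h = "\<lambda>t. Zfun lam t * Fhat lam s t / t"
  have prim: "((\<lambda>t. 2 * Eu s (two.uz t)) has_field_derivative ?h t) (at t within D2)" if t: "t \<in> D2" for t
  proof -
    note u = two.uz_Wz[OF t] two.uz_inverse[OF t]
    note nz = Wz_nz[OF u(1)]
    have tn: "t \<noteq> 0" using nz(3) u(2) by simp
    have "((\<lambda>t. 2 * Eu s (two.uz t)) has_field_derivative 2 * (eu s (two.uz t) * (two.uz t / Zp t))) (at t within D2)"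
      by (intro DERIV_cmult two.comp_deriv t Eu nz(8))
    moreover have "2 * (eu s (two.uz t) * (two.uz t / Zp t)) = ?h t"
      unfolding Fhat_eq[OF t] Fu_def eu_def u(2,3) using t tn nz(1) two.Z_nz[OF t]
      by (simp add: Zfun_eq power2_eq_square)
    ultimately show ?thesis by simp
  qed
  have int: "1/2 * contour_integral g ?h = Eu s (two.uz z) - Eu s (two.uz (pathstart g))"
    if g: "valid_path g" "path_image g \<subseteq> D2" "pathfinish g = z" for g
    using contour_integral_unique[OF contour_integral_primitive[OF prim g(1,2)]] g(3) by simp
  obtain X where X: "\<And>z. z \<in> SA \<Longrightarrow> cmod z < X" using SA_bounded by blast
  have lim: "\<exists>R. \<forall>g. valid_path g \<and> path_image g \<subseteq> D2 \<and> pathfinish g = z \<and> cmod (pathstart g) \<ge> R \<longrightarrow>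
      cmod (1/2 * contour_integral g ?h - Eu s (two.uz z)) < \<epsilon>" if eps: "\<epsilon> > 0" for \<epsilon>
  proof -
    obtain R where R: "\<And>u. u \<in> W \<Longrightarrow> Im u \<ge> 0 \<Longrightarrow> cmod u \<ge> R \<Longrightarrow> cmod (Eu s u) < \<epsilon>" using Eu(2)[OF eps, of s] by blast
    show ?thesis
    proof (intro exI[of _ "max X (R + 2)"] allI impI)
      fix g assume g: "valid_path g \<and> path_image g \<subseteq> D2 \<and> pathfinish g = z \<and> max X (R + 2) \<le> cmod (pathstart g)"
      define a where "a = pathstart g"
      have a: "a \<in> D2" "cmod a \<ge> X" "cmod a \<ge> R + 2" using g by (auto simp: a_def)
      have "a \<notin> SA" using X[of a] a(2) by auto
      moreover have "cmod (2 * complex_of_real lam) \<le> 2" using lam0 lam1 by (simp add: norm_mult)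
      ultimately have "cmod (two.uz a) \<ge> R"
        using uz_far_ge[OF a(1)] norm_triangle_ineq2[of a "2 * complex_of_real lam"] a(3) by argo
      then have "cmod (Eu s (two.uz a)) < \<epsilon>" using R Wz_nz(8,9)[OF two.uz_Wz[OF a(1)]] by blast
      then show "cmod (1/2 * contour_integral g ?h - Eu s (two.uz z)) < \<epsilon>"
      proof -
        have "1/2 * contour_integral g ?h - Eu s (two.uz z) = - Eu s (two.uz a)" using int[of g] g by (simp only: a_def) simp
        then show ?thesis using \<open>cmod (Eu s (two.uz a)) < \<epsilon>\<close> by (simp only: norm_minus_cancel)
      qed
    qed
  qed
  show ?thesis unfolding Ehat_def D2_def[symmetric]
  proof (rule the_equality)
    show "\<forall>\<epsilon>>0. \<exists>R. \<forall>g. valid_path g \<and> path_image g \<subseteq> D2 \<and> pathfinish g = z \<and> R \<le> cmod (pathstart g) \<longrightarrow>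
        cmod (1/2 * contour_integral g ?h - Eu s (two.uz z)) < \<epsilon>" using lim by blast
    fix E assume E: "\<forall>\<epsilon>>0. \<exists>R. \<forall>g. valid_path g \<and> path_image g \<subseteq> D2 \<and> pathfinish g = z \<and> R \<le> cmod (pathstart g) \<longrightarrow>
        cmod (1/2 * contour_integral g ?h - E) < \<epsilon>"
    show "E = Eu s (two.uz z)"
    proof (rule ccontr)
      assume "E \<noteq> Eu s (two.uz z)"
      define \<epsilon> where "\<epsilon> = cmod (E - Eu s (two.uz z)) / 2"
      have eps: "\<epsilon> > 0" using \<open>E \<noteq> _\<close> by (simp add: \<epsilon>_def)
      obtain R1 where R1: "\<And>g. valid_path g \<Longrightarrow> path_image g \<subseteq> D2 \<Longrightarrow> pathfinish g = z \<Longrightarrow> R1 \<le> cmod (pathstart g) \<Longrightarrow>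
        cmod (1/2 * contour_integral g ?h - E) < \<epsilon>" using E eps by meson
      obtain R2 where R2: "\<And>g. valid_path g \<Longrightarrow> path_image g \<subseteq> D2 \<Longrightarrow> pathfinish g = z \<Longrightarrow> R2 \<le> cmod (pathstart g) \<Longrightarrow>
        cmod (1/2 * contour_integral g ?h - Eu s (two.uz z)) < \<epsilon>" using lim[OF eps] by meson
      obtain g where g: "valid_path g" "path_image g \<subseteq> D2" "pathfinish g = z" "max R1 R2 \<le> cmod (pathstart g)"
        using D2_path_from_far[OF z] by blast
      define c where "c = 1/2 * contour_integral g ?h"
      have "cmod (c - E) < \<epsilon>" "cmod (c - Eu s (two.uz z)) < \<epsilon>" using R1[OF g(1-3)] R2[OF g(1-3)] g(4) by (simp_all add: c_def)
      moreover have "E - Eu s (two.uz z) = (c - Eu s (two.uz z)) - (c - E)" by simp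
      then have "cmod (E - Eu s (two.uz z)) \<le> cmod (c - Eu s (two.uz z)) + cmod (c - E)" by (metis norm_triangle_ineq4)
      ultimately show False unfolding \<epsilon>_def by argo
    qed
  qed
qed

section \<open>Continuation across gamma2\<close>

lemma uz_agree: "z \<notin> SA \<Longrightarrow> z \<in> D3 \<Longrightarrow> z \<in> D2 \<Longrightarrow> three.uz z = two.uz z"
  by (simp add: three.uz_def two.uz_def Z3_eq_Zp)

text \<open>Composing \<open>fu\<close> with the other choice \<open>three.uz\<close> of
  \<open>u\<close> gives a function that is continuous off \<open>gamma3\<close> and agrees with
  \<open>f\<close> on \<open>S1\<close>; by \<open>half_plane_identity\<close> it is the
  continuation. Outside \<open>SA\<close> and the cuts both choices of \<open>u\<close> coincide, so
  one formula covers all cases.\<close>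

lemma val3_eq:
  assumes f: "\<And>z. z \<in> D2 \<Longrightarrow> f z = fu (two.uz z)" and fu: "\<And>u. u \<in> Wz \<Longrightarrow> fu field_differentiable (at u)" and z: "z \<in> D3"
  shows "val3 lam f z = fu (three.uz z)"
proof -
  define h0 where "h0 = (\<lambda>z. if z \<in> D3 then fu (three.uz z) else 0)"
  have "continuous_on Wz fu"
    using fu continuous_at_imp_continuous_on field_differentiable_imp_continuous_at by blast
  then have "continuous_on D3 (\<lambda>z. fu (three.uz z))"
    by (rule continuous_on_compose2[OF _ three.continuous_on_uz]) (use three.uz_Wz in blast)
  then have c0: "continuous_on D3 h0" by (rule continuous_on_eq) (simp add: h0_def)
  have hol0: "h0 holomorphic_on interior D3"
    unfolding holomorphic_on_def
  proof
    fix w assume w: "w \<in> interior D3"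
    then have wD: "w \<in> D3" using interior_subset by blast
    obtain d where "(fu has_field_derivative d) (at (three.uz w))"
      using fu[OF three.uz_Wz[OF wD]] by (auto simp: field_differentiable_def)
    from three.comp_deriv[OF wD this]
    have "((\<lambda>z. fu (three.uz z)) has_field_derivative d * (three.uz w / Z3 w)) (at w within D3)" .
    then have "(h0 has_field_derivative d * (three.uz w / Z3 w)) (at w within D3)"
      by (rule has_field_derivative_transform_within[OF _ zero_less_one wD]) (simp add: h0_def)
    then show "h0 field_differentiable at w within interior D3"
      unfolding field_differentiable_def using DERIV_subset interior_subset by blast
  qed
  have SB: "z \<in> D3 \<and> z \<in> D2 \<and> z \<notin> SA" if "z \<in> SB" for z
    using that SABC_D SABC_disjoint by blast
  have on_SB: "h0 z = f z" if "z \<in> SB" for z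
    using SB[OF that] uz_agree[of z] by (simp add: h0_def f)
  have cont: "continuation lam f = h0"
    unfolding continuation_def D3_def[symmetric] S0_S1_eq
  proof (rule the_equality)
    show "continuous_on D3 h0 \<and> h0 holomorphic_on interior D3 \<and> (\<forall>z\<in>SB. h0 z = f z) \<and> (\<forall>z. z \<notin> D3 \<longrightarrow> h0 z = 0)"
      using c0 hol0 on_SB by (simp add: h0_def)
    fix h assume h: "continuous_on D3 h \<and> h holomorphic_on interior D3 \<and> (\<forall>z\<in>SB. h z = f z) \<and> (\<forall>z. z \<notin> D3 \<longrightarrow> h z = 0)"
    have ne: "SB \<noteq> {}"
    proof -
      obtain X where X: "X > 2" "\<And>z. z \<in> Cplus \<Longrightarrow> cmod z \<ge> X \<Longrightarrow> Im z \<le> ic \<Longrightarrow> Re z \<ge> 2 * lam \<Longrightarrow> z \<in> SC"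
        "\<And>z. z \<in> Cplus \<Longrightarrow> cmod z > 2 \<Longrightarrow> Re z < 2 * lam \<Longrightarrow> z \<in> SB" using far_points by blast
      have "- complex_of_real X \<in> SB" using X(1) lam0 by (intro X(3)) (auto simp: Cplus_iff)
      then show ?thesis by blast
    qed
    show "h = h0"
    proof
      fix w show "h w = h0 w"
      proof (cases "w \<in> D3")
        case True
        have "h w - h0 w = 0"
          by (rule half_plane_identity[OF openin_D2_D3(2) connected_D(2) _ _ openin_SB _ ne _ True])
             (use h c0 hol0 on_SB SB in \<open>auto intro!: continuous_intros holomorphic_intros\<close>)
        then show ?thesis by simp
      qed (use h in \<open>simp add: h0_def\<close>)
    qed
  qed
  show ?thesis
  proof (cases "z \<in> Sm1 lam \<union> gamma2 lam")
    case True
    then show ?thesis using z by (simp add: val3_def cont h0_def)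
  next
    case False
    then have "z \<notin> SA" "z \<in> D2" using z by (auto simp: Sm1_eq D2_def D3_def)
    then show ?thesis using False z uz_agree[of z] by (simp add: val3_def f)
  qed
qed

lemma Ku_diff: "u \<in> Wz \<Longrightarrow> Ku s field_differentiable (at u)"
  using Ku_holomorphic P0(1,2) Wz_nz(8) holomorphic_on_imp_differentiable_at by blast

lemma zu_Zu_diff: "u \<in> Wz \<Longrightarrow> zu field_differentiable (at u)" "u \<in> Wz \<Longrightarrow> Zu field_differentiable (at u)"
  using zu_Zu_holomorphic P0(1,2) Wz_nz(8) holomorphic_on_imp_differentiable_at by blast+

definition Gu :: "nat \<Rightarrow> nat \<Rightarrow> complex \<Rightarrow> complex" where
  "Gu n s u = (\<Sum>k\<in>{s..<n}. Fu k u * Fu (s + n - k - 1) u)"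

text \<open>Hereby every multivalued function in the theorem becomes a single-valued function of
  \<open>u = three.uz z\<close>.\<close>

lemma val3_values:
  assumes z: "z \<in> D3"
  shows "val3 lam (xi lam) z = xiu (three.uz z)" "val3 lam (sqrt_zZ lam) z = sigma (three.uz z)"
    "val3 lam (Ehat lam s) z = Eu s (three.uz z)"
    "val3 lam (\<lambda>t. Zfun lam t * Fhat lam s t / t) z = Z3 z * Fu s (three.uz z) / z"
    "val3 lam (\<lambda>t. Zfun lam t * Ghat lam n s t / t) z = Z3 z * Gu n s (three.uz z) / z"
proof -
  show "val3 lam (xi lam) z = xiu (three.uz z)"
    by (rule val3_eq[OF _ _ z]) (use xiu_deriv in \<open>auto simp: xi_eq field_differentiable_def\<close>)
  show "val3 lam (sqrt_zZ lam) z = sigma (three.uz z)"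
    by (rule val3_eq[OF _ _ z]) (use sigma_deriv in \<open>auto simp: sqrt_zZ_eq field_differentiable_def\<close>)
  show "val3 lam (Ehat lam s) z = Eu s (three.uz z)"
    by (rule val3_eq[OF _ _ z]) (use Eu(1) Wz_nz(8) in \<open>auto simp: Ehat_eq field_differentiable_def\<close>)
  have 4: "val3 lam (\<lambda>t. Zfun lam t * Fhat lam s t / t) z = (\<lambda>u. Zu u * Fu s u / zu u) (three.uz z)"
  proof (rule val3_eq[OF _ _ z])
    show "(\<lambda>u. Zu u * Fu s u / zu u) field_differentiable (at u)" if "u \<in> Wz" for u
      using that unfolding Fu_def
      by (intro field_differentiable_mult field_differentiable_divide zu_Zu_diff Ku_diff) (auto simp: Wz_nz(3))
  qed (simp add: Zfun_eq Fhat_eq two.uz_inverse)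
  then show "val3 lam (\<lambda>t. Zfun lam t * Fhat lam s t / t) z = Z3 z * Fu s (three.uz z) / z"
    by (simp add: three.uz_inverse z)
  have "val3 lam (\<lambda>t. Zfun lam t * Ghat lam n s t / t) z = (\<lambda>u. Zu u * Gu n s u / zu u) (three.uz z)"
  proof (rule val3_eq[OF _ _ z])
    fix u assume u: "u \<in> Wz"
    have "Gu n s field_differentiable (at u)"
      unfolding Gu_def Fu_def by (intro field_differentiable_sum field_differentiable_mult Ku_diff zu_Zu_diff u)
    then show "(\<lambda>u. Zu u * Gu n s u / zu u) field_differentiable (at u)"
      using u by (intro field_differentiable_mult field_differentiable_divide zu_Zu_diff) (auto simp: Wz_nz(3))
  qed (simp add: Zfun_eq Ghat_eq two.uz_inverse Gu_def)
  then show "val3 lam (\<lambda>t. Zfun lam t * Ghat lam n s t / t) z = Z3 z * Gu n s (three.uz z) / z"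
    by (simp add: three.uz_inverse z)
qed

end

section \<open>The differential equation of the relative error\<close>

text \<open>
  The recurrence for the coefficients says that \<open>x + \<Sum> F s / x ^ s\<close> formally solves the Riccati equation
  \<open>S' + S\<^sup>2 = x\<^sup>2 + 2 F 1\<close>; this is the residual of the truncated series.
\<close>

lemma riccati_residual:
  fixes F DF :: "nat \<Rightarrow> complex" and x :: complex
  assumes x: "x \<noteq> 0" and DF: "\<And>s. s \<ge> 1 \<Longrightarrow> DF s = - 2 * F (Suc s) - (\<Sum>j\<in>{1..<s}. F j * F (s - j))" and m: "m \<ge> 1"
  shows "x ^ 2 + 2 * F 1 - (x + (\<Sum>s\<in>{1..<m}. F s / x ^ s)) ^ 2 - (\<Sum>s\<in>{1..<m}. DF s / x ^ s)
       = 2 * F m / x ^ (m - 1) - (\<Sum>s\<in>{1..<m}. (\<Sum>k\<in>{s..<m}. F k * F (s + m - k - 1)) / x ^ (s + m - 1))"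
  using m
proof (induction m rule: nat_induct_at_least)
  case base
  then show ?case by simp
next
  case (Suc m)
  define G where "G = (\<lambda>m s. \<Sum>k\<in>{s..<m}. F k * F (s + m - k - 1))"
  define B where "B = (\<Sum>s\<in>{1..<m}. F s / x ^ s)"
  define D where "D = (\<Sum>s\<in>{1..<m}. DF s / x ^ s)"
  define T where "T = (\<Sum>j\<in>{1..<m}. F j * F (m - j))"
  have IH: "x ^ 2 + 2 * F 1 - (x + B) ^ 2 - D = 2 * F m / x ^ (m - 1) - (\<Sum>s\<in>{1..<m}. G m s / x ^ (s + m - 1))"
    using Suc.IH by (simp add: B_def D_def G_def)
  \<comment> \<open>The terms \<open>k = s\<close> and \<open>k = m\<close> both equal
    \<open>F s * F m\<close>; the others make up \<open>G m (Suc s)\<close>.\<close>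
  have Gs: "G (Suc m) s = 2 * F s * F m + G m (Suc s)" if "s \<in> {1..<m}" for s
  proof -
    have "{s..<Suc m} = insert s (insert m {Suc s..<m})" using that by auto
    moreover have "s + m - k = Suc s + m - k - 1" for k by simp
    ultimately show ?thesis unfolding G_def using that by simp
  qed
  have Gm: "G (Suc m) m = F m ^ 2" by (simp add: G_def power2_eq_square)
  have GT: "G m 1 = T" by (simp add: G_def T_def)
  \<comment> \<open>The summand \<open>s = 1\<close> is the convolution \<open>T\<close>; after the
    index shift the range is padded by \<open>G m m\<close>, an empty sum.\<close>
  have shift: "(\<Sum>s\<in>{1..<m}. G m s / x ^ (s + m - 1)) = T / x ^ m + (\<Sum>s\<in>{1..<m}. G m (Suc s) / x ^ (s + m))"
  proof (cases "m = 1")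
    case True then show ?thesis by (simp add: T_def)
  next
    case False
    then have "m = Suc (Suc (m - 2))" using Suc.hyps by simp
    then obtain k where k: "m = Suc (Suc k)" by blast
    define f where "f = (\<lambda>s. G m s / x ^ (s + m - 1))"
    have "1 < m" using k by simp
    then have "(\<Sum>s\<in>{1..<m}. f s) = f 1 + (\<Sum>s\<in>{Suc 1..<m}. f s)" by (rule sum.atLeast_Suc_lessThan)
    also have "(\<Sum>s\<in>{Suc 1..<m}. f s) = (\<Sum>s\<in>{1..<Suc k}. f (Suc s))"
      unfolding k by (rule sum.shift_bounds_Suc_ivl)
    also have "\<dots> = (\<Sum>s\<in>{1..<m}. f (Suc s))"
      by (rule sum.mono_neutral_left) (use k in \<open>auto simp: G_def f_def\<close>)
    finally show ?thesis unfolding GT[symmetric] f_def by simp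
  qed
  have "(\<Sum>s\<in>{1..<Suc m}. G (Suc m) s / x ^ (s + Suc m - 1)) = (\<Sum>s\<in>{1..<m}. G (Suc m) s / x ^ (s + m)) + F m ^ 2 / x ^ (m + m)"
    using Suc.hyps Gm by simp
  also have "(\<Sum>s\<in>{1..<m}. G (Suc m) s / x ^ (s + m)) = (\<Sum>s\<in>{1..<m}. (2 * F m / x ^ m) * (F s / x ^ s) + G m (Suc s) / x ^ (s + m))"
    by (intro sum.cong refl) (simp add: Gs add_divide_distrib power_add mult.commute)
  also have "\<dots> = 2 * F m / x ^ m * B + (\<Sum>s\<in>{1..<m}. G m (Suc s) / x ^ (s + m))"
    by (simp add: sum.distrib B_def sum_distrib_left)
  finally have R: "(\<Sum>s\<in>{1..<Suc m}. G (Suc m) s / x ^ (s + Suc m - 1))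
      = 2 * F m / x ^ m * B + (\<Sum>s\<in>{1..<m}. G m (Suc s) / x ^ (s + m)) + F m ^ 2 / x ^ (m + m)" .
  have S: "(\<Sum>s\<in>{1..<Suc m}. F s / x ^ s) = B + F m / x ^ m" "(\<Sum>s\<in>{1..<Suc m}. DF s / x ^ s) = D + DF m / x ^ m"
    using Suc.hyps by (simp_all add: B_def D_def)
  have xm: "F m / x ^ (m - 1) = x * (F m / x ^ m)" using Suc.hyps x by (cases m) auto
  define Q where "Q = (F m / x ^ m) ^ 2"
  define d where "d = DF m / x ^ m"
  have Q: "Q = F m ^ 2 / x ^ (m + m)" by (simp add: Q_def power_divide power_add power2_eq_square)
  have d: "d = - 2 * F (Suc m) / x ^ m - T / x ^ m"
    using DF[OF Suc.hyps] by (simp add: T_def d_def diff_divide_distrib)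
  have I: "x ^ 2 + 2 * F 1 - (x + B) ^ 2 - D = 2 * (x * (F m / x ^ m)) - (T / x ^ m + (\<Sum>s\<in>{1..<m}. G m (Suc s) / x ^ (s + m)))"
    unfolding IH shift xm[symmetric] by simp
  have "x ^ 2 + 2 * F 1 - (x + (B + F m / x ^ m)) ^ 2 - (D + d)
      = (x ^ 2 + 2 * F 1 - (x + B) ^ 2 - D) - 2 * (x + B) * (F m / x ^ m) - Q - d"
    unfolding Q_def by (simp add: power2_eq_square algebra_simps)
  also have "\<dots> = 2 * F (Suc m) / x ^ m - (2 * F m / x ^ m * B + (\<Sum>s\<in>{1..<m}. G m (Suc s) / x ^ (s + m)) + F m ^ 2 / x ^ (m + m))"
    unfolding I Q d by (simp add: algebra_simps)
  finally have "x ^ 2 + 2 * F 1 - (x + (B + F m / x ^ m)) ^ 2 - (D + DF m / x ^ m)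
      = 2 * F (Suc m) / x ^ m - (2 * F m / x ^ m * B + (\<Sum>s\<in>{1..<m}. G m (Suc s) / x ^ (s + m)) + F m ^ 2 / x ^ (m + m))"
    unfolding d_def .
  then show ?case unfolding R[symmetric] S[symmetric] by (simp add: G_def)
qed

context turning_point
begin

text \<open>
  As functions of u: wl is the logarithmic coordinate of \<open>\<mu> z e\<^bsup>-\<pi>i\<^esup>\<close>, yu the Whittaker function there, Vu its
  approximation, Hu the relative error, and y1u, Gd the derivatives of yu, Hu with respect to \<open>\<xi>\<close>,
  while xd is \<open>d\<xi>/du\<close>. The logarithmic derivative of Vu with respect to \<open>\<xi>\<close> is Su + au, where au comes from
  the factor \<open>(z/Z)\<^sup>1\<^sup>/\<^sup>2\<close>.
\<close>

definition wl :: "real \<Rightarrow> complex \<Rightarrow> complex" where "wl \<mu> u = of_real (ln \<mu>) + Ln_up (zu u) - of_real pi * \<i>"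
definition Su :: "real \<Rightarrow> nat \<Rightarrow> complex \<Rightarrow> complex" where "Su \<mu> m u = of_real \<mu> + (\<Sum>s\<in>{1..<m}. Fu s u / of_real \<mu> ^ s)"
definition Xu :: "real \<Rightarrow> nat \<Rightarrow> complex \<Rightarrow> complex" where "Xu \<mu> m u = of_real \<mu> * xiu u + (\<Sum>s\<in>{1..<m}. Eu s u / of_real \<mu> ^ s)"
definition au :: "complex \<Rightarrow> complex" where "au u = (4 - 2 * of_real lam * zu u) / Zu u ^ 3"
definition dau :: "complex \<Rightarrow> complex" where
  "dau u = - 4 * of_real lam * zu u / Zu u ^ 4 - 6 * zu u * (zu u - 2 * of_real lam) * (4 - 2 * of_real lam * zu u) / Zu u ^ 6"
definition pref :: "real \<Rightarrow> complex" where
  "pref \<mu> = exp (complex_of_real (lam * \<mu> * pi) * \<i>) * complex_of_real ((1 - lam) powr \<mu>) * complex_of_real ((2 * exp 1 / \<mu>) powr (lam * \<mu>))"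
definition Vu :: "real \<Rightarrow> nat \<Rightarrow> complex \<Rightarrow> complex" where "Vu \<mu> m u = pref \<mu> * sigma u * exp (Xu \<mu> m u)"
definition gW :: "real \<Rightarrow> complex \<Rightarrow> complex" where "gW \<mu> = whittaker_W (- (lam * \<mu>)) \<mu>"
definition yu :: "real \<Rightarrow> complex \<Rightarrow> complex" where "yu \<mu> u = gW \<mu> (wl \<mu> u)"
definition y1u :: "real \<Rightarrow> complex \<Rightarrow> complex" where "y1u \<mu> u = deriv (gW \<mu>) (wl \<mu> u) * (2 / Zu u)"
definition Hu :: "real \<Rightarrow> nat \<Rightarrow> complex \<Rightarrow> complex" where "Hu \<mu> m u = yu \<mu> u / Vu \<mu> m u - 1"
definition Gd :: "real \<Rightarrow> nat \<Rightarrow> complex \<Rightarrow> complex" where "Gd \<mu> m u = (y1u \<mu> u - (Su \<mu> m u + au u) * yu \<mu> u) / Vu \<mu> m u"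
definition rho :: "real \<Rightarrow> nat \<Rightarrow> complex \<Rightarrow> complex" where
  "rho \<mu> m u = 2 * Fu m u / of_real \<mu> ^ (m - 1) - (\<Sum>s\<in>{1..<m}. Gu m s u / of_real \<mu> ^ (s + m - 1))"
definition psi :: "real \<Rightarrow> nat \<Rightarrow> complex \<Rightarrow> complex" where "psi \<mu> m u = 2 * (\<Sum>s\<in>{1..<m}. Fu s u / of_real \<mu> ^ s)"
definition xd :: "complex \<Rightarrow> complex" where "xd u = Zu u ^ 2 / (2 * zu u * u)"
text \<open>The recurrence solved for the derivative of \<open>Fhat s\<close> with respect to
  \<open>xi\<close>, as \<open>dz / d xi = 2 z / Z\<close>.\<close>

definition DFu :: "nat \<Rightarrow> complex \<Rightarrow> complex" where
  "DFu s u = - 2 * Fu (Suc s) u - (\<Sum>j\<in>{1..<s}. Fu j u * Fu (s - j) u)"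

lemma uzZ: "u \<noteq> 0 \<Longrightarrow> u = Zu u + zu u - 2 * of_real lam"
  by (simp add: Zu_def zu_def add_divide_distrib diff_divide_distrib)

lemma Zu_sq: "u \<noteq> 0 \<Longrightarrow> Zu u ^ 2 = zu u ^ 2 - 4 * of_real lam * zu u + 4"
  using Zu_power2 by (simp add: Zsq_def)

section \<open>Derivatives with respect to xi\<close>

context
  fixes u assumes u: "u \<in> Wz"
begin

lemma Dzu: "(zu has_field_derivative 2 * zu u / Zu u * xd u) (at u)"
proof -
  have "2 * zu u / Zu u * xd u = Zu u / u" using Wz_nz[OF u] by (simp add: xd_def power2_eq_square)
  then show ?thesis using zu_deriv[OF Wz_nz(1)[OF u]] by (simp only:)
qed

lemma DZu: "(Zu has_field_derivative 2 * zu u * (zu u - 2 * of_real lam) / Zu u ^ 2 * xd u) (at u)"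
proof -
  have "2 * zu u * (zu u - 2 * of_real lam) / Zu u ^ 2 * xd u = (zu u - 2 * of_real lam) / u"
    using Wz_nz[OF u] by (simp add: xd_def)
  also have "\<dots> = (1 - of_real (ic\<^sup>2) / u ^ 2) / 2"
    using Wz_nz[OF u] by (simp add: zu_def field_simps power2_eq_square)
  finally show ?thesis using Zu_deriv[OF Wz_nz(1)[OF u]] by (simp only:)
qed

lemma Im_zu: "Im (zu u) \<ge> 0"
proof -
  have "Im (of_real (ic\<^sup>2) / u) = - (ic\<^sup>2 * Im u) / (cmod u)\<^sup>2" by (simp add: Im_divide cmod_power2)
  also have "\<dots> \<le> 0" using Wz_nz(9)[OF u] by (simp add: divide_nonpos_nonneg)
  finally show ?thesis using Wz_nz(9)[OF u] by (simp add: zu_def)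
qed

lemma Dwl: "(wl \<mu> has_field_derivative 2 / Zu u * xd u) (at u)"
proof -
  have "Re (zu u) \<noteq> 0 \<or> Im (zu u) > 0" using Im_zu Wz_nz(3)[OF u] by (auto simp: complex_eq_iff)
  from DERIV_chain2[OF Ln_up_deriv[OF this] Dzu]
  have "((\<lambda>u. Ln_up (zu u)) has_field_derivative 1 / zu u * (2 * zu u / Zu u * xd u)) (at u)" .
  moreover have "1 / zu u * (2 * zu u / Zu u * xd u) = 2 / Zu u * xd u" using Wz_nz[OF u] by simp
  ultimately have L: "((\<lambda>u. Ln_up (zu u)) has_field_derivative 2 / Zu u * xd u) (at u)" by (rule DERIV_cong)
  have "(wl \<mu> has_field_derivative (0 + 2 / Zu u * xd u - 0)) (at u)"
    unfolding wl_def[abs_def] by (intro DERIV_diff DERIV_add DERIV_const L)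
  then show ?thesis by simp
qed

lemma exp_wl: "\<mu> > 0 \<Longrightarrow> exp (wl \<mu> u) = - of_real \<mu> * zu u"
proof -
  assume "\<mu> > 0"
  then have "exp (complex_of_real (ln \<mu>)) = of_real \<mu>" by (simp add: exp_of_real)
  moreover have "exp (of_real pi * \<i>) = - 1" by (simp add: mult.commute)
  ultimately show ?thesis unfolding wl_def exp_diff exp_add using Wz_nz(3)[OF u] by (simp add: exp_Ln_up)
qed

lemma gW_solution: "\<mu> > 0 \<Longrightarrow> whittaker_solution (- (lam * \<mu>)) \<mu> (gW \<mu>)"
  using is_whittaker_W_whittaker_W[of "- (lam * \<mu>)" \<mu>] lam0 unfolding gW_def is_whittaker_W_iff by simp

lemma Dyu: "\<mu> > 0 \<Longrightarrow> (yu \<mu> has_field_derivative y1u \<mu> u * xd u) (at u)"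
proof -
  assume mu: "\<mu> > 0"
  have hol: "gW \<mu> holomorphic_on UNIV" using gW_solution[OF mu] by (simp add: whittaker_solution_def)
  from DERIV_chain2[OF entire_has_derivs(1)[OF hol] Dwl]
  have "(yu \<mu> has_field_derivative deriv (gW \<mu>) (wl \<mu> u) * (2 / Zu u * xd u)) (at u)" unfolding yu_def[abs_def] .
  then show ?thesis unfolding y1u_def mult.assoc .
qed

lemma au_alt: "au u = 1 / Zu u - zu u * (zu u - 2 * of_real lam) / Zu u ^ 3"
proof -
  have "1 / Zu u = Zu u ^ 2 / Zu u ^ 3" using Wz_nz(2)[OF u] by (simp add: power2_eq_square power3_eq_cube)
  then have "1 / Zu u - zu u * (zu u - 2 * of_real lam) / Zu u ^ 3 = (Zu u ^ 2 - zu u * (zu u - 2 * of_real lam)) / Zu u ^ 3"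
    by (simp add: diff_divide_distrib)
  then show ?thesis unfolding au_def Zu_sq[OF Wz_nz(1)[OF u]] by (simp add: power2_eq_square algebra_simps)
qed

text \<open>The Whittaker equation in the variable \<open>xi\<close>: the potential becomes
  \<open>\<mu>^2 - 1 / Z^2\<close>, and the change of variable contributes the first-order term with
  coefficient \<open>2 au\<close>.\<close>

lemma Dy1u:
  assumes mu: "\<mu> > 0"
  shows "(y1u \<mu> has_field_derivative ((of_real \<mu> ^ 2 - 1 / Zu u ^ 2) * yu \<mu> u + 2 * au u * y1u \<mu> u) * xd u) (at u)"
proof -
  note nz = Wz_nz[OF u]
  define g0 g1 where "g0 = gW \<mu> (wl \<mu> u)" and "g1 = deriv (gW \<mu>) (wl \<mu> u)"
  define Z z l x where "Z = Zu u" and "z = zu u" and "l = complex_of_real lam" and "x = xd u"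
  have Z0: "Z \<noteq> 0" using nz by (simp add: Z_def)
  have hol: "gW \<mu> holomorphic_on UNIV" using gW_solution[OF mu] by (simp add: whittaker_solution_def)
  \<comment> \<open>At \<open>e^w = - \<mu> z\<close> with parameter \<open>- lam \<mu>\<close> the
    coefficient of the equation collapses to \<open>\<mu>^2 Z^2 / 4 - 1/4\<close>; this explains the
    scaling of the argument and the form of \<open>Zsq\<close>.\<close>
  have g2: "deriv (deriv (gW \<mu>)) (wl \<mu> u) = g1 + (of_real \<mu> ^ 2 * Z ^ 2 / 4 - 1 / 4) * g0"
  proof -
    have "deriv (deriv (gW \<mu>)) (wl \<mu> u) - g1 = (of_real \<mu> ^ 2 - 1/4 - of_real (- (lam * \<mu>)) * exp (wl \<mu> u) + exp (wl \<mu> u) ^ 2 / 4) * g0"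
      using gW_solution[OF mu] unfolding whittaker_solution_def g0_def g1_def by blast
    moreover have "of_real \<mu> ^ 2 - 1/4 - of_real (- (lam * \<mu>)) * exp (wl \<mu> u) + exp (wl \<mu> u) ^ 2 / 4 = of_real \<mu> ^ 2 * Z ^ 2 / 4 - 1 / 4"
      unfolding exp_wl[OF mu] Z_def Zu_sq[OF nz(1)] by (simp add: power2_eq_square field_simps)
    ultimately have "deriv (deriv (gW \<mu>)) (wl \<mu> u) - g1 = (of_real \<mu> ^ 2 * Z ^ 2 / 4 - 1 / 4) * g0" by (simp only:)
    then show ?thesis by (metis diff_add_cancel add.commute)
  qed
  have "((\<lambda>u. deriv (gW \<mu>) (wl \<mu> u)) has_field_derivative deriv (deriv (gW \<mu>)) (wl \<mu> u) * (2 / Zu u * xd u)) (at u)"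
    by (rule DERIV_chain2[OF entire_has_derivs(2)[OF hol] Dwl])
  moreover have "((\<lambda>u. 2 / Zu u) has_field_derivative - (2 * (2 * z * (z - 2 * l) / Z ^ 2 * x)) / Z ^ 2) (at u)"
    using DERIV_divide[OF DERIV_const[of 2] DZu] Z0 by (simp add: Z_def z_def l_def x_def power2_eq_square)
  ultimately have "(y1u \<mu> has_field_derivative deriv (deriv (gW \<mu>)) (wl \<mu> u) * (2 / Zu u * xd u) * (2 / Zu u)
      + - (2 * (2 * z * (z - 2 * l) / Z ^ 2 * x)) / Z ^ 2 * deriv (gW \<mu>) (wl \<mu> u)) (at u)"
    unfolding y1u_def[abs_def] by (rule DERIV_mult)
  moreover have "deriv (deriv (gW \<mu>)) (wl \<mu> u) * (2 / Zu u * xd u) * (2 / Zu u)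
      + - (2 * (2 * z * (z - 2 * l) / Z ^ 2 * x)) / Z ^ 2 * deriv (gW \<mu>) (wl \<mu> u)
      = ((of_real \<mu> ^ 2 - 1 / Zu u ^ 2) * yu \<mu> u + 2 * au u * y1u \<mu> u) * xd u"
    unfolding g2 au_alt yu_def y1u_def g0_def[symmetric] g1_def[symmetric] Z_def[symmetric] z_def[symmetric] l_def[symmetric] x_def[symmetric]
    using Z0 by (simp add: field_simps power2_eq_square power3_eq_cube)
  ultimately show ?thesis by simp
qed

lemma Dsigma: "(sigma has_field_derivative au u * sigma u * xd u) (at u)"
proof -
  note nz = Wz_nz[OF u]
  define Z z l where "Z = Zu u" and "z = zu u" and "l = complex_of_real lam"
  have a: "1 / (u - of_real u1) + 1 / (u - of_real u2) = (u + 2 * l) / (u * z)"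
  proof -
    have "1 / (u - of_real u1) + 1 / (u - of_real u2) = (2 * u - of_real (u1 + u2)) / ((u - of_real u1) * (u - of_real u2))"
      using nz by (simp add: field_simps)
    also have "(u - of_real u1) * (u - of_real u2) = 2 * (u * z)" using zu_factor[OF nz(1)] nz(1) by (simp add: z_def)
    also have "2 * u - of_real (u1 + u2) = 2 * (u + 2 * l)" unfolding u12 l_def by simp
    finally have e: "1 / (u - of_real u1) + 1 / (u - of_real u2) = (2 * (u + 2 * l)) / (2 * (u * z))" .
    show ?thesis by (rule trans[OF e mult_divide_mult_cancel_left]) simp
  qed
  have b: "1 / (u - \<i> * of_real ic) + 1 / (u + \<i> * of_real ic) = 1 / Z"
  proof -
    have "1 / (u - \<i> * of_real ic) + 1 / (u + \<i> * of_real ic) = 2 * u / ((u - \<i> * of_real ic) * (u + \<i> * of_real ic))"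
      using nz by (simp add: add_divide_eq_iff divide_add_eq_iff)
    also have "(u - \<i> * of_real ic) * (u + \<i> * of_real ic) = 2 * u * Z" using Zu_factor[OF nz(1)] nz(1) by (simp add: Z_def)
    finally show ?thesis using nz(1) by simp
  qed
  \<comment> \<open>\<open>u = Z + z - 2 lam\<close> and the quadratic equation of \<open>Z\<close>
    eliminate \<open>u\<close>.\<close>
  have key: "(u + 2 * l) * Z - u * z = 4 - 2 * l * z"
  proof -
    have "(u + 2 * l) * Z - u * z = Z ^ 2 - z ^ 2 + 2 * l * z"
      by (subst (1 2) uzZ[OF nz(1)]) (simp add: Z_def z_def l_def power2_eq_square algebra_simps)
    then show ?thesis unfolding Z_def Zu_sq[OF nz(1)] by (simp add: z_def l_def)
  qed
  have "(1 / (u - of_real u1) + 1 / (u - of_real u2) - 1 / (u - \<i> * of_real ic) - 1 / (u + \<i> * of_real ic)) / 2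
      = ((u + 2 * l) / (u * z) - 1 / Z) / 2"
    unfolding diff_diff_eq a b ..
  also have "\<dots> = ((u + 2 * l) * Z - u * z) / (2 * (u * z * Z))"
    using nz by (simp add: Z_def z_def field_simps)
  also have "\<dots> = au u * xd u" unfolding key
    using nz by (simp add: au_def xd_def Z_def z_def l_def power2_eq_square power3_eq_cube)
  finally show ?thesis using sigma_deriv[OF u] by (simp add: mult_ac)
qed

lemma DFu: "s \<ge> 1 \<Longrightarrow> (Fu s has_field_derivative DFu s u * xd u) (at u)"
proof -
  assume "s \<ge> 1"
  then obtain m where m: "s = Suc m" by (metis One_nat_def Suc_le_D)
  note nz = Wz_nz[OF u]
  have "DFu s u = 2 * (zu u / Zu u) * (deriv (Fu s) u * (u / Zu u))"
    unfolding DFu_def m Fu_Suc_Suc[OF nz(1,2)] by simp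
  then have "DFu s u * xd u = deriv (Fu s) u" using nz by (simp add: xd_def power2_eq_square)
  then show ?thesis using Fu_deriv[OF nz(8)] by simp
qed

lemma DEu: "(Eu s has_field_derivative Fu s u * xd u) (at u)"
proof -
  have "Fu s u * xd u = eu s u" using Wz_nz[OF u] by (simp add: Fu_def xd_def eu_def)
  then show ?thesis using Eu(1)[OF Wz_nz(8)[OF u]] by simp
qed

lemma Dau: "(au has_field_derivative dau u * xd u) (at u)"
proof -
  note nz = Wz_nz[OF u]
  have n: "((\<lambda>u. 4 - 2 * of_real lam * zu u) has_field_derivative 0 - 2 * of_real lam * (2 * zu u / Zu u * xd u)) (at u)"
    by (intro DERIV_diff DERIV_const DERIV_cmult Dzu)
  have d: "((\<lambda>u. Zu u ^ 3) has_field_derivative of_nat 3 * (2 * zu u * (zu u - 2 * of_real lam) / Zu u ^ 2 * xd u * Zu u ^ (3 - Suc 0))) (at u)"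
    by (rule DERIV_power[OF DZu])
  have "Zu u ^ 3 \<noteq> 0" using nz by simp
  from DERIV_divide[OF n d this] show ?thesis
    unfolding au_def[abs_def]
  proof (rule DERIV_cong)
    have eq: "((0 - 2 * l * (2 * z / Z * x)) * Z ^ 3 - (4 - 2 * l * z) * (of_nat 3 * (2 * z * (z - 2 * l) / Z ^ 2 * x * Z ^ (3 - Suc 0)))) / (Z ^ 3 * Z ^ 3)
      = (- 4 * l * z / Z ^ 4 - 6 * z * (z - 2 * l) * (4 - 2 * l * z) / Z ^ 6) * x" if "Z \<noteq> 0" for Z z l x :: complex
    proof -
      have "(0 - 2 * l * (2 * z / Z * x)) * Z ^ 3 = - 4 * l * z * x * Z ^ 2" using that by (simp add: eval_nat_numeral)
      moreover have "of_nat 3 * (2 * z * (z - 2 * l) / Z ^ 2 * x * Z ^ (3 - Suc 0)) = 6 * z * (z - 2 * l) * x"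
        using that by simp
      ultimately have "((0 - 2 * l * (2 * z / Z * x)) * Z ^ 3 - (4 - 2 * l * z) * (of_nat 3 * (2 * z * (z - 2 * l) / Z ^ 2 * x * Z ^ (3 - Suc 0)))) / (Z ^ 3 * Z ^ 3)
        = (- 4 * l * z * x * Z ^ 2) / (Z ^ 4 * Z ^ 2) - (4 - 2 * l * z) * (6 * z * (z - 2 * l) * x) / Z ^ 6"
        by (simp add: diff_divide_distrib flip: power_add)
      also have "(- 4 * l * z * x * Z ^ 2) / (Z ^ 4 * Z ^ 2) = - 4 * l * z * x / Z ^ 4"
        by (rule mult_divide_mult_cancel_right) (use that in simp)
      finally show ?thesis by (simp add: algebra_simps)
    qed
    show "((0 - 2 * of_real lam * (2 * zu u / Zu u * xd u)) * Zu u ^ 3 - (4 - 2 * of_real lam * zu u) * (of_nat 3 * (2 * zu u * (zu u - 2 * of_real lam) / Zu u ^ 2 * xd u * Zu u ^ (3 - Suc 0)))) / (Zu u ^ 3 * Zu u ^ 3) = dau u * xd u"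
      unfolding dau_def by (rule eq) (use nz in simp)
  qed
qed

text \<open>The origin of \<open>Fhat 1\<close>: it is half the potential
  \<open>a^2 - a' - 1 / Z^2\<close> that is left over by the Liouville transformation with the
  factor \<open>(z/Z)^(1/2)\<close>.\<close>

lemma Fu_1: "2 * Fu 1 u = au u ^ 2 - dau u - 1 / Zu u ^ 2"
proof -
  note nz = Wz_nz[OF u]
  define Z z l where "Z = Zu u" and "z = zu u" and "l = complex_of_real lam"
  define Q where "Q = z ^ 2 - 4 * l * z + 4"
  have Z0: "Z \<noteq> 0" using nz by (simp add: Z_def)
  have Q: "Z ^ 2 = Q" using Zu_sq[OF nz(1)] by (simp add: Z_def z_def l_def Q_def)
  have "1 / Z ^ 2 = Z ^ 4 / Z ^ 6" "4 * l * z / Z ^ 4 = 4 * l * z * Z ^ 2 / Z ^ 6"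
    using Z0 by (simp_all add: eval_nat_numeral)
  moreover have "((4 - 2 * l * z) / Z ^ 3) ^ 2 = (4 - 2 * l * z) ^ 2 / Z ^ 6" by (simp add: power_divide flip: power_mult)
  ultimately have "au u ^ 2 - dau u - 1 / Zu u ^ 2 =
      ((4 - 2 * l * z) ^ 2 + 4 * l * z * Z ^ 2 + 6 * z * (z - 2 * l) * (4 - 2 * l * z) - Z ^ 4) / Z ^ 6"
    unfolding au_def dau_def Z_def[symmetric] z_def[symmetric] l_def[symmetric]
    by (simp add: add_divide_distrib diff_divide_distrib)
  also have "Z ^ 4 = Q ^ 2" unfolding Q[symmetric] by (simp flip: power_mult)
  also have "(4 - 2 * l * z) ^ 2 + 4 * l * z * Z ^ 2 + 6 * z * (z - 2 * l) * (4 - 2 * l * z) - Q ^ 2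
     = - (z * (z ^ 3 - 16 * z + 4 * l ^ 2 * z + 16 * l))"
    unfolding Q Q_def by (simp add: eval_nat_numeral algebra_simps)
  finally have e: "au u ^ 2 - dau u - 1 / Zu u ^ 2 = - (z * (z ^ 3 - 16 * z + 4 * l ^ 2 * z + 16 * l)) / Z ^ 6" .
  have g: "2 * (y * (- A / (2 * B))) = - (y * A) / B" for y A B :: complex by simp
  have "2 * Fu 1 u = - (z * (z ^ 3 - 16 * z + 4 * l ^ 2 * z + 16 * l)) / Z ^ 6"
    unfolding Fu_def One_nat_def Ku.simps Z_def[symmetric] z_def[symmetric] l_def[symmetric] by (rule g)
  then show ?thesis unfolding e .
qed

lemma DSu: "(Su \<mu> m has_field_derivative (\<Sum>s\<in>{1..<m}. DFu s u / of_real \<mu> ^ s) * xd u) (at u)"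
proof -
  have "(Su \<mu> m has_field_derivative 0 + (\<Sum>s\<in>{1..<m}. DFu s u * xd u / of_real \<mu> ^ s)) (at u)"
    unfolding Su_def[abs_def] by (intro DERIV_add DERIV_const DERIV_sum DERIV_cdivide DFu) auto
  then show ?thesis by (simp add: sum_distrib_right)
qed

lemma DXu: "(Xu \<mu> m has_field_derivative Su \<mu> m u * xd u) (at u)"
proof -
  have "(Xu \<mu> m has_field_derivative of_real \<mu> * xd u + (\<Sum>s\<in>{1..<m}. Fu s u * xd u / of_real \<mu> ^ s)) (at u)"
    unfolding Xu_def[abs_def] using xiu_deriv[OF u]
    by (intro DERIV_add DERIV_cmult DERIV_sum DERIV_cdivide DEu) (simp add: xd_def)
  then show ?thesis by (simp add: Su_def sum_distrib_right distrib_right)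
qed

lemma DVu: "(Vu \<mu> m has_field_derivative (Su \<mu> m u + au u) * Vu \<mu> m u * xd u) (at u)"
proof -
  have "(Vu \<mu> m has_field_derivative pref \<mu> * (au u * sigma u * xd u) * exp (Xu \<mu> m u)
      + exp (Xu \<mu> m u) * (Su \<mu> m u * xd u) * (pref \<mu> * sigma u)) (at u)"
    unfolding Vu_def[abs_def] by (intro DERIV_mult DERIV_cmult Dsigma DERIV_chain2[OF DERIV_exp DXu])
  then show ?thesis by (simp add: Vu_def algebra_simps)
qed

lemma pref_nz: "\<mu> > 0 \<Longrightarrow> pref \<mu> \<noteq> 0"
  using lam1 by (simp add: pref_def)

lemma Vu_nz: "\<mu> > 0 \<Longrightarrow> Vu \<mu> m u \<noteq> 0"
  by (simp add: Vu_def pref_nz sigma_nz)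

lemma DHu: "\<mu> > 0 \<Longrightarrow> (Hu \<mu> m has_field_derivative Gd \<mu> m u * xd u) (at u)"
proof -
  assume mu: "\<mu> > 0"
  note V = Vu_nz[OF mu, of m]
  have "(Hu \<mu> m has_field_derivative (y1u \<mu> u * xd u * Vu \<mu> m u - yu \<mu> u * ((Su \<mu> m u + au u) * Vu \<mu> m u * xd u)) / (Vu \<mu> m u * Vu \<mu> m u) - 0) (at u)"
    unfolding Hu_def[abs_def] by (intro DERIV_diff DERIV_const DERIV_divide Dyu[OF mu] DVu V)
  moreover have "(y1u \<mu> u * xd u * Vu \<mu> m u - yu \<mu> u * ((Su \<mu> m u + au u) * Vu \<mu> m u * xd u)) / (Vu \<mu> m u * Vu \<mu> m u) - 0 = Gd \<mu> m u * xd u"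
    unfolding Gd_def using V by (simp add: field_simps)
  ultimately show ?thesis by simp
qed

text \<open>By \<open>Fu_1\<close> the leftover potential is \<open>2 F 1\<close>, so the defect of
  the truncated series in the Riccati equation is the quantity computed by
  \<open>riccati_residual\<close>.\<close>

lemma rho_eq: "\<mu> > 0 \<Longrightarrow> m \<ge> 1 \<Longrightarrow>
  rho \<mu> m u = of_real \<mu> ^ 2 - Su \<mu> m u ^ 2 - (\<Sum>s\<in>{1..<m}. DFu s u / of_real \<mu> ^ s) + au u ^ 2 - dau u - 1 / Zu u ^ 2"
proof -
  assume "\<mu> > 0" "m \<ge> 1"
  then have "of_real \<mu> ^ 2 + 2 * Fu 1 u - Su \<mu> m u ^ 2 - (\<Sum>s\<in>{1..<m}. DFu s u / of_real \<mu> ^ s) = rho \<mu> m u"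
    unfolding rho_def Gu_def Su_def by (intro riccati_residual) (auto simp: DFu_def)
  then show ?thesis unfolding Fu_1 by (simp only: algebra_simps)
qed

lemma DGd:
  assumes mu: "\<mu> > 0" and m: "m \<ge> 1"
  shows "(Gd \<mu> m has_field_derivative (rho \<mu> m u * (1 + Hu \<mu> m u) - (2 * of_real \<mu> + psi \<mu> m u) * Gd \<mu> m u) * xd u) (at u)"
proof -
  define y y1 S a V x DS da where "y = yu \<mu> u" and "y1 = y1u \<mu> u" and "S = Su \<mu> m u" and "a = au u" and "V = Vu \<mu> m u" and "x = xd u"
    and "DS = (\<Sum>s\<in>{1..<m}. DFu s u / of_real \<mu> ^ s)" and "da = dau u"
  note defs = y_def y1_def S_def a_def V_def x_def DS_def da_def
  define M where "M = of_real \<mu> ^ 2 - 1 / Zu u ^ 2"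
  have V: "V \<noteq> 0" using Vu_nz[OF mu] by (simp add: V_def)
  have d: "(Gd \<mu> m has_field_derivative (((M * y + 2 * a * y1) * x - ((DS * x + da * x) * y + y1 * x * (S + a))) * V
      - (y1 - (S + a) * y) * ((S + a) * V * x)) / (V * V)) (at u)"
    unfolding Gd_def[abs_def] defs M_def
    by (intro DERIV_divide DERIV_diff DERIV_mult DERIV_add Dy1u Dyu mu DSu Dau DVu Vu_nz)
  have r: "rho \<mu> m u = M - S ^ 2 - DS + a ^ 2 - da" unfolding rho_eq[OF mu m] M_def defs by simp
  \<comment> \<open>The damping coefficient is twice the logarithmic derivative of the exponential
    factor of \<open>Vu\<close>; the factor \<open>sigma\<close> contributes nothing to it.\<close>
  have p: "2 * of_real \<mu> + psi \<mu> m u = 2 * S" by (simp add: psi_def S_def Su_def)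
  have H: "1 + Hu \<mu> m u = y / V" "Gd \<mu> m u = (y1 - (S + a) * y) / V" by (simp_all add: Hu_def Gd_def defs)
  have "((M * y + 2 * a * y1) * x - ((DS * x + da * x) * y + y1 * x * (S + a))) * V - (y1 - (S + a) * y) * ((S + a) * V * x)
      = ((M - S ^ 2 - DS + a ^ 2 - da) * y - 2 * S * (y1 - (S + a) * y)) * x * V"
    by (simp add: power2_eq_square algebra_simps)
  then have "(((M * y + 2 * a * y1) * x - ((DS * x + da * x) * y + y1 * x * (S + a))) * V
      - (y1 - (S + a) * y) * ((S + a) * V * x)) / (V * V) = ((M - S ^ 2 - DS + a ^ 2 - da) * (y / V) - 2 * S * ((y1 - (S + a) * y) / V)) * x"
  proof -
    have g: "(c * y - e * w) * x * V / (V * V) = (c * (y / V) - e * (w / V)) * x" for c e w using V by (simp add: field_simps)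
    assume "((M * y + 2 * a * y1) * x - ((DS * x + da * x) * y + y1 * x * (S + a))) * V - (y1 - (S + a) * y) * ((S + a) * V * x)
      = ((M - S ^ 2 - DS + a ^ 2 - da) * y - 2 * S * (y1 - (S + a) * y)) * x * V"
    then show ?thesis by (simp only: g)
  qed
  then show ?thesis using d unfolding r p H x_def by (simp only:)
qed

end

end

section \<open>Behaviour at the start of a path\<close>

lemma R2_arcs_local:
  assumes arc: "R2_arc_on ({real k..real (Suc k)} \<inter> {0<..}) p"
  obtains p' where "continuous_on ({real k..real (Suc k)} \<inter> {0<..}) p" "continuous_on ({real k..real (Suc k)} \<inter> {0<..}) p'"
    "\<And>t. t \<in> {real k<..<real (Suc k)} \<Longrightarrow> (p has_vector_derivative p' t) (at t) \<and> vector_derivative p (at t) = p' t"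
proof -
  define I where "I = {real k..real (Suc k)} \<inter> {0<..}"
  obtain p' p'' where p: "\<And>t. t \<in> I \<Longrightarrow> (p has_vector_derivative p' t) (at t within I) \<and> (p' has_vector_derivative p'' t) (at t within I)"
    using arc unfolding R2_arc_on_def I_def by blast
  have c: "continuous_on I p" "continuous_on I p'"
    unfolding continuous_on_eq_continuous_within using p has_vector_derivative_continuous by metis+
  have d: "(p has_vector_derivative p' t) (at t)" if "t \<in> {real k<..<real (Suc k)}" for t
  proof -
    have "{real k<..<real (Suc k)} \<subseteq> I" by (auto simp: I_def)
    then have "(p has_vector_derivative p' t) (at t within {real k<..<real (Suc k)})"
      by (intro has_vector_derivative_within_subset[OF conjunct1[OF p]]) (use that in auto)
    then show ?thesis by (rule iffD1[OF has_vector_derivative_within_open[OF that open_greaterThanLessThan]])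
  qed
  have dd: "(p has_vector_derivative p' t) (at t) \<and> vector_derivative p (at t) = p' t" if "t \<in> {real k<..<real (Suc k)}" for t
    using d[OF that] vector_derivative_at[OF d[OF that]] by (rule conjI)
  show ?thesis by (rule that[of p', OF c[unfolded I_def] dd])
qed

context
  fixes p :: "real \<Rightarrow> complex" and N :: nat
  assumes arcs: "\<And>k. k < N \<Longrightarrow> R2_arc_on ({real k..real (Suc k)} \<inter> {0<..}) p"
begin

lemma R2_arcs_continuous: "continuous_on {0<..real N} p"
proof -
  have "continuous_on ({0..real j} \<inter> {0<..}) p" if "j \<le> N" for j
    using that
  proof (induction j)
    case (Suc j)
    define A B where "A = {0..real j} \<inter> {0<..}" and "B = {real j..real (Suc j)} \<inter> {0<..}"
    have U: "{0..real (Suc j)} \<inter> {0<..} = A \<union> B" by (auto simp: A_def B_def)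
    have "A = (A \<union> B) \<inter> {0..real j}" "B = (A \<union> B) \<inter> {real j..real (Suc j)}" by (auto simp: A_def B_def)
    then have cl: "closedin (top_of_set (A \<union> B)) A" "closedin (top_of_set (A \<union> B)) B"
      by (metis closedin_closed_Int closed_atLeastAtMost)+
    have "continuous_on A p" using Suc by (simp add: A_def)
    moreover have "continuous_on B p" using R2_arcs_local[OF arcs[of j]] Suc.prems unfolding B_def by (metis Suc_le_lessD)
    ultimately show ?case unfolding U by (intro continuous_on_Un_local cl)
  qed simp
  then have "continuous_on ({0..real N} \<inter> {0<..}) p" by simp
  moreover have "{0..real N} \<inter> {0<..} = {0<..real N}" by auto
  ultimately show ?thesis by simp
qed

lemma R2_arcs_interior:
  assumes t: "t \<in> {0<..<real N} - real ` {..N}"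
  shows "(p has_vector_derivative vector_derivative p (at t)) (at t)" "isCont (\<lambda>t. vector_derivative p (at t)) t"
proof -
  define k where "k = nat \<lfloor>t\<rfloor>"
  have k: "real k \<le> t" "t < real (Suc k)" using t unfolding k_def by simp_all linarith
  have "k < N" using k t by simp
  then have "t \<noteq> real k" using t by auto
  then have tk: "t \<in> {real k<..<real (Suc k)}" using k by simp
  obtain p' where p': "continuous_on ({real k..real (Suc k)} \<inter> {0<..}) p'"
    "\<And>t. t \<in> {real k<..<real (Suc k)} \<Longrightarrow> (p has_vector_derivative p' t) (at t) \<and> vector_derivative p (at t) = p' t"
    using R2_arcs_local[OF arcs[OF \<open>k < N\<close>]] by metis
  show "(p has_vector_derivative vector_derivative p (at t)) (at t)" using p'(2)[OF tk] by simp
  have "continuous_on {real k<..<real (Suc k)} p'" by (rule continuous_on_subset[OF p'(1)]) auto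
  then have c: "isCont p' t" using tk continuous_on_eq_continuous_at[OF open_greaterThanLessThan] by metis
  have ev: "eventually (\<lambda>s. vector_derivative p (at s) = p' s) (nhds t)"
    by (rule eventually_mono[OF eventually_nhds_in_open[OF open_greaterThanLessThan tk]]) (use p'(2) in blast)
  show "isCont (\<lambda>t. vector_derivative p (at t)) t" by (rule iffD2[OF isCont_cong[OF ev] c])
qed

text \<open>The arcs are treated one after the other. The bound \<open>a > 0\<close> keeps away from
  the parameter 0 of the point at infinity, and the possibly missing derivatives at the joints
  concern finitely many parameters only.\<close>

lemma R2_arcs_integrable:
  fixes c :: "complex \<Rightarrow> complex"
  assumes c: "continuous_on (p ` {0<..real N}) c" and a: "0 < a"
  shows "(\<lambda>t. cmod (c (p t) * vector_derivative p (at t))) integrable_on {a..real N}"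
proof -
  define f where "f = (\<lambda>t. cmod (c (p t) * vector_derivative p (at t)))"
  have piece: "f integrable_on {max a (real k)..real (Suc k)}" if k: "k < N" for k
  proof -
    define J where "J = {max a (real k)..real (Suc k)}"
    obtain p' where p': "continuous_on ({real k..real (Suc k)} \<inter> {0<..}) p'"
      "\<And>t. t \<in> {real k<..<real (Suc k)} \<Longrightarrow> (p has_vector_derivative p' t) (at t) \<and> vector_derivative p (at t) = p' t"
      using R2_arcs_local[OF arcs[OF k]] by metis
    have sub: "J \<subseteq> {real k..real (Suc k)} \<inter> {0<..}" "J \<subseteq> {0<..real N}" using a k by (auto simp: J_def)
    have "continuous_on J (\<lambda>t. c (p t))"
      by (rule continuous_on_compose2[OF c continuous_on_subset[OF R2_arcs_continuous sub(2)]]) (use sub in auto)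
    then have "continuous_on J (\<lambda>t. cmod (c (p t) * p' t))"
      by (intro continuous_intros continuous_on_subset[OF p'(1) sub(1)])
    then have i: "(\<lambda>t. cmod (c (p t) * p' t)) integrable_on J" unfolding J_def by (rule integrable_continuous_real)
    have "f integrable_on J"
      by (rule integrable_spike_finite[OF _ _ i, of "{real k, real (Suc k)}"])
         (use p'(2) in \<open>auto simp: f_def J_def\<close>)
    then show ?thesis by (simp add: J_def)
  qed
  have "f integrable_on {a..real j}" if "j \<le> N" for j
    using that
  proof (induction j)
    case 0 then show ?case using a by (auto intro: integrable_on_empty)
  next
    case (Suc j)
    show ?case
    proof (cases "a \<le> real j")
      case True
      show ?thesis
        by (rule Henstock_Kurzweil_Integration.integrable_combine[OF True]) (use Suc piece[of j] True in \<open>auto simp: max_def\<close>)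
    next
      case False
      then show ?thesis using piece[of j] Suc.prems by (simp add: max_def)
    qed
  qed
  then show ?thesis unfolding f_def by simp
qed

end

text \<open>Links the real integral over \<open>[a, N]\<close>, needed for the Gronwall estimate,
  with the extended integral over \<open>(0, N]\<close>. The upper bound is free of
  \<open>a\<close>, which permits \<open>a\<close> to tend to 0.\<close>

lemma abs_path_integral_ge:
  assumes i: "(\<lambda>t. cmod (c (p t) * vector_derivative p (at t))) integrable_on {a..real N}" and a: "0 < a"
    and h: "\<And>t. t \<in> {0<..real N} \<Longrightarrow> h (p t) = c (p t)" and fin: "abs_path_integral N p h < \<infinity>"
  shows "integral {a..real N} (\<lambda>t. cmod (c (p t) * vector_derivative p (at t))) \<le> enn2real (abs_path_integral N p h)"
proof -
  define f where "f = (\<lambda>t. cmod (c (p t) * vector_derivative p (at t)))"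
  have "(f has_integral integral {a..real N} f) {a..real N}" using i unfolding f_def by (rule integrable_integral)
  then have "ennreal (integral {a..real N} f) = (\<integral>\<^sup>+t. ennreal (f t) * indicator {a..real N} t \<partial>lborel)"
    by (intro nn_integral_has_integral_lebesgue'[symmetric]) (auto simp: f_def)
  also have "\<dots> \<le> abs_path_integral N p h"
    unfolding abs_path_integral_def
  proof (rule nn_integral_mono)
    fix t
    show "ennreal (f t) * indicator {a..real N} t \<le> ennreal (cmod (h (p t) * vector_derivative p (at t))) * indicator {0<..real N} t"
      using a h[of t] by (auto simp: f_def indicator_def)
  qed
  finally have "ennreal (integral {a..real N} f) \<le> abs_path_integral N p h" .
  moreover have "integral {a..real N} f \<ge> 0" by (rule integral_nonneg) (use i in \<open>auto simp: f_def\<close>)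
  ultimately show ?thesis using fin enn2real_mono[of "ennreal (integral {a..real N} f)" "abs_path_integral N p h"] by (simp add: f_def)
qed

section \<open>Limits as u tends to infinity\<close>

context turning_point
begin

context
  fixes v :: "real \<Rightarrow> complex" and F :: "real filter"
  assumes inf: "filterlim v at_infinity F" and vW: "eventually (\<lambda>t. v t \<in> Wz) F"
begin

lemma over_v: "((\<lambda>t. c / v t) \<longlongrightarrow> 0) F"
  by (rule tendsto_divide_0[OF tendsto_const inf])

lemma v_large: "eventually (\<lambda>t. cmod (v t) > R) F"
  using inf unfolding filterlim_at_infinity_conv_norm_at_top filterlim_at_top_dense by blast

lemma Zu_inf: "filterlim (\<lambda>t. Zu (v t)) at_infinity F"
proof -
  have "filterlim (\<lambda>t. (1/2) * v t) at_infinity F" by (rule tendsto_mult_filterlim_at_infinity[OF tendsto_const _ inf]) simp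
  then have "filterlim (\<lambda>t. of_real (ic\<^sup>2) / 2 / v t + (1/2) * v t) at_infinity F"
    by (rule tendsto_add_filterlim_at_infinity[OF over_v])
  then show ?thesis by (simp add: Zu_def add_divide_distrib add.commute mult.commute)
qed

lemma over_Z: "((\<lambda>t. c / Zu (v t)) \<longlongrightarrow> 0) F"
  by (rule tendsto_divide_0[OF tendsto_const Zu_inf])

lemma zu_inf: "filterlim (\<lambda>t. zu (v t)) at_infinity F"
proof -
  have "filterlim (\<lambda>t. (1/2) * v t) at_infinity F" by (rule tendsto_mult_filterlim_at_infinity[OF tendsto_const _ inf]) simp
  then have "filterlim (\<lambda>t. (2 * of_real lam - of_real (ic\<^sup>2) / 2 / v t) + (1/2) * v t) at_infinity F"
    by (rule tendsto_add_filterlim_at_infinity[OF tendsto_diff[OF tendsto_const over_v]])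
  then show ?thesis by (simp add: zu_def diff_divide_distrib algebra_simps)
qed

lemma Fu_lim: "((\<lambda>t. Fu s (v t)) \<longlongrightarrow> 0) F"
proof -
  obtain R C where RC: "R > ic" "R \<ge> 1" "\<And>u. cmod u > R \<Longrightarrow> cmod (Ku s u) \<le> C / cmod u ^ 3" using Ku_decay[of s] by blast
  obtain R' where R': "\<And>u. cmod u > R' \<Longrightarrow> cmod (zu u) \<le> cmod u" using zu_Zu_bounds by blast
  have "eventually (\<lambda>t. cmod (Fu s (v t)) \<le> cmod (of_real C / v t * (1 / v t))) F"
    using v_large[of "max R R'"]
  proof eventually_elim
    case (elim t)
    define x where "x = cmod (v t)"
    have x: "x > R" "x > R'" "x > 0" using elim RC(2) by (auto simp: x_def)
    have "cmod (Ku s (v t)) \<le> C / x ^ 3" using RC(3)[of "v t"] x by (simp add: x_def)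
    also have "\<dots> \<le> \<bar>C\<bar> / x ^ 3" using x by (intro divide_right_mono) auto
    finally have K: "cmod (Ku s (v t)) \<le> \<bar>C\<bar> / x ^ 3" .
    have "cmod (Fu s (v t)) \<le> x * (\<bar>C\<bar> / x ^ 3)"
      unfolding Fu_def norm_mult using R'[of "v t"] x K by (intro mult_mono) (auto simp: x_def)
    also have "\<dots> = cmod (of_real C / v t * (1 / v t))"
      using x by (simp add: norm_mult norm_divide x_def[symmetric] power3_eq_cube)
    finally show ?case .
  qed
  moreover have "((\<lambda>t. of_real C / v t * (1 / v t)) \<longlongrightarrow> 0 * 0) F" by (intro tendsto_mult over_v)
  ultimately show ?thesis using Lim_null_comparison[of "\<lambda>t. Fu s (v t)" "\<lambda>t. cmod (of_real C / v t * (1 / v t))"]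
    tendsto_norm_zero by fastforce
qed

lemma Eu_lim: "((\<lambda>t. Eu s (v t)) \<longlongrightarrow> 0) F"
proof (rule tendstoI)
  fix e :: real assume "e > 0"
  then obtain R where R: "\<And>u. u \<in> W \<Longrightarrow> Im u \<ge> 0 \<Longrightarrow> cmod u \<ge> R \<Longrightarrow> cmod (Eu s u) < e" using Eu(2) by blast
  show "eventually (\<lambda>t. dist (Eu s (v t)) 0 < e) F"
    using v_large[of R] vW
  proof eventually_elim
    case (elim t)
    then show ?case using R[of "v t"] Wz_nz(8,9)[OF elim(2)] by simp
  qed
qed

lemma Ln_lim: "((\<lambda>t. Ln (1 - c / v t)) \<longlongrightarrow> 0) F"
proof -
  have "((\<lambda>t. Ln (1 - c / v t)) \<longlongrightarrow> Ln (1 - 0)) F" by (intro tendsto_intros over_v) auto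
  then show ?thesis by simp
qed

lemma au_lim: "((\<lambda>t. au (v t)) \<longlongrightarrow> 0) F"
proof -
  have "((\<lambda>t. 4 / Zu (v t) * (1 / Zu (v t)) * (1 / Zu (v t)) - 2 * of_real lam * (1 + (2 * of_real lam - of_real (ic\<^sup>2) / v t) * (1 / Zu (v t))) * ((1 / Zu (v t)) * (1 / Zu (v t))))
      \<longlongrightarrow> 0 * 0 * 0 - 2 * of_real lam * (1 + (2 * of_real lam - 0) * 0) * (0 * 0)) F"
    by (intro tendsto_intros over_v over_Z)
  moreover have "eventually (\<lambda>t. 4 / Zu (v t) * (1 / Zu (v t)) * (1 / Zu (v t)) - 2 * of_real lam * (1 + (2 * of_real lam - of_real (ic\<^sup>2) / v t) * (1 / Zu (v t))) * ((1 / Zu (v t)) * (1 / Zu (v t))) = au (v t)) F"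
    using vW
  proof eventually_elim
    case (elim t)
    define Z where "Z = Zu (v t)"
    have Z: "Z \<noteq> 0" using Wz_nz(2)[OF elim] by (simp add: Z_def)
    have z: "zu (v t) = Z + (2 * of_real lam - of_real (ic\<^sup>2) / v t)" by (simp add: zu_def Zu_def Z_def field_simps)
    have g: "4 / Z * (1 / Z) * (1 / Z) - 2 * l * (1 + w * (1 / Z)) * ((1 / Z) * (1 / Z)) = (4 - 2 * l * (Z + w)) / Z ^ 3" for l w
      using Z by (simp add: field_simps power3_eq_cube)
    show ?case unfolding au_def z Z_def[symmetric] by (rule g)
  qed
  ultimately show ?thesis using tendsto_cong by fastforce
qed

text \<open>What remains of the Whittaker phase once the exponent \<open>Xu\<close> and the
  logarithm of the constant prefactor are subtracted; it vanishes at infinity.\<close>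

definition Th :: "real \<Rightarrow> nat \<Rightarrow> complex \<Rightarrow> complex" where
  "Th \<mu> m u = of_real \<mu> * (- of_real lam * (Ln (1 - of_real u1 / u) + Ln (1 - of_real u2 / u)) - of_real (ic\<^sup>2) / u / 2
     - Ln (1 - of_real u1 / u) + Ln (1 - of_real u2 / u)) - (\<Sum>s\<in>{1..<m}. Eu s u / of_real \<mu> ^ s)"

lemma Th_lim: "((\<lambda>t. Th \<mu> m (v t)) \<longlongrightarrow> 0) F"
proof -
  have "((\<lambda>t. Th \<mu> m (v t)) \<longlongrightarrow> of_real \<mu> * (- of_real lam * (0 + 0) - 0 / 2 - 0 + 0) - (\<Sum>s\<in>{1..<m}. 0 * inverse (of_real \<mu> ^ s))) F"
    unfolding Th_def divide_inverse[of "Eu _ _"]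
    by (intro tendsto_intros over_v Ln_lim Eu_lim) simp
  then show ?thesis by simp
qed

lemma sigma_lim: "((\<lambda>t. sigma (v t)) \<longlongrightarrow> 1) F"
proof -
  have "((\<lambda>t. exp ((Ln (1 - of_real u1 / v t) + Ln (1 - of_real u2 / v t) - Ln (1 - \<i> * of_real ic / v t) - Ln (1 - (- \<i> * of_real ic) / v t)) / 2)) \<longlongrightarrow> exp ((0 + 0 - 0 - 0) / 2)) F"
    by (intro tendsto_intros Ln_lim) simp
  moreover have "eventually (\<lambda>t. exp ((Ln (1 - of_real u1 / v t) + Ln (1 - of_real u2 / v t) - Ln (1 - \<i> * of_real ic / v t) - Ln (1 - (- \<i> * of_real ic) / v t)) / 2) = sigma (v t)) F"
    using vW v_large[of "\<bar>u1\<bar> + \<bar>u2\<bar> + \<bar>ic\<bar>"]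
  proof eventually_elim
    case (elim t)
    have "Im (v t) \<ge> 0" using Wz_nz(9)[OF elim(1)] .
    note L = Ln_up_diff[OF this]
    have "Ln_up (v t - of_real u1) - Ln_up (v t) = Ln (1 - of_real u1 / v t)"
      "Ln_up (v t - of_real u2) - Ln_up (v t) = Ln (1 - of_real u2 / v t)"
      "Ln_up (v t - \<i> * of_real ic) - Ln_up (v t) = Ln (1 - \<i> * of_real ic / v t)"
      "Ln_up (v t - (- \<i> * of_real ic)) - Ln_up (v t) = Ln (1 - (- \<i> * of_real ic) / v t)"
      using elim(2) by (intro L; simp add: norm_mult)+
    then show ?case unfolding sigma_def by (simp add: algebra_simps flip: \<open>Ln_up (v t - of_real u1) - Ln_up (v t) = Ln (1 - of_real u1 / v t)\<close>)
  qed
  ultimately show ?thesis using tendsto_cong by fastforce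
qed

text \<open>Taken from \<open>zu u = (u - u1) (u - u2) / (2 u)\<close>. No multiple of
  \<open>2 \<pi> i\<close> appears, since \<open>u\<close> and \<open>zu u\<close> have arguments in
  \<open>[0, \<pi>]\<close> and each of the two corrections has imaginary part below
  \<open>\<pi> / 2\<close> in modulus.\<close>

lemma Ln_zu_far:
  assumes u: "u \<in> Wz" "cmod u > \<bar>u1\<bar> + \<bar>u2\<bar>"
  shows "Ln_up (zu u) = Ln_up u + Ln (1 - of_real u1 / u) + Ln (1 - of_real u2 / u) - of_real (ln 2)"
proof (rule exp_eq_of_small_Im)
  note nz = Wz_nz[OF u(1)]
  have e: "exp (Ln (1 - of_real c / u)) = (u - of_real c) / u \<and> \<bar>Im (Ln (1 - of_real c / u))\<bar> < pi / 2" if "\<bar>c\<bar> < cmod u" for c :: real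
  proof -
    have "cmod (of_real c / u) < 1" using that nz(1) by (simp add: norm_divide)
    then have re: "Re (1 - of_real c / u) > 0" using complex_Re_le_cmod[of "of_real c / u"] by simp
    then have "1 - of_real c / u \<noteq> 0" by force
    then show ?thesis using Re_Ln_pos_lt[of "1 - of_real c / u"] re nz(1) by (simp add: diff_divide_distrib)
  qed
  have e12: "exp (Ln (1 - of_real u1 / u)) = (u - of_real u1) / u" "\<bar>Im (Ln (1 - of_real u1 / u))\<bar> < pi / 2"
    "exp (Ln (1 - of_real u2 / u)) = (u - of_real u2) / u" "\<bar>Im (Ln (1 - of_real u2 / u))\<bar> < pi / 2"
    using e[of u1] e[of u2] u(2) by auto
  have "exp (complex_of_real (ln 2)) = 2" by (simp add: exp_of_real)
  then show "exp (Ln_up (zu u)) = exp (Ln_up u + Ln (1 - of_real u1 / u) + Ln (1 - of_real u2 / u) - of_real (ln 2))"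
    unfolding exp_add exp_diff e12 using nz by (simp add: exp_Ln_up zu_factor)
  have "0 \<le> Im (Ln_up (zu u))" "Im (Ln_up (zu u)) \<le> pi" "0 \<le> Im (Ln_up u)" "Im (Ln_up u) \<le> pi"
    using Im_Ln_pos_le[OF nz(1)] Im_Ln_pos_le[OF nz(3)] Ln_up_eq_Ln[OF nz(1,9)] Ln_up_eq_Ln[OF nz(3) Im_zu[OF u(1)]] nz(9) Im_zu[OF u(1)] by auto
  then show "\<bar>Im (Ln_up (zu u)) - Im (Ln_up u + Ln (1 - of_real u1 / u) + Ln (1 - of_real u2 / u) - of_real (ln 2))\<bar> < 2 * pi"
    using e12(2,4) unfolding abs_less_iff plus_complex.sel minus_complex.sel Im_complex_of_real by linarith
qed

text \<open>Comparing the expansion of \<open>xi\<close> at infinity with the phase of the leading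
  form shows that the constants in front of the approximation are exactly those for which the
  quotient tends to 1.\<close>

lemma phase_far:
  assumes u: "u \<in> Wz" "cmod u > \<bar>u1\<bar> + \<bar>u2\<bar>" and mu: "\<mu> > 0"
  shows "exp (whittaker_phase (- (lam * \<mu>)) (wl \<mu> u)) / Vu \<mu> m u = exp (Th \<mu> m u) / sigma u"
proof -
  note nz = Wz_nz[OF u(1)]
  define l1 l2 L where "l1 = Ln (1 - of_real u1 / u)" and "l2 = Ln (1 - of_real u2 / u)" and "L = Ln_up u"
  have "Ln_up (u - of_real u1) - L = l1" "Ln_up (u - of_real u2) - L = l2"
    unfolding l1_def l2_def L_def using u(2) by (intro Ln_up_diff nz(9); simp)+
  then have x: "Ln_up (u - of_real u1) = L + l1" "Ln_up (u - of_real u2) = L + l2" by (auto simp: algebra_simps)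
  have Zz: "Zu u = zu u - 2 * of_real lam + of_real (ic\<^sup>2) / u" by (simp add: Zu_def zu_def field_simps)
  \<comment> \<open>The logarithm of \<open>pref\<close>: \<open>ln \<mu>\<close> and
    \<open>- \<pi> i\<close> stem from \<open>wl\<close>, \<open>ln 2\<close> from
    \<open>zu\<close>, \<open>ln (1 - lam)\<close> from \<open>xiu\<close>, and the summand 1 from
    the constant \<open>lam\<close> in \<open>(zu - Zu) / 2\<close>.\<close>
  define P where "P = complex_of_real \<mu> * of_real (ln (1 - lam)) + of_real lam * of_real \<mu> * (of_real (ln 2) + 1 - of_real (ln \<mu>)) + of_real lam * of_real \<mu> * of_real pi * \<i>"
  have "pref \<mu> = exp P"
  proof -
    have "complex_of_real ((1 - lam) powr \<mu>) = exp (of_real \<mu> * of_real (ln (1 - lam)))"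
      using lam1 by (simp add: powr_def exp_of_real flip: of_real_mult)
    moreover have "ln (2 * exp 1 / \<mu>) = ln 2 + 1 - ln \<mu>" using mu by (simp add: ln_div ln_mult)
    then have "complex_of_real ((2 * exp 1 / \<mu>) powr (lam * \<mu>)) = of_real (exp (lam * \<mu> * (ln 2 + 1 - ln \<mu>)))"
      using mu by (simp add: powr_def)
    then have "complex_of_real ((2 * exp 1 / \<mu>) powr (lam * \<mu>)) = exp (of_real lam * of_real \<mu> * (of_real (ln 2) + 1 - of_real (ln \<mu>)))"
      unfolding exp_of_real[symmetric] by simp
    ultimately show ?thesis unfolding pref_def P_def exp_add by simp
  qed
  moreover have "whittaker_phase (- (lam * \<mu>)) (wl \<mu> u) = Th \<mu> m u + P + Xu \<mu> m u"
  proof -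
    have w: "wl \<mu> u = of_real (ln \<mu>) + (L + l1 + l2 - of_real (ln 2)) - of_real pi * \<i>"
      unfolding wl_def Ln_zu_far[OF u] l1_def l2_def L_def ..
    have X: "xiu u = Zu u / 2 - of_real lam * L + (L + l1) - (L + l2) - of_real (ln (1 - lam))"
      unfolding xiu_def x L_def ..
    show ?thesis
      unfolding whittaker_phase_def exp_wl[OF u(1) mu] unfolding w Th_def Xu_def X Zz P_def l1_def[symmetric] l2_def[symmetric]
      by (simp add: algebra_simps add_divide_distrib diff_divide_distrib)
  qed
  ultimately show ?thesis by (simp add: Vu_def exp_add)
qed

context
  fixes \<mu> assumes mu: "\<mu> > 0" and arg: "((\<lambda>t. Im (wl \<mu> (v t))) \<longlongrightarrow> 0) F"
begin

text \<open>The argument of \<open>\<mu> z e^(- \<pi> i)\<close> tends to 0 at the end of the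
  negative axis, so the asymptotics in a strip about the real axis suffice.\<close>

lemma ratio_lim:
  "((\<lambda>t. whittaker_ratio (- (lam * \<mu>)) (gW \<mu>) (wl \<mu> (v t))) \<longlongrightarrow> 1) F"
  "((\<lambda>t. deriv (whittaker_ratio (- (lam * \<mu>)) (gW \<mu>)) (wl \<mu> (v t))) \<longlongrightarrow> 0) F"
proof -
  have W: "is_whittaker_W (- (lam * \<mu>)) \<mu> (gW \<mu>)"
    unfolding gW_def using lam0 mu by (intro is_whittaker_W_whittaker_W) simp
  have re: "filterlim (\<lambda>t. Re (wl \<mu> (v t))) at_top F"
  proof -
    have "filterlim (\<lambda>t. ln (cmod (zu (v t)))) at_top F"
      by (rule filterlim_compose[OF ln_at_top]) (use zu_inf in \<open>simp only: filterlim_at_infinity_conv_norm_at_top\<close>)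
    then have "filterlim (\<lambda>t. ln \<mu> + ln (cmod (zu (v t)))) at_top F"
      by (rule filterlim_tendsto_add_at_top[OF tendsto_const])
    moreover have "eventually (\<lambda>t. ln \<mu> + ln (cmod (zu (v t))) = Re (wl \<mu> (v t))) F"
      using vW
    proof eventually_elim
      case (elim t)
      have "Ln_up (zu (v t)) = Ln (zu (v t))" by (rule Ln_up_eq_Ln[OF Wz_nz(3)[OF elim] Im_zu[OF elim]])
      then show ?case using Wz_nz(3)[OF elim] by (simp add: wl_def)
    qed
    ultimately show ?thesis using filterlim_cong by fastforce
  qed
  have "eventually (\<lambda>t. \<bar>Im (wl \<mu> (v t))\<bar> \<le> 1) F"
    using tendstoD[OF arg zero_less_one] by (auto elim: eventually_mono)
  then have "filterlim (\<lambda>t. wl \<mu> (v t)) (inf (filtercomap Re at_top) (principal {w. \<bar>Im w\<bar> \<le> 1})) F"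
    using re by (simp add: filterlim_inf filterlim_filtercomap_iff filterlim_principal o_def)
  then show "((\<lambda>t. whittaker_ratio (- (lam * \<mu>)) (gW \<mu>) (wl \<mu> (v t))) \<longlongrightarrow> 1) F"
    "((\<lambda>t. deriv (whittaker_ratio (- (lam * \<mu>)) (gW \<mu>)) (wl \<mu> (v t))) \<longlongrightarrow> 0) F"
    by (rule filterlim_compose[OF whittaker_ratio_asymptotics(1)[OF W]], rule filterlim_compose[OF whittaker_ratio_asymptotics(2)[OF W]])
qed

lemma T_lim: "((\<lambda>t. exp (Th \<mu> m (v t)) / sigma (v t)) \<longlongrightarrow> 1) F"
  using tendsto_divide[OF tendsto_exp[OF Th_lim] sigma_lim] by simp

lemma far: "eventually (\<lambda>t. v t \<in> Wz \<and> cmod (v t) > \<bar>u1\<bar> + \<bar>u2\<bar>) F"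
  by (rule eventually_conj[OF vW v_large])

lemma Hu_lim: "((\<lambda>t. Hu \<mu> m (v t)) \<longlongrightarrow> 0) F"
proof -
  let ?r = "whittaker_ratio (- (lam * \<mu>)) (gW \<mu>)"
  have "((\<lambda>t. ?r (wl \<mu> (v t)) * (exp (Th \<mu> m (v t)) / sigma (v t)) - 1) \<longlongrightarrow> 1 * 1 - 1) F"
    by (intro tendsto_intros ratio_lim T_lim)
  moreover have "eventually (\<lambda>t. ?r (wl \<mu> (v t)) * (exp (Th \<mu> m (v t)) / sigma (v t)) - 1 = Hu \<mu> m (v t)) F"
    using far
  proof eventually_elim
    case (elim t)
    have "yu \<mu> (v t) = ?r (wl \<mu> (v t)) * exp (whittaker_phase (- (lam * \<mu>)) (wl \<mu> (v t)))"
      by (simp add: yu_def whittaker_ratio_def mult.assoc flip: exp_add)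
    then show ?case unfolding Hu_def phase_far[OF conjunct1[OF elim] conjunct2[OF elim] mu, symmetric] by simp
  qed
  ultimately show ?thesis using tendsto_cong by fastforce
qed

text \<open>The derivative of the Whittaker ratio tends to 0, and the slope times
  \<open>2 / Z\<close> equals \<open>\<mu>\<close> up to a term of order \<open>u^-2\<close>,
  matching the leading term of \<open>Su\<close>.\<close>

lemma Gd_lim: "((\<lambda>t. Gd \<mu> m (v t)) \<longlongrightarrow> 0) F"
proof -
  let ?r = "whittaker_ratio (- (lam * \<mu>)) (gW \<mu>)"
  let ?E = "\<lambda>t. (deriv ?r (wl \<mu> (v t)) * (2 / Zu (v t)) + ?r (wl \<mu> (v t)) * (- (of_real \<mu> * (of_real (ic\<^sup>2) / v t) * (1 / Zu (v t)))
      - (\<Sum>s\<in>{1..<m}. Fu s (v t) * inverse (of_real \<mu> ^ s)) - au (v t))) * (exp (Th \<mu> m (v t)) / sigma (v t))"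
  have "(?E \<longlongrightarrow> (0 * 0 + 1 * (- (of_real \<mu> * 0 * 0) - (\<Sum>s\<in>{1..<m}. 0 * inverse (of_real \<mu> ^ s)) - 0)) * 1) F"
    by (intro tendsto_intros ratio_lim T_lim over_v over_Z Fu_lim au_lim)
  moreover have "eventually (\<lambda>t. ?E t = Gd \<mu> m (v t)) F"
    using far
  proof eventually_elim
    case (elim t)
    define u where "u = v t"
    have u: "u \<in> Wz" "cmod u > \<bar>u1\<bar> + \<bar>u2\<bar>" using elim by (simp_all add: u_def)
    note nz = Wz_nz[OF u(1)]
    define k w e where "k = - (lam * \<mu>)" and "w = wl \<mu> u" and "e = exp (whittaker_phase k w)"
    define S where "S = (\<Sum>s\<in>{1..<m}. Fu s u * inverse (of_real \<mu> ^ s))"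
    have ee: "exp (- whittaker_phase k w) * e = 1" unfolding e_def exp_add[symmetric] by simp
    have y: "yu \<mu> u = ?r w * e"
      unfolding whittaker_ratio_def k_def[symmetric] yu_def w_def[symmetric] using ee by (simp add: mult.assoc)
    have "deriv ?r w = (deriv (gW \<mu>) w - whittaker_slope k w * gW \<mu> w) * exp (- whittaker_phase k w)"
      unfolding k_def by (rule DERIV_imp_deriv[OF whittaker_ratio_deriv[OF gW_solution[OF u(1) mu]]])
    then have "deriv ?r w * e = deriv (gW \<mu>) w - whittaker_slope k w * gW \<mu> w"
      using ee by (simp add: mult.assoc)
    then have y1: "y1u \<mu> u = (deriv ?r w + whittaker_slope k w * ?r w) * e * (2 / Zu u)"
      using y unfolding y1u_def yu_def w_def[symmetric] by (simp add: algebra_simps)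
    have s: "whittaker_slope k w * (2 / Zu u) = of_real \<mu> - of_real \<mu> * (of_real (ic\<^sup>2) / u) * (1 / Zu u)"
    proof -
      have "whittaker_slope k w * 2 = of_real \<mu> * (zu u - 2 * of_real lam)"
        unfolding whittaker_slope_def w_def exp_wl[OF u(1) mu] k_def by (simp add: algebra_simps)
      also have "zu u - 2 * of_real lam = Zu u - of_real (ic\<^sup>2) / u" by (simp add: Zu_def zu_def field_simps)
      finally have "whittaker_slope k w * 2 = of_real \<mu> * (Zu u - of_real (ic\<^sup>2) / u)" .
      then have "whittaker_slope k w * (2 / Zu u) = of_real \<mu> * (Zu u - of_real (ic\<^sup>2) / u) / Zu u" by simp
      then show ?thesis using nz(2) by (simp add: right_diff_distrib diff_divide_distrib)
    qed
    have SS: "Su \<mu> m u = of_real \<mu> + S" by (simp add: Su_def S_def divide_inverse)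
    define q where "q = of_real \<mu> * (of_real (ic\<^sup>2) / u) * (1 / Zu u)"
    have "y1u \<mu> u = (deriv ?r w * (2 / Zu u) + (of_real \<mu> - q) * ?r w) * e"
      unfolding y1 q_def s[symmetric] by (simp add: distrib_right mult_ac add_divide_distrib)
    then have "y1u \<mu> u - (Su \<mu> m u + au u) * yu \<mu> u = (deriv ?r w * (2 / Zu u) + ?r w * (- q - S - au u)) * e"
      unfolding y SS by (simp add: algebra_simps)
    then have "Gd \<mu> m u = (deriv ?r w * (2 / Zu u) + ?r w * (- q - S - au u)) * (e / Vu \<mu> m u)"
      unfolding Gd_def by simp
    also have "e / Vu \<mu> m u = exp (Th \<mu> m u) / sigma u" unfolding e_def w_def k_def by (rule phase_far[OF u mu])
    finally show ?case unfolding q_def S_def w_def u_def by simp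
  qed
  ultimately show ?thesis using tendsto_cong by fastforce
qed

end

lemma Re_xiu_le: "\<exists>C. eventually (\<lambda>t. Re (xiu (v t)) \<le> Re (zu (v t)) / 2 + C) F"
proof -
  let ?b = "\<lambda>t. of_real (ic\<^sup>2) / v t / 2 + Ln (1 - of_real u1 / v t) - Ln (1 - of_real u2 / v t)"
  have "(?b \<longlongrightarrow> 0 / 2 + 0 - 0) F" by (intro tendsto_intros over_v Ln_lim) simp
  then have "eventually (\<lambda>t. dist (?b t) 0 < 1) F" by (intro tendstoD) simp_all
  then have "eventually (\<lambda>t. Re (xiu (v t)) \<le> Re (zu (v t)) / 2 + (1 - ln (1 - lam))) F"
    using vW v_large[of "\<bar>u1\<bar> + \<bar>u2\<bar> + 1"]
  proof eventually_elim
    case (elim t)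
    define u where "u = v t"
    note u = elim(2)[folded u_def]
    note nz = Wz_nz[OF u]
    have l: "Ln_up (u - of_real u1) - Ln_up u = Ln (1 - of_real u1 / u)" "Ln_up (u - of_real u2) - Ln_up u = Ln (1 - of_real u2 / u)"
      using elim(3) by (intro Ln_up_diff nz(9); simp add: u_def)+
    have b: "Re (?b t) \<le> 1" using elim(1) complex_Re_le_cmod[of "?b t"] unfolding dist_norm diff_zero by argo
    have "xiu u = zu u / 2 - of_real lam - of_real lam * Ln_up u + ?b t - of_real (ln (1 - lam))"
      unfolding xiu_def l[symmetric, folded u_def] u_def[symmetric] by (simp add: Zu_def zu_def field_simps)
    then have "Re (xiu u) = Re (zu u) / 2 - lam - lam * Re (Ln_up u) + Re (?b t) - ln (1 - lam)" by simp
    moreover have "Re (Ln_up u) \<ge> 0"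
      using nz(1) Ln_up_eq_Ln[OF nz(1,9)] elim(3) by (simp add: u_def)
    then have "lam * Re (Ln_up u) \<ge> 0" using lam0 by simp
    ultimately show ?case using b lam0 unfolding u_def[symmetric] by argo
  qed
  then show ?thesis by blast
qed

end

end

section \<open>The error bound\<close>

text \<open>Positive weights ensure that a finite sum has finite summands; a zero weight would hide
  an infinite one.\<close>

lemma enn2real_weighted_sum:
  fixes c :: "nat \<Rightarrow> real" and A :: "nat \<Rightarrow> ennreal"
  assumes "finite I" "\<And>i. i \<in> I \<Longrightarrow> c i > 0" "(\<Sum>i\<in>I. ennreal (c i) * A i) < \<infinity>"
  shows "(\<forall>i\<in>I. A i < \<infinity>) \<and> enn2real (\<Sum>i\<in>I. ennreal (c i) * A i) = (\<Sum>i\<in>I. c i * enn2real (A i))"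
  using assms
proof (induction I rule: finite_induct)
  case (insert j I)
  have lt: "ennreal (c j) * A j < \<infinity>" "(\<Sum>i\<in>I. ennreal (c i) * A i) < \<infinity>"
    using insert by (auto simp: ennreal_add_eq_top less_top)
  have "c j > 0" using insert by simp
  then have "A j < \<infinity>" using lt(1) by (auto simp: ennreal_mult_less_top)
  moreover have "(\<forall>i\<in>I. A i < \<infinity>) \<and> enn2real (\<Sum>i\<in>I. ennreal (c i) * A i) = (\<Sum>i\<in>I. c i * enn2real (A i))"
    using insert.IH insert.prems lt by simp
  ultimately show ?case using insert lt \<open>c j > 0\<close> by (simp add: enn2real_plus enn2real_mult)
qed simp

context turning_point
begin

lemma Fu_continuous: "continuous_on Wz (Fu s)"
  using Fu_deriv Wz_nz(8) DERIV_isCont continuous_at_imp_continuous_on by metis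

lemma coefficients_continuous:
  "continuous_on Wz (Gu n s)" "continuous_on Wz (rho \<mu> m)" "continuous_on Wz (psi \<mu> m)"
proof -
  show G: "continuous_on Wz (Gu n s)" for n s unfolding Gu_def by (intro continuous_intros Fu_continuous)
  show "continuous_on Wz (rho \<mu> m)" "continuous_on Wz (psi \<mu> m)"
    unfolding rho_def psi_def divide_inverse by (intro continuous_intros Fu_continuous G)+
qed

lemma on_D3: "continuous_on Wz f \<Longrightarrow> continuous_on D3 (\<lambda>z. f (three.uz z))"
  by (rule continuous_on_compose2[OF _ three.continuous_on_uz]) (use three.uz_Wz in auto)

text \<open>A derivative in \<open>u\<close> written as a multiple of \<open>xd = d xi / du\<close>
  becomes the same multiple of \<open>d xi / dt = Z p' / (2 z)\<close>, the form that
  \<open>liouville_green_gronwall\<close> requires. The joints at integer parameters are its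
  exceptional set.\<close>

lemma along_path:
  assumes arcs': "\<forall>k<N. R2_arc_on ({real k..real (Suc k)} \<inter> {0<..}) p"
    and inD': "\<forall>t\<in>{0<..real N}. p t \<in> D3"
  shows "continuous_on Wz f \<Longrightarrow> continuous_on {0<..real N} (\<lambda>t. f (three.uz (p t)))"
    and "\<And>d t. t \<in> {0<..<real N} - real ` {..N} \<Longrightarrow> (f has_field_derivative d * xd (three.uz (p t))) (at (three.uz (p t))) \<Longrightarrow>
      ((\<lambda>t. f (three.uz (p t))) has_vector_derivative d * (Z3 (p t) / (2 * p t) * vector_derivative p (at t))) (at t)"
    and "\<And>c t. continuous_on D3 c \<Longrightarrow> t \<in> {0<..<real N} - real ` {..N} \<Longrightarrow> isCont (\<lambda>t. cmod (c (p t) * vector_derivative p (at t))) t"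
    and "\<And>c a. continuous_on D3 c \<Longrightarrow> 0 < a \<Longrightarrow> (\<lambda>t. cmod (c (p t) * vector_derivative p (at t))) integrable_on {a..real N}"
proof -
  have arcs: "\<And>k. k < N \<Longrightarrow> R2_arc_on ({real k..real (Suc k)} \<inter> {0<..}) p" and inD: "\<And>t. t \<in> {0<..real N} \<Longrightarrow> p t \<in> D3"
    using assms by auto
  have pc: "continuous_on {0<..real N} p" by (rule R2_arcs_continuous[OF arcs])
  show "continuous_on {0<..real N} (\<lambda>t. f (three.uz (p t)))" if "continuous_on Wz f"
    by (rule continuous_on_compose2[OF on_D3[OF that] pc]) (use inD in auto)
  fix t assume t: "t \<in> {0<..<real N} - real ` {..N}"
  define S where "S = {0<..<real N}"
  have tS: "t \<in> S" "open S" and pD: "p ` S \<subseteq> D3" "p t \<in> D3" using t inD by (auto simp: S_def)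
  have dp: "(p has_vector_derivative vector_derivative p (at t)) (at t)" by (rule R2_arcs_interior(1)[OF arcs t])
  show "((\<lambda>t. f (three.uz (p t))) has_vector_derivative d * (Z3 (p t) / (2 * p t) * vector_derivative p (at t))) (at t)"
    if f: "(f has_field_derivative d * xd (three.uz (p t))) (at (three.uz (p t)))" for d
  proof -
    have "(three.uz has_field_derivative three.uz (p t) / Z3 (p t)) (at (p t) within p ` S)"
      by (rule DERIV_subset[OF three.uz_deriv[OF pD(2)] pD(1)])
    from field_vector_diff_chain_within[OF has_vector_derivative_at_within[OF dp] this]
    have v: "((three.uz \<circ> p) has_vector_derivative vector_derivative p (at t) * (three.uz (p t) / Z3 (p t))) (at t within S)" .
    have "(f has_field_derivative d * xd (three.uz (p t))) (at ((three.uz \<circ> p) t) within (three.uz \<circ> p) ` S)"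
      using f by (simp add: has_field_derivative_at_within)
    from field_vector_diff_chain_within[OF v this]
    have "((f \<circ> (three.uz \<circ> p)) has_vector_derivative vector_derivative p (at t) * (three.uz (p t) / Z3 (p t)) * (d * xd (three.uz (p t)))) (at t within S)" .
    then have "((f \<circ> (three.uz \<circ> p)) has_vector_derivative vector_derivative p (at t) * (three.uz (p t) / Z3 (p t)) * (d * xd (three.uz (p t)))) (at t)"
      by (rule iffD1[OF has_vector_derivative_within_open[OF tS]])
    moreover have "vector_derivative p (at t) * (three.uz (p t) / Z3 (p t)) * (d * xd (three.uz (p t))) = d * (Z3 (p t) / (2 * p t) * vector_derivative p (at t))"
      using three.uz_nz[OF pD(2)] three.Z_nz[OF pD(2)] unfolding xd_def three.uz_inverse[OF pD(2)] by (simp add: power2_eq_square)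
    ultimately show ?thesis by (simp add: o_def)
  qed
  fix c :: "complex \<Rightarrow> complex" assume c: "continuous_on D3 c"
  have "continuous_on S (\<lambda>t. c (p t))"
    by (rule continuous_on_compose2[OF c continuous_on_subset[OF pc]]) (use pD(1) in \<open>auto simp: S_def\<close>)
  then have "isCont (\<lambda>t. c (p t)) t" using continuous_on_eq_continuous_at[OF tS(2)] tS(1) by metis
  then show "isCont (\<lambda>t. cmod (c (p t) * vector_derivative p (at t))) t"
    by (intro continuous_intros R2_arcs_interior(2)[OF arcs t])
next
  have arcs: "\<And>k. k < N \<Longrightarrow> R2_arc_on ({real k..real (Suc k)} \<inter> {0<..}) p" and inD: "\<And>t. t \<in> {0<..real N} \<Longrightarrow> p t \<in> D3"
    using assms by auto
  fix c :: "complex \<Rightarrow> complex" and a :: real assume c: "continuous_on D3 c" and a: "0 < a"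
  show "(\<lambda>t. cmod (c (p t) * vector_derivative p (at t))) integrable_on {a..real N}"
    by (rule R2_arcs_integrable[OF arcs continuous_on_subset[OF c] a]) (use inD in auto)
qed

definition cF :: "nat \<Rightarrow> complex \<Rightarrow> complex" where "cF s z = Z3 z * Fu s (three.uz z) / z"
definition cG :: "nat \<Rightarrow> nat \<Rightarrow> complex \<Rightarrow> complex" where "cG n s z = Z3 z * Gu n s (three.uz z) / z"

lemma cF_cG_continuous: "continuous_on D3 (cF s)" "continuous_on D3 (cG n s)"
  unfolding cF_def cG_def using three.S_Cplus
  by (auto intro!: continuous_intros continuous_on_Z3 on_D3 Fu_continuous coefficients_continuous simp: Cplus_def)

text \<open>Near its start the path satisfies \<open>Re z \<le> - |z| / 2\<close>. Far out such
  points lie in \<open>S1\<close>, where both choices of \<open>u\<close> agree, and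
  \<open>uz_far_ge\<close> sends \<open>u\<close> to infinity.\<close>

lemma path_start:
  assumes P: "progressive_path3 lam \<delta> z N p" and mu: "\<mu> > 0"
  defines "v \<equiv> (\<lambda>t. three.uz (p t))"
  shows "filterlim v at_infinity (at_right 0)" "eventually (\<lambda>t. v t \<in> Wz) (at_right 0)"
    "((\<lambda>t. Im (wl \<mu> (v t))) \<longlongrightarrow> 0) (at_right 0)"
    "mono_on {0<..real N} (\<lambda>t. Re (xiu (v t)))"
proof -
  have N: "N \<ge> 1" and inf: "filterlim p at_infinity (at_right 0)" and arg: "((\<lambda>t. Arg (p t)) \<longlongrightarrow> pi) (at_right 0)"
    and inD: "\<And>t. t \<in> {0<..real N} \<Longrightarrow> p t \<in> D3"
    and mono: "mono_on {0<..real N} (\<lambda>t. Re (val3 lam (xi lam) (p t))) \<or> antimono_on {0<..real N} (\<lambda>t. Re (val3 lam (xi lam) (p t)))"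
    using P by (auto simp: progressive_path3_def D3_def)
  have ev: "eventually (\<lambda>t. t \<in> {0<..<real N}) (at_right 0)" using N by (intro eventually_at_right_real) simp
  have pinf: "filterlim (\<lambda>t. cmod (p t)) at_top (at_right 0)" using inf by (simp only: filterlim_at_infinity_conv_norm_at_top)
  have large: "eventually (\<lambda>t. cmod (p t) > R) (at_right 0)" for R
    using pinf unfolding filterlim_at_top_dense by blast
  have "((\<lambda>t. cos (Arg (p t))) \<longlongrightarrow> cos pi) (at_right 0)" by (intro tendsto_cos arg)
  then have "eventually (\<lambda>t. cos (Arg (p t)) < - 1 / 2) (at_right 0)" by (rule order_tendstoD) simp
  with ev have left: "eventually (\<lambda>t. Re (p t) \<le> - cmod (p t) / 2) (at_right 0)"
  proof eventually_elim
    case (elim t)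
    have "p t \<in> Cplus" using inD[of t] elim(1) three.S_Cplus by auto
    then have "Re (p t) = cmod (p t) * cos (Arg (p t))"
      using Cplus_polar(1) by (metis Re_complex_of_real cis.sel(1) mult.commute scaleR_complex.sel(1) scaleR_conv_of_real)
    also have "\<dots> \<le> cmod (p t) * (- 1 / 2)" using elim(2) by (intro mult_left_mono) auto
    finally show ?case by simp
  qed
  obtain X where X: "X > 2" "\<And>z. z \<in> Cplus \<Longrightarrow> cmod z \<ge> X \<Longrightarrow> Im z \<le> ic \<Longrightarrow> Re z \<ge> 2 * lam \<Longrightarrow> z \<in> SC"
    "\<And>z. z \<in> Cplus \<Longrightarrow> cmod z > 2 \<Longrightarrow> Re z < 2 * lam \<Longrightarrow> z \<in> SB" using far_points by blast
  show vinf: "filterlim v at_infinity (at_right 0)"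
    unfolding filterlim_at_infinity_conv_norm_at_top
  proof (rule filterlim_at_top_mono)
    show "filterlim (\<lambda>t. - 2 + cmod (p t)) at_top (at_right 0)"
      by (rule filterlim_tendsto_add_at_top[OF tendsto_const pinf])
    show "eventually (\<lambda>t. - 2 + cmod (p t) \<le> cmod (v t)) (at_right 0)"
      using ev left large[of 2]
    proof eventually_elim
      case (elim t)
      have D: "p t \<in> D3" using inD elim(1) by auto
      have "p t \<in> SB" using D three.S_Cplus elim lam0 by (intro X(3)) auto
      then have s: "p t \<notin> SA" "p t \<in> D2" using SABC_D SABC_disjoint by blast+
      have "cmod (2 * complex_of_real lam) \<le> 2" using lam0 lam1 by (simp add: norm_mult)
      then show ?case unfolding v_def uz_agree[OF s(1) D s(2)]
        using uz_far_ge[OF s(2,1)] norm_triangle_ineq2[of "p t" "2 * of_real lam"] by argo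
    qed
  qed
  show vW: "eventually (\<lambda>t. v t \<in> Wz) (at_right 0)"
    using ev by eventually_elim (use inD three.uz_Wz in \<open>auto simp: v_def\<close>)
  have zv: "zu (v t) = p t" if "t \<in> {0<..real N}" for t using three.uz_inverse(1)[OF inD[OF that]] by (simp add: v_def)
  have "((\<lambda>t. Arg (p t) - pi) \<longlongrightarrow> pi - pi) (at_right 0)" by (intro tendsto_intros arg)
  moreover have "eventually (\<lambda>t. Arg (p t) - pi = Im (wl \<mu> (v t))) (at_right 0)"
    using ev
  proof eventually_elim
    case (elim t)
    have "p t \<noteq> 0" "Im (p t) \<ge> 0" using inD[of t] three.S_Cplus elim by (auto simp: Cplus_def)
    then show ?case using zv[of t] elim by (simp add: wl_def Ln_up_eq_Ln Arg_eq_Im_Ln)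
  qed
  ultimately show "((\<lambda>t. Im (wl \<mu> (v t))) \<longlongrightarrow> 0) (at_right 0)" using tendsto_cong by fastforce
  have val: "val3 lam (xi lam) (p t) = xiu (v t)" if "t \<in> {0<..real N}" for t
    using val3_values(1)[OF inD[OF that]] by (simp add: v_def)
  \<comment> \<open>At the start \<open>Re xi\<close> tends to minus infinity, so it cannot be
    decreasing along the path; this settles the direction that the definition of a progressive path
    leaves open.\<close>
  have "\<not> antimono_on {0<..real N} (\<lambda>t. Re (val3 lam (xi lam) (p t)))"
  proof
    assume anti: "antimono_on {0<..real N} (\<lambda>t. Re (val3 lam (xi lam) (p t)))"
    obtain C where C: "eventually (\<lambda>t. Re (xiu (v t)) \<le> Re (zu (v t)) / 2 + C) (at_right 0)" using Re_xiu_le[OF vinf vW] by blast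
    define B where "B = Re (xiu (v (real N)))"
    have "eventually (\<lambda>t. False) (at_right (0::real))"
      using ev C left large[of "4 * (C - B)"]
    proof eventually_elim
      case (elim t)
      have tN: "t \<in> {0<..real N}" "real N \<in> {0<..real N}" "t \<le> real N" using elim(1) by auto
      have "Re (val3 lam (xi lam) (p (real N))) \<le> Re (val3 lam (xi lam) (p t))"
        using monotone_onD[OF anti tN] by simp
      then have "B \<le> Re (xiu (v t))" unfolding val[OF tN(1)] val[OF tN(2)] B_def .
      then show False using elim zv[OF tN(1)] by (simp only: ) argo
    qed
    then show False by (simp add: eventually_False)
  qed
  then have "mono_on {0<..real N} (\<lambda>t. Re (val3 lam (xi lam) (p t)))" using mono by blast
  then show "mono_on {0<..real N} (\<lambda>t. Re (xiu (v t)))" unfolding monotone_on_def using val by simp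
qed

text \<open>The Gronwall estimate holds on \<open>[a, N]\<close> with bounds \<open>A\<close> and
  \<open>B\<close> for the two integrals that do not depend on \<open>a\<close>; as \<open>a\<close>
  tends to 0, the initial data \<open>g0\<close> and \<open>a0\<close> vanish.\<close>

lemma path_error:
  assumes P: "progressive_path3 lam \<delta> z N p" and mu: "\<mu> > 0" and m: "m \<ge> 1"
    and fin: "omega3 lam m \<mu> N p < \<infinity>" "varpi3 lam m \<mu> N p < \<infinity>"
  defines "\<omega> \<equiv> enn2real (omega3 lam m \<mu> N p)" and "\<pi>' \<equiv> enn2real (varpi3 lam m \<mu> N p)"
  shows "cmod (Hu \<mu> m (three.uz z)) \<le> \<omega> / \<mu> ^ m * exp (\<omega> / \<mu> ^ m + \<pi>' / \<mu>)"
proof -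
  define v where "v = (\<lambda>t. three.uz (p t))"
  have vt: "three.uz (p t) = v t" for t by (simp add: v_def)
  note start = path_start[OF P mu, unfolded vt]
  have N: "N \<ge> 1" and pN: "p (real N) = z" and inD: "\<And>t. t \<in> {0<..real N} \<Longrightarrow> p t \<in> D3"
    and arcs: "\<forall>k<N. R2_arc_on ({real k..real (Suc k)} \<inter> {0<..}) p"
    using P by (auto simp: progressive_path3_def D3_def)
  have inD': "\<forall>t\<in>{0<..real N}. p t \<in> D3" using inD by blast
  note path = along_path[OF arcs inD', unfolded vt]
  define X' where "X' = (\<lambda>t. Z3 (p t) / (2 * p t) * vector_derivative p (at t))"
  define iF where "iF = (\<lambda>a s. integral {a..real N} (\<lambda>t. cmod (cF s (p t) * vector_derivative p (at t))))"
  define iG where "iG = (\<lambda>a s. integral {a..real N} (\<lambda>t. cmod (cG m s (p t) * vector_derivative p (at t))))"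
  define aF where "aF = (\<lambda>s. abs_path_integral N p (val3 lam (\<lambda>t. Zfun lam t * Fhat lam s t / t)))"
  define aG where "aG = (\<lambda>s. abs_path_integral N p (val3 lam (\<lambda>t. Zfun lam t * Ghat lam m s t / t)))"
  have FG_int: "(\<lambda>t. cmod (cF s (p t) * vector_derivative p (at t))) integrable_on {a..real N}"
    "(\<lambda>t. cmod (cG m s (p t) * vector_derivative p (at t))) integrable_on {a..real N}" if "0 < a" for a s
    by (intro path(4) cF_cG_continuous that)+
  have om: "omega3 lam m \<mu> N p = aF m + (\<Sum>s\<in>{1..<m}. ennreal (1 / (2 * \<mu> ^ s)) * aG s)"
    by (simp add: omega3_def aF_def aG_def)
  have vp: "varpi3 lam m \<mu> N p = (\<Sum>s\<in>{..<m - 1}. ennreal (2 / \<mu> ^ s) * aF (Suc s))"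
    by (simp add: varpi3_def aF_def)
  have f1: "aF m < \<infinity>" "(\<Sum>s\<in>{1..<m}. ennreal (1 / (2 * \<mu> ^ s)) * aG s) < \<infinity>"
    using fin(1) unfolding om by (auto simp: less_top)
  have "(\<forall>s\<in>{1..<m}. aG s < \<infinity>) \<and> enn2real (\<Sum>s\<in>{1..<m}. ennreal (1 / (2 * \<mu> ^ s)) * aG s) = (\<Sum>s\<in>{1..<m}. 1 / (2 * \<mu> ^ s) * enn2real (aG s))"
    by (rule enn2real_weighted_sum[OF _ _ f1(2)]) (use mu in simp_all)
  then have G: "\<forall>s\<in>{1..<m}. aG s < \<infinity>" "enn2real (\<Sum>s\<in>{1..<m}. ennreal (1 / (2 * \<mu> ^ s)) * aG s) = (\<Sum>s\<in>{1..<m}. 1 / (2 * \<mu> ^ s) * enn2real (aG s))"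
    by blast+
  have Fs: "\<forall>s\<in>{..<m - 1}. aF (Suc s) < \<infinity>" "\<pi>' = (\<Sum>s\<in>{..<m - 1}. 2 / \<mu> ^ s * enn2real (aF (Suc s)))"
    using enn2real_weighted_sum[OF _ _ fin(2)[unfolded vp]] mu unfolding \<pi>'_def vp by auto
  have \<omega>: "\<omega> = enn2real (aF m) + (\<Sum>s\<in>{1..<m}. 1 / (2 * \<mu> ^ s) * enn2real (aG s))"
    unfolding \<omega>_def om G(2)[symmetric] by (rule enn2real_plus) (use f1 in \<open>simp_all only: infinity_ennreal_def\<close>)
  have iF: "iF a s \<le> enn2real (aF s)" if "0 < a" "aF s < \<infinity>" for a s
    unfolding iF_def aF_def
    by (rule abs_path_integral_ge[OF FG_int(1)[OF that(1)] that(1)]) (use inD val3_values(4) that(2) in \<open>auto simp: cF_def aF_def\<close>)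
  have iG: "iG a s \<le> enn2real (aG s)" if "0 < a" "aG s < \<infinity>" for a s
    unfolding iG_def aG_def
    by (rule abs_path_integral_ge[OF FG_int(2)[OF that(1)] that(1)]) (use inD val3_values(5) that(2) in \<open>auto simp: cG_def aG_def\<close>)
  have pos: "\<omega> \<ge> 0" "\<pi>' \<ge> 0" by (simp_all add: \<omega>_def \<pi>'_def)
  define A B where "A = \<mu> * (\<omega> / \<mu> ^ m)" and "B = \<pi>' / \<mu>"
  have AB: "A \<ge> 0" "B \<ge> 0" using pos mu by (simp_all add: A_def B_def)
  have Wz: "v t \<in> Wz" if "t \<in> {0<..real N}" for t using inD[OF that] three.uz_Wz by (simp add: v_def)
  define hN where "hN = cmod (Hu \<mu> m (v (real N)))"
  define g0 a0 where "g0 = (\<lambda>a. cmod (Gd \<mu> m (v a)))" and "a0 = (\<lambda>a. cmod (Hu \<mu> m (v a)) + cmod (Gd \<mu> m (v a)) / \<mu>)"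
  have c_rho: "continuous_on D3 (\<lambda>z. rho \<mu> m (three.uz z) * (Z3 z / (2 * z)))" "continuous_on D3 (\<lambda>z. psi \<mu> m (three.uz z) * (Z3 z / (2 * z)))"
    using three.S_Cplus by (auto intro!: continuous_intros continuous_on_Z3 on_D3 coefficients_continuous simp: Cplus_def)
  have X'r: "f (v t) * X' t = (\<lambda>z. f (three.uz z) * (Z3 z / (2 * z))) (p t) * vector_derivative p (at t)" for f t
    by (simp add: X'_def v_def)
  have est: "hN \<le> a0 a + ((1 + a0 a) * A + g0 a * B) * exp (A / \<mu> + B) / \<mu>" if a: "a \<in> {0<..<real N}" for a
  proof -
    have ab: "a \<le> real N" "0 < a" "{a..real N} \<subseteq> {0<..real N}" "{a<..<real N} \<subseteq> {0<..<real N}" using a by auto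
    define IA IB where "IA = integral {a..real N} (\<lambda>t. cmod (rho \<mu> m (v t) * X' t))" and "IB = integral {a..real N} (\<lambda>t. cmod (psi \<mu> m (v t) * X' t))"
    have iAB: "(\<lambda>t. cmod (rho \<mu> m (v t) * X' t)) integrable_on {a..real N}" "(\<lambda>t. cmod (psi \<mu> m (v t) * X' t)) integrable_on {a..real N}"
      unfolding X'r by (rule path(4)[OF c_rho(1) ab(2)], rule path(4)[OF c_rho(2) ab(2)])
    have cXHG: "continuous_on Wz xiu" "continuous_on Wz (Hu \<mu> m)" "continuous_on Wz (Gd \<mu> m)"
      using xiu_continuous DHu[OF _ mu] DGd[OF _ mu m] DERIV_isCont continuous_at_imp_continuous_on by metis+
    have gr: "cmod (Hu \<mu> m (v (real N))) \<le> a0 a + ((1 + a0 a) * IA + g0 a * IB) * exp (IA / \<mu> + IB) / \<mu>"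
      unfolding IA_def IB_def a0_def g0_def
    proof (rule liouville_green_gronwall(2)[where K = "real ` {..N}" and X = "\<lambda>t. xiu (v t)" and G = "\<lambda>t. Gd \<mu> m (v t)" and \<rho> = "\<lambda>t. rho \<mu> m (v t)"
          and \<psi> = "\<lambda>t. psi \<mu> m (v t)" and X' = X' and H = "\<lambda>t. Hu \<mu> m (v t)", OF ab(1) _ mu])
      show "continuous_on {a..real N} (\<lambda>t. xiu (v t))" "continuous_on {a..real N} (\<lambda>t. Hu \<mu> m (v t))" "continuous_on {a..real N} (\<lambda>t. Gd \<mu> m (v t))"
        by (rule continuous_on_subset[OF path(1) ab(3)], rule cXHG)+
      show "mono_on {a..real N} (\<lambda>t. Re (xiu (v t)))" by (rule monotone_on_subset[OF start(4) ab(3)])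
      fix t assume "t \<in> {a<..<real N} - real ` {..N}"
      then have t: "t \<in> {0<..<real N} - real ` {..N}" using ab(4) by blast
      have u: "v t \<in> Wz" using t by (intro Wz) auto
      have "(xiu has_field_derivative 1 * xd (v t)) (at (v t))" using xiu_deriv[OF u] by (simp add: xd_def)
      from path(2)[where f = xiu, OF t this] show "((\<lambda>t. xiu (v t)) has_vector_derivative X' t) (at t)"
        unfolding X'_def mult_1_left .
      show "((\<lambda>t. Hu \<mu> m (v t)) has_vector_derivative Gd \<mu> m (v t) * X' t) (at t)"
        unfolding X'_def by (rule path(2)[where f = "Hu \<mu> m", OF t DHu[OF u mu]])
      show "((\<lambda>t. Gd \<mu> m (v t)) has_vector_derivative (rho \<mu> m (v t) * (1 + Hu \<mu> m (v t)) - (2 * of_real \<mu> + psi \<mu> m (v t)) * Gd \<mu> m (v t)) * X' t) (at t)"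
        unfolding X'_def by (rule path(2)[where f = "Gd \<mu> m", OF t DGd[OF u mu m]])
      show "isCont (\<lambda>t. cmod (rho \<mu> m (v t) * X' t)) t" "isCont (\<lambda>t. cmod (psi \<mu> m (v t) * X' t)) t"
        unfolding X'r by (rule path(3)[OF c_rho(1) t], rule path(3)[OF c_rho(2) t])
    qed (use iAB in simp_all)
    \<comment> \<open>The \<open>1/2\<close> in \<open>d xi = Z / (2 z) dz\<close> cancels the 2 in
      front of \<open>Fu m\<close> in \<open>rho\<close> and produces the weights
      \<open>1 / (2 \<mu>^s)\<close> of \<open>omega3\<close>.\<close>
    have halfF: "cmod (Z3 (p t) / (2 * p t) * vector_derivative p (at t)) * cmod (Fu s (v t)) = cmod (cF s (p t) * vector_derivative p (at t)) / 2"
      "cmod (Z3 (p t) / (2 * p t) * vector_derivative p (at t)) * cmod (Gu m s (v t)) = cmod (cG m s (p t) * vector_derivative p (at t)) / 2" for t s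
      by (simp_all add: cF_def cG_def v_def norm_mult norm_divide mult_ac)
    have "IA \<le> integral {a..real N} (\<lambda>t. 1 / \<mu> ^ (m - 1) * (cmod (cF m (p t) * vector_derivative p (at t)) + (\<Sum>s\<in>{1..<m}. 1 / (2 * \<mu> ^ s) * cmod (cG m s (p t) * vector_derivative p (at t)))))"
      unfolding IA_def
    proof (rule integral_le[OF iAB(1)])
      show "(\<lambda>t. 1 / \<mu> ^ (m - 1) * (cmod (cF m (p t) * vector_derivative p (at t)) + (\<Sum>s\<in>{1..<m}. 1 / (2 * \<mu> ^ s) * cmod (cG m s (p t) * vector_derivative p (at t))))) integrable_on {a..real N}"
        by (intro integrable_on_mult_right integrable_add integrable_sum FG_int ab) auto
      fix t
      define x where "x = cmod (Z3 (p t) / (2 * p t) * vector_derivative p (at t))"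
      have "cmod (rho \<mu> m (v t)) \<le> 2 * cmod (Fu m (v t)) / \<mu> ^ (m - 1) + (\<Sum>s\<in>{1..<m}. cmod (Gu m s (v t)) / \<mu> ^ (s + m - 1))"
      proof -
        have "cmod (rho \<mu> m (v t)) \<le> cmod (2 * Fu m (v t) / of_real \<mu> ^ (m - 1)) + cmod (\<Sum>s\<in>{1..<m}. Gu m s (v t) / of_real \<mu> ^ (s + m - 1))"
          unfolding rho_def by (rule norm_triangle_ineq4)
        also have "cmod (\<Sum>s\<in>{1..<m}. Gu m s (v t) / of_real \<mu> ^ (s + m - 1)) \<le> (\<Sum>s\<in>{1..<m}. cmod (Gu m s (v t)) / \<mu> ^ (s + m - 1))"
          by (rule sum_norm_le) (use mu in \<open>simp add: norm_divide norm_power\<close>)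
        finally show ?thesis using mu by (simp add: norm_divide norm_mult norm_power)
      qed
      then have "cmod (rho \<mu> m (v t)) * x \<le> (2 * cmod (Fu m (v t)) / \<mu> ^ (m - 1) + (\<Sum>s\<in>{1..<m}. cmod (Gu m s (v t)) / \<mu> ^ (s + m - 1))) * x"
        by (rule mult_right_mono) (simp add: x_def)
      also have "\<dots> = 2 * (x * cmod (Fu m (v t))) / \<mu> ^ (m - 1) + (\<Sum>s\<in>{1..<m}. (x * cmod (Gu m s (v t))) / \<mu> ^ (s + m - 1))"
        unfolding mult.commute[of _ x] distrib_left sum_distrib_left by (simp add: mult_ac)
      also have "\<dots> = 1 / \<mu> ^ (m - 1) * (cmod (cF m (p t) * vector_derivative p (at t)) + (\<Sum>s\<in>{1..<m}. 1 / (2 * \<mu> ^ s) * cmod (cG m s (p t) * vector_derivative p (at t))))"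
      proof -
        have "\<mu> ^ (s + m - 1) = \<mu> ^ s * \<mu> ^ (m - 1)" for s using m by (simp flip: power_add)
        then show ?thesis unfolding x_def halfF distrib_left sum_distrib_left by (simp add: mult_ac)
      qed
      finally show "cmod (rho \<mu> m (v t) * X' t) \<le> 1 / \<mu> ^ (m - 1) * (cmod (cF m (p t) * vector_derivative p (at t)) + (\<Sum>s\<in>{1..<m}. 1 / (2 * \<mu> ^ s) * cmod (cG m s (p t) * vector_derivative p (at t))))"
        unfolding x_def X'_def norm_mult .
    qed
    also have "\<dots> = 1 / \<mu> ^ (m - 1) * (iF a m + (\<Sum>s\<in>{1..<m}. 1 / (2 * \<mu> ^ s) * iG a s))"
      unfolding iF_def iG_def
      by (rule integral_unique, intro has_integral_mult_right has_integral_add has_integral_sum integrable_integral FG_int ab) simp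
    also have "\<dots> \<le> 1 / \<mu> ^ (m - 1) * (enn2real (aF m) + (\<Sum>s\<in>{1..<m}. 1 / (2 * \<mu> ^ s) * enn2real (aG s)))"
      using mu f1(1) G(1) ab(2) by (intro mult_left_mono add_mono sum_mono iF iG) auto
    also have "\<dots> = A"
    proof -
      have "\<mu> ^ m = \<mu> * \<mu> ^ (m - 1)" using m by (cases m) auto
      then show ?thesis unfolding A_def \<omega>[symmetric] using mu by simp
    qed
    finally have IA: "IA \<le> A" .
    have "IB \<le> integral {a..real N} (\<lambda>t. \<Sum>s\<in>{1..<m}. 1 / \<mu> ^ s * cmod (cF s (p t) * vector_derivative p (at t)))"
      unfolding IB_def
    proof (rule integral_le[OF iAB(2)])
      show "(\<lambda>t. \<Sum>s\<in>{1..<m}. 1 / \<mu> ^ s * cmod (cF s (p t) * vector_derivative p (at t))) integrable_on {a..real N}"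
        by (intro integrable_on_mult_right integrable_sum FG_int ab) auto
      fix t
      define x where "x = cmod (Z3 (p t) / (2 * p t) * vector_derivative p (at t))"
      have "cmod (\<Sum>s\<in>{1..<m}. Fu s (v t) / of_real \<mu> ^ s) \<le> (\<Sum>s\<in>{1..<m}. cmod (Fu s (v t)) / \<mu> ^ s)"
        by (rule sum_norm_le) (use mu in \<open>simp add: norm_divide norm_power\<close>)
      then have "cmod (psi \<mu> m (v t)) * x \<le> (2 * (\<Sum>s\<in>{1..<m}. cmod (Fu s (v t)) / \<mu> ^ s)) * x"
        unfolding psi_def norm_mult by (intro mult_right_mono) (simp_all add: x_def)
      also have "\<dots> = (\<Sum>s\<in>{1..<m}. 2 * (x * cmod (Fu s (v t))) / \<mu> ^ s)"
        by (simp add: sum_distrib_right sum_distrib_left mult_ac)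
      also have "\<dots> = (\<Sum>s\<in>{1..<m}. 1 / \<mu> ^ s * cmod (cF s (p t) * vector_derivative p (at t)))"
        unfolding x_def halfF by simp
      finally show "cmod (psi \<mu> m (v t) * X' t) \<le> (\<Sum>s\<in>{1..<m}. 1 / \<mu> ^ s * cmod (cF s (p t) * vector_derivative p (at t)))"
        unfolding x_def X'_def norm_mult .
    qed
    also have "\<dots> = (\<Sum>s\<in>{1..<m}. 1 / \<mu> ^ s * iF a s)"
      unfolding iF_def
      by (rule integral_unique, intro has_integral_mult_right has_integral_sum integrable_integral FG_int ab) simp
    also have "\<dots> = (\<Sum>s\<in>{..<m - 1}. 1 / \<mu> ^ Suc s * iF a (Suc s))"
    proof -
      obtain k where k: "m = Suc k" using m by (cases m) auto
      show ?thesis unfolding k One_nat_def sum.shift_bounds_Suc_ivl by (simp add: lessThan_atLeast0)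
    qed
    also have "\<dots> \<le> (\<Sum>s\<in>{..<m - 1}. 1 / \<mu> ^ Suc s * enn2real (aF (Suc s)))"
      using mu Fs(1) ab(2) by (intro sum_mono mult_left_mono iF) auto
    \<comment> \<open>A factor 2 is given away here to reach \<open>varpi3\<close>; the index shift
      has supplied the additional \<open>1 / \<mu>\<close>.\<close>
    also have "\<dots> \<le> (\<Sum>s\<in>{..<m - 1}. 2 / \<mu> ^ s * enn2real (aF (Suc s)) / \<mu>)"
      using mu by (intro sum_mono) (simp add: field_simps)
    also have "\<dots> = B" unfolding B_def Fs(2) by (rule sum_divide_distrib[symmetric])
    finally have IB: "IB \<le> B" .
    have nn: "IA \<ge> 0" "IB \<ge> 0" unfolding IA_def IB_def by (intro integral_nonneg iAB; simp)+
    have "a0 a \<ge> 0" "g0 a \<ge> 0" using mu by (simp_all add: a0_def g0_def)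
    then have "((1 + a0 a) * IA + g0 a * IB) * exp (IA / \<mu> + IB) / \<mu> \<le> ((1 + a0 a) * A + g0 a * B) * exp (A / \<mu> + B) / \<mu>"
      using IA IB nn AB mu by (intro divide_right_mono mult_mono add_mono add_nonneg_nonneg mult_nonneg_nonneg iffD2[OF exp_le_cancel_iff]) auto
    then show ?thesis using gr by (simp add: hN_def)
  qed
  have lim: "(g0 \<longlongrightarrow> 0) (at_right 0)" "(a0 \<longlongrightarrow> 0) (at_right 0)"
  proof -
    have h: "((\<lambda>t. cmod (Hu \<mu> m (v t))) \<longlongrightarrow> 0) (at_right 0)" and g: "((\<lambda>t. cmod (Gd \<mu> m (v t))) \<longlongrightarrow> 0) (at_right 0)"
      using Hu_lim[OF start(1,2) mu start(3)] Gd_lim[OF start(1,2) mu start(3)] by (simp_all add: tendsto_norm_zero)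
    show "(g0 \<longlongrightarrow> 0) (at_right 0)" using g unfolding g0_def .
    have "((\<lambda>t. cmod (Hu \<mu> m (v t)) + cmod (Gd \<mu> m (v t)) / \<mu>) \<longlongrightarrow> 0 + 0 / \<mu>) (at_right 0)"
      by (intro tendsto_intros h g) (use mu in simp)
    then show "(a0 \<longlongrightarrow> 0) (at_right 0)" unfolding a0_def by simp
  qed
  have "((\<lambda>a. a0 a + ((1 + a0 a) * A + g0 a * B) * exp (A / \<mu> + B) / \<mu>) \<longlongrightarrow> 0 + ((1 + 0) * A + 0 * B) * exp (A / \<mu> + B) / \<mu>) (at_right 0)"
    by (intro tendsto_intros lim) (use mu in simp)
  moreover have "eventually (\<lambda>a. hN \<le> a0 a + ((1 + a0 a) * A + g0 a * B) * exp (A / \<mu> + B) / \<mu>) (at_right 0)"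
    by (rule eventually_mono[OF eventually_at_right_real[of 0 "real N"] est]) (use N in simp_all)
  ultimately have "hN \<le> 0 + ((1 + 0) * A + 0 * B) * exp (A / \<mu> + B) / \<mu>"
    by (rule tendsto_lowerbound) simp
  then show ?thesis using mu by (simp add: hN_def v_def pN A_def B_def)
qed

section \<open>From order n to order n + r\<close>

definition eta :: "real \<Rightarrow> nat \<Rightarrow> complex \<Rightarrow> complex" where "eta \<mu> n z = Hu \<mu> n (three.uz z)"

text \<open>Both orders approximate the same function, and the approximations differ by the
  exponential of the additional terms.\<close>

lemma eta_shift:
  assumes "z \<in> D3" "\<mu> > 0" "n \<ge> 1"
  shows "1 + eta \<mu> n z = exp (\<Sum>s\<in>{n..<n + r}. Eu s (three.uz z) / of_real \<mu> ^ s) * (1 + eta \<mu> (n + r) z)"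
proof -
  have "(\<Sum>s\<in>{1..<n + r}. f s) = (\<Sum>s\<in>{1..<n}. f s) + (\<Sum>s\<in>{n..<n + r}. f s)" for f :: "nat \<Rightarrow> complex"
    using assms(3) by (intro sum.atLeastLessThan_concat[symmetric]) auto
  then have "Vu \<mu> (n + r) (three.uz z) = Vu \<mu> n (three.uz z) * exp (\<Sum>s\<in>{n..<n + r}. Eu s (three.uz z) / of_real \<mu> ^ s)"
    by (simp add: Vu_def Xu_def exp_add mult.assoc)
  then show ?thesis using Vu_nz[OF three.uz_Wz[OF assms(1)] assms(2), of n] by (simp add: eta_def Hu_def)
qed

lemma eta_properties:
  assumes mu: "\<mu> > 0" and n: "n \<ge> 1" and z: "z \<in> D3"
  shows "whittaker_W (- (lam * \<mu>)) \<mu> (complex_of_real (ln \<mu>) + Ln z - complex_of_real pi * \<i>) =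
      pref \<mu> * val3 lam (sqrt_zZ lam) z *
      exp (complex_of_real \<mu> * val3 lam (xi lam) z + (\<Sum>s\<in>{1..<n}. val3 lam (Ehat lam s) z / complex_of_real \<mu> ^ s)) * (1 + eta \<mu> n z)"
    and "progressive_path3 lam \<delta> z N p \<Longrightarrow> omega3 lam (n + r) \<mu> N p < \<infinity> \<Longrightarrow> varpi3 lam (n + r) \<mu> N p < \<infinity> \<Longrightarrow>
      cmod (eta \<mu> n z) \<le>
        cmod (exp (\<Sum>s\<in>{n..<n + r}. val3 lam (Ehat lam s) z / complex_of_real \<mu> ^ s) - 1) +
        enn2real (omega3 lam (n + r) \<mu> N p) / \<mu> ^ (n + r) *
        exp (enn2real (varpi3 lam (n + r) \<mu> N p) / \<mu> + (\<Sum>s\<in>{n..<n + r}. Re (val3 lam (Ehat lam s) z) / \<mu> ^ s) +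
             enn2real (omega3 lam (n + r) \<mu> N p) / \<mu> ^ (n + r))"
proof -
  note u = three.uz_Wz[OF z] three.uz_inverse[OF z]
  have zn: "z \<noteq> 0" "Im z \<ge> 0" using z three.S_Cplus by (auto simp: Cplus_def)
  have w: "complex_of_real (ln \<mu>) + Ln z - complex_of_real pi * \<i> = wl \<mu> (three.uz z)"
    unfolding wl_def u(2) Ln_up_eq_Ln[OF zn] ..
  have V: "pref \<mu> * val3 lam (sqrt_zZ lam) z * exp (complex_of_real \<mu> * val3 lam (xi lam) z + (\<Sum>s\<in>{1..<n}. val3 lam (Ehat lam s) z / complex_of_real \<mu> ^ s))
      = Vu \<mu> n (three.uz z)"
    unfolding Vu_def Xu_def val3_values[OF z] ..
  show "whittaker_W (- (lam * \<mu>)) \<mu> (complex_of_real (ln \<mu>) + Ln z - complex_of_real pi * \<i>) =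
      pref \<mu> * val3 lam (sqrt_zZ lam) z *
      exp (complex_of_real \<mu> * val3 lam (xi lam) z + (\<Sum>s\<in>{1..<n}. val3 lam (Ehat lam s) z / complex_of_real \<mu> ^ s)) * (1 + eta \<mu> n z)"
    unfolding V w eta_def Hu_def yu_def gW_def using Vu_nz[OF u(1) mu, of n] by simp
  assume P: "progressive_path3 lam \<delta> z N p" and fin: "omega3 lam (n + r) \<mu> N p < \<infinity>" "varpi3 lam (n + r) \<mu> N p < \<infinity>"
  define x y where "x = enn2real (omega3 lam (n + r) \<mu> N p) / \<mu> ^ (n + r)" and "y = enn2real (varpi3 lam (n + r) \<mu> N p) / \<mu>"
  define B where "B = (\<Sum>s\<in>{n..<n + r}. val3 lam (Ehat lam s) z / complex_of_real \<mu> ^ s)"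
  have ReB: "Re B = (\<Sum>s\<in>{n..<n + r}. Re (val3 lam (Ehat lam s) z) / \<mu> ^ s)"
    unfolding B_def Re_sum by (simp flip: of_real_power)
  have e: "cmod (eta \<mu> (n + r) z) \<le> x * exp (x + y)"
    using path_error[OF P mu _ fin] n by (simp add: eta_def x_def y_def)
  have "1 + eta \<mu> n z = exp B * (1 + eta \<mu> (n + r) z)"
    using eta_shift[OF z mu n, of r] by (simp add: B_def val3_values[OF z])
  then have "eta \<mu> n z = exp B * (1 + eta \<mu> (n + r) z) - 1" by (metis add_diff_cancel_left')
  \<comment> \<open>The two summands of the final bound: the explicit exponential minus 1, and the
    error of the higher order.\<close>
  also have "\<dots> = (exp B - 1) + exp B * eta \<mu> (n + r) z" by (simp add: algebra_simps)
  finally have "cmod (eta \<mu> n z) \<le> cmod (exp B - 1) + exp (Re B) * cmod (eta \<mu> (n + r) z)"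
    by (metis norm_exp_eq_Re norm_mult norm_triangle_ineq)
  moreover have "exp (Re B) * cmod (eta \<mu> (n + r) z) \<le> exp (Re B) * (x * exp (x + y))" using e by (intro mult_left_mono) auto
  moreover have "exp (Re B) * (x * exp (x + y)) = x * exp (y + Re B + x)" by (simp add: exp_add)
  ultimately have "cmod (eta \<mu> n z) \<le> cmod (exp B - 1) + x * exp (y + Re B + x)" by argo
  then show "cmod (eta \<mu> n z) \<le>
        cmod (exp (\<Sum>s\<in>{n..<n + r}. val3 lam (Ehat lam s) z / complex_of_real \<mu> ^ s) - 1) +
        enn2real (omega3 lam (n + r) \<mu> N p) / \<mu> ^ (n + r) *
        exp (enn2real (varpi3 lam (n + r) \<mu> N p) / \<mu> + (\<Sum>s\<in>{n..<n + r}. Re (val3 lam (Ehat lam s) z) / \<mu> ^ s) +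
             enn2real (omega3 lam (n + r) \<mu> N p) / \<mu> ^ (n + r))"
    unfolding x_def y_def B_def[symmetric] ReB .
qed

end

theorem theorem2p2:
  fixes \<delta> :: real and n r :: nat
  assumes "\<delta> > 0" and "n \<ge> 1"
  shows "\<exists>\<eta> :: real \<Rightarrow> real \<Rightarrow> complex \<Rightarrow> complex.
    \<forall>\<^sub>F \<mu> :: real in at_top. \<forall>lam \<kappa> :: real. \<kappa> = lam * \<mu> \<and> 0 \<le> lam \<and> lam \<le> 1 - \<delta> \<longrightarrow>
      (\<forall>z \<in> Zset3 lam \<delta>.
         whittaker_W (- \<kappa>) \<mu> (complex_of_real (ln \<mu>) + Ln z - complex_of_real pi * \<i>) =
           exp (complex_of_real (\<kappa> * pi) * \<i>) *
           complex_of_real ((1 - lam) powr \<mu>) *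
           complex_of_real ((2 * exp 1 / \<mu>) powr \<kappa>) *
           val3 lam (sqrt_zZ lam) z *
           exp (complex_of_real \<mu> * val3 lam (xi lam) z +
                (\<Sum>s\<in>{1..<n}. val3 lam (Ehat lam s) z / complex_of_real \<mu> ^ s)) *
           (1 + \<eta> \<mu> lam z) \<and>
         (\<forall>N p. progressive_path3 lam \<delta> z N p \<and>
                omega3 lam (n + r) \<mu> N p < \<infinity> \<and> varpi3 lam (n + r) \<mu> N p < \<infinity> \<longrightarrow>
           cmod (\<eta> \<mu> lam z) \<le>
             cmod (exp (\<Sum>s\<in>{n..<n + r}. val3 lam (Ehat lam s) z / complex_of_real \<mu> ^ s) - 1) +
             enn2real (omega3 lam (n + r) \<mu> N p) / \<mu> ^ (n + r) *
             exp (enn2real (varpi3 lam (n + r) \<mu> N p) / \<mu> +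
                  (\<Sum>s\<in>{n..<n + r}. Re (val3 lam (Ehat lam s) z) / \<mu> ^ s) +
                  enn2real (omega3 lam (n + r) \<mu> N p) / \<mu> ^ (n + r))))"
proof (intro exI[of _ "\<lambda>\<mu> lam z. turning_point.eta lam \<mu> n z"] eventually_mono[OF eventually_gt_at_top[of 0]] allI impI ballI)
  fix \<mu> lam \<kappa> :: real and z assume mu: "0 < \<mu>" and l: "\<kappa> = lam * \<mu> \<and> 0 \<le> lam \<and> lam \<le> 1 - \<delta>" and z: "z \<in> Zset3 lam \<delta>"
  interpret turning_point lam by unfold_locales (use l assms in auto)
  have \<kappa>: "\<kappa> = lam * \<mu>" using l by simp
  \<comment> \<open>Points of \<open>gamma3\<close> have distance 0 from it, so
    \<open>\<delta> > 0\<close> keeps \<open>z\<close> off the cut.\<close>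
  have "z \<in> Cplus" "z \<notin> gamma3 lam" using z assms(1) by (auto simp: Zset3_def)
  then have z: "z \<in> D3" by (simp add: D3_def)
  note E = eta_properties[OF mu assms(2) z]
  show "whittaker_W (- \<kappa>) \<mu> (complex_of_real (ln \<mu>) + Ln z - complex_of_real pi * \<i>) =
           exp (complex_of_real (\<kappa> * pi) * \<i>) *
           complex_of_real ((1 - lam) powr \<mu>) *
           complex_of_real ((2 * exp 1 / \<mu>) powr \<kappa>) *
           val3 lam (sqrt_zZ lam) z *
           exp (complex_of_real \<mu> * val3 lam (xi lam) z +
                (\<Sum>s\<in>{1..<n}. val3 lam (Ehat lam s) z / complex_of_real \<mu> ^ s)) *
           (1 + eta \<mu> n z) \<and>
         (\<forall>N p. progressive_path3 lam \<delta> z N p \<and>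
                omega3 lam (n + r) \<mu> N p < \<infinity> \<and> varpi3 lam (n + r) \<mu> N p < \<infinity> \<longrightarrow>
           cmod (eta \<mu> n z) \<le>
             cmod (exp (\<Sum>s\<in>{n..<n + r}. val3 lam (Ehat lam s) z / complex_of_real \<mu> ^ s) - 1) +
             enn2real (omega3 lam (n + r) \<mu> N p) / \<mu> ^ (n + r) *
             exp (enn2real (varpi3 lam (n + r) \<mu> N p) / \<mu> +
                  (\<Sum>s\<in>{n..<n + r}. Re (val3 lam (Ehat lam s) z) / \<mu> ^ s) +
                  enn2real (omega3 lam (n + r) \<mu> N p) / \<mu> ^ (n + r)))"
    unfolding \<kappa> using E(1)[unfolded pref_def] E(2) by blast
qed

end
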